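(* As $\varepsilon\to 0$, the functionals $J^{CvK}_\varepsilon$ $\Gamma$-converge to the functional $J^{CvK}$ in the following sense: (i) (liminf inequality) for every sequence $(w_\varepsilon)$ with $w_\varepsilon\in W^{2,2}_{{\rm det},\varepsilon}(S)$, every $w\in W^{2,2}_{\langle 0\rangle}(I)$ and every $\vartheta\in W^{1,2}_{\langle 0\rangle}(I)$ such that $w_\varepsilon\rightharpoonup w$ weakly in $W^{2,2}(S)$ and $\nabla_{\!\varepsilon} w_\varepsilon\rightharpoonup (w',\vartheta)$ weakly in $W^{1,2}(S;\mathbb{R}^2)$, we have $$\liminf_{\varepsilon\to 0} J^{CvK}_\varepsilon(w_\varepsilon)\ge J^{CvK}(w,\vartheta);$$ (ii) (recovery sequence) for every $w\in W^{2,2}_{\langle 0\rangle}(I)$ and $\vartheta\in W^{1,2}_{\langle 0\rangle}(I)$ there exists a sequence $(w_\varepsilon)$ with $w_\varepsilon\in W^{2,2}_{{\rm det},\varepsilon}(S)$ such that $w_\varepsilon\rightharpoonup w$ weakly in $W^{2,2}(S)$, $\nabla_{\!\varepsilon} w_\varepsilon\rightharpoonup (w',\vartheta)$ weakly in $W^{1,2}(S;\mathbb{R}^2)$, and $$\limsup_{\varepsilon\to 0} J^{CvK}_\varepsilon(w_\varepsilon)\le J^{CvK}(w,\vartheta).$$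
   Context: Let $\ell>0$, $I=(-\ell/2,\ell/2)$ and $S=I\times(-1/2,1/2)\subset\mathbb{R}^2$, with coordinates $x=(x_1,x_2)$. Functions on $I$ are identified with functions on $S$ that are independent of $x_2$. The parameter $\varepsilon>0$ tends to $0$; a "sequence" $(w_\varepsilon)$ is indexed by such $\varepsilon$. $\mathbb{R}^{2\times2}_{\rm sym}$ is the space of symmetric real $2\times 2$ matrices, and $Q_2:\mathbb{R}^{2\times 2}_{\rm sym}\to[0,+\infty)$ is a given positive definite quadratic form. For $t\in\mathbb{R}$, $t^+=\max\{t,0\}$ and $t^-=\max\{-t,0\}$. For an open set $\Omega\subset\mathbb{R}^\alpha$, $\alpha=1,2$, $$W^{1,2}_{\langle 0\rangle}(\Omega):=\Big\{g\in W^{1,2}(\Omega): \int_\Omega g\,dx=0\Big\},\qquad W^{2,2}_{\langle 0\rangle}(\Omega):=\Big\{g\in W^{2,2}(\Omega): \int_\Omega g\,dx=0,\ \int_\Omega\nabla g\,dx=0\Big\}.$$ Scaled differential operators: for $w\in W^{2,2}(S)$, $$\nabla_{\!\varepsilon} w:=\Big(\partial_1 w,\tfrac1\varepsilon\partial_2 w\Big),\qquad \nabla^2_\varepsilon w:=\begin{pmatrix}\partial^2_{11}w & \frac1\varepsilon\partial^2_{12}w\\ \frac1\varepsilon\partial^2_{21}w & \frac1{\varepsilon^2}\partial^2_{22}w\end{pmatrix}.$$ Constrained space and energy: $$W^{2,2}_{{\rm det},\varepsilon}(S):=\{w\in W^{2,2}_{\langle 0\rangle}(S): \det\nabla^2_\varepsilon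 w=0\ \text{a.e. in } S\},$$ $$J^{CvK}_\varepsilon:W^{2,2}_{{\rm det},\varepsilon}(S)\to\mathbb{R},\qquad J^{CvK}_\varepsilon(w):=\frac1{24}\int_S Q_2(\nabla^2_\varepsilon w)\,dx.$$ Limit density $\overline Q:\mathbb{R}\times\mathbb{R}\to[0,+\infty)$: $$\overline Q(\kappa,\tau):=\min_{\gamma\in\mathbb{R}}\Big\{Q_2(M)+\alpha^+(\det M)^++\alpha^-(\det M)^-:\ M=\begin{pmatrix}\kappa&\tau\\ \tau&\gamma\end{pmatrix}\Big\},$$ where $$\alpha^+:=\sup\{\alpha>0: Q_2(M)+\alpha\det M\ge0\ \text{for every } M\in\mathbb{R}^{2\times2}_{\rm sym}\},$$ $$\alpha^-:=\sup\{\alpha>0: Q_2(M)-\alpha\det M\ge0\ \text{for every } M\in\mathbb{R}^{2\times2}_{\rm sym}\}.$$ Limit functional $J^{CvK}:W^{2,2}_{\langle 0\rangle}(I)\times W^{1,2}_{\langle 0\rangle}(I)\to\mathbb{R}$: $$J^{CvK}(w,\vartheta):=\frac1{24}\int_I \overline Q(w'',\vartheta')\,dx_1.$$ *)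

theory Defs
  imports "HOL-Analysis.Analysis"
begin

section \<open>Sobolev spaces on open subsets of Euclidean spaces\<close>

text \<open>
  Elements of the function spaces below are functions, not classes modulo almost everywhere
  equality on \<open>\<Omega>\<close>; every notion used is invariant under changes on null sets, and values outside
  \<open>\<Omega>\<close> play no role.
\<close>

primrec C_k :: "nat \<Rightarrow> ('a::euclidean_space \<Rightarrow> real) \<Rightarrow> bool" where
  "C_k 0 f \<longleftrightarrow> continuous_on UNIV f"
| "C_k (Suc k) f \<longleftrightarrow>
     (\<forall>x. f differentiable (at x)) \<and> (\<forall>v. C_k k (\<lambda>x. frechet_derivative f (at x) v))"

definition test_functions :: "'a::euclidean_space set \<Rightarrow> ('a \<Rightarrow> real) set" where
  "test_functions \<Omega> = {\<phi>. (\<forall>k. C_k k \<phi>) \<and>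
     compact (closure {x. \<phi> x \<noteq> 0}) \<and> closure {x. \<phi> x \<noteq> 0} \<subseteq> \<Omega>}"

definition L1_loc :: "'a::euclidean_space set \<Rightarrow> ('a \<Rightarrow> 'b::euclidean_space) set" where
  "L1_loc \<Omega> = {f. \<forall>K. compact K \<and> K \<subseteq> \<Omega> \<longrightarrow> integrable (lebesgue_on K) f}"

definition L2 :: "'a::euclidean_space set \<Rightarrow> ('a \<Rightarrow> 'b::euclidean_space) set" where
  "L2 \<Omega> = {f. f \<in> borel_measurable (lebesgue_on \<Omega>) \<and>
     integrable (lebesgue_on \<Omega>) (\<lambda>x. (norm (f x))\<^sup>2)}"

definition is_weak_deriv ::
  "'a::euclidean_space set \<Rightarrow> 'a \<Rightarrow> ('a \<Rightarrow> 'b::euclidean_space) \<Rightarrow> ('a \<Rightarrow> 'b) \<Rightarrow> bool" where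
  "is_weak_deriv \<Omega> b f g \<longleftrightarrow> f \<in> L1_loc \<Omega> \<and> g \<in> L1_loc \<Omega> \<and>
     (\<forall>\<phi>\<in>test_functions \<Omega>.
        (LINT x|lebesgue_on \<Omega>. frechet_derivative \<phi> (at x) b *\<^sub>R f x) =
        - (LINT x|lebesgue_on \<Omega>. \<phi> x *\<^sub>R g x))"

text \<open>
  A representative of the weak derivative of \<open>f\<close> in direction \<open>b\<close>, unique up to null sets
  (and unspecified if there is no weak derivative).
\<close>

definition weak_deriv ::
  "'a::euclidean_space set \<Rightarrow> 'a \<Rightarrow> ('a \<Rightarrow> 'b::euclidean_space) \<Rightarrow> 'a \<Rightarrow> 'b" where
  "weak_deriv \<Omega> b f = (SOME g. is_weak_deriv \<Omega> b f g)"

definition W12 :: "'a::euclidean_space set \<Rightarrow> ('a \<Rightarrow> 'b::euclidean_space) set" where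
  "W12 \<Omega> = {f \<in> L2 \<Omega>. \<forall>b\<in>Basis. \<exists>g\<in>L2 \<Omega>. is_weak_deriv \<Omega> b f g}"

definition W22 :: "'a::euclidean_space set \<Rightarrow> ('a \<Rightarrow> 'b::euclidean_space) set" where
  "W22 \<Omega> = {f \<in> W12 \<Omega>. \<forall>b\<in>Basis. weak_deriv \<Omega> b f \<in> W12 \<Omega>}"

definition W12_norm :: "'a::euclidean_space set \<Rightarrow> ('a \<Rightarrow> 'b::euclidean_space) \<Rightarrow> real" where
  "W12_norm \<Omega> f = sqrt ((LINT x|lebesgue_on \<Omega>. (norm (f x))\<^sup>2) +
     (\<Sum>b\<in>Basis. LINT x|lebesgue_on \<Omega>. (norm (weak_deriv \<Omega> b f x))\<^sup>2))"

definition W22_norm :: "'a::euclidean_space set \<Rightarrow> ('a \<Rightarrow> 'b::euclidean_space) \<Rightarrow> real" where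
  "W22_norm \<Omega> f = sqrt ((LINT x|lebesgue_on \<Omega>. (norm (f x))\<^sup>2) +
     (\<Sum>b\<in>Basis. LINT x|lebesgue_on \<Omega>. (norm (weak_deriv \<Omega> b f x))\<^sup>2) +
     (\<Sum>b\<in>Basis. \<Sum>c\<in>Basis.
        LINT x|lebesgue_on \<Omega>. (norm (weak_deriv \<Omega> c (weak_deriv \<Omega> b f) x))\<^sup>2))"

definition W12_mean0 :: "'a::euclidean_space set \<Rightarrow> ('a \<Rightarrow> real) set" where
  "W12_mean0 \<Omega> = {g \<in> W12 \<Omega>. (LINT x|lebesgue_on \<Omega>. g x) = 0}"

definition W22_mean0 :: "'a::euclidean_space set \<Rightarrow> ('a \<Rightarrow> real) set" where
  "W22_mean0 \<Omega> = {g \<in> W22 \<Omega>. (LINT x|lebesgue_on \<Omega>. g x) = 0 \<and>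
     (\<forall>b\<in>Basis. (LINT x|lebesgue_on \<Omega>. weak_deriv \<Omega> b g x) = 0)}"


section \<open>Weak convergence\<close>

text \<open>
  Here \<open>V\<close> is a linear space of functions with seminorm \<open>N\<close>. A functional bounded with respect
  to \<open>N\<close> takes the same value on functions whose difference has seminorm 0, so these are the
  continuous linear functionals on the associated normed space.
\<close>

definition bounded_linear_functional ::
  "('a \<Rightarrow> 'b::real_vector) set \<Rightarrow> (('a \<Rightarrow> 'b) \<Rightarrow> real) \<Rightarrow> (('a \<Rightarrow> 'b) \<Rightarrow> real) \<Rightarrow> bool" where
  "bounded_linear_functional V N \<Lambda> \<longleftrightarrow>
     (\<forall>f\<in>V. \<forall>g\<in>V. \<Lambda> (\<lambda>x. f x + g x) = \<Lambda> f + \<Lambda> g) \<and>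
     (\<forall>c. \<forall>f\<in>V. \<Lambda> (\<lambda>x. c *\<^sub>R f x) = c * \<Lambda> f) \<and>
     (\<exists>C. \<forall>f\<in>V. \<bar>\<Lambda> f\<bar> \<le> C * N f)"

definition weakly_converges ::
  "('a \<Rightarrow> 'b::real_vector) set \<Rightarrow> (('a \<Rightarrow> 'b) \<Rightarrow> real) \<Rightarrow>
   ('i \<Rightarrow> 'a \<Rightarrow> 'b) \<Rightarrow> ('a \<Rightarrow> 'b) \<Rightarrow> 'i filter \<Rightarrow> bool" where
  "weakly_converges V N f f0 F \<longleftrightarrow> f0 \<in> V \<and> (\<forall>\<^sub>F i in F. f i \<in> V) \<and>
     (\<forall>\<Lambda>. bounded_linear_functional V N \<Lambda> \<longrightarrow> ((\<lambda>i. \<Lambda> (f i)) \<longlongrightarrow> \<Lambda> f0) F)"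


section \<open>Quadratic forms and the limit density\<close>

definition sym_mat :: "(real^2^2) set" where
  "sym_mat = {M. transpose M = M}"

text \<open>
  Only the values of \<open>Q\<close> on symmetric matrices matter. Every bilinear form on the subspace of
  symmetric matrices is the restriction of one on the whole matrix space.
\<close>

definition pos_def_quadratic_form :: "(real^2^2 \<Rightarrow> real) \<Rightarrow> bool" where
  "pos_def_quadratic_form Q \<longleftrightarrow>
     (\<exists>B :: real^2^2 \<Rightarrow> real^2^2 \<Rightarrow> real. bilinear B \<and> (\<forall>M\<in>sym_mat. Q M = B M M)) \<and>
     (\<forall>M\<in>sym_mat. M \<noteq> 0 \<longrightarrow> Q M > 0)"

definition alpha_plus :: "(real^2^2 \<Rightarrow> real) \<Rightarrow> real" where
  "alpha_plus Q = Sup {\<alpha>. \<alpha> > 0 \<and> (\<forall>M\<in>sym_mat. Q M + \<alpha> * det M \<ge> 0)}"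

definition alpha_minus :: "(real^2^2 \<Rightarrow> real) \<Rightarrow> real" where
  "alpha_minus Q = Sup {\<alpha>. \<alpha> > 0 \<and> (\<forall>M\<in>sym_mat. Q M - \<alpha> * det M \<ge> 0)}"

definition Q_bar :: "(real^2^2 \<Rightarrow> real) \<Rightarrow> real \<Rightarrow> real \<Rightarrow> real" where
  "Q_bar Q \<kappa> \<tau> = (LEAST v. \<exists>\<gamma>. \<exists>M :: real^2^2.
     M = vector [vector [\<kappa>, \<tau>], vector [\<tau>, \<gamma>]] \<and>
     v = Q M + alpha_plus Q * max (det M) 0 + alpha_minus Q * max (- det M) 0)"


section \<open>The ribbon and its energies\<close>

definition interval_I :: "real \<Rightarrow> real set" where
  "interval_I l = {- l / 2 <..< l / 2}"

definition strip_S :: "real \<Rightarrow> (real^2) set" where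
  "strip_S l = {x. x $ 1 \<in> interval_I l \<and> x $ 2 \<in> {- 1 / 2 <..< 1 / 2}}"

abbreviation partial :: "real \<Rightarrow> 2 \<Rightarrow> (real^2 \<Rightarrow> real) \<Rightarrow> real^2 \<Rightarrow> real" where
  "partial l i w \<equiv> weak_deriv (strip_S l) (axis i 1) w"

abbreviation deriv_I :: "real \<Rightarrow> (real \<Rightarrow> real) \<Rightarrow> real \<Rightarrow> real" where
  "deriv_I l w \<equiv> weak_deriv (interval_I l) 1 w"

definition scaled_grad :: "real \<Rightarrow> real \<Rightarrow> (real^2 \<Rightarrow> real) \<Rightarrow> real^2 \<Rightarrow> real^2" where
  "scaled_grad l \<epsilon> w x = vector [partial l 1 w x, (1 / \<epsilon>) * partial l 2 w x]"

definition scaled_hessian :: "real \<Rightarrow> real \<Rightarrow> (real^2 \<Rightarrow> real) \<Rightarrow> real^2 \<Rightarrow> real^2^2" where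
  "scaled_hessian l \<epsilon> w x = vector
     [vector [partial l 1 (partial l 1 w) x, (1 / \<epsilon>) * partial l 1 (partial l 2 w) x],
      vector [(1 / \<epsilon>) * partial l 2 (partial l 1 w) x, (1 / \<epsilon>\<^sup>2) * partial l 2 (partial l 2 w) x]]"

definition W22_det :: "real \<Rightarrow> real \<Rightarrow> (real^2 \<Rightarrow> real) set" where
  "W22_det l \<epsilon> = {w \<in> W22_mean0 (strip_S l).
     AE x in lebesgue_on (strip_S l). det (scaled_hessian l \<epsilon> w x) = 0}"

definition J_eps :: "(real^2^2 \<Rightarrow> real) \<Rightarrow> real \<Rightarrow> real \<Rightarrow> (real^2 \<Rightarrow> real) \<Rightarrow> real" where
  "J_eps Q l \<epsilon> w = 1 / 24 * (LINT x|lebesgue_on (strip_S l). Q (scaled_hessian l \<epsilon> w x))"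

definition J_lim :: "(real^2^2 \<Rightarrow> real) \<Rightarrow> real \<Rightarrow> (real \<Rightarrow> real) \<Rightarrow> (real \<Rightarrow> real) \<Rightarrow> real" where
  "J_lim Q l w \<theta> = 1 / 24 *
     (LINT t|lebesgue_on (interval_I l). Q_bar Q (deriv_I l (deriv_I l w) t) (deriv_I l \<theta> t))"

definition ribbon_converges ::
  "real \<Rightarrow> (real \<Rightarrow> real^2 \<Rightarrow> real) \<Rightarrow> (real \<Rightarrow> real) \<Rightarrow> (real \<Rightarrow> real) \<Rightarrow> bool" where
  "ribbon_converges l w\<epsilon> w \<theta> \<longleftrightarrow>
     weakly_converges (W22 (strip_S l)) (W22_norm (strip_S l))
       w\<epsilon> (\<lambda>x. w (x $ 1)) (at_right 0) \<and>
     weakly_converges (W12 (strip_S l)) (W12_norm (strip_S l))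
       (\<lambda>\<epsilon>. scaled_grad l \<epsilon> (w\<epsilon> \<epsilon>)) (\<lambda>x. vector [deriv_I l w (x $ 1), \<theta> (x $ 1)]) (at_right 0)"

end

theory Submission imports Defs begin

text \<open>Where \<open>det M = 0\<close>, \<open>Q(M)\<close> equals
  \<open>f(M) = Q(M) + \<alpha>\<^sup>+ (det M)\<^sup>+ + \<alpha>\<^sup>- (det M)\<^sup>-\<close>, which is the maximum of the two positive
  semidefinite forms \<open>Q + \<alpha>\<^sup>+ det\<close> and \<open>Q - \<alpha>\<^sup>- det\<close>. Hence \<open>f\<close> is convex, and so is its marginal
  minimum, the limit density. The liminf inequality is weak lower semicontinuity of a convex
  integral, proved with affine minorants along simple functions.

  For the recovery sequence, each pair \<open>(\<kappa>, \<tau>)\<close>, completed by the optimal \<open>\<gamma>\<close>, is a convex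
  combination of two matrices of determinant zero with the same total energy, obtained by moving
  along a null direction of the form that is active at the optimum. Splitting every cell of a fine
  partition of \<open>I\<close> accordingly gives profiles
  \<open>\<Sum>\<^sub>j k\<^sub>j(x\<^sub>1) (1, p\<^sub>j, p\<^sub>j\<^sup>2)\<close> with separated supports; they are realised exactly by the sums
  \<open>\<Sum>\<^sub>j H\<^sub>j(x\<^sub>1 + \<epsilon> p\<^sub>j x\<^sub>2)\<close>, \<open>H\<^sub>j'' = k\<^sub>j\<close>, whose scaled Hessian is singular because for small \<open>\<epsilon>\<close>
  at most one summand is curved at any point.\<close>

section \<open>The relaxed energy density\<close>

text \<open>The constants \<open>ap\<close> are the largest admissible ones, so each extreme form
  has a null vector N. As \<open>S\<close> is positive definite, the signed determinant of N is
  negative, and the line through the optimum in direction N meets the cone det = 0 on both sides. A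
  sum of developable pieces is not developable in general, because the determinant of its Hessian
  has cross terms. The j-th piece depends on x_1 + \<epsilon> p_j x_2, which differs from x_1 by
  O(\<epsilon>) only; gaps of fixed width between the supports therefore suppress the cross terms
  once \<epsilon> is small. This is why the profile is fixed before \<epsilon>. Second derivatives
  of the approximants oscillate, so nothing is compared at that level. Matching the cell averages of
  \<kappa> and \<tau> makes the primitives agree at the cell ends, hence uniformly close. Uniform
  closeness of the function and of its scaled gradient, plus an energy bound, then yields weak
  convergence of second derivatives by integration by parts. Mean-zero constraints are repaired by
  affine functions, which the Hessian does not see.\<close>

lemma eventually_quadratic_neg:
  fixes a b :: real
  assumes "a < 0"
  shows "\<forall>\<^sub>F t in at_right 0. a * t + b * t\<^sup>2 < 0"
proof -
  have "((\<lambda>t. a + b * t) \<longlongrightarrow> a + b * 0) (at_right 0)"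
    by (intro tendsto_intros)
  then have "\<forall>\<^sub>F t in at_right 0. a + b * t < 0"
    using order_tendstoD(2)[of _ "a + b * 0" _ 0] assms by simp
  moreover have "\<forall>\<^sub>F t in at_right (0::real). t > 0"
    by (simp add: eventually_at_right_less)
  ultimately show ?thesis
  proof eventually_elim
    case (elim t)
    then have "t * (a + b * t) < 0" by (simp add: mult_pos_neg)
    then show ?case by (simp add: algebra_simps power2_eq_square)
  qed
qed

text \<open>The expression is affine in t, and an affine function bounded below is constant. It
  arises from a semidefinite form along a null direction, where the quadratic term is
  absent.\<close>

lemma psd_null_orthogonal:
  fixes c :: real
  assumes "\<And>t. 0 \<le> c + 2 * t * d"
  shows "d = 0"
proof (rule ccontr)
  assume "d \<noteq> 0"
  \<comment> \<open>At this t the affine function equals c - (|c| + 1), which is negative.\<close>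
  then have "2 * (- (\<bar>c\<bar> + 1) / (2 * d)) * d = - (\<bar>c\<bar> + 1)" by simp
  then show False using assms[of "- (\<bar>c\<bar> + 1) / (2 * d)"] by linarith
qed

section \<open>Symmetric matrices as triples, with determinant and norm\<close>

type_synonym vec3 = "real \<times> real \<times> real"

definition dtb :: "vec3 \<Rightarrow> vec3 \<Rightarrow> real" where
  "dtb u v = (fst u * snd (snd v) + fst v * snd (snd u)) / 2 - fst (snd u) * fst (snd v)"

lemma dtb_simps [simp]: "dtb (x, y, z) (x', y', z') = (x * z' + x' * z) / 2 - y * y'"
  by (simp add: dtb_def)

lemma bilinear_dtb: "bilinear dtb"
  unfolding bilinear_def
  by (auto intro!: linearI simp: dtb_def field_simps)

lemma dtb_commute: "dtb u v = dtb v u"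
  by (simp add: dtb_def algebra_simps)

lemma norm_vec3: "(norm (x, y, z :: real))\<^sup>2 = x\<^sup>2 + y\<^sup>2 + (z::real)\<^sup>2" for x y :: real
  by (simp add: norm_Pair)

text \<open>With constant 1 here, a coercivity constant c can be used directly as the size of an
  admissible multiple of the determinant.\<close>

lemma abs_dtb_le: "\<bar>dtb u u\<bar> \<le> (norm u)\<^sup>2"
proof -
  obtain x y z where u: "u = (x, y, z)" by (cases u) auto
  have "0 \<le> (x - z)\<^sup>2" "0 \<le> (x + z)\<^sup>2" by simp_all
  then have "2 * (x * z) \<le> x\<^sup>2 + z\<^sup>2" "- (2 * (x * z)) \<le> x\<^sup>2 + z\<^sup>2"
    by (simp_all add: power2_diff power2_sum)
  moreover have "0 \<le> x\<^sup>2" "0 \<le> y\<^sup>2" "0 \<le> z\<^sup>2" "y * y = y\<^sup>2"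
    by (simp_all add: power2_eq_square)
  moreover have "dtb u u = x * z - y * y" by (simp add: u)
  ultimately show ?thesis unfolding u norm_vec3 by linarith
qed

lemma bilinear_quad:
  fixes S :: "'a::real_vector \<Rightarrow> 'a \<Rightarrow> real"
  assumes "bilinear S" "\<And>u v. S u v = S v u"
  shows "S (u + t *\<^sub>R v) (u + t *\<^sub>R v) = S u u + 2 * t * S u v + t\<^sup>2 * S v v"
  using assms(1)
  by (simp add: bilinear_ladd bilinear_radd bilinear_lmul bilinear_rmul assms(2)[of v u] power2_eq_square algebra_simps)

text \<open>The triple \<open>(x, y, z)\<close> stands for the symmetric matrix with rows \<open>(x, y)\<close> and \<open>(y, z)\<close>, and
  \<open>dtb\<close> is the polarised determinant. Below, \<open>ap 1\<close> and \<open>ap (-1)\<close> are \<open>\<alpha>\<^sup>+\<close> and \<open>\<alpha>\<^sup>-\<close>, \<open>ff\<close> is the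
  density under the minimum in the definition of the limit density, \<open>gm\<close> a minimiser, and \<open>qb\<close>
  the limit density.\<close>

locale sym_form =
  fixes S :: "vec3 \<Rightarrow> vec3 \<Rightarrow> real"
  assumes bil: "bilinear S" and sym: "S u v = S v u"
    and pos: "u \<noteq> 0 \<Longrightarrow> S u u > 0"
begin

lemma S_simps:
  "S (u + u') v = S u v + S u' v" "S v (u + u') = S v u + S v u'"
  "S (c *\<^sub>R u) v = c * S u v" "S v (c *\<^sub>R u) = c * S v u"
  "S (u - u') v = S u v - S u' v" "S v (u - u') = S v u - S v u'"
  "S 0 v = 0" "S v 0 = 0"
  using bil by (simp_all add: bilinear_ladd bilinear_radd bilinear_lmul bilinear_rmul bilinear_lsub
      bilinear_rsub bilinear_lzero bilinear_rzero)

lemma nonneg: "S u u \<ge> 0"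
  using pos[of u] by (cases "u = 0") (auto simp: S_simps)

lemma continuous_on_bilinear:
  fixes T :: "vec3 \<Rightarrow> vec3 \<Rightarrow> real"
  assumes "bilinear T" "continuous_on A f" "continuous_on A g"
  shows "continuous_on A (\<lambda>x. T (f x) (g x))"
  using bounded_bilinear.continuous_on[OF assms(1)[unfolded bilinear_conv_bounded_bilinear] assms(2,3)] .

lemmas continuous_S [continuous_intros] = continuous_on_bilinear[OF bil]
  and continuous_dtb [continuous_intros] = continuous_on_bilinear[OF bilinear_dtb]

lemma scale_unit:
  assumes "bilinear T" "u \<noteq> 0"
  shows "T u u = (norm u)\<^sup>2 * T (u /\<^sub>R norm u) (u /\<^sub>R norm u)"
  using assms by (simp add: bilinear_lmul bilinear_rmul power2_eq_square field_simps)

text \<open>The form has a positive minimum on the compact unit sphere, and homogeneity carries this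
  bound to every vector.\<close>

lemma coercive_form:
  fixes T :: "vec3 \<Rightarrow> vec3 \<Rightarrow> real"
  assumes "bilinear T" "\<And>u. u \<noteq> 0 \<Longrightarrow> T u u > 0"
  shows "\<exists>c>0. \<forall>u. T u u \<ge> c * (norm u)\<^sup>2"
proof -
  have ne: "sphere (0::vec3) 1 \<noteq> {}" by simp
  have "continuous_on (sphere 0 1) (\<lambda>u. T u u)"
    by (rule continuous_on_bilinear[OF assms(1) continuous_on_id continuous_on_id])
  then obtain u0 where u0: "u0 \<in> sphere 0 1" "\<And>u. u \<in> sphere 0 1 \<Longrightarrow> T u0 u0 \<le> T u u"
    using continuous_attains_inf[OF compact_sphere ne] by blast
  show ?thesis
  proof (intro exI[of _ "T u0 u0"] conjI allI)
    have "u0 \<noteq> 0" using u0(1) by auto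
    then show "T u0 u0 > 0" by (rule assms(2))
    show "T u u \<ge> T u0 u0 * (norm u)\<^sup>2" for u
    proof (cases "u = 0")
      case False
      then have "u /\<^sub>R norm u \<in> sphere 0 1" by simp
      then show ?thesis using u0(2) scale_unit[OF assms(1) False]
        by (metis mult.commute mult_left_mono zero_le_power2)
    qed (use assms(1) in \<open>simp add: bilinear_lzero\<close>)
  qed
qed

text \<open>The pencil through \<open>S\<close> in the direction of the determinant. Both forms
  whose maximum is \<open>ff\<close> belong to it; the members in between serve as touching
  minorants at a kink.\<close>

definition Sb :: "real \<Rightarrow> vec3 \<Rightarrow> vec3 \<Rightarrow> real" where "Sb \<beta> u v = S u v + \<beta> * dtb u v"

lemma bilinear_Sb: "bilinear (Sb \<beta>)"
  unfolding bilinear_def Sb_def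
  by (intro conjI allI linearI) (simp_all add: S_simps dtb_def field_simps)

definition ap :: "real \<Rightarrow> real" where
  "ap \<sigma> = Sup {\<alpha>. \<alpha> > 0 \<and> (\<forall>u. S u u + \<alpha> * (\<sigma> * dtb u u) \<ge> 0)}"

text \<open>The supremum is over a nonempty bounded set, and semidefiniteness passes to it. Strict
  positivity at the supremum would give coercivity with some m > 0, and \<alpha> could then be
  raised by m; maximality therefore forces a null vector.\<close>

lemma ap_props:
  assumes \<sigma>: "\<sigma> = 1 \<or> \<sigma> = -1"
  shows ap_pos: "ap \<sigma> > 0" and ap_psd: "S u u + ap \<sigma> * (\<sigma> * dtb u u) \<ge> 0"
    and ap_null: "\<exists>N. N \<noteq> 0 \<and> S N N + ap \<sigma> * (\<sigma> * dtb N N) = 0"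
proof -
  let ?T = "{\<alpha>. \<alpha> > 0 \<and> (\<forall>u. S u u + \<alpha> * (\<sigma> * dtb u u) \<ge> 0)}"
  have le: "\<bar>\<sigma> * dtb u u\<bar> \<le> (norm u)\<^sup>2" for u using abs_dtb_le[of u] \<sigma> by auto
  obtain c where c: "c > 0" "\<And>u. S u u \<ge> c * (norm u)\<^sup>2" using coercive_form[OF bil pos] by blast
  \<comment> \<open>The coercivity constant is admissible because the signed determinant is bounded
    by the squared norm.\<close>
  have cT: "c \<in> ?T"
  proof (clarsimp simp: c(1))
    fix x y z
    have "c * \<bar>\<sigma> * dtb (x,y,z) (x,y,z)\<bar> \<le> c * (norm (x,y,z))\<^sup>2" using le c(1) by (intro mult_left_mono) auto
    moreover have "- (c * \<bar>\<sigma> * dtb (x,y,z) (x,y,z)\<bar>) \<le> c * (\<sigma> * dtb (x,y,z) (x,y,z))"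
      using c(1) by (smt (verit) mult_left_mono mult_minus_right)
    ultimately show "0 \<le> S (x,y,z) (x,y,z) + c * (\<sigma> * (x * z - y * y))" using c(2)[of "(x,y,z)"] by (simp add: mult.commute)
  qed
  \<comment> \<open>A vector with signed determinant -1 bounds every admissible \<alpha> by its
    energy: an off-diagonal matrix for \<sigma> = 1, the identity for \<sigma> = -1.\<close>
  have "\<exists>w. \<sigma> * dtb w w = -1"
    using \<sigma>
  proof
    assume "\<sigma> = 1" then show ?thesis by (intro exI[of _ "(0,1,0)"]) simp
  next
    assume "\<sigma> = -1" then show ?thesis by (intro exI[of _ "(1,0,1)"]) simp
  qed
  then obtain w where w: "\<sigma> * dtb w w = -1" by blast
  have bdd: "bdd_above ?T"
  proof (rule bdd_aboveI[of _ "S w w"])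
    fix x assume "x \<in> ?T"
    then have "0 \<le> S w w + x * (\<sigma> * dtb w w)" by blast
    then show "x \<le> S w w" using w by simp
  qed
  show apos: "ap \<sigma> > 0"
    using cSup_upper[OF cT bdd] c(1) unfolding ap_def by linarith
  show psd: "S u u + ap \<sigma> * (\<sigma> * dtb u u) \<ge> 0" for u
  proof (cases "\<sigma> * dtb u u \<ge> 0")
    case True then show ?thesis using nonneg[of u] apos by simp
  next
    case False
    \<comment> \<open>Only negative signed determinants constrain \<alpha>, and there each
      admissible value lies below this quotient.\<close>
    have "ap \<sigma> \<le> S u u / (- (\<sigma> * dtb u u))" unfolding ap_def
    proof (rule cSup_least)
      fix x assume "x \<in> ?T"
      then have "S u u + x * (\<sigma> * dtb u u) \<ge> 0" by blast
      then have "x * (- (\<sigma> * dtb u u)) \<le> S u u" by (simp add: mult_minus_right)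
      moreover have "0 < - (\<sigma> * dtb u u)" using False by linarith
      ultimately show "x \<le> S u u / (- (\<sigma> * dtb u u))" by (simp only: pos_le_divide_eq)
    qed (use cT in blast)
    then have "ap \<sigma> * (- (\<sigma> * dtb u u)) \<le> S u u"
      using False by (intro pos_le_divide_eq[THEN iffD1]) auto
    then show ?thesis by simp
  qed
  show "\<exists>N. N \<noteq> 0 \<and> S N N + ap \<sigma> * (\<sigma> * dtb N N) = 0"
  proof (rule ccontr)
    assume "\<not> ?thesis"
    then have strict: "S u u + ap \<sigma> * (\<sigma> * dtb u u) > 0" if "u \<noteq> 0" for u
      using psd[of u] that by (metis order_le_less)
    let ?R = "Sb (ap \<sigma> * \<sigma>)"
    have "?R u u > 0" if "u \<noteq> 0" for u using strict[OF that] by (simp add: Sb_def mult_ac)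
    from coercive_form[OF bilinear_Sb this] obtain m where m: "m > 0" "\<And>u. ?R u u \<ge> m * (norm u)\<^sup>2"
      by auto
    have "ap \<sigma> + m \<in> ?T"
    proof (clarsimp, intro conjI allI)
      show "ap \<sigma> + m > 0" using apos m(1) by simp
      fix x y z
      have "m * \<bar>\<sigma> * dtb (x,y,z) (x,y,z)\<bar> \<le> m * (norm (x,y,z))\<^sup>2" using le m(1) by (intro mult_left_mono) auto
      moreover have "- (m * \<bar>\<sigma> * dtb (x,y,z) (x,y,z)\<bar>) \<le> m * (\<sigma> * dtb (x,y,z) (x,y,z))"
        using m(1) by (smt (verit) mult_left_mono mult_minus_right)
      ultimately show "0 \<le> S (x,y,z) (x,y,z) + (ap \<sigma> + m) * (\<sigma> * (x * z - y * y))"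
        using m(2)[of "(x,y,z)"] by (simp add: algebra_simps Sb_def)
    qed
    from cSup_upper[OF this bdd] show False using m(1) unfolding ap_def by linarith
  qed
qed

lemma Sb_commute: "Sb \<beta> u v = Sb \<beta> v u"
  unfolding Sb_def by (metis sym dtb_commute)

lemmas Sb_quad = bilinear_quad[OF bilinear_Sb Sb_commute]

section \<open>The relaxed density as a maximum of two forms\<close>

definition ff :: "vec3 \<Rightarrow> real" where
  "ff u = S u u + ap 1 * max (dtb u u) 0 + ap (-1) * max (- dtb u u) 0"

text \<open>The two forms differ by the positive multiple \<open>ap 1 + ap (-1)\<close> of the
  determinant, so the sign of the determinant decides which is larger.\<close>

lemma ff_eq_max: "ff u = max (Sb (ap 1) u u) (Sb (- ap (-1)) u u)"
proof (cases "dtb u u \<ge> 0")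
  case True
  then have "- ap (-1) * dtb u u \<le> 0" "ap 1 * dtb u u \<ge> 0"
    using ap_pos[of 1] ap_pos[of "-1"] by (simp_all add: mult_nonneg_nonneg)
  then show ?thesis using True by (auto simp: ff_def Sb_def max_def)
next
  case False
  then have "- ap (-1) * dtb u u \<ge> 0" "ap 1 * dtb u u \<le> 0"
    using ap_pos[of 1] ap_pos[of "-1"] by (simp_all add: mult_nonneg_nonpos)
  then show ?thesis using False by (auto simp: ff_def Sb_def max_def)
qed

text \<open>The value is affine in \<beta>, so the least favourable \<beta> is an endpoint, selected
  by the sign of the determinant.\<close>

lemma Sb_psd:
  assumes "- ap (-1) \<le> \<beta>" "\<beta> \<le> ap 1"
  shows "Sb \<beta> u u \<ge> 0"
proof (cases "dtb u u \<ge> 0")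
  case True
  from mult_right_mono[OF assms(1) this] show ?thesis
    using ap_psd[of "-1" u] unfolding Sb_def by linarith
next
  case False
  then have "dtb u u \<le> 0" by simp
  from mult_right_mono_neg[OF assms(2) this] show ?thesis
    using ap_psd[of 1 u] unfolding Sb_def by linarith
qed

text \<open>Again affine in \<beta>, now with the more favourable endpoint. Together with
  \<open>Sb_psd\<close> this gives convex quadratic minorants of \<open>ff\<close>.\<close>

lemma Sb_le_ff:
  assumes "- ap (-1) \<le> \<beta>" "\<beta> \<le> ap 1"
  shows "Sb \<beta> u u \<le> ff u"
proof (cases "dtb u u \<ge> 0")
  case True
  from mult_right_mono[OF assms(2) this] show ?thesis
    unfolding ff_eq_max Sb_def by linarith
next
  case False
  then have "dtb u u \<le> 0" by simp
  from mult_right_mono_neg[OF assms(1) this] show ?thesis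
    unfolding ff_eq_max Sb_def by linarith
qed

lemma ff_ge: "S u u \<le> ff u"
  using ap_pos[of 1] ap_pos[of "-1"] by (simp add: ff_def)

lemma ff_minimizer: "\<exists>\<gamma>. \<forall>\<gamma>'. ff (x, y, \<gamma>) \<le> ff (x, y, \<gamma>')"
proof -
  obtain c where c: "c > 0" "\<And>u. S u u \<ge> c * (norm u)\<^sup>2" using coercive_form[OF bil pos] by blast
  have low: "c * z\<^sup>2 \<le> ff (x, y, z)" for z
  proof -
    have "c * z\<^sup>2 \<le> c * (norm (x, y, z))\<^sup>2" using c(1) unfolding norm_vec3 by (intro mult_left_mono) auto
    then show ?thesis using c(2)[of "(x,y,z)"] ff_ge[of "(x,y,z)"] by linarith
  qed
  \<comment> \<open>Beyond this radius the coercive lower bound is at least the value at \<gamma> =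
    0, so a minimum over the compact interval is global.\<close>
  define R where "R = sqrt (ff (x, y, 0) / c)"
  have f0: "ff (x, y, 0) \<ge> 0" using low[of 0] by simp
  have R: "R \<ge> 0" "c * R\<^sup>2 = ff (x, y, 0)" using f0 c(1) by (auto simp: R_def)
  have "continuous_on {-R..R} (\<lambda>z. ff (x, y, z))"
    unfolding ff_def by (intro continuous_intros)
  then obtain \<gamma> where \<gamma>: "\<gamma> \<in> {-R..R}" "\<And>z. z \<in> {-R..R} \<Longrightarrow> ff (x, y, \<gamma>) \<le> ff (x, y, z)"
    using continuous_attains_inf[of "{-R..R}" "\<lambda>z. ff (x, y, z)"] R(1) by auto
  have "ff (x, y, \<gamma>) \<le> ff (x, y, z)" for z
  proof (cases "z \<in> {-R..R}")
    case False
    then have "\<bar>R\<bar> \<le> \<bar>z\<bar>" using R(1) by auto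
    then have "R\<^sup>2 \<le> z\<^sup>2" by (simp only: abs_le_square_iff)
    then have "c * R\<^sup>2 \<le> c * z\<^sup>2" using c(1) by simp
    moreover have "ff (x, y, \<gamma>) \<le> ff (x, y, 0)" using \<gamma>(2)[of 0] R(1) by simp
    ultimately show ?thesis using low[of z] R(2) by linarith
  qed (rule \<gamma>(2))
  then show ?thesis by blast
qed

definition gm :: "real \<Rightarrow> real \<Rightarrow> real" where
  "gm x y = (SOME \<gamma>. \<forall>\<gamma>'. ff (x, y, \<gamma>) \<le> ff (x, y, \<gamma>'))"

lemma gm: "ff (x, y, gm x y) \<le> ff (x, y, \<gamma>)"
  using someI_ex[OF ff_minimizer[of x y]] unfolding gm_def by blast

definition qb :: "real \<Rightarrow> real \<Rightarrow> real" where "qb x y = ff (x, y, gm x y)"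

lemma qb_le: "qb x y \<le> ff (x, y, \<gamma>)"
  unfolding qb_def by (rule gm)

text \<open>First-order optimality in \<open>\<gamma>\<close> for the maximum of two convex quadratic functions: at a kink
  some convex combination of the two derivatives vanishes.\<close>

lemma max_quadratics_optimality:
  fixes x y :: real
  defines "e \<equiv> (0, 0, 1) :: vec3" and "u \<equiv> (x, y, gm x y)"
  shows "\<exists>\<beta>. - ap (-1) \<le> \<beta> \<and> \<beta> \<le> ap 1 \<and> ff u = Sb \<beta> u u \<and> Sb \<beta> u e = 0"
proof -
  have min: "ff u \<le> ff (u + t *\<^sub>R e)" for t
    unfolding u_def e_def using gm[of x y "gm x y + t"] by simp
  \<comment> \<open>The determinant is affine in \<gamma>; it keeps its sign near a point where it
    is nonzero, and the active form does not change there.\<close>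
  have dt: "dtb (u + t *\<^sub>R e) (u + t *\<^sub>R e) = dtb u u + t * x" for t
    by (simp add: u_def e_def algebra_simps)
  let ?P = "Sb (ap 1)" and ?M = "Sb (- ap (-1))"
  have p: "ap 1 > 0" "ap (-1) > 0" using ap_pos[of 1] ap_pos[of "-1"] by auto
  have lim: "((\<lambda>t. dtb u u + (s * t) * x) \<longlongrightarrow> dtb u u + (s * 0) * x) (at_right 0)" for s
    by (intro tendsto_intros)
  have right: "\<not> (\<forall>\<^sub>F t in at_right 0. ff (u + (s * t) *\<^sub>R e) < ff u)" for s
  proof
    assume "\<forall>\<^sub>F t in at_right 0. ff (u + (s * t) *\<^sub>R e) < ff u"
    from eventually_happens[OF this] min show False by (auto simp: not_less[symmetric])
  qed
  \<comment> \<open>If one form is active along the ray with direction s, minimality makes its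
    one-sided slope nonnegative; using s = 1 and s = -1 gives a vanishing derivative.\<close>
  have one_sided: "2 * s * Sb \<beta> u e \<ge> 0"
    if ev: "\<forall>\<^sub>F t in at_right 0. ff (u + (s * t) *\<^sub>R e) = Sb \<beta> (u + (s * t) *\<^sub>R e) (u + (s * t) *\<^sub>R e)"
      and eq: "ff u = Sb \<beta> u u" for s \<beta>
  proof (rule ccontr)
    assume "\<not> ?thesis"
    then have "\<forall>\<^sub>F t in at_right 0. (2 * s * Sb \<beta> u e) * t + (s\<^sup>2 * Sb \<beta> e e) * t\<^sup>2 < 0"
      by (intro eventually_quadratic_neg) auto
    with ev have "\<forall>\<^sub>F t in at_right 0. ff (u + (s * t) *\<^sub>R e) < ff u"
      by eventually_elim (auto simp: Sb_quad eq power_mult_distrib algebra_simps)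
    with right show False by blast
  qed
  consider "dtb u u > 0" | "dtb u u < 0" | "dtb u u = 0" by linarith
  then show ?thesis
  proof cases
    case 1
    have "\<forall>\<^sub>F t in at_right 0. ff (u + (s * t) *\<^sub>R e) = ?P (u + (s * t) *\<^sub>R e) (u + (s * t) *\<^sub>R e)" for s
    proof -
      have "\<forall>\<^sub>F t in at_right 0. dtb u u + (s * t) * x > 0"
        using order_tendstoD(1)[OF lim, of 0 s] 1 by simp
      then show ?thesis by (rule eventually_mono) (unfold ff_def Sb_def dt, simp)
    qed
    moreover have eq: "ff u = ?P u u" using 1 by (simp add: ff_def Sb_def)
    ultimately have "2 * 1 * ?P u e \<ge> 0" "2 * (-1) * ?P u e \<ge> 0" using one_sided by blast+
    then have "?P u e = 0" by simp
    then show ?thesis using eq p by (intro exI[of _ "ap 1"]) auto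
  next
    case 2
    have "\<forall>\<^sub>F t in at_right 0. ff (u + (s * t) *\<^sub>R e) = ?M (u + (s * t) *\<^sub>R e) (u + (s * t) *\<^sub>R e)" for s
    proof -
      have "\<forall>\<^sub>F t in at_right 0. dtb u u + (s * t) * x < 0"
        using order_tendstoD(2)[OF lim, of s 0] 2 by simp
      then show ?thesis
      proof eventually_elim
        case (elim t)
        then have "dtb (u + (s * t) *\<^sub>R e) (u + (s * t) *\<^sub>R e) < 0" unfolding dt .
        then show ?case unfolding ff_def Sb_def by simp
      qed
    qed
    moreover have eq: "ff u = ?M u u" using 2 by (simp add: ff_def Sb_def)
    ultimately have "2 * 1 * ?M u e \<ge> 0" "2 * (-1) * ?M u e \<ge> 0" using one_sided by blast+
    then have "?M u e = 0" by simp
    then show ?thesis using eq p by (intro exI[of _ "- ap (-1)"]) auto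
  next
    case 3
    then have eq: "ff u = Sb \<beta> u u" for \<beta> by (simp add: ff_def Sb_def)
    \<comment> \<open>At a kink both forms cannot descend strictly in the same direction, since
      their maximum would then decrease.\<close>
    have sgn: "\<not> (s * ?P u e < 0 \<and> s * ?M u e < 0)" for s
    proof
      assume "s * ?P u e < 0 \<and> s * ?M u e < 0"
      then have "\<forall>\<^sub>F t in at_right 0. (2 * (s * ?P u e)) * t + (s\<^sup>2 * ?P e e) * t\<^sup>2 < 0"
        "\<forall>\<^sub>F t in at_right 0. (2 * (s * ?M u e)) * t + (s\<^sup>2 * ?M e e) * t\<^sup>2 < 0"
        by (auto intro!: eventually_quadratic_neg)
      then have "\<forall>\<^sub>F t in at_right 0. ff (u + (s * t) *\<^sub>R e) < ff u"
      proof eventually_elim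
        case (elim t)
        then have "?P (u + (s * t) *\<^sub>R e) (u + (s * t) *\<^sub>R e) < ff u"
          "?M (u + (s * t) *\<^sub>R e) (u + (s * t) *\<^sub>R e) < ff u"
          unfolding Sb_quad using eq[of "ap 1"] eq[of "- ap (-1)"] by (auto simp: power_mult_distrib algebra_simps)
        then show ?case by (simp add: ff_eq_max[of "u + (s * t) *\<^sub>R e"])
      qed
      with right show False by blast
    qed
    show ?thesis
    proof (cases "?P u e = ?M u e")
      case True
      then have "?P u e = 0" using sgn[of 1] sgn[of "-1"] by (auto simp: not_less)
      then show ?thesis using eq p by (intro exI[of _ "ap 1"]) auto
    next
      case False
      \<comment> \<open>Zero of the affine interpolation from the slope of \<open>?P\<close> at 0 to
        that of \<open>?M\<close> at 1; it lies in [0, 1] because the slopes do not share a strict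
        sign.\<close>
      define s where "s = ?P u e / (?P u e - ?M u e)"
      have s: "0 \<le> s" "s \<le> 1" using sgn[of 1] sgn[of "-1"] False
        by (auto simp: s_def zero_le_divide_iff divide_le_eq not_less)
      define \<beta> where "\<beta> = (1 - s) * ap 1 + s * (- ap (-1))"
      have "Sb \<beta> u e = (1 - s) * ?P u e + s * ?M u e"
        by (simp add: Sb_def \<beta>_def algebra_simps)
      also have "\<dots> = 0" using False unfolding s_def by (simp add: field_simps)
      finally have "Sb \<beta> u e = 0" .
      moreover have "\<beta> \<le> ap 1" "- ap (-1) \<le> \<beta>"
        using convex_bound_le[of "ap 1" "ap 1" "- ap (-1)" "1 - s" s]
          convex_bound_le[of "- ap 1" "ap (-1)" "ap (-1)" "1 - s" s] s p
        by (auto simp: \<beta>_def)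
      ultimately show ?thesis using eq by blast
    qed
  qed
qed

section \<open>Growth and subgradients of the limit density\<close>

lemma form_bounded: "\<exists>C>0. \<forall>u v. \<bar>T u v\<bar> \<le> C * norm u * norm v" if "bilinear T" for T :: "vec3 \<Rightarrow> vec3 \<Rightarrow> real"
proof -
  have "bounded_bilinear T" using that bilinear_conv_bounded_bilinear by blast
  from bounded_bilinear.pos_bounded[OF this] show ?thesis
    by (auto simp: mult_ac)
qed

text \<open>The competitor \<gamma> = 0 gives the quadratic upper bound of the minimum.\<close>

lemma qb_bounds:
  "\<exists>c C. c > 0 \<and> C > 0 \<and> (\<forall>u. c * (norm u)\<^sup>2 \<le> S u u) \<and> (\<forall>u. S u u \<le> C * (norm u)\<^sup>2) \<and>
    (\<forall>x y. 0 \<le> qb x y) \<and> (\<forall>x y. qb x y \<le> C * (x\<^sup>2 + y\<^sup>2))"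
proof -
  obtain c where c: "c > 0" "\<And>u. S u u \<ge> c * (norm u)\<^sup>2" using coercive_form[OF bil pos] by blast
  obtain C where C: "C > 0" "\<And>u v. \<bar>S u v\<bar> \<le> C * norm u * norm v" using form_bounded[OF bil] by blast
  define C' where "C' = C + ap 1 + ap (-1)"
  have p: "ap 1 > 0" "ap (-1) > 0" using ap_pos[of 1] ap_pos[of "-1"] by auto
  have S: "S u u \<le> C * (norm u)\<^sup>2" for u using C(2)[of u u] by (simp add: power2_eq_square mult_ac)
  have "ff u \<le> C * (norm u)\<^sup>2 + ap 1 * (norm u)\<^sup>2 + ap (-1) * (norm u)\<^sup>2" for u
    unfolding ff_def using S[of u] abs_dtb_le[of u] p by (intro add_mono mult_left_mono) auto
  then have f: "ff u \<le> C' * (norm u)\<^sup>2" for u by (simp add: C'_def algebra_simps)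
  have "qb x y \<le> C' * (x\<^sup>2 + y\<^sup>2)" for x y
    using qb_le[of x y 0] f[of "(x,y,0)"] unfolding norm_vec3 by simp
  moreover have "S u u \<le> C' * (norm u)\<^sup>2" for u using f[of u] ff_ge[of u] by simp
  moreover have "0 \<le> qb x y" for x y using ff_ge nonneg unfolding qb_def by (meson order_trans)
  moreover have "C' > 0" using C(1) p by (simp add: C'_def)
  ultimately show ?thesis using c by (intro exI[of _ c] exI[of _ C']) blast
qed

text \<open>At the minimiser, the form \<open>Sb \<beta>\<close> supplied by
  \<open>max_quadratics_optimality\<close> touches \<open>ff\<close> and has zero derivative in
  \<gamma>. Its tangent is therefore an affine function of the first two entries alone.
  Semidefiniteness and \<open>Sb_le_ff\<close> put this tangent below \<open>ff\<close> for every
  third entry, including the optimal one.\<close>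

lemma qb_subgradient:
  obtains K p1 p2 where "K > 0"
    "\<And>x y x' y'. qb x' y' \<ge> qb x y + p1 x y * (x' - x) + p2 x y * (y' - y)"
    "\<And>x y. \<bar>p1 x y\<bar> \<le> K * norm (x, y)" "\<And>x y. \<bar>p2 x y\<bar> \<le> K * norm (x, y)"
proof -
  let ?e = "(0, 0, 1) :: vec3"
  define u where "u x y = (x, y, gm x y)" for x y
  have "\<forall>x y. \<exists>\<beta>. - ap (-1) \<le> \<beta> \<and> \<beta> \<le> ap 1 \<and> ff (u x y) = Sb \<beta> (u x y) (u x y) \<and> Sb \<beta> (u x y) ?e = 0"
    using max_quadratics_optimality unfolding u_def by blast
  then obtain \<beta> where \<beta>: "- ap (-1) \<le> \<beta> x y" "\<beta> x y \<le> ap 1" "ff (u x y) = Sb (\<beta> x y) (u x y) (u x y)"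
     "Sb (\<beta> x y) (u x y) ?e = 0" for x y by metis
  define P where "P x y v = 2 * Sb (\<beta> x y) (u x y) v" for x y v
  have sub: "qb x' y' \<ge> qb x y + P x y (1,0,0) * (x' - x) + P x y (0,1,0) * (y' - y)" for x y x' y'
  proof -
    let ?\<beta> = "\<beta> x y" and ?u = "u x y" and ?v = "u x' y'"
    note B = bilinear_Sb[of ?\<beta>]
    have v: "?v - ?u = (x' - x) *\<^sub>R (1,0,0) + (y' - y) *\<^sub>R (0,1,0) + (gm x' y' - gm x y) *\<^sub>R ?e"
      by (simp add: u_def)
    have "Sb ?\<beta> ?v ?v = Sb ?\<beta> ?u ?u + 2 * Sb ?\<beta> ?u (?v - ?u) + Sb ?\<beta> (?v - ?u) (?v - ?u)"
      using Sb_quad[of ?\<beta> ?u 1 "?v - ?u"] by simp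
    also have "Sb ?\<beta> ?u (?v - ?u) = (x' - x) * Sb ?\<beta> ?u (1,0,0) + (y' - y) * Sb ?\<beta> ?u (0,1,0)"
      unfolding v using \<beta>(4)[of x y] B by (simp only: bilinear_radd bilinear_rmul) simp
    finally have "Sb ?\<beta> ?v ?v = Sb ?\<beta> ?u ?u + P x y (1,0,0) * (x' - x) + P x y (0,1,0) * (y' - y) + Sb ?\<beta> (?v - ?u) (?v - ?u)"
      by (simp add: P_def algebra_simps)
    moreover have "Sb ?\<beta> ?v ?v \<le> ff ?v" "Sb ?\<beta> (?v - ?u) (?v - ?u) \<ge> 0"
      by (intro Sb_le_ff Sb_psd \<beta>)+
    moreover have "qb x' y' = ff ?v" "qb x y = Sb ?\<beta> ?u ?u" using \<beta>(3) by (simp_all add: qb_def u_def)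
    ultimately show ?thesis by simp
  qed
  obtain c C where c: "c > 0" "C > 0" "\<And>u. c * (norm u)\<^sup>2 \<le> S u u" "\<And>x y. qb x y \<le> C * (x\<^sup>2 + y\<^sup>2)"
    using qb_bounds by blast
  obtain C1 where C1: "C1 > 0" "\<And>u v. \<bar>S u v\<bar> \<le> C1 * norm u * norm v" using form_bounded[OF bil] by blast
  obtain C2 where C2: "C2 > 0" "\<And>u v. \<bar>dtb u v\<bar> \<le> C2 * norm u * norm v" using form_bounded[OF bilinear_dtb] by blast
  define A where "A = ap 1 + ap (-1)"
  have pp: "ap 1 > 0" "ap (-1) > 0" using ap_pos[of 1] ap_pos[of "-1"] by auto
  \<comment> \<open>From c |u|^2 \<le> \<open>qb x y\<close> \<le> C |(x, y)|^2: the minimiser, and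
    hence the slope, grows at most linearly.\<close>
  define D where "D = sqrt (C / c)"
  have D: "D > 0" using c by (simp add: D_def)
  have nu: "norm (u x y) \<le> D * norm (x, y)" for x y
  proof -
    have "c * (norm (u x y))\<^sup>2 \<le> C * (x\<^sup>2 + y\<^sup>2)"
      using c(3)[of "u x y"] c(4)[of x y] ff_ge[of "u x y"] by (simp add: qb_def u_def)
    then have "(norm (u x y))\<^sup>2 \<le> (D * norm (x, y))\<^sup>2" using c(1,2)
      by (simp add: D_def power_mult_distrib norm_Pair field_simps)
    then show ?thesis using D by (simp add: power2_le_iff_abs_le)
  qed
  have bound: "\<bar>P x y v\<bar> \<le> 2 * (C1 + A * C2) * D * norm (x, y)" if "norm v = 1" for x y v
  proof -
    have "\<bar>\<beta> x y\<bar> \<le> A" using \<beta>(1,2)[of x y] pp by (auto simp: A_def)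
    then have "\<bar>Sb (\<beta> x y) (u x y) v\<bar> \<le> C1 * norm (u x y) * 1 + A * (C2 * norm (u x y) * 1)"
      unfolding Sb_def using C1(2)[of "u x y" v] C2(2)[of "u x y" v] that
      by (intro order_trans[OF abs_triangle_ineq] add_mono) (auto simp: abs_mult intro!: mult_mono)
    also have "\<dots> = (C1 + A * C2) * norm (u x y)" by (simp add: algebra_simps)
    also have "\<dots> \<le> (C1 + A * C2) * (D * norm (x, y))"
      using nu C1(1) C2(1) pp by (intro mult_left_mono) (auto simp: A_def)
    finally have "\<bar>Sb (\<beta> x y) (u x y) v\<bar> \<le> (C1 + A * C2) * (D * norm (x, y))" .
    then show ?thesis unfolding P_def abs_mult by (simp only: abs_numeral mult.assoc)
  qed
  have "2 * (C1 + A * C2) * D > 0" using C1(1) C2(1) pp D by (simp add: A_def add_pos_pos)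
  then show ?thesis
    by (intro that[of "2 * (C1 + A * C2) * D" "\<lambda>x y. P x y (1,0,0)" "\<lambda>x y. P x y (0,1,0)"] sub bound)
      (simp_all add: norm_Pair)
qed

section \<open>Splitting into two states of determinant zero\<close>

lemma rank_one_reduce:
  assumes "dtb (x, y, z) (x, y, z) = 0"
  shows "\<exists>p. y = x * p \<and> S (x, x * p, x * p\<^sup>2) (x, x * p, x * p\<^sup>2) \<le> S (x, y, z) (x, y, z)"
proof (cases "x = 0")
  case True
  \<comment> \<open>With x = 0 the determinant forces y = 0. The remaining entry z, which is not of
    the form x p^2 unless it is zero, is dropped; this can only lower the energy.\<close>
  then have "y = 0" using assms by simp
  then show ?thesis using True nonneg S_simps(7) by (intro exI[of _ 0]) (simp flip: zero_prod_def)
next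
  case False
  then have "z = x * (y / x)\<^sup>2" using assms by (simp add: power2_eq_square field_simps)
  then show ?thesis using False by (intro exI[of _ "y / x"]) simp
qed

text \<open>The null vector N of the active form is orthogonal to the optimum, so that form is
  constant along the line through it; at points of determinant zero it coincides with
  \<open>S\<close>. Reduction to the shape (x, x p, x p^2) may change the third entry, which is
  harmless because only the averages of the first two are prescribed.\<close>

lemma two_state_split:
  "\<exists>\<mu> x1 p1 x2 p2. 0 \<le> \<mu> \<and> \<mu> \<le> 1 \<and> x = \<mu> * x1 + (1 - \<mu>) * x2 \<and> y = \<mu> * (x1 * p1) + (1 - \<mu>) * (x2 * p2) \<and>
     \<mu> * S (x1, x1 * p1, x1 * p1\<^sup>2) (x1, x1 * p1, x1 * p1\<^sup>2) +
     (1 - \<mu>) * S (x2, x2 * p2, x2 * p2\<^sup>2) (x2, x2 * p2, x2 * p2\<^sup>2) \<le> qb x y"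
proof -
  let ?u = "(x, y, gm x y)"
  have "\<exists>\<mu> v w. 0 \<le> \<mu> \<and> \<mu> \<le> 1 \<and> ?u = \<mu> *\<^sub>R v + (1 - \<mu>) *\<^sub>R w \<and> dtb v v = 0 \<and> dtb w w = 0 \<and>
     \<mu> * S v v + (1 - \<mu>) * S w w \<le> qb x y"
  proof (cases "dtb ?u ?u = 0")
    case True
    then show ?thesis using ff_ge[of ?u] by (intro exI[of _ 1] exI[of _ ?u]) (auto simp: qb_def)
  next
    case False
    define \<sigma> where "\<sigma> = sgn (dtb ?u ?u)"
    have \<sigma>: "\<sigma> = 1 \<or> \<sigma> = -1" using False by (auto simp: \<sigma>_def sgn_if)
    obtain N where N: "N \<noteq> 0" "S N N + ap \<sigma> * (\<sigma> * dtb N N) = 0" using ap_null[OF \<sigma>] by blast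
    note aps = ap_pos[OF \<sigma>]
    let ?R = "Sb (ap \<sigma> * \<sigma>)"
    have RN: "?R N N = 0" using N(2) by (simp add: Sb_def mult_ac)
    have Rpsd: "?R v v \<ge> 0" for v using ap_psd[OF \<sigma>, of v] by (simp add: Sb_def mult_ac)
    have "?R ?u N = 0"
    proof (rule psd_null_orthogonal)
      show "0 \<le> ?R ?u ?u + 2 * t * ?R ?u N" for t
        using Rpsd[of "?u + t *\<^sub>R N"] unfolding Sb_quad RN by simp
    qed
    then have Rconst: "?R (?u + t *\<^sub>R N) (?u + t *\<^sub>R N) = ?R ?u ?u" for t
      unfolding Sb_quad RN by simp
    have fR: "ff ?u = ?R ?u ?u" using False by (auto simp: ff_def Sb_def \<sigma>_def sgn_if algebra_simps)
    \<comment> \<open>\<open>S N N\<close> is positive and cancels against the determinant term, so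
      the determinant of N has the sign opposite to that at the optimum.\<close>
    have dN: "\<sigma> * dtb N N < 0"
      using N pos[of N] aps by (smt (verit) mult_nonneg_nonneg)
    have du: "\<sigma> * dtb ?u ?u > 0" using False by (auto simp: \<sigma>_def sgn_if)
    \<comment> \<open>Along the line the signed determinant is c - 2 b t - a t^2 with a and c
      positive, so its two roots lie on opposite sides of 0.\<close>
    define a b c where "a = - (\<sigma> * dtb N N)" and "b = - (\<sigma> * dtb ?u N)" and "c = \<sigma> * dtb ?u ?u"
    have ac: "a > 0" "c > 0" using dN du by (simp_all add: a_def c_def)
    define r where "r = sqrt (b\<^sup>2 + a * c)"
    have "b\<^sup>2 < b\<^sup>2 + a * c" using ac by simp
    from real_sqrt_less_mono[OF this] have r: "r > \<bar>b\<bar>" by (simp add: r_def)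
    have r2: "r\<^sup>2 = b\<^sup>2 + a * c" unfolding r_def using ac by simp
    define t1 t2 where "t1 = (- b - r) / a" and "t2 = (- b + r) / a"
    have t: "t1 < 0" "t2 > 0" using r ac by (auto simp: t1_def t2_def divide_less_0_iff zero_less_divide_iff)
    have root: "dtb (?u + t *\<^sub>R N) (?u + t *\<^sub>R N) = 0" if "t = t1 \<or> t = t2" for t
    proof -
      have "a * (c - 2 * t * b - t\<^sup>2 * a) = (b\<^sup>2 + a * c) - (a * t + b)\<^sup>2"
        by (simp add: power2_eq_square algebra_simps)
      also have "(a * t + b)\<^sup>2 = r\<^sup>2" using that ac by (auto simp: t1_def t2_def)
      finally have "c - 2 * t * b - t\<^sup>2 * a = 0" using r2 ac by simp
      moreover have "\<sigma> * dtb (?u + t *\<^sub>R N) (?u + t *\<^sub>R N) = c - 2 * t * b - t\<^sup>2 * a"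
        unfolding bilinear_quad[OF bilinear_dtb dtb_commute] a_def b_def c_def by (simp add: algebra_simps del: dtb_simps)
      ultimately show ?thesis using \<sigma> by auto
    qed
    \<comment> \<open>Weights that put the barycentre of the two roots at t = 0.\<close>
    define \<mu> where "\<mu> = t2 / (t2 - t1)"
    have \<mu>: "0 \<le> \<mu>" "\<mu> \<le> 1" "\<mu> * t1 + (1 - \<mu>) * t2 = 0" using t by (auto simp: \<mu>_def field_simps)
    let ?v = "?u + t1 *\<^sub>R N" and ?w = "?u + t2 *\<^sub>R N"
    have "\<mu> *\<^sub>R ?v + (1 - \<mu>) *\<^sub>R ?w = ?u + (\<mu> * t1 + (1 - \<mu>) * t2) *\<^sub>R N"
      unfolding scaleR_add_right scaleR_add_left scaleR_diff_left scaleR_scaleR by (simp only: scaleR_one) (simp add: algebra_simps)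
    then have "?u = \<mu> *\<^sub>R ?v + (1 - \<mu>) *\<^sub>R ?w" using \<mu>(3) by simp
    moreover have SR: "S ?v ?v = ?R ?v ?v" "S ?w ?w = ?R ?w ?w" using root by (simp_all add: Sb_def del: dtb_simps)
    then have "\<mu> * S ?v ?v + (1 - \<mu>) * S ?w ?w = qb x y"
      unfolding SR Rconst qb_def fR by (simp add: algebra_simps)
    ultimately show ?thesis using \<mu> root by (intro exI[of _ \<mu>] exI[of _ ?v] exI[of _ ?w]) simp
  qed
  then obtain \<mu> v w where *: "0 \<le> \<mu>" "\<mu> \<le> 1" "?u = \<mu> *\<^sub>R v + (1 - \<mu>) *\<^sub>R w" "dtb v v = 0" "dtb w w = 0"
     "\<mu> * S v v + (1 - \<mu>) * S w w \<le> qb x y" by blast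
  obtain x1 y1 z1 x2 y2 z2 where vw: "v = (x1, y1, z1)" "w = (x2, y2, z2)" by (cases v, cases w) auto
  obtain p1 where p1: "y1 = x1 * p1" "S (x1, x1 * p1, x1 * p1\<^sup>2) (x1, x1 * p1, x1 * p1\<^sup>2) \<le> S v v"
    using rank_one_reduce *(4) vw by blast
  obtain p2 where p2: "y2 = x2 * p2" "S (x2, x2 * p2, x2 * p2\<^sup>2) (x2, x2 * p2, x2 * p2\<^sup>2) \<le> S w w"
    using rank_one_reduce *(5) vw by blast
  show ?thesis
  proof (intro exI conjI)
    show "\<mu> * S (x1, x1 * p1, x1 * p1\<^sup>2) (x1, x1 * p1, x1 * p1\<^sup>2) +
     (1 - \<mu>) * S (x2, x2 * p2, x2 * p2\<^sup>2) (x2, x2 * p2, x2 * p2\<^sup>2) \<le> qb x y"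
      using p1(2) p2(2) *(1,2,6) by (smt (verit) mult_left_mono)
  qed (use * vw p1 p2 in auto)
qed

end

section \<open>From triples back to matrices\<close>

definition sm :: "vec3 \<Rightarrow> real^2^2" where
  "sm u = vector [vector [fst u, fst (snd u)], vector [fst (snd u), snd (snd u)]]"

lemma sm_nth [simp]:
  "sm u $ 1 $ 1 = fst u" "sm u $ 1 $ 2 = fst (snd u)" "sm u $ 2 $ 1 = fst (snd u)" "sm u $ 2 $ 2 = snd (snd u)"
  by (simp_all add: sm_def)

lemma linear_sm: "linear sm"
  by (rule linearI) (simp_all add: vec_eq_iff forall_2)

lemma det_sm: "det (sm u) = dtb u u"
  by (simp add: det_2 dtb_def)

lemma sym_mat_eq: "sym_mat = range sm"
proof (intro set_eqI iffI)
  fix M :: "real^2^2" assume "M \<in> sym_mat"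
  then have "transpose M $ 1 $ 2 = M $ 1 $ 2" by (simp add: sym_mat_def)
  then have "M $ 2 $ 1 = M $ 1 $ 2" by (simp add: transpose_def)
  then have "M = sm (M $ 1 $ 1, M $ 1 $ 2, M $ 2 $ 2)" by (simp add: vec_eq_iff forall_2)
  then show "M \<in> range sm" by blast
qed (auto simp: sym_mat_def transpose_def vec_eq_iff forall_2)

lemma inj_sm: "sm u = 0 \<Longrightarrow> u = 0"
  by (simp add: vec_eq_iff forall_2 prod_eq_iff)

text \<open>Symmetrising the given bilinear form leaves its diagonal unchanged, and the coordinates
  \<open>sm\<close> restrict it to symmetric matrices, where positivity is known.\<close>

lemma sym_form_exists:
  assumes "pos_def_quadratic_form Q"
  shows "\<exists>S. sym_form S \<and> (\<forall>u. Q (sm u) = S u u)"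
proof -
  obtain B where B: "bilinear B" "\<And>M. M \<in> sym_mat \<Longrightarrow> Q M = B M M" "\<And>M. M \<in> sym_mat \<Longrightarrow> M \<noteq> 0 \<Longrightarrow> Q M > 0"
    using assms unfolding pos_def_quadratic_form_def by blast
  note L = linear_add[OF linear_sm] linear_cmul[OF linear_sm]
  define S where "S u v = (B (sm u) (sm v) + B (sm v) (sm u)) / 2" for u v
  have Q: "Q (sm u) = S u u" for u using B(2)[of "sm u"] by (simp add: S_def sym_mat_eq)
  have "bilinear S"
    unfolding bilinear_def S_def
    by (intro conjI allI linearI)
      (simp_all add: L bilinear_ladd[OF B(1)] bilinear_radd[OF B(1)] bilinear_lmul[OF B(1)] bilinear_rmul[OF B(1)] field_simps)
  moreover have "S u u > 0" if "u \<noteq> 0" for u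
    using B(3)[of "sm u"] inj_sm that unfolding sym_mat_eq Q by blast
  ultimately have "sym_form S" by unfold_locales (simp_all add: S_def add.commute)
  then show ?thesis using Q by blast
qed

text \<open>\<open>LEAST\<close> is meaningful here because the minimum over \<gamma> is attained at
  \<open>gm\<close>.\<close>

lemma (in sym_form) Q_bar_eq:
  assumes "\<And>u. Q (sm u) = S u u"
  shows "Q_bar Q = qb"
proof (intro ext)
  fix x y
  have ap: "alpha_plus Q = ap 1" "alpha_minus Q = ap (-1)"
    unfolding alpha_plus_def alpha_minus_def ap_def sym_mat_eq by (simp_all add: assms det_sm)
  have eq: "Q M + alpha_plus Q * max (det M) 0 + alpha_minus Q * max (- det M) 0 = ff (x, y, \<gamma>)"
    if "M = vector [vector [x, y], vector [y, \<gamma>]]" for \<gamma> M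
  proof -
    have M: "M = sm (x, y, \<gamma>)" using that by (simp add: sm_def)
    show ?thesis unfolding M det_sm assms ap ff_def ..
  qed
  show "Q_bar Q x y = qb x y"
    unfolding Q_bar_def
  proof (rule Least_equality)
    show "\<exists>\<gamma> M. M = vector [vector [x, y], vector [y, \<gamma>]] \<and>
      qb x y = Q M + alpha_plus Q * max (det M) 0 + alpha_minus Q * max (- det M) 0"
      using eq[of _ "gm x y"] unfolding qb_def by metis
    show "qb x y \<le> v" if "\<exists>\<gamma> M. M = vector [vector [x, y], vector [y, \<gamma>]] \<and>
      v = Q M + alpha_plus Q * max (det M) 0 + alpha_minus Q * max (- det M) 0" for v
      using that eq qb_le by metis
  qed
qed

section \<open>Smooth test functions\<close>

lemma tendsto_poly_div_exp_0: "((\<lambda>y. poly P y / exp y) \<longlongrightarrow> (0::real)) at_top"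
proof -
  have "((\<lambda>y. \<Sum>i\<le>degree P. coeff P i * (y ^ i / exp y)) \<longlongrightarrow> (\<Sum>i\<le>degree P. coeff P i * 0)) (at_top :: real filter)"
    by (intro tendsto_intros tendsto_power_div_exp_0)
  then show ?thesis by (simp add: poly_altdef sum_divide_distrib)
qed

text \<open>Cauchy's flat function exp(-1/t) times a polynomial in 1/t. The polynomial factor is
  carried along because this family is closed under differentiation, so smoothness becomes an
  induction.\<close>

definition flat_exp :: "real poly \<Rightarrow> real \<Rightarrow> real" where
  "flat_exp P t = (if t > 0 then poly P (1 / t) * exp (- (1 / t)) else 0)"

text \<open>With s = 1/t, differentiation in t is -s^2 d/ds, which turns P(s) exp(-s) into s^2 (P -
  P')(s) exp(-s). At t = 0 the right difference quotient is s P(s) / exp s with s tending to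
  infinity.\<close>

lemma flat_exp_deriv:
  "(flat_exp P has_real_derivative flat_exp ([:0, 0, 1:] * (P - pderiv P)) t) (at t)"
proof -
  consider "t > 0" | "t < 0" | "t = 0" by linarith
  then show ?thesis
  proof cases
    case 1
    have "((\<lambda>t. poly P (1 / t) * exp (- (1 / t))) has_real_derivative
        flat_exp ([:0, 0, 1:] * (P - pderiv P)) t) (at t)"
      using 1 by (auto intro!: derivative_eq_intros simp: flat_exp_def field_simps power2_eq_square)
    then show ?thesis
      by (rule has_field_derivative_transform_within_open[of _ _ _ "{0<..}"]) (use 1 in \<open>auto simp: flat_exp_def\<close>)
  next
    case 2
    have "((\<lambda>t. 0) has_real_derivative flat_exp ([:0, 0, 1:] * (P - pderiv P)) t) (at t)"
      using 2 by (simp add: flat_exp_def)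
    then show ?thesis
      by (rule has_field_derivative_transform_within_open[of _ _ _ "{..<0}"]) (use 2 in \<open>auto simp: flat_exp_def\<close>)
  next
    case 3
    have "((\<lambda>h. flat_exp P h / h) \<longlongrightarrow> 0) (at_left 0)"
      by (rule tendsto_eventually) (auto simp: flat_exp_def eventually_at_filter)
    moreover have "((\<lambda>h. flat_exp P h / h) \<longlongrightarrow> 0) (at_right 0)"
    proof -
      have "((\<lambda>h. poly ([:0, 1:] * P) (inverse h) / exp (inverse h)) \<longlongrightarrow> 0) (at_right (0::real))"
        by (rule filterlim_compose[OF tendsto_poly_div_exp_0 filterlim_inverse_at_top_right])
      moreover have "\<forall>\<^sub>F h in at_right (0::real).
          poly ([:0, 1:] * P) (inverse h) / exp (inverse h) = flat_exp P h / h"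
        by (auto simp: flat_exp_def eventually_at_filter exp_minus field_simps)
      ultimately show ?thesis by (rule Lim_transform_eventually)
    qed
    ultimately have "((\<lambda>h. flat_exp P h / h) \<longlongrightarrow> 0) (at 0)"
      by (simp add: filterlim_split_at)
    then show ?thesis using 3 by (simp add: DERIV_def) (simp add: flat_exp_def)
  qed
qed

section \<open>Smooth functions and their directional derivatives\<close>

abbreviation D :: "'a::euclidean_space \<Rightarrow> ('a \<Rightarrow> real) \<Rightarrow> 'a \<Rightarrow> real" where
  "D v f x \<equiv> frechet_derivative f (at x) v"

lemma C_k_SucD: "C_k (Suc k) f \<Longrightarrow> C_k k f"
proof (induction k arbitrary: f)
  case 0
  then show ?case by (simp add: continuous_at_imp_continuous_on differentiable_imp_continuous_within)
next
  case (Suc k)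
  show ?case using Suc.prems Suc.IH by (subst C_k.simps(2)) (auto simp del: C_k.simps(1) intro: Suc.IH simp: C_k.simps(2)[of "Suc k"])
qed

lemma D_eqI: "(f has_derivative f') (at x) \<Longrightarrow> D v f x = f' v"
  by (simp flip: frechet_derivative_at)

lemma D_const [simp]: "D v (\<lambda>x. c) x = 0"
  by (rule D_eqI) simp

lemma C_k_const: "C_k k (\<lambda>x. c)"
  by (induction k arbitrary: c) simp_all

lemma has_derivative_D: "f differentiable at x \<Longrightarrow> (f has_derivative (\<lambda>v. D v f x)) (at x)"
  using frechet_derivative_works by blast

lemma D_add:
  "f differentiable at x \<Longrightarrow> g differentiable at x \<Longrightarrow> D v (\<lambda>x. f x + g x) x = D v f x + D v g x"
  by (intro D_eqI has_derivative_add has_derivative_D)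

lemma D_mult:
  "f differentiable at x \<Longrightarrow> g differentiable at x \<Longrightarrow> D v (\<lambda>x. f x * g x) x = f x * D v g x + D v f x * g x"
  by (intro D_eqI has_derivative_mult has_derivative_D)

lemma C_k_add: "C_k k f \<Longrightarrow> C_k k g \<Longrightarrow> C_k k (\<lambda>x. f x + g x)"
  by (induction k arbitrary: f g) (auto intro: continuous_intros simp: D_add)

lemma C_k_mult: "C_k k f \<Longrightarrow> C_k k g \<Longrightarrow> C_k k (\<lambda>x. f x * g x)"
proof (induction k arbitrary: f g)
  case (Suc k)
  then have "C_k k f" "C_k k g" by (auto intro: C_k_SucD simp del: C_k.simps)
  with Suc show ?case by (auto simp: D_mult intro!: C_k_add)
qed (auto intro: continuous_intros)

lemma C_k_cmult: "C_k k f \<Longrightarrow> C_k k (\<lambda>x. c * f x)"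
  by (intro C_k_mult C_k_const)

definition smooth :: "('a::euclidean_space \<Rightarrow> real) \<Rightarrow> bool" where
  "smooth f \<longleftrightarrow> (\<forall>k. C_k k f)"

lemma smooth_continuous: "smooth f \<Longrightarrow> continuous_on UNIV f"
  unfolding smooth_def using C_k.simps(1) by blast

lemma smooth_differentiable: "smooth f \<Longrightarrow> f differentiable at x"
  unfolding smooth_def using C_k.simps(2) by blast

lemma smooth_D: "smooth f \<Longrightarrow> smooth (\<lambda>x. D v f x)"
  unfolding smooth_def using C_k.simps(2) by blast

lemma smooth_mult: "smooth f \<Longrightarrow> smooth g \<Longrightarrow> smooth (\<lambda>x. f x * g x)"
  by (simp add: smooth_def C_k_mult)

text \<open>Symmetry of second derivatives is only needed for a class of test functions that is rich
  enough for the fundamental lemma; on products it is immediate from the Leibniz rule.\<close>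

definition csmooth :: "('a::euclidean_space \<Rightarrow> real) \<Rightarrow> bool" where
  "csmooth f \<longleftrightarrow> smooth f \<and> (\<forall>v w x. D w (\<lambda>x. D v f x) x = D v (\<lambda>x. D w f x) x)"

lemma csmooth_const: "csmooth (\<lambda>x. c)"
  by (simp add: csmooth_def smooth_def C_k_const)

lemma csmooth_mult:
  assumes "csmooth f" "csmooth g"
  shows "csmooth (\<lambda>x. f x * g x)"
proof -
  have s: "smooth f" "smooth g" using assms by (auto simp: csmooth_def)
  note d = smooth_differentiable[OF s(1)] smooth_differentiable[OF s(2)]
    smooth_differentiable[OF smooth_D[OF s(1)]] smooth_differentiable[OF smooth_D[OF s(2)]]
  have "D w (\<lambda>x. D v (\<lambda>x. f x * g x) x) x = D v (\<lambda>x. D w (\<lambda>x. f x * g x) x) x" for v w x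
  proof -
    have c: "D w (\<lambda>x. D v f x) x = D v (\<lambda>x. D w f x) x" "D w (\<lambda>x. D v g x) x = D v (\<lambda>x. D w g x) x"
      using assms by (auto simp: csmooth_def)
    show ?thesis using d c by (simp add: D_mult D_add algebra_simps differentiable_mult)
  qed
  then show ?thesis using smooth_mult[OF s] by (simp add: csmooth_def)
qed

lemma csmooth_prod: "finite I \<Longrightarrow> (\<And>i. i \<in> I \<Longrightarrow> csmooth (f i)) \<Longrightarrow> csmooth (\<lambda>x. \<Prod>i\<in>I. f i x)"
  by (induction I rule: finite_induct) (auto intro: csmooth_const csmooth_mult)

lemma flat_exp_affine_deriv:
  "((\<lambda>x. flat_exp P (\<alpha> * (x \<bullet> b) + \<beta>)) has_derivative
    (\<lambda>v. \<alpha> * (v \<bullet> b) * flat_exp ([:0, 0, 1:] * (P - pderiv P)) (\<alpha> * (x \<bullet> b) + \<beta>))) (at x)"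
proof -
  have "((\<lambda>x. flat_exp P (\<alpha> * (x \<bullet> b) + \<beta>)) has_derivative
    (\<lambda>v. flat_exp ([:0, 0, 1:] * (P - pderiv P)) (\<alpha> * (x \<bullet> b) + \<beta>) * (\<alpha> * (v \<bullet> b)))) (at x)"
    by (rule has_derivative_compose[OF _ flat_exp_deriv[unfolded has_field_derivative_def], of "\<lambda>x. \<alpha> * (x \<bullet> b) + \<beta>"])
      (auto intro!: derivative_eq_intros)
  then show ?thesis by (simp add: mult_ac)
qed

lemmas D_flat_exp = D_eqI[OF flat_exp_affine_deriv]

lemma C_k_flat_exp: "C_k k (\<lambda>x. flat_exp P (\<alpha> * (x \<bullet> b) + \<beta>))"
proof (induction k arbitrary: P)
  case 0
  show ?case using flat_exp_affine_deriv
    by (auto intro!: continuous_at_imp_continuous_on has_derivative_continuous)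
next
  case (Suc k)
  have "(\<lambda>x. flat_exp P (\<alpha> * (x \<bullet> b) + \<beta>)) differentiable at x" for x
    using flat_exp_affine_deriv differentiable_def by blast
  then show ?case using C_k_cmult[OF Suc] by (simp add: D_flat_exp)
qed

lemma csmooth_flat_exp: "csmooth (\<lambda>x. flat_exp P (\<alpha> * (x \<bullet> b) + \<beta>))"
proof -
  have diff: "(\<lambda>x. flat_exp P (\<alpha> * (x \<bullet> b) + \<beta>)) differentiable at x" for P x
    using flat_exp_affine_deriv differentiable_def by blast
  have "D v (\<lambda>x. D w (\<lambda>x. flat_exp P (\<alpha> * (x \<bullet> b) + \<beta>)) x) x =
     D w (\<lambda>x. D v (\<lambda>x. flat_exp P (\<alpha> * (x \<bullet> b) + \<beta>)) x) x" for v w x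
    unfolding D_flat_exp by (simp add: D_mult diff D_flat_exp)
  then show ?thesis by (auto simp: csmooth_def smooth_def C_k_flat_exp)
qed

text \<open>For n > 0 each factor vanishes within distance 1/n of its face, so the support is
  compact in the open box; inside the box the value tends to 1 as n grows, since exp(-1/t) tends to
  1 at infinity.\<close>

definition bump :: "real \<Rightarrow> 'a::euclidean_space \<Rightarrow> 'a \<Rightarrow> 'a \<Rightarrow> real" where
  "bump n c d x = (\<Prod>b\<in>Basis. flat_exp 1 (n * ((x - c) \<bullet> b) - 1) * flat_exp 1 (n * ((d - x) \<bullet> b) - 1))"

lemma csmooth_bump: "csmooth (bump n c d)"
proof -
  have "csmooth (\<lambda>x. flat_exp 1 (n * ((x - c) \<bullet> b) - 1))" for b
    using csmooth_flat_exp[of 1 n b "- n * (c \<bullet> b) - 1"] by (simp add: algebra_simps)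
  moreover have "csmooth (\<lambda>x. flat_exp 1 (n * ((d - x) \<bullet> b) - 1))" for b
    using csmooth_flat_exp[of 1 "- n" b "n * (d \<bullet> b) - 1"] by (simp add: algebra_simps)
  ultimately show ?thesis unfolding bump_def[abs_def]
    by (intro csmooth_prod csmooth_mult finite_Basis)
qed

lemma flat_exp_1_range: "0 \<le> flat_exp 1 t" "flat_exp 1 t \<le> 1"
  by (auto simp: flat_exp_def)

lemma bump_range: "0 \<le> bump n c d x" "bump n c d x \<le> 1"
  unfolding bump_def by (auto intro!: prod_nonneg prod_le_1 mult_nonneg_nonneg mult_le_one flat_exp_1_range)

lemma bump_support: "bump n c d x \<noteq> 0 \<Longrightarrow> b \<in> Basis \<Longrightarrow> n * ((x - c) \<bullet> b) \<ge> 1 \<and> n * ((d - x) \<bullet> b) \<ge> 1"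
  by (auto simp: bump_def flat_exp_def split: if_splits)

definition ctest :: "'a::euclidean_space set \<Rightarrow> ('a \<Rightarrow> real) set" where
  "ctest \<Omega> = {\<phi> \<in> test_functions \<Omega>. csmooth \<phi>}"

lemma test_functionsI:
  assumes "smooth \<phi>" "compact K" "K \<subseteq> \<Omega>" "\<And>x. x \<notin> K \<Longrightarrow> \<phi> x = 0"
  shows "\<phi> \<in> test_functions \<Omega>"
proof -
  have "closure {x. \<phi> x \<noteq> 0} \<subseteq> K" using assms(2,4) by (intro closure_minimal compact_imp_closed) auto
  moreover from this have "compact (closure {x. \<phi> x \<noteq> 0})"
    using assms(2) compact_Int_closed[of K "closure {x. \<phi> x \<noteq> 0}"] by (simp add: Int_absorb1)
  ultimately show ?thesis using assms by (auto simp: test_functions_def smooth_def)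
qed

lemma test_functionsE:
  assumes "\<phi> \<in> test_functions \<Omega>"
  obtains K where "smooth \<phi>" "compact K" "K \<subseteq> \<Omega>" "\<And>x. x \<notin> K \<Longrightarrow> \<phi> x = 0"
  using assms closure_subset[of "{x. \<phi> x \<noteq> 0}"] unfolding test_functions_def smooth_def by blast

lemma test_functions_mult:
  assumes "\<phi> \<in> test_functions \<Omega>" "smooth \<psi>"
  shows "(\<lambda>x. \<phi> x * \<psi> x) \<in> test_functions \<Omega>"
  using assms by (elim test_functionsE) (auto intro!: test_functionsI smooth_mult)

lemma ctest_mult: "\<phi> \<in> ctest \<Omega> \<Longrightarrow> \<psi> \<in> ctest \<Omega> \<Longrightarrow> (\<lambda>x. \<phi> x * \<psi> x) \<in> ctest \<Omega>"
  unfolding ctest_def using csmooth_mult test_functions_mult csmooth_def by blast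

lemma test_functions_add:
  assumes "\<phi> \<in> test_functions \<Omega>" "\<psi> \<in> test_functions \<Omega>"
  shows "(\<lambda>x. \<phi> x + \<psi> x) \<in> test_functions \<Omega>"
proof -
  from assms(1) obtain K where K: "smooth \<phi>" "compact K" "K \<subseteq> \<Omega>" "\<And>x. x \<notin> K \<Longrightarrow> \<phi> x = 0"
    by (rule test_functionsE) blast
  from assms(2) obtain L where L: "smooth \<psi>" "compact L" "L \<subseteq> \<Omega>" "\<And>x. x \<notin> L \<Longrightarrow> \<psi> x = 0"
    by (rule test_functionsE) blast
  show ?thesis
    by (rule test_functionsI[of _ "K \<union> L"]) (use K L in \<open>auto simp: smooth_def C_k_add\<close>)
qed

lemma test_functions_cmult: "\<phi> \<in> test_functions \<Omega> \<Longrightarrow> (\<lambda>x. c * \<phi> x) \<in> test_functions \<Omega>"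
  using test_functions_mult[of \<phi> \<Omega> "\<lambda>_. c"] by (simp add: smooth_def C_k_const mult.commute)

lemma D_zero_outside:
  assumes "compact K" "\<And>x. x \<notin> K \<Longrightarrow> \<phi> x = 0" "x \<notin> K"
  shows "D v \<phi> x = 0"
proof (rule D_eqI[of _ "\<lambda>_. 0"])
  have "((\<lambda>_. 0::real) has_derivative (\<lambda>_. 0)) (at x)" by simp
  then show "(\<phi> has_derivative (\<lambda>_. 0)) (at x)"
    by (rule has_derivative_transform_within_open[of _ _ _ _ "- K"])
      (use assms compact_imp_closed in auto)
qed

lemma test_functions_D:
  assumes "\<phi> \<in> test_functions \<Omega>"
  shows "(\<lambda>x. D v \<phi> x) \<in> test_functions \<Omega>"
proof -
  from assms obtain K where K: "smooth \<phi>" "compact K" "K \<subseteq> \<Omega>" "\<And>x. x \<notin> K \<Longrightarrow> \<phi> x = 0"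
    by (rule test_functionsE) blast
  show ?thesis
    by (rule test_functionsI[OF smooth_D[OF K(1)] K(2,3)]) (rule D_zero_outside[OF K(2,4)])
qed

lemma bump_in_ctest:
  assumes "n > 0" "box c d \<subseteq> \<Omega>"
  shows "bump n c d \<in> ctest \<Omega>"
proof -
  let ?e = "(1 / n) *\<^sub>R (One :: 'a)"
  have e: "?e \<bullet> b = 1 / n" if "b \<in> Basis" for b using that by simp
  have n: "1 / n > 0" using assms(1) by simp
  have "bump n c d \<in> test_functions \<Omega>"
  proof (rule test_functionsI[of _ "cbox (c + ?e) (d - ?e)"])
    show "smooth (bump n c d)" using csmooth_bump by (auto simp: csmooth_def)
    show "cbox (c + ?e) (d - ?e) \<subseteq> \<Omega>"
    proof (rule order_trans[OF _ assms(2)], rule subsetI)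
      fix x assume x: "x \<in> cbox (c + ?e) (d - ?e)"
      show "x \<in> box c d" unfolding mem_box
      proof
        fix b :: 'a assume b: "b \<in> Basis"
        then have "(c + ?e) \<bullet> b \<le> x \<bullet> b" "x \<bullet> b \<le> (d - ?e) \<bullet> b" using x by (auto simp only: mem_box)
        then show "c \<bullet> b < x \<bullet> b \<and> x \<bullet> b < d \<bullet> b"
          unfolding inner_add_left inner_diff_left e[OF b] using n by linarith
      qed
    qed
    show "bump n c d x = 0" if "x \<notin> cbox (c + ?e) (d - ?e)" for x
    proof (rule ccontr)
      assume "bump n c d x \<noteq> 0"
      then have "\<forall>b\<in>Basis. n * ((x - c) \<bullet> b) \<ge> 1 \<and> n * ((d - x) \<bullet> b) \<ge> 1" using bump_support by blast
      then have "\<forall>b\<in>Basis. 1 / n \<le> (x - c) \<bullet> b \<and> 1 / n \<le> (d - x) \<bullet> b"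
        using assms(1) by (simp add: pos_divide_le_eq mult.commute)
      then have "x \<in> cbox (c + ?e) (d - ?e)"
        unfolding mem_box inner_add_left inner_diff_left using e by fastforce
      with that show False by blast
    qed
  qed auto
  then show ?thesis by (simp add: ctest_def csmooth_bump)
qed

lemma bump_tendsto: "(\<lambda>n. bump (real (Suc n)) c d x) \<longlonglongrightarrow> indicator (box c d) x"
proof -
  have one: "(\<lambda>n. flat_exp 1 (real (Suc n) * t - 1)) \<longlonglongrightarrow> (if t > 0 then 1 else 0)" for t
  proof (cases "t > 0")
    case True
    have "filterlim (\<lambda>n. real (Suc n) * t) at_top sequentially"
      by (rule filterlim_at_top_mult_tendsto_pos[OF tendsto_const True
          filterlim_compose[OF filterlim_real_sequentially filterlim_Suc]])
    from filterlim_tendsto_add_at_top[OF tendsto_const this, of "-1"]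
    have lim: "filterlim (\<lambda>n. real (Suc n) * t - 1) at_top sequentially" by simp
    have "((\<lambda>y. exp (- inverse y)) \<longlongrightarrow> exp (- 0)) (at_top :: real filter)"
      by (intro tendsto_intros tendsto_inverse_0_at_top filterlim_ident)
    from filterlim_compose[OF this lim]
    have "(\<lambda>n. exp (- (1 / (real (Suc n) * t - 1)))) \<longlonglongrightarrow> 1" by (simp add: inverse_eq_divide)
    moreover have "\<forall>\<^sub>F n in sequentially. exp (- (1 / (real (Suc n) * t - 1))) = flat_exp 1 (real (Suc n) * t - 1)"
      using eventually_compose_filterlim[OF eventually_gt_at_top[of 0] lim]
      by eventually_elim (auto simp: flat_exp_def)
    ultimately show ?thesis using True by (simp add: Lim_transform_eventually)
  next
    case False
    then have "real (Suc n) * t - 1 \<le> 0" for n by (smt (verit) mult_nonneg_nonpos of_nat_0_le_iff)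
    then have "flat_exp 1 (real (Suc n) * t - 1) = 0" for n by (simp add: flat_exp_def not_less[symmetric])
    then show ?thesis using False by simp
  qed
  have "(\<lambda>n. bump (real (Suc n)) c d x) \<longlonglongrightarrow>
     (\<Prod>b\<in>Basis. (if (x - c) \<bullet> b > 0 then 1 else 0) * (if (d - x) \<bullet> b > 0 then 1 else 0))"
    unfolding bump_def by (intro tendsto_intros one)
  also have "(\<Prod>b\<in>Basis. (if (x - c) \<bullet> b > 0 then 1 else 0) * (if (d - x) \<bullet> b > 0 then 1 else 0)) =
     (indicator (box c d) x :: real)"
    by (auto simp: indicator_def mem_box inner_diff_left prod_zero_iff intro!: prod.neutral)
  finally show ?thesis .
qed

section \<open>Square-integrable functions and density\<close>

definition sqi :: "'a measure \<Rightarrow> ('a \<Rightarrow> real) \<Rightarrow> bool" where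
  "sqi M f \<longleftrightarrow> f \<in> borel_measurable M \<and> integrable M (\<lambda>x. (f x)\<^sup>2)"

lemma L2_eq_sqi: "f \<in> L2 \<Omega> \<longleftrightarrow> sqi (lebesgue_on \<Omega>) f"
  by (simp add: L2_def sqi_def)

lemma sqi_measurable [measurable_dest]: "sqi M f \<Longrightarrow> f \<in> borel_measurable M"
  by (simp add: sqi_def)

lemma sqi_square: "sqi M f \<Longrightarrow> integrable M (\<lambda>x. (f x)\<^sup>2)"
  by (simp add: sqi_def)

lemma sqi_dominated:
  assumes "sqi M g" "f \<in> borel_measurable M" "AE x in M. \<bar>f x\<bar> \<le> \<bar>g x\<bar>"
  shows "sqi M f"
  unfolding sqi_def
proof
  show "integrable M (\<lambda>x. (f x)\<^sup>2)"
  proof (rule Bochner_Integration.integrable_bound[OF sqi_square[OF assms(1)]])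
    show "AE x in M. norm ((f x)\<^sup>2) \<le> norm ((g x)\<^sup>2)"
      using assms(3) by eventually_elim (simp add: abs_le_square_iff)
  qed (use assms(2) in measurable)
qed (rule assms(2))

lemma sqi_mult_integrable:
  assumes "sqi M f" "sqi M g"
  shows "integrable M (\<lambda>x. f x * g x)"
proof (rule Bochner_Integration.integrable_bound)
  show "integrable M (\<lambda>x. (f x)\<^sup>2 + (g x)\<^sup>2)" using assms by (simp add: sqi_def)
  show "(\<lambda>x. f x * g x) \<in> borel_measurable M" using assms by measurable
  have "\<bar>a * b\<bar> \<le> a\<^sup>2 + b\<^sup>2" for a b :: real
  proof -
    have "2 * (\<bar>a\<bar> * \<bar>b\<bar>) \<le> a\<^sup>2 + b\<^sup>2" using sum_squares_bound[of "\<bar>a\<bar>" "\<bar>b\<bar>"] by (simp add: mult.assoc)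
    moreover have "0 \<le> \<bar>a\<bar> * \<bar>b\<bar>" by simp
    ultimately show ?thesis unfolding abs_mult by linarith
  qed
  then show "AE x in M. norm (f x * g x) \<le> norm ((f x)\<^sup>2 + (g x)\<^sup>2)" by simp
qed

lemma sqi_cmult: "sqi M f \<Longrightarrow> sqi M (\<lambda>x. c * f x)"
  by (auto simp: sqi_def power_mult_distrib)

lemma sqi_add:
  assumes "sqi M f" "sqi M g"
  shows "sqi M (\<lambda>x. f x + g x)"
  using assms sqi_mult_integrable[OF assms] by (auto simp: sqi_def power2_sum mult.assoc)

lemma sqi_diff: "sqi M f \<Longrightarrow> sqi M g \<Longrightarrow> sqi M (\<lambda>x. f x - g x)"
  using sqi_add[of M f "\<lambda>x. -1 * g x"] sqi_cmult[of M g "-1"] by simp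

lemma (in finite_measure) sqi_bounded:
  assumes "f \<in> borel_measurable M" "AE x in M. \<bar>f x\<bar> \<le> C"
  shows "sqi M f"
proof (rule sqi_dominated[OF _ assms(1)])
  show "sqi M (\<lambda>x. C)" by (simp add: sqi_def)
  show "AE x in M. \<bar>f x\<bar> \<le> \<bar>C\<bar>" using assms(2) by eventually_elim simp
qed

lemma (in finite_measure) sqi_integrable:
  assumes "sqi M f"
  shows "integrable M f"
proof -
  have "sqi M (\<lambda>_. 1)" by (rule sqi_bounded[of _ 1]) auto
  from sqi_mult_integrable[OF assms this] show ?thesis by simp
qed

lemma Cauchy_Schwarz_integral:
  assumes "sqi M f" "sqi M g"
  shows "\<bar>\<integral>x. f x * g x \<partial>M\<bar> \<le> sqrt (\<integral>x. (f x)\<^sup>2 \<partial>M) * sqrt (\<integral>x. (g x)\<^sup>2 \<partial>M)"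
proof -
  let ?A = "\<integral>x. (f x)\<^sup>2 \<partial>M" and ?B = "\<integral>x. f x * g x \<partial>M" and ?C = "\<integral>x. (g x)\<^sup>2 \<partial>M"
  note i = sqi_square[OF assms(1)] sqi_square[OF assms(2)] sqi_mult_integrable[OF assms]
  have nn: "?A \<ge> 0" "?C \<ge> 0" by simp_all
  have key: "0 \<le> ?A + 2 * s * ?B + s\<^sup>2 * ?C" for s
  proof -
    have "0 \<le> (\<integral>x. (f x + s * g x)\<^sup>2 \<partial>M)" by simp
    also have "\<dots> = (\<integral>x. (f x)\<^sup>2 + (2 * s * (f x * g x) + s\<^sup>2 * (g x)\<^sup>2) \<partial>M)"
      by (simp add: power2_sum power_mult_distrib algebra_simps)
    also have "\<dots> = ?A + 2 * s * ?B + s\<^sup>2 * ?C" using i by simp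
    finally show ?thesis .
  qed
  have "?B\<^sup>2 \<le> ?A * ?C"
  proof (cases "?C = 0")
    case True
    then have "?B = 0" using psd_null_orthogonal[of ?A ?B] key by (simp add: True)
    then show ?thesis using nn by simp
  next
    case False
    then have C: "?C > 0" using nn(2) by linarith
    \<comment> \<open>The value s = -B/C minimises the quadratic in \<open>key\<close>;
      multiplication by C > 0 leaves the discriminant.\<close>
    have "0 \<le> (?A + 2 * (- ?B / ?C) * ?B + (- ?B / ?C)\<^sup>2 * ?C) * ?C"
      using key[of "- ?B / ?C"] C by (intro mult_nonneg_nonneg) auto
    also have "\<dots> = ?A * ?C - ?B\<^sup>2" using C by (simp add: field_simps power2_eq_square)
    finally show ?thesis by simp
  qed
  from real_sqrt_le_mono[OF this] show ?thesis by (simp only: real_sqrt_abs real_sqrt_mult)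
qed

text \<open>Open boxes are closed under intersection and generate the Borel sets, so Dynkin's
  argument needs only complements and disjoint unions. The null step passes from Borel to Lebesgue
  sets.\<close>

lemma lebesgue_set_induct [consumes 1, case_names box compl union null]:
  fixes A :: "'a::euclidean_space set"
  assumes A: "A \<in> sets lebesgue"
    and box: "\<And>c d. P (box c d)"
    and compl: "\<And>A. A \<in> sets lebesgue \<Longrightarrow> P A \<Longrightarrow> P (UNIV - A)"
    and union: "\<And>F :: nat \<Rightarrow> 'a set. disjoint_family F \<Longrightarrow> (\<And>i. F i \<in> sets lebesgue) \<Longrightarrow> (\<And>i. P (F i)) \<Longrightarrow> P (\<Union>i. F i)"
    and null: "\<And>A B. A \<in> sets lebesgue \<Longrightarrow> B \<in> sets lebesgue \<Longrightarrow> P A \<Longrightarrow> (AE x in lebesgue. x \<in> A \<longleftrightarrow> x \<in> B) \<Longrightarrow> P B"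
  shows "P A"
proof -
  have borel: "P S" if "S \<in> sets borel" for S
  proof -
    let ?G = "range (\<lambda>(a, b). box a b :: 'a set)"
    have sig: "sigma_sets UNIV ?G = sets borel" by (simp add: borel_eq_box)
    have leb: "S \<in> sets lebesgue" if "S \<in> sigma_sets UNIV ?G" for S
      using that unfolding sig by simp
    have "Int_stable ?G" by (auto simp: Int_stable_def box_Int_box)
    moreover have "?G \<subseteq> Pow UNIV" by simp
    moreover have "S \<in> sigma_sets UNIV ?G" using that by (simp add: sig)
    ultimately show ?thesis
    proof (induction rule: sigma_sets_induct_disjoint)
      case empty
      show ?case using box[of 0 0] by simp
    next
      case (union F)
      then show ?case using assms(4)[of F] leb by blast
    qed (use box compl leb in auto)
  qed
  obtain S N N' where *: "A = S \<union> N" "N \<subseteq> N'" "N' \<in> null_sets lborel" "S \<in> sets lborel"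
    using sets_completionE[OF A] by blast
  have "AE x in lebesgue. x \<notin> N'" using *(3) by (intro AE_completion AE_not_in)
  then have "AE x in lebesgue. x \<in> S \<longleftrightarrow> x \<in> A"
    by eventually_elim (use * in auto)
  then show ?thesis using null[of S A] borel[of S] A *(4) by simp
qed

text \<open>A functional monotone class argument. Sets are treated first, by
  \<open>lebesgue_set_induct\<close>; uniformly bounded simple functions then converge to f.
  Modification on a null set is covered by the limit hypothesis, via a constant sequence.\<close>

lemma bounded_measurable_induct:
  fixes a b :: "'a::euclidean_space"
  defines "M \<equiv> lebesgue_on (box a b)"
  assumes f: "f \<in> borel_measurable M" "\<And>x. x \<in> box a b \<Longrightarrow> \<bar>f x\<bar> \<le> C"
    and box: "\<And>c d. box c d \<subseteq> box a b \<Longrightarrow> P (indicator (box c d))"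
    and add: "\<And>f g. P f \<Longrightarrow> P g \<Longrightarrow> P (\<lambda>x. f x + g x)"
    and cmult: "\<And>f c. P f \<Longrightarrow> P (\<lambda>x. c * f x :: real)"
    and lim: "\<And>s f C. (\<And>i::nat. s i \<in> borel_measurable M) \<Longrightarrow> f \<in> borel_measurable M \<Longrightarrow> (\<And>i. P (s i)) \<Longrightarrow>
      (\<And>i x. x \<in> box a b \<Longrightarrow> \<bar>s i x\<bar> \<le> C) \<Longrightarrow> (AE x in M. (\<lambda>i. s i x) \<longlonglongrightarrow> f x) \<Longrightarrow> P f"
  shows "P f"
proof -
  have spM: "space M = box a b" by (simp add: M_def)
  have setsM: "A \<in> sets lebesgue" if "A \<in> sets M" for A
    using that unfolding M_def by (auto simp: sets_restrict_space)
  have ind: "indicator A \<in> borel_measurable M" if "A \<in> sets lebesgue" for A :: "'a set"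
    using that unfolding M_def by (intro measurable_restrict_space1) simp
  have AE_M: "AE x in M. Q x" if "AE x in lebesgue. Q x" for Q
    using that unfolding M_def by (subst AE_restrict_space_iff) auto
  have cong: "P g" if "P f" "f \<in> borel_measurable M" "g \<in> borel_measurable M"
    "\<And>x. x \<in> box a b \<Longrightarrow> \<bar>f x\<bar> \<le> C" "AE x in M. f x = g x" for f g C
  proof (rule lim[of "\<lambda>_. f" g C])
    show "AE x in M. (\<lambda>i::nat. f x) \<longlonglongrightarrow> g x" using that(5) by eventually_elim simp
  qed (use that in auto)
  have P0: "P (\<lambda>x. 0)" using cmult[OF box[of a a], of 0] by simp
  have sum: "P (\<lambda>x. \<Sum>i\<in>I. c i * f i x)" if "finite I" "\<And>i. i \<in> I \<Longrightarrow> P (f i)" for I and c :: "'b \<Rightarrow> real" and f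
    using that
  proof (induction I rule: finite_induct)
    case (insert i I)
    have "P (\<lambda>x. c i * f i x + (\<Sum>i\<in>I. c i * f i x))"
      by (intro add cmult insert) (use insert in auto)
    then show ?case using insert by simp
  qed (simp add: P0)
  have sets: "P (indicator A)" if "A \<in> sets lebesgue" for A
    using that
  proof (induction rule: lebesgue_set_induct)
    case (box c d)
    obtain c' d' where cd: "box c d \<inter> box a b = box c' d'" using box_Int_box by blast
    have "P (indicator (box c' d'))" using assms(4)[of c' d'] cd by blast
    then show ?case
    proof (rule cong[of _ _ 1])
      show "AE x in M. indicator (box c' d') x = (indicator (box c d) x :: real)"
        by (intro AE_I2) (auto simp: indicator_def spM simp flip: cd)
    qed (auto intro!: ind simp del: indicator_simps)
  next
    case (compl A)
    have "P (\<lambda>x. indicator (box a b) x + -1 * indicator A x)"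
      by (intro add cmult compl) (rule assms(4), simp)
    then show ?case
    proof (rule cong[of _ _ 1])
      show "AE x in M. indicator (box a b) x + -1 * indicator A x = (indicator (UNIV - A) x :: real)"
        by (intro AE_I2) (auto simp: indicator_def spM)
      show "(\<lambda>x. indicator (box a b) x + -1 * indicator A x :: real) \<in> borel_measurable M"
        using compl by (intro borel_measurable_add borel_measurable_times ind borel_measurable_const) auto
      show "indicator (UNIV - A) \<in> borel_measurable M"
        using sets.compl_sets[OF compl(1)] by (intro ind) simp
    qed (auto simp: indicator_def)
  next
    case (union F)
    \<comment> \<open>Partial sums over disjoint sets are again indicators, hence uniformly bounded
      by 1.\<close>
    define s where "s n x = (\<Sum>i<n. 1 * indicator (F i) x :: real)" for n x
    have s: "s n x = indicator (\<Union>i<n. F i) x" for n x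
      unfolding s_def using union(1) by (simp add: indicator_UN_disjoint disjoint_family_on_def)
    show ?case
    proof (rule lim[of s _ 1])
      show "s i \<in> borel_measurable M" for i unfolding s_def using union(2) ind by (intro borel_measurable_sum) auto
      show "P (s i)" for i unfolding s_def by (rule sum) (auto intro: union)
      show "\<bar>s i x\<bar> \<le> 1" for i x unfolding s by (simp add: indicator_def)
      have "(\<lambda>i. s i x) \<longlonglongrightarrow> indicator (\<Union>i. F i) x" for x
        unfolding s by (rule LIMSEQ_indicator_UN)
      then show "AE x in M. (\<lambda>i. s i x) \<longlonglongrightarrow> indicator (\<Union>i. F i) x" by simp
    qed (use union(2) in \<open>auto intro!: ind\<close>)
  next
    case (null A B)
    from AE_M[OF null(3)] have "AE x in M. (indicator A x :: real) = indicator B x"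
      by eventually_elim (auto simp: indicator_def)
    from cong[OF null(4) ind[OF null(1)] ind[OF null(2)] _ this, of 1] show ?case by (simp add: indicator_def)
  qed
  obtain s where s: "\<And>i. simple_function M (s i)" "\<And>x. x \<in> space M \<Longrightarrow> (\<lambda>i. s i x) \<longlonglongrightarrow> f x"
    "\<And>i x. x \<in> space M \<Longrightarrow> dist (s i x) 0 \<le> 2 * dist (f x) 0"
    using borel_measurable_implies_sequence_metric[OF f(1), of 0] by blast
  have smeas: "s i \<in> borel_measurable M" for i using s(1) by (rule borel_measurable_simple_function)
  have sb: "\<bar>s i x\<bar> \<le> 2 * C" if "x \<in> box a b" for i x
    using s(3)[of x i] f(2)[OF that] that by (simp add: spM)
  have Ps: "P (s i)" for i
  proof -
    \<comment> \<open>Expansion of the simple function over its finitely many level sets; the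
      identity with \<open>s i\<close> is known on \<open>space M\<close>, hence the passage through
      \<open>cong\<close>.\<close>
    let ?g = "\<lambda>x. \<Sum>y\<in>s i ` space M. y * indicator (s i -` {y} \<inter> space M) x"
    have sets_i: "s i -` {y} \<inter> space M \<in> sets M" for y using s(1) smeas by measurable
    have eq: "s i x = ?g x" if "x \<in> space M" for x
      using simple_function_indicator_representation_banach[OF s(1)[of i] that]
      unfolding real_scaleR_def by (simp only: mult.commute)
    have "P ?g" using simple_functionD(1)[OF s(1)[of i]] sets_i
      by (intro sum) (auto intro!: sets setsM)
    moreover have "?g \<in> borel_measurable M" using sets_i by (intro borel_measurable_sum borel_measurable_times) auto
    moreover have "\<bar>?g x\<bar> \<le> 2 * C" if "x \<in> box a b" for x
      unfolding eq[OF that[folded spM], symmetric] by (rule sb[OF that])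
    moreover have "AE x in M. ?g x = s i x" by (intro AE_I2 eq[symmetric])
    ultimately show ?thesis by (intro cong[of ?g "s i" "2 * C"] smeas)
  qed
  show ?thesis
    by (rule lim[OF smeas f(1) Ps sb]) (use s(2) in \<open>auto intro!: AE_I2\<close>)
qed

section \<open>Density of test functions\<close>

lemma continuous_measurable_lebesgue_on:
  fixes f :: "'a::euclidean_space \<Rightarrow> 'b::euclidean_space"
  assumes "continuous_on UNIV f"
  shows "f \<in> borel_measurable (lebesgue_on S)"
  by (intro measurable_restrict_space1 measurable_completion) (use assms in \<open>simp add: borel_measurable_continuous_onI\<close>)

lemma finite_measure_box: "finite_measure (lebesgue_on (box a b))"
  by (rule finite_measure_lebesgue_on) simp

lemma vanishing_bounded:
  fixes \<phi> :: "'a::euclidean_space \<Rightarrow> real"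
  assumes "continuous_on UNIV \<phi>" "compact K" "\<And>x. x \<notin> K \<Longrightarrow> \<phi> x = 0"
  shows "\<exists>C\<ge>0. \<forall>x. \<bar>\<phi> x\<bar> \<le> C"
proof -
  have "bounded (\<phi> ` K)"
    by (intro compact_imp_bounded compact_continuous_image continuous_on_subset[OF assms(1)] assms(2)) simp
  then obtain C where C: "\<forall>x\<in>K. \<bar>\<phi> x\<bar> \<le> C" by (auto simp: bounded_iff)
  have "\<bar>\<phi> x\<bar> \<le> max C 0" for x using C assms(3)[of x] by (cases "x \<in> K") fastforce+
  then show ?thesis by (intro exI[of _ "max C 0"]) auto
qed

lemma test_bounded:
  assumes "\<phi> \<in> test_functions \<Omega>"
  shows "\<exists>C\<ge>0. \<forall>x. \<bar>\<phi> x\<bar> \<le> C"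
  using assms by (rule test_functionsE) (blast intro: vanishing_bounded smooth_continuous)

lemma test_measurable:
  assumes "\<phi> \<in> test_functions \<Omega>"
  shows "\<phi> \<in> borel_measurable (lebesgue_on S)"
  using assms by (rule test_functionsE) (rule continuous_measurable_lebesgue_on[OF smooth_continuous])

lemma sqi_test:
  assumes "\<phi> \<in> test_functions \<Omega>"
  shows "sqi (lebesgue_on (box a b)) \<phi>"
proof -
  obtain C where "\<forall>x. \<bar>\<phi> x\<bar> \<le> C" using test_bounded[OF assms] by blast
  then show ?thesis
    by (intro finite_measure.sqi_bounded[OF finite_measure_box, of _ _ _ C] test_measurable[OF assms]) simp
qed

lemma bump_measurable: "bump n c d \<in> borel_measurable (lebesgue_on S)"
  using csmooth_bump[of n c d] by (intro continuous_measurable_lebesgue_on smooth_continuous) (simp add: csmooth_def)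

lemma L2_dominated_convergence:
  assumes "\<And>i. s i \<in> borel_measurable M" "f \<in> borel_measurable M" "sqi M w"
    and "\<And>i. AE x in M. \<bar>f x - s i x\<bar> \<le> w x" and "AE x in M. (\<lambda>i. s i x) \<longlonglongrightarrow> f x"
  shows "(\<lambda>i::nat. \<integral>x. (f x - s i x)\<^sup>2 \<partial>M) \<longlonglongrightarrow> 0"
proof -
  have "(\<lambda>i. \<integral>x. (f x - s i x)\<^sup>2 \<partial>M) \<longlonglongrightarrow> (\<integral>x. 0 \<partial>M)"
  proof (rule integral_dominated_convergence)
    show "integrable M (\<lambda>x. (w x)\<^sup>2)" using assms(3) by (rule sqi_square)
    show "(\<lambda>x. (f x - s i x)\<^sup>2) \<in> borel_measurable M" for i using assms(1,2) by measurable
    show "AE x in M. (\<lambda>i. (f x - s i x)\<^sup>2) \<longlonglongrightarrow> 0"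
      using assms(5)
    proof eventually_elim
      case (elim x)
      have "(\<lambda>i. (f x - s i x)\<^sup>2) \<longlonglongrightarrow> (f x - f x)\<^sup>2" by (intro tendsto_intros elim)
      then show ?case by simp
    qed
    show "AE x in M. norm ((f x - s i x)\<^sup>2) \<le> (w x)\<^sup>2" for i
      using assms(4)[of i]
    proof eventually_elim
      case (elim x)
      then have "\<bar>f x - s i x\<bar>\<^sup>2 \<le> (w x)\<^sup>2" by (intro power_mono) auto
      then show ?case by simp
    qed
  qed simp
  then show ?thesis by simp
qed

definition test_approx :: "'a::euclidean_space set \<Rightarrow> ('a \<Rightarrow> real) \<Rightarrow> bool" where
  "test_approx \<Omega> f \<longleftrightarrow> sqi (lebesgue_on \<Omega>) f \<and>
     (\<forall>\<eta>>0. \<exists>\<phi>\<in>test_functions \<Omega>. (\<integral>x. (f x - \<phi> x)\<^sup>2 \<partial>lebesgue_on \<Omega>) \<le> \<eta>)"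

lemma integral_square_add_le:
  assumes "sqi M f" "sqi M g"
  shows "(\<integral>x. (f x + g x)\<^sup>2 \<partial>M) \<le> 2 * (\<integral>x. (f x)\<^sup>2 \<partial>M) + 2 * (\<integral>x. (g x)\<^sup>2 \<partial>M)"
proof -
  note i = sqi_square[OF assms(1)] sqi_square[OF assms(2)]
  have "(f x + g x)\<^sup>2 \<le> 2 * (f x)\<^sup>2 + 2 * (g x)\<^sup>2" for x
    using sum_squares_bound[of "f x" "g x"] by (simp add: power2_sum)
  then have "(\<integral>x. (f x + g x)\<^sup>2 \<partial>M) \<le> (\<integral>x. 2 * (f x)\<^sup>2 + 2 * (g x)\<^sup>2 \<partial>M)"
    using i sqi_square[OF sqi_add[OF assms]] by (intro integral_mono) auto
  then show ?thesis using i by simp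
qed

lemma test_approx_add:
  fixes a b :: "'a::euclidean_space"
  assumes "test_approx (box a b) f" "test_approx (box a b) g"
  shows "test_approx (box a b) (\<lambda>x. f x + g x)"
  unfolding test_approx_def
proof (intro conjI allI impI)
  let ?M = "lebesgue_on (box a b)"
  have s: "sqi ?M f" "sqi ?M g" using assms by (auto simp: test_approx_def)
  then show "sqi ?M (\<lambda>x. f x + g x)" by (rule sqi_add)
  fix \<eta> :: real assume "\<eta> > 0"
  then have "\<eta> / 4 > 0" by simp
  then obtain \<phi> \<psi> where p: "\<phi> \<in> test_functions (box a b)" "(\<integral>x. (f x - \<phi> x)\<^sup>2 \<partial>?M) \<le> \<eta> / 4"
    "\<psi> \<in> test_functions (box a b)" "(\<integral>x. (g x - \<psi> x)\<^sup>2 \<partial>?M) \<le> \<eta> / 4"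
    using assms unfolding test_approx_def by blast
  have "(\<integral>x. (f x + g x - (\<phi> x + \<psi> x))\<^sup>2 \<partial>?M) = (\<integral>x. ((f x - \<phi> x) + (g x - \<psi> x))\<^sup>2 \<partial>?M)"
    by (simp add: algebra_simps)
  also have "\<dots> \<le> 2 * (\<integral>x. (f x - \<phi> x)\<^sup>2 \<partial>?M) + 2 * (\<integral>x. (g x - \<psi> x)\<^sup>2 \<partial>?M)"
    using s p sqi_test by (intro integral_square_add_le sqi_diff) blast+
  also have "\<dots> \<le> \<eta>" using p by simp
  finally show "\<exists>\<phi>\<in>test_functions (box a b). (\<integral>x. (f x + g x - \<phi> x)\<^sup>2 \<partial>?M) \<le> \<eta>"
    by (rule bexI[of _ "\<lambda>x. \<phi> x + \<psi> x"]) (rule test_functions_add[OF p(1,3)])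
qed

lemma test_approx_cmult:
  fixes a b :: "'a::euclidean_space"
  assumes "test_approx (box a b) f"
  shows "test_approx (box a b) (\<lambda>x. c * f x)"
  unfolding test_approx_def
proof (intro conjI allI impI)
  let ?M = "lebesgue_on (box a b)"
  show "sqi ?M (\<lambda>x. c * f x)" using assms by (auto simp: test_approx_def sqi_cmult)
  fix \<eta> :: real assume \<eta>: "\<eta> > 0"
  have c: "0 < c\<^sup>2 + 1" by (smt (verit) zero_le_power2)
  then have "\<eta> / (c\<^sup>2 + 1) > 0" using \<eta> by simp
  then obtain \<phi> where p: "\<phi> \<in> test_functions (box a b)" "(\<integral>x. (f x - \<phi> x)\<^sup>2 \<partial>?M) \<le> \<eta> / (c\<^sup>2 + 1)"
    using assms unfolding test_approx_def by blast
  have "(\<integral>x. (c * f x - c * \<phi> x)\<^sup>2 \<partial>?M) = c\<^sup>2 * (\<integral>x. (f x - \<phi> x)\<^sup>2 \<partial>?M)"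
    by (simp add: power_mult_distrib flip: right_diff_distrib)
  also have "\<dots> \<le> c\<^sup>2 * (\<eta> / (c\<^sup>2 + 1))" using p by (intro mult_left_mono) auto
  also have "\<dots> \<le> \<eta>" using \<eta> c by (simp add: field_simps)
  finally show "\<exists>\<phi>\<in>test_functions (box a b). (\<integral>x. (c * f x - \<phi> x)\<^sup>2 \<partial>?M) \<le> \<eta>"
    by (rule bexI[of _ "\<lambda>x. c * \<phi> x"]) (rule test_functions_cmult[OF p(1)])
qed

lemma test_approx_limit:
  fixes a b :: "'a::euclidean_space"
  defines "M \<equiv> lebesgue_on (box a b)"
  assumes f: "sqi M f" and s: "\<And>i::nat. test_approx (box a b) (s i)"
    and lim: "(\<lambda>i. \<integral>x. (f x - s i x)\<^sup>2 \<partial>M) \<longlonglongrightarrow> 0"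
  shows "test_approx (box a b) f"
  unfolding test_approx_def
proof (intro conjI allI impI)
  show "sqi (lebesgue_on (box a b)) f" using f by (simp add: M_def)
  fix \<eta> :: real assume \<eta>: "\<eta> > 0"
  have "\<forall>\<^sub>F i in sequentially. (\<integral>x. (f x - s i x)\<^sup>2 \<partial>M) < \<eta> / 4"
    using \<eta> by (intro order_tendstoD(2)[OF lim]) simp
  then obtain i where i: "(\<integral>x. (f x - s i x)\<^sup>2 \<partial>M) < \<eta> / 4" by (auto dest: eventually_happens)
  obtain \<phi> where p: "\<phi> \<in> test_functions (box a b)" "(\<integral>x. (s i x - \<phi> x)\<^sup>2 \<partial>M) \<le> \<eta> / 4"
    using s[of i] \<eta> unfolding test_approx_def M_def by (meson zero_less_divide_iff zero_less_numeral)
  have si: "sqi M (s i)" using s by (simp add: test_approx_def M_def)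
  have "(\<integral>x. (f x - \<phi> x)\<^sup>2 \<partial>M) = (\<integral>x. ((f x - s i x) + (s i x - \<phi> x))\<^sup>2 \<partial>M)" by simp
  also have "\<dots> \<le> 2 * (\<integral>x. (f x - s i x)\<^sup>2 \<partial>M) + 2 * (\<integral>x. (s i x - \<phi> x)\<^sup>2 \<partial>M)"
    using f si sqi_test[OF p(1), of a b] by (intro integral_square_add_le sqi_diff) (simp_all add: M_def)
  also have "\<dots> \<le> \<eta>" using p i by simp
  finally show "\<exists>\<phi>\<in>test_functions (box a b). (\<integral>x. (f x - \<phi> x)\<^sup>2 \<partial>lebesgue_on (box a b)) \<le> \<eta>"
    using p(1) unfolding M_def by blast
qed

lemma test_approx_test: "\<phi> \<in> test_functions (box a b) \<Longrightarrow> test_approx (box a b) \<phi>"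
  unfolding test_approx_def using sqi_test[of \<phi> "box a b" a b] by (auto intro!: bexI[of _ \<phi>])

lemma ctest_test: "\<phi> \<in> ctest \<Omega> \<Longrightarrow> \<phi> \<in> test_functions \<Omega>"
  by (simp add: ctest_def)

lemma box_indicator_measurable: "(indicator (box c d) :: 'a::euclidean_space \<Rightarrow> real) \<in> borel_measurable (lebesgue_on S)"
  by (intro measurable_restrict_space1 measurable_completion) simp

text \<open>Box indicators are L2 limits of bumps, which starts the induction on bounded functions;
  a general square-integrable function is then reached by truncation.\<close>

theorem test_functions_dense:
  fixes a b :: "'a::euclidean_space"
  assumes "sqi (lebesgue_on (box a b)) f"
  shows "test_approx (box a b) f"
proof -
  let ?M = "lebesgue_on (box a b)"
  interpret finite_measure ?M by (rule finite_measure_box)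
  have bounded: "test_approx (box a b) g"
    if "g \<in> borel_measurable ?M" "\<And>x. x \<in> box a b \<Longrightarrow> \<bar>g x\<bar> \<le> C" for g C
    using that
  proof (rule bounded_measurable_induct[where P = "test_approx (box a b)"])
    fix c d :: 'a assume cd: "box c d \<subseteq> box a b"
    show "test_approx (box a b) (indicator (box c d))"
    proof (rule test_approx_limit[of a b _ "\<lambda>n. bump (real (Suc n)) c d"])
      show "sqi ?M (indicator (box c d))"
        by (rule sqi_bounded[of _ 1, OF box_indicator_measurable]) (simp add: indicator_def)
      have "bump (real (Suc n)) c d \<in> test_functions (box a b)" for n
        using cd by (intro ctest_test bump_in_ctest) auto
      then show "test_approx (box a b) (bump (real (Suc n)) c d)" for n by (rule test_approx_test)
      show "(\<lambda>i. \<integral>x. (indicator (box c d) x - bump (real (Suc i)) c d x)\<^sup>2 \<partial>?M) \<longlonglongrightarrow> 0"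
      proof (rule L2_dominated_convergence[where w = "\<lambda>_. 1"])
        show "AE x in ?M. \<bar>indicator (box c d) x - bump (real (Suc i)) c d x\<bar> \<le> 1" for i
        proof (rule AE_I2)
          show "\<bar>indicator (box c d) x - bump (real (Suc i)) c d x\<bar> \<le> 1" for x
            using bump_range[of "real (Suc i)" c d x] by (cases "x \<in> box c d") (simp_all add: abs_le_iff)
        qed
        show "sqi ?M (\<lambda>_. 1)" by (rule sqi_bounded[of _ 1]) auto
        show "AE x in ?M. (\<lambda>i. bump (real (Suc i)) c d x) \<longlonglongrightarrow> indicator (box c d) x"
          using bump_tendsto[of c d] by simp
      qed (auto intro: box_indicator_measurable bump_measurable)
    qed
  next
    fix s and f :: "'a \<Rightarrow> real" and C :: real
    assume s: "\<And>i::nat. s i \<in> borel_measurable ?M" "f \<in> borel_measurable ?M" "\<And>i. test_approx (box a b) (s i)"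
      "\<And>i x. x \<in> box a b \<Longrightarrow> \<bar>s i x\<bar> \<le> C" "AE x in ?M. (\<lambda>i. s i x) \<longlonglongrightarrow> f x"
    have "AE x in ?M. x \<in> box a b" by (rule AE_I2) simp
    with s(5) have f: "AE x in ?M. x \<in> box a b \<and> \<bar>f x\<bar> \<le> C"
    proof eventually_elim
      case (elim x)
      then have "\<bar>f x\<bar> \<le> C" by (intro tendsto_le[OF _ tendsto_const tendsto_rabs[OF elim(1)]]) (auto simp: s(4))
      then show ?case using elim by simp
    qed
    show "test_approx (box a b) f"
    proof (rule test_approx_limit[OF _ s(3)])
      show "sqi ?M f" by (rule sqi_bounded[of _ C, OF s(2)]) (use f in \<open>eventually_elim, simp\<close>)
      show "(\<lambda>i. \<integral>x. (f x - s i x)\<^sup>2 \<partial>?M) \<longlonglongrightarrow> 0"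
      proof (rule L2_dominated_convergence[where w = "\<lambda>_. 2 * C"])
        show "AE x in ?M. \<bar>f x - s i x\<bar> \<le> 2 * C" for i
          using f
        proof eventually_elim
          case (elim x)
          then have "\<bar>s i x\<bar> \<le> C" by (intro s(4)) simp
          then show ?case using elim by linarith
        qed
        show "sqi ?M (\<lambda>_. 2 * C)" by (rule sqi_bounded[of _ "\<bar>2 * C\<bar>"]) auto
      qed (use s in auto)
    qed
  qed (assumption | rule test_approx_add test_approx_cmult)+
  \<comment> \<open>Truncation at height n: bounded, pointwise convergent, and with error dominated
    by |f| itself.\<close>
  define t where "t n x = max (- real n) (min (real n) (f x))" for n x
  have fm: "f \<in> borel_measurable ?M" using assms by (simp add: sqi_def)
  have tm: "t n \<in> borel_measurable ?M" for n unfolding t_def using fm by measurable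
  have lim: "(\<lambda>n. t n x) \<longlonglongrightarrow> f x" for x
  proof (rule tendsto_eventually)
    obtain N where N: "\<bar>f x\<bar> \<le> real N" using real_arch_simple by blast
    show "\<forall>\<^sub>F n in sequentially. t n x = f x"
      using eventually_ge_at_top[of N]
    proof eventually_elim
      case (elim n)
      then have "\<bar>f x\<bar> \<le> real n" using N by linarith
      then show ?case by (auto simp: t_def)
    qed
  qed
  show ?thesis
  proof (rule test_approx_limit[OF assms])
    show "test_approx (box a b) (t n)" for n
      by (rule bounded[OF tm, of _ "real n"]) (auto simp: t_def)
    show "(\<lambda>i. \<integral>x. (f x - t i x)\<^sup>2 \<partial>?M) \<longlonglongrightarrow> 0"
    proof (rule L2_dominated_convergence[OF tm fm, where w = "\<lambda>x. \<bar>f x\<bar>"])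
      show "sqi ?M (\<lambda>x. \<bar>f x\<bar>)" using assms by (auto simp: sqi_def)
      show "AE x in ?M. \<bar>f x - t i x\<bar> \<le> \<bar>f x\<bar>" for i
        by (intro AE_I2) (auto simp: t_def max_def min_def)
    qed (use lim in simp)
  qed
qed

text \<open>The functions whose product with G has integral zero include box indicators, as limits
  of bumps, and are closed under bounded limits. Hence they include sgn G, and the integral of |G|
  vanishes.\<close>

lemma fundamental_lemma_integrable:
  fixes a b :: "'a::euclidean_space"
  defines "M \<equiv> lebesgue_on (box a b)"
  assumes G: "integrable M G" and zero: "\<And>\<phi>. \<phi> \<in> ctest (box a b) \<Longrightarrow> (\<integral>x. \<phi> x * G x \<partial>M) = 0"
  shows "AE x in M. G x = (0::real)"
proof -
  note Gm = borel_measurable_integrable[OF G]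
  define P where "P f \<longleftrightarrow> integrable M (\<lambda>x. f x * G x) \<and> (\<integral>x. f x * G x \<partial>M) = 0" for f
  have limP: "P f" if s: "\<And>i::nat. s i \<in> borel_measurable M" "f \<in> borel_measurable M" "\<And>i. (\<integral>x. s i x * G x \<partial>M) = 0"
      "\<And>i x. x \<in> box a b \<Longrightarrow> \<bar>s i x\<bar> \<le> C" "AE x in M. (\<lambda>i. s i x) \<longlonglongrightarrow> f x" for s f C
  proof -
    have 1: "(\<lambda>x. f x * G x) \<in> borel_measurable M" "(\<lambda>x. s i x * G x) \<in> borel_measurable M" for i
      using s(1,2) Gm by measurable
    have 2: "integrable M (\<lambda>x. C * \<bar>G x\<bar>)" using G by simp
    have 3: "AE x in M. (\<lambda>i. s i x * G x) \<longlonglongrightarrow> f x * G x"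
      using s(5) by eventually_elim (intro tendsto_intros)
    have 4: "AE x in M. norm (s i x * G x) \<le> C * \<bar>G x\<bar>" for i
      by (intro AE_I2) (auto simp: M_def abs_mult intro!: mult_right_mono s(4))
    from integrable_dominated_convergence[OF 1 2 3 4] integral_dominated_convergence[OF 1 2 3 4]
    show ?thesis unfolding P_def s(3) by (auto dest: LIMSEQ_unique[OF tendsto_const])
  qed
  have "P (\<lambda>x. sgn (G x))"
  proof (rule bounded_measurable_induct[where P = P and a = a and b = b and C = 1])
    show "(\<lambda>x. sgn (G x)) \<in> borel_measurable (lebesgue_on (box a b))" using Gm unfolding M_def by measurable
    show "\<bar>sgn (G x)\<bar> \<le> 1" for x by (simp add: sgn_if)
    show "P (\<lambda>x. f x + g x)" if "P f" "P g" for f g using that by (simp add: P_def distrib_right)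
    show "P (\<lambda>x. c * f x)" if "P f" for f c using that by (simp add: P_def mult.assoc)
    show "P f" if "\<And>i::nat. s i \<in> borel_measurable (lebesgue_on (box a b))" "f \<in> borel_measurable (lebesgue_on (box a b))"
        "\<And>i. P (s i)" "\<And>i x. x \<in> box a b \<Longrightarrow> \<bar>s i x\<bar> \<le> C" "AE x in lebesgue_on (box a b). (\<lambda>i. s i x) \<longlonglongrightarrow> f x" for s f C
      by (rule limP[of s f C]) (use that[folded M_def] in \<open>simp_all add: P_def\<close>)
    fix c d :: 'a assume cd: "box c d \<subseteq> box a b"
    have T: "bump (real (Suc n)) c d \<in> ctest (box a b)" for n
      using cd by (intro bump_in_ctest) auto
    show "P (indicator (box c d))"
    proof (rule limP[of "\<lambda>n. bump (real (Suc n)) c d" _ 1])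
      show "\<bar>bump (real (Suc n)) c d x\<bar> \<le> 1" for n x using bump_range[of "real (Suc n)" c d x] by simp
      show "AE x in M. (\<lambda>i. bump (real (Suc i)) c d x) \<longlonglongrightarrow> indicator (box c d) x"
        using bump_tendsto[of c d] by simp
      show "(\<integral>x. bump (real (Suc n)) c d x * G x \<partial>M) = 0" for n by (rule zero[OF T])
    qed (auto simp: M_def intro: box_indicator_measurable bump_measurable)
  qed
  then have "(\<integral>x. \<bar>G x\<bar> \<partial>M) = 0" by (simp add: P_def sgn_mult_abs mult_sgn_abs mult.commute abs_sgn[symmetric])
  then have "AE x in M. \<bar>G x\<bar> = 0"
    using integral_nonneg_eq_0_iff_AE[of M "\<lambda>x. \<bar>G x\<bar>"] G by simp
  then show ?thesis by simp
qed

text \<open>\<phi> is bounded and vanishes off a compact subset of \<Omega>, where local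
  integrability applies.\<close>

lemma L1_loc_integrable_test:
  fixes g :: "'a::euclidean_space \<Rightarrow> 'b::euclidean_space"
  assumes g: "g \<in> L1_loc \<Omega>" and \<phi>: "\<phi> \<in> test_functions \<Omega>" and \<Omega>: "\<Omega> \<in> sets lebesgue"
  shows "integrable (lebesgue_on \<Omega>) (\<lambda>x. \<phi> x *\<^sub>R g x)"
proof -
  from \<phi> obtain K where K: "smooth \<phi>" "compact K" "K \<subseteq> \<Omega>" "\<And>x. x \<notin> K \<Longrightarrow> \<phi> x = 0"
    by (rule test_functionsE) blast
  obtain C where C: "C \<ge> 0" "\<forall>x. \<bar>\<phi> x\<bar> \<le> C" using test_bounded[OF \<phi>] by blast
  have Kl: "K \<in> sets lebesgue" using K(2) by (simp add: borel_compact)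
  have "integrable (lebesgue_on K) g" using g K by (simp add: L1_loc_def)
  then have i: "integrable lebesgue (\<lambda>x. indicator K x *\<^sub>R g x)" using Kl by (simp add: integrable_restrict_space)
  have "integrable lebesgue (\<lambda>x. \<phi> x *\<^sub>R (indicator K x *\<^sub>R g x))"
  proof (rule Bochner_Integration.integrable_bound)
    show "integrable lebesgue (\<lambda>x. C *\<^sub>R (indicator K x *\<^sub>R g x))" by (intro integrable_scaleR_right i)
    have "\<phi> \<in> borel_measurable lebesgue" using test_measurable[OF \<phi>, of UNIV] by (simp add: lebesgue_on_UNIV_eq)
    then show "(\<lambda>x. \<phi> x *\<^sub>R (indicator K x *\<^sub>R g x)) \<in> borel_measurable lebesgue"
      using borel_measurable_integrable[OF i] by measurable
    show "AE x in lebesgue. norm (\<phi> x *\<^sub>R (indicator K x *\<^sub>R g x)) \<le> norm (C *\<^sub>R (indicator K x *\<^sub>R g x))"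
      using C by (intro AE_I2) (auto simp: indicator_def intro!: mult_right_mono)
  qed
  also have "(\<lambda>x. \<phi> x *\<^sub>R (indicator K x *\<^sub>R g x)) = (\<lambda>x. indicator \<Omega> x *\<^sub>R (\<phi> x *\<^sub>R g x))"
    using K by (auto simp: fun_eq_iff indicator_def)
  finally show ?thesis using \<Omega> by (simp add: integrable_restrict_space)
qed

text \<open>Multiplication by a bump cutoff makes a locally integrable g integrable, and the product
  of two test functions is again one, so the integrable case applies. The cutoffs converge to 1 on
  the box.\<close>

lemma fundamental_lemma:
  fixes a b :: "'a::euclidean_space" and g :: "'a \<Rightarrow> real"
  assumes g: "g \<in> L1_loc (box a b)"
    and zero: "\<And>\<phi>. \<phi> \<in> ctest (box a b) \<Longrightarrow> (\<integral>x. \<phi> x * g x \<partial>lebesgue_on (box a b)) = 0"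
  shows "AE x in lebesgue_on (box a b). g x = 0"
proof -
  let ?M = "lebesgue_on (box a b)"
  let ?\<chi> = "\<lambda>n. bump (real (Suc n)) a b"
  have T: "?\<chi> n \<in> ctest (box a b)" for n by (intro bump_in_ctest) auto
  have "AE x in ?M. ?\<chi> n x * g x = 0" for n
  proof (rule fundamental_lemma_integrable)
    show "integrable ?M (\<lambda>x. ?\<chi> n x * g x)"
      using L1_loc_integrable_test[OF g ctest_test[OF T]] by simp
    show "(\<integral>x. \<phi> x * (?\<chi> n x * g x) \<partial>?M) = 0" if "\<phi> \<in> ctest (box a b)" for \<phi>
      using zero[OF ctest_mult[OF that T]] by (simp add: mult.assoc)
  qed
  then have "AE x in ?M. \<forall>n. ?\<chi> n x * g x = 0" by (simp only: AE_all_countable simp_thms)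
  moreover have "AE x in ?M. x \<in> box a b" by (rule AE_I2) simp
  ultimately show ?thesis
  proof eventually_elim
    case (elim x)
    have "(\<lambda>n. ?\<chi> n x * g x) \<longlonglongrightarrow> indicator (box a b) x * g x" by (intro tendsto_intros bump_tendsto)
    then have "(\<lambda>n. 0) \<longlonglongrightarrow> indicator (box a b) x * g x" by (simp only: elim(1)[rule_format])
    from LIMSEQ_unique[OF this tendsto_const] show ?case using elim(2) by simp
  qed
qed

lemma box_lebesgue: "box a b \<in> sets lebesgue"
  by simp

lemma L1_loc_cong_AE:
  fixes f g :: "'a::euclidean_space \<Rightarrow> 'b::euclidean_space"
  assumes f: "f \<in> L1_loc \<Omega>" and \<Omega>: "\<Omega> \<in> sets lebesgue" and eq: "AE x in lebesgue_on \<Omega>. f x = g x"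
  shows "g \<in> L1_loc \<Omega>"
  unfolding L1_loc_def
proof (intro CollectI allI impI)
  fix K assume K: "compact K \<and> K \<subseteq> \<Omega>"
  then have Kl: "K \<in> sets lebesgue" by (simp add: borel_compact)
  have "integrable (lebesgue_on K) f" using f K by (simp add: L1_loc_def)
  then have i: "integrable lebesgue (\<lambda>x. indicator K x *\<^sub>R f x)" using Kl by (simp add: integrable_restrict_space)
  have "AE x in lebesgue. x \<in> \<Omega> \<longrightarrow> f x = g x" using eq \<Omega> by (simp add: AE_restrict_space_iff)
  then have ae: "AE x in lebesgue. indicator K x *\<^sub>R f x = indicator K x *\<^sub>R g x"
    by eventually_elim (use K in \<open>auto simp: indicator_def\<close>)
  have "(\<lambda>x. indicator K x *\<^sub>R g x) \<in> borel_measurable lebesgue"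
    by (rule borel_measurable_AE[OF borel_measurable_integrable[OF i] ae])
  with integrable_cong_AE[OF borel_measurable_integrable[OF i] this ae] i
  have "integrable lebesgue (\<lambda>x. indicator K x *\<^sub>R g x)" by simp
  then show "integrable (lebesgue_on K) g" using Kl by (simp add: integrable_restrict_space)
qed

lemma integrable_L1_loc:
  fixes f :: "'a::euclidean_space \<Rightarrow> 'b::euclidean_space"
  assumes f: "integrable (lebesgue_on \<Omega>) f" and \<Omega>: "\<Omega> \<in> sets lebesgue"
  shows "f \<in> L1_loc \<Omega>"
  unfolding L1_loc_def
proof (intro CollectI allI impI)
  fix K assume K: "compact K \<and> K \<subseteq> \<Omega>"
  then have Kl: "K \<in> sets lebesgue" by (simp add: borel_compact)
  have i: "integrable lebesgue (\<lambda>x. indicator \<Omega> x *\<^sub>R f x)" using f \<Omega> by (simp add: integrable_restrict_space)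
  have "integrable lebesgue (\<lambda>x. indicator K x *\<^sub>R (indicator \<Omega> x *\<^sub>R f x))"
    using integrable_mult_indicator[OF Kl i] .
  moreover have "(\<lambda>x. indicator K x *\<^sub>R (indicator \<Omega> x *\<^sub>R f x)) = (\<lambda>x. indicator K x *\<^sub>R f x)"
    using K by (auto simp: indicator_def fun_eq_iff)
  ultimately show "integrable (lebesgue_on K) f" using Kl by (simp add: integrable_restrict_space)
qed

lemma L1_loc_add: "f \<in> L1_loc \<Omega> \<Longrightarrow> g \<in> L1_loc \<Omega> \<Longrightarrow> (\<lambda>x. f x + g x) \<in> L1_loc \<Omega>"
  by (simp add: L1_loc_def)

lemma L1_loc_scaleR: "f \<in> L1_loc \<Omega> \<Longrightarrow> (\<lambda>x. c *\<^sub>R f x) \<in> L1_loc \<Omega>"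
  by (simp add: L1_loc_def)

lemma L1_loc_inner: "f \<in> L1_loc \<Omega> \<Longrightarrow> (\<lambda>x. f x \<bullet> i) \<in> L1_loc \<Omega>"
  by (auto simp: L1_loc_def)

lemma sqi_L1_loc: "sqi (lebesgue_on (box a b)) f \<Longrightarrow> f \<in> L1_loc (box a b)"
  by (intro integrable_L1_loc finite_measure.sqi_integrable finite_measure_box) simp_all

section \<open>Weak derivatives\<close>

lemma weak_deriv_cong_AE:
  fixes f f' g g' :: "'a::euclidean_space \<Rightarrow> 'b::euclidean_space"
  assumes w: "is_weak_deriv (box a b) v f g"
    and f: "AE x in lebesgue_on (box a b). f x = f' x" and g: "AE x in lebesgue_on (box a b). g x = g' x"
  shows "is_weak_deriv (box a b) v f' g'"
  unfolding is_weak_deriv_def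
proof (intro conjI ballI)
  let ?M = "lebesgue_on (box a b)"
  have L: "f \<in> L1_loc (box a b)" "g \<in> L1_loc (box a b)" using w by (auto simp: is_weak_deriv_def)
  show L': "f' \<in> L1_loc (box a b)" "g' \<in> L1_loc (box a b)"
    by (rule L1_loc_cong_AE[OF L(1) box_lebesgue f] L1_loc_cong_AE[OF L(2) box_lebesgue g])+
  fix \<phi> :: "'a \<Rightarrow> real" assume \<phi>: "\<phi> \<in> test_functions (box a b)"
  have i: "integrable ?M (\<lambda>x. \<psi> x *\<^sub>R h x)" if "\<psi> \<in> test_functions (box a b)" "h \<in> L1_loc (box a b)" for \<psi> and h :: "'a \<Rightarrow> 'b"
    using that by (intro L1_loc_integrable_test) auto
  have "(LINT x|?M. D v \<phi> x *\<^sub>R f' x) = (LINT x|?M. D v \<phi> x *\<^sub>R f x)"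
    using f by (intro integral_cong_AE borel_measurable_integrable i L L' test_functions_D \<phi>) (auto elim: eventually_mono)
  also have "\<dots> = - (LINT x|?M. \<phi> x *\<^sub>R g x)" using w \<phi> by (simp add: is_weak_deriv_def)
  also have "(LINT x|?M. \<phi> x *\<^sub>R g x) = (LINT x|?M. \<phi> x *\<^sub>R g' x)"
    using g by (intro integral_cong_AE borel_measurable_integrable i L L' \<phi>) (auto elim: eventually_mono)
  finally show "(LINT x|?M. D v \<phi> x *\<^sub>R f' x) = - (LINT x|?M. \<phi> x *\<^sub>R g' x)" .
qed

text \<open>Both functions have the same set of weak derivatives, so the choice operator picks the
  very same representative. This genuine equality lets iterated derivatives be rewritten inside
  \<open>weak_deriv\<close>.\<close>

lemma weak_deriv_eq_cong:
  fixes f f' :: "'a::euclidean_space \<Rightarrow> 'b::euclidean_space"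
  assumes "AE x in lebesgue_on (box a b). f x = f' x"
  shows "weak_deriv (box a b) v f = weak_deriv (box a b) v f'"
proof -
  have "AE x in lebesgue_on (box a b). f' x = f x" using assms by eventually_elim simp
  then have "is_weak_deriv (box a b) v f = is_weak_deriv (box a b) v f'"
    using assms weak_deriv_cong_AE[of a b v _ _ _ _] by (intro ext iffI) (blast intro: weak_deriv_cong_AE AE_I2)+
  then show ?thesis by (simp add: weak_deriv_def)
qed

text \<open>The restriction to \<open>ctest\<close> matters for mixed derivatives, where the
  integral identity is derived only for test functions whose second derivatives commute.\<close>

lemma weak_deriv_unique_ctest:
  fixes g g' :: "'a::euclidean_space \<Rightarrow> 'b::euclidean_space"
  assumes g: "g \<in> L1_loc (box a b)" "g' \<in> L1_loc (box a b)"
    and eq: "\<And>\<phi>. \<phi> \<in> ctest (box a b) \<Longrightarrow> (LINT x|lebesgue_on (box a b). \<phi> x *\<^sub>R g x) = (LINT x|lebesgue_on (box a b). \<phi> x *\<^sub>R g' x)"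
  shows "AE x in lebesgue_on (box a b). g x = g' x"
proof -
  let ?M = "lebesgue_on (box a b)"
  have i: "integrable ?M (\<lambda>x. \<phi> x *\<^sub>R h x)" if "\<phi> \<in> ctest (box a b)" "h \<in> L1_loc (box a b)" for \<phi> and h :: "'a \<Rightarrow> 'b"
    using that by (intro L1_loc_integrable_test ctest_test) auto
  have "AE x in ?M. (g x + (-1) *\<^sub>R g' x) \<bullet> i = 0" if "i \<in> Basis" for i
  proof (rule fundamental_lemma)
    show "(\<lambda>x. (g x + (-1) *\<^sub>R g' x) \<bullet> i) \<in> L1_loc (box a b)"
      by (intro L1_loc_inner L1_loc_add L1_loc_scaleR g)
    fix \<phi> :: "'a \<Rightarrow> real" assume \<phi>: "\<phi> \<in> ctest (box a b)"
    note ii = i[OF \<phi> g(1)] i[OF \<phi> g(2)]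
    have "(LINT x|?M. \<phi> x * ((g x + (-1) *\<^sub>R g' x) \<bullet> i)) = (LINT x|?M. (\<phi> x *\<^sub>R g x - \<phi> x *\<^sub>R g' x) \<bullet> i)"
      by (simp add: inner_diff_left algebra_simps)
    also have "\<dots> = (LINT x|?M. \<phi> x *\<^sub>R g x - \<phi> x *\<^sub>R g' x) \<bullet> i"
      using ii by (intro integral_inner_left Bochner_Integration.integrable_diff)
    also have "(LINT x|?M. \<phi> x *\<^sub>R g x - \<phi> x *\<^sub>R g' x) = 0"
      using Bochner_Integration.integral_diff[OF ii] eq[OF \<phi>] by simp
    finally show "(LINT x|?M. \<phi> x * ((g x + (-1) *\<^sub>R g' x) \<bullet> i)) = 0" by simp
  qed
  then have "AE x in ?M. \<forall>i\<in>Basis. (g x + (-1) *\<^sub>R g' x) \<bullet> i = 0"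
    by (intro AE_finite_allI) auto
  then show ?thesis
    by eventually_elim (simp only: euclidean_all_zero_iff scaleR_minus_left scaleR_one add_uminus_conv_diff right_minus_eq)
qed

lemma is_weak_deriv_unique:
  fixes g g' :: "'a::euclidean_space \<Rightarrow> 'b::euclidean_space"
  assumes "is_weak_deriv (box a b) v f g" "is_weak_deriv (box a b) v f g'"
  shows "AE x in lebesgue_on (box a b). g x = g' x"
proof (rule weak_deriv_unique_ctest)
  show "g \<in> L1_loc (box a b)" "g' \<in> L1_loc (box a b)" using assms by (auto simp: is_weak_deriv_def)
  fix \<phi> :: "'a \<Rightarrow> real" assume "\<phi> \<in> ctest (box a b)"
  then have T: "\<phi> \<in> test_functions (box a b)" by (rule ctest_test)
  have "(LINT x|lebesgue_on (box a b). D v \<phi> x *\<^sub>R f x) = - (LINT x|lebesgue_on (box a b). \<phi> x *\<^sub>R g x)"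
    using assms(1) T by (simp add: is_weak_deriv_def)
  moreover have "(LINT x|lebesgue_on (box a b). D v \<phi> x *\<^sub>R f x) = - (LINT x|lebesgue_on (box a b). \<phi> x *\<^sub>R g' x)"
    using assms(2) T by (simp add: is_weak_deriv_def)
  ultimately show "(LINT x|lebesgue_on (box a b). \<phi> x *\<^sub>R g x) = (LINT x|lebesgue_on (box a b). \<phi> x *\<^sub>R g' x)"
    by simp
qed

lemma weak_deriv_is:
  assumes "is_weak_deriv \<Omega> v f g"
  shows "is_weak_deriv \<Omega> v f (weak_deriv \<Omega> v f)"
  unfolding weak_deriv_def by (rule someI[where P = "is_weak_deriv \<Omega> v f", OF assms])

lemma weak_deriv_AE:
  fixes g :: "'a::euclidean_space \<Rightarrow> 'b::euclidean_space"
  assumes "is_weak_deriv (box a b) v f g"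
  shows "AE x in lebesgue_on (box a b). weak_deriv (box a b) v f x = g x"
  by (rule is_weak_deriv_unique[OF weak_deriv_is[OF assms] assms])

lemma is_weak_deriv_add:
  fixes f g f' g' :: "'a::euclidean_space \<Rightarrow> 'b::euclidean_space"
  assumes "is_weak_deriv (box a b) v f g" "is_weak_deriv (box a b) v f' g'"
  shows "is_weak_deriv (box a b) v (\<lambda>x. f x + f' x) (\<lambda>x. g x + g' x)"
  unfolding is_weak_deriv_def
proof (intro conjI ballI)
  have L: "f \<in> L1_loc (box a b)" "g \<in> L1_loc (box a b)" "f' \<in> L1_loc (box a b)" "g' \<in> L1_loc (box a b)"
    using assms by (auto simp: is_weak_deriv_def)
  show "(\<lambda>x. f x + f' x) \<in> L1_loc (box a b)" "(\<lambda>x. g x + g' x) \<in> L1_loc (box a b)" using L by (auto intro: L1_loc_add)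
  fix \<phi> :: "'a \<Rightarrow> real" assume \<phi>: "\<phi> \<in> test_functions (box a b)"
  have i: "integrable (lebesgue_on (box a b)) (\<lambda>x. \<psi> x *\<^sub>R h x)"
    if "\<psi> \<in> test_functions (box a b)" "h \<in> L1_loc (box a b)" for \<psi> and h :: "'a \<Rightarrow> 'b"
    using that by (intro L1_loc_integrable_test) auto
  show "(LINT x|lebesgue_on (box a b). D v \<phi> x *\<^sub>R (f x + f' x)) = - (LINT x|lebesgue_on (box a b). \<phi> x *\<^sub>R (g x + g' x))"
    using assms \<phi> L i[OF \<phi>] i[OF test_functions_D[OF \<phi>]] by (simp add: is_weak_deriv_def scaleR_add_right)
qed

lemma is_weak_deriv_scaleR:
  fixes f g :: "'a::euclidean_space \<Rightarrow> 'b::euclidean_space"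
  assumes "is_weak_deriv (box a b) v f g"
  shows "is_weak_deriv (box a b) v (\<lambda>x. c *\<^sub>R f x) (\<lambda>x. c *\<^sub>R g x)"
  unfolding is_weak_deriv_def
proof (intro conjI ballI)
  show "(\<lambda>x. c *\<^sub>R f x) \<in> L1_loc (box a b)" "(\<lambda>x. c *\<^sub>R g x) \<in> L1_loc (box a b)"
    using assms by (auto simp: is_weak_deriv_def intro!: L1_loc_scaleR)
  fix \<phi> :: "'a \<Rightarrow> real" assume "\<phi> \<in> test_functions (box a b)"
  then have "(LINT x|lebesgue_on (box a b). D v \<phi> x *\<^sub>R f x) = - (LINT x|lebesgue_on (box a b). \<phi> x *\<^sub>R g x)"
    using assms by (simp add: is_weak_deriv_def)
  then have "c *\<^sub>R (LINT x|lebesgue_on (box a b). D v \<phi> x *\<^sub>R f x) = - (c *\<^sub>R (LINT x|lebesgue_on (box a b). \<phi> x *\<^sub>R g x))"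
    by simp
  then show "(LINT x|lebesgue_on (box a b). D v \<phi> x *\<^sub>R c *\<^sub>R f x) = - (LINT x|lebesgue_on (box a b). \<phi> x *\<^sub>R c *\<^sub>R g x)"
    by (simp only: integral_scaleR_right[symmetric] scaleR_left_commute)
qed

text \<open>Mixed weak derivatives commute because the test functions of class \<open>ctest\<close> already
  separate points.\<close>

lemma weak_deriv_commute:
  fixes f :: "'a::euclidean_space \<Rightarrow> real"
  assumes "is_weak_deriv (box a b) v f g" "is_weak_deriv (box a b) w f h"
    "is_weak_deriv (box a b) w g gw" "is_weak_deriv (box a b) v h hv"
  shows "AE x in lebesgue_on (box a b). gw x = hv x"
proof (rule weak_deriv_unique_ctest)
  show "gw \<in> L1_loc (box a b)" "hv \<in> L1_loc (box a b)" using assms by (auto simp: is_weak_deriv_def)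
  let ?M = "lebesgue_on (box a b)"
  fix \<phi> :: "'a \<Rightarrow> real" assume c: "\<phi> \<in> ctest (box a b)"
  note \<phi> = ctest_test[OF c]
  have "(LINT x|?M. \<phi> x *\<^sub>R gw x) = - (LINT x|?M. D w \<phi> x *\<^sub>R g x)" using assms(3) \<phi> by (simp add: is_weak_deriv_def)
  also have "\<dots> = (LINT x|?M. D v (\<lambda>x. D w \<phi> x) x *\<^sub>R f x)"
    using assms(1) test_functions_D[OF \<phi>] by (simp add: is_weak_deriv_def)
  also have "(\<lambda>x. D v (\<lambda>x. D w \<phi> x) x) = (\<lambda>x. D w (\<lambda>x. D v \<phi> x) x)"
    using c by (auto simp: ctest_def csmooth_def)
  then have "(LINT x|?M. D v (\<lambda>x. D w \<phi> x) x *\<^sub>R f x) = (LINT x|?M. D w (\<lambda>x. D v \<phi> x) x *\<^sub>R f x)"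
    by metis
  also have "\<dots> = - (LINT x|?M. D v \<phi> x *\<^sub>R h x)"
    using assms(2) test_functions_D[OF \<phi>] by (simp add: is_weak_deriv_def)
  also have "\<dots> = (LINT x|?M. \<phi> x *\<^sub>R hv x)" using assms(4) \<phi> by (simp add: is_weak_deriv_def)
  finally show "(LINT x|?M. \<phi> x *\<^sub>R gw x) = (LINT x|?M. \<phi> x *\<^sub>R hv x)" .
qed

text \<open>For a fixed test function both sides of the defining identity are L2-continuous, by
  Cauchy-Schwarz. This is how smooth approximation transfers classical derivatives to weak
  ones.\<close>

lemma is_weak_deriv_limit:
  fixes a b :: "'a::euclidean_space"
  defines "M \<equiv> lebesgue_on (box a b)"
  assumes w: "\<And>n::nat. is_weak_deriv (box a b) v (F n) (G n)"
    and s: "\<And>n. sqi M (F n)" "\<And>n. sqi M (G n)" "sqi M f" "sqi M g"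
    and lim: "(\<lambda>n. \<integral>x. (f x - F n x)\<^sup>2 \<partial>M) \<longlonglongrightarrow> 0" "(\<lambda>n. \<integral>x. (g x - G n x)\<^sup>2 \<partial>M) \<longlonglongrightarrow> 0"
  shows "is_weak_deriv (box a b) v f g"
  unfolding is_weak_deriv_def
proof (intro conjI ballI)
  show "f \<in> L1_loc (box a b)" "g \<in> L1_loc (box a b)" using s by (auto simp: M_def intro: sqi_L1_loc)
  fix \<phi> :: "'a \<Rightarrow> real" assume \<phi>: "\<phi> \<in> test_functions (box a b)"
  have conv: "(\<lambda>n. \<integral>x. \<psi> x * H n x \<partial>M) \<longlonglongrightarrow> (\<integral>x. \<psi> x * h x \<partial>M)"
    if "\<psi> \<in> test_functions (box a b)" "\<And>n. sqi M (H n)" "sqi M h" "(\<lambda>n. \<integral>x. (h x - H n x)\<^sup>2 \<partial>M) \<longlonglongrightarrow> 0" for \<psi> H h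
  proof -
    have \<psi>: "sqi M \<psi>" using sqi_test[OF that(1)] by (simp add: M_def)
    have B: "\<bar>(\<integral>x. \<psi> x * h x \<partial>M) - (\<integral>x. \<psi> x * H n x \<partial>M)\<bar> \<le> sqrt (\<integral>x. (\<psi> x)\<^sup>2 \<partial>M) * sqrt (\<integral>x. (h x - H n x)\<^sup>2 \<partial>M)" for n
    proof -
      have "(\<integral>x. \<psi> x * h x \<partial>M) - (\<integral>x. \<psi> x * H n x \<partial>M) = (\<integral>x. \<psi> x * (h x - H n x) \<partial>M)"
        using sqi_mult_integrable[OF \<psi> that(3)] sqi_mult_integrable[OF \<psi> that(2)[of n]] by (simp add: right_diff_distrib)
      then show ?thesis using Cauchy_Schwarz_integral[OF \<psi> sqi_diff[OF that(3) that(2)[of n]]] by simp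
    qed
    have "(\<lambda>n. sqrt (\<integral>x. (\<psi> x)\<^sup>2 \<partial>M) * sqrt (\<integral>x. (h x - H n x)\<^sup>2 \<partial>M)) \<longlonglongrightarrow> 0"
      using tendsto_mult[OF tendsto_const tendsto_real_sqrt[OF that(4)], of "sqrt (\<integral>x. (\<psi> x)\<^sup>2 \<partial>M)"] by simp
    from Lim_null_comparison[OF always_eventually[OF allI] this, of "\<lambda>n. (\<integral>x. \<psi> x * h x \<partial>M) - (\<integral>x. \<psi> x * H n x \<partial>M)"] B
    have "(\<lambda>n. (\<integral>x. \<psi> x * h x \<partial>M) - (\<integral>x. \<psi> x * H n x \<partial>M)) \<longlonglongrightarrow> 0" by simp
    from tendsto_diff[OF tendsto_const[of "\<integral>x. \<psi> x * h x \<partial>M"] this] show ?thesis by simp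
  qed
  have "(\<lambda>n. \<integral>x. D v \<phi> x * F n x \<partial>M) \<longlonglongrightarrow> (\<integral>x. D v \<phi> x * f x \<partial>M)"
    by (intro conv test_functions_D \<phi> s lim)
  moreover have "(\<integral>x. D v \<phi> x * F n x \<partial>M) = - (\<integral>x. \<phi> x * G n x \<partial>M)" for n
    using w[of n] \<phi> by (simp add: is_weak_deriv_def M_def)
  ultimately have "(\<lambda>n. - (\<integral>x. \<phi> x * G n x \<partial>M)) \<longlonglongrightarrow> (\<integral>x. D v \<phi> x * f x \<partial>M)" by simp
  moreover have "(\<lambda>n. - (\<integral>x. \<phi> x * G n x \<partial>M)) \<longlonglongrightarrow> - (\<integral>x. \<phi> x * g x \<partial>M)"
    by (intro tendsto_minus conv \<phi> s lim)
  ultimately show "(LINT x|lebesgue_on (box a b). D v \<phi> x *\<^sub>R f x) = - (LINT x|lebesgue_on (box a b). \<phi> x *\<^sub>R g x)"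
    using LIMSEQ_unique unfolding M_def by fastforce
qed

text \<open>Translation invariance of Lebesgue measure, applied to difference quotients, replaces Fubini.\<close>

lemma integral_directional_derivative_eq_0:
  fixes \<psi> \<Psi> :: "'a::euclidean_space \<Rightarrow> real"
  assumes deriv: "\<And>x t. ((\<lambda>t. \<psi> (x + t *\<^sub>R v)) has_real_derivative \<Psi> (x + t *\<^sub>R v)) (at t)"
    and cont: "continuous_on UNIV \<psi>" "continuous_on UNIV \<Psi>"
    and K: "compact K" "\<And>x. x \<notin> K \<Longrightarrow> \<psi> x = 0" "\<And>x. x \<notin> K \<Longrightarrow> \<Psi> x = 0"
  shows "(\<integral>x. \<Psi> x \<partial>lborel) = 0"
proof -
  obtain C where C: "C \<ge> 0" "\<And>x. \<bar>\<Psi> x\<bar> \<le> C" using vanishing_bounded[OF cont(2) K(1,3)] by blast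
  obtain r where r: "\<And>x. x \<in> K \<Longrightarrow> norm x \<le> r" using compact_imp_bounded[OF K(1)] by (auto simp: bounded_iff)
  \<comment> \<open>All the difference quotients, whose steps are at most 1, vanish outside this
    ball, which provides one integrable majorant.\<close>
  let ?B = "cball (0::'a) (r + norm v)"
  define q where "q n x = (\<psi> (x + (1 / real (Suc n)) *\<^sub>R v) - \<psi> x) * real (Suc n)" for n x
  have meas: "\<psi> \<in> borel_measurable borel" "\<Psi> \<in> borel_measurable borel"
    using cont by (auto intro: borel_measurable_continuous_onI)
  have qb: "\<bar>q n x\<bar> \<le> C * indicator ?B x" for n x
  proof -
    let ?t = "1 / real (Suc n)"
    have "?t > 0" by simp
    then obtain z where z: "0 < z" "z < ?t" "\<psi> (x + ?t *\<^sub>R v) - \<psi> (x + 0 *\<^sub>R v) = (?t - 0) * \<Psi> (x + z *\<^sub>R v)"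
      using MVT2[of 0 ?t "\<lambda>t. \<psi> (x + t *\<^sub>R v)" "\<lambda>t. \<Psi> (x + t *\<^sub>R v)"] deriv by blast
    then have q: "q n x = \<Psi> (x + z *\<^sub>R v)" by (simp add: q_def field_simps)
    show ?thesis
    proof (cases "x \<in> ?B")
      case True then show ?thesis using C(2) by (simp add: q)
    next
      case False
      have "x + z *\<^sub>R v \<notin> K"
      proof
        assume "x + z *\<^sub>R v \<in> K"
        then have "norm (x + z *\<^sub>R v) \<le> r" by (rule r)
        moreover have "z \<le> 1" using z(2) by (rule order_trans[OF less_imp_le]) simp
        then have "norm (z *\<^sub>R v) \<le> norm v" using z(1) by (simp add: mult_left_le_one_le)
        moreover have "norm x \<le> norm (x + z *\<^sub>R v) + norm (z *\<^sub>R v)" by (metis add_diff_cancel_right' norm_triangle_ineq4)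
        ultimately show False using False by simp
      qed
      then show ?thesis using K(3) False by (simp add: q)
    qed
  qed
  have lim: "(\<lambda>n. q n x) \<longlonglongrightarrow> \<Psi> x" for x
  proof -
    have "((\<lambda>h. (\<psi> (x + h *\<^sub>R v) - \<psi> x) / h) \<longlongrightarrow> \<Psi> x) (at 0)"
      using deriv[of x 0] by (simp add: DERIV_def)
    moreover have "filterlim (\<lambda>n. 1 / real (Suc n)) (at 0) sequentially"
      unfolding filterlim_at using LIMSEQ_inverse_real_of_nat by (simp add: inverse_eq_divide)
    ultimately have "(\<lambda>n. (\<psi> (x + (1 / real (Suc n)) *\<^sub>R v) - \<psi> x) / (1 / real (Suc n))) \<longlonglongrightarrow> \<Psi> x"
      by (rule filterlim_compose)
    then show ?thesis by (simp add: q_def)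
  qed
  have qm: "q n \<in> borel_measurable lborel" for n
  proof -
    have "continuous_on UNIV (q n)" unfolding q_def
      by (intro continuous_intros continuous_on_compose2[OF cont(1)]) auto
    then show ?thesis by (simp add: borel_measurable_continuous_onI)
  qed
  have iB: "integrable lborel (\<lambda>x. C * indicator ?B x)"
    using emeasure_bounded_finite[of ?B] by (intro integrable_mult_right) (auto simp: integrable_indicator_iff)
  obtain C' where C': "C' \<ge> 0" "\<And>x. \<bar>\<psi> x\<bar> \<le> C'" using vanishing_bounded[OF cont(1) K(1,2)] by blast
  have i\<psi>: "integrable lborel \<psi>"
  proof (rule Bochner_Integration.integrable_bound)
    show "integrable lborel (\<lambda>x. C' * indicator K x)"
      using emeasure_bounded_finite[of K] K(1) borel_compact[OF K(1)] compact_imp_bounded[OF K(1)]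
      by (intro integrable_mult_right) (auto simp: integrable_indicator_iff)
    show "AE x in lborel. norm (\<psi> x) \<le> norm (C' * indicator K x)"
      using C' K(2) by (intro AE_I2) (auto simp: indicator_def)
  qed (use meas in simp)
  have zero: "(\<integral>x. q n x \<partial>lborel) = 0" for n
  proof -
    let ?c = "(1 / real (Suc n)) *\<^sub>R v"
    \<comment> \<open>By translation invariance both terms of the difference quotient have the same
      integral.\<close>
    have D: "distr lborel borel ((+) ?c) = lborel" by (rule lborel_distr_plus)
    have "integrable (distr lborel borel ((+) ?c)) \<psi>" using i\<psi> by (simp only: D)
    then have i: "integrable lborel (\<lambda>x. \<psi> (?c + x))" by (subst (asm) integrable_distr_eq) (use meas in auto)
    have "(\<integral>x. \<psi> (?c + x) \<partial>lborel) = (\<integral>x. \<psi> x \<partial>distr lborel borel ((+) ?c))"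
      by (rule integral_distr[symmetric]) (use meas in auto)
    also have "\<dots> = (\<integral>x. \<psi> x \<partial>lborel)" by (simp only: D)
    finally show ?thesis using i i\<psi> by (simp add: q_def add.commute)
  qed
  have "(\<lambda>n. \<integral>x. q n x \<partial>lborel) \<longlonglongrightarrow> (\<integral>x. \<Psi> x \<partial>lborel)"
    by (rule integral_dominated_convergence[OF _ qm iB]) (use lim qb meas in auto)
  then show ?thesis unfolding zero by (rule LIMSEQ_unique[OF _ tendsto_const])
qed

section \<open>Classical derivatives as weak derivatives\<close>

lemma continuous_sqi_box:
  fixes h :: "'a::euclidean_space \<Rightarrow> real"
  assumes "continuous_on UNIV h"
  shows "sqi (lebesgue_on (box a b)) h"
proof -
  have "bounded (h ` cbox a b)"
    by (intro compact_imp_bounded compact_continuous_image continuous_on_subset[OF assms]) auto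
  then obtain C where C: "\<And>x. x \<in> cbox a b \<Longrightarrow> \<bar>h x\<bar> \<le> C" by (auto simp: bounded_iff)
  have "AE x in lebesgue_on (box a b). \<bar>h x\<bar> \<le> C"
    using C box_subset_cbox[of a b] by (intro AE_I2) auto
  then show ?thesis
    by (rule finite_measure.sqi_bounded[OF finite_measure_box continuous_measurable_lebesgue_on[OF assms]])
qed

text \<open>By the product rule, the sum of the two integrands is the directional derivative of the
  compactly supported function \<phi> f, whose integral over the whole space is zero.\<close>

lemma classical_is_weak_deriv:
  fixes f g :: "'a::euclidean_space \<Rightarrow> real"
  assumes deriv: "\<And>x. (f has_derivative F x) (at x)" and g: "\<And>x. F x v = g x" and cont: "continuous_on UNIV g"
  shows "is_weak_deriv (box a b) v f g"
  unfolding is_weak_deriv_def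
proof (intro conjI ballI)
  let ?\<Omega> = "box a b"
  have cf: "continuous_on UNIV f"
    by (intro continuous_at_imp_continuous_on ballI has_derivative_continuous[OF deriv])
  note L = sqi_L1_loc[OF continuous_sqi_box]
  show "f \<in> L1_loc ?\<Omega>" "g \<in> L1_loc ?\<Omega>" by (rule L[OF cf] L[OF cont])+
  fix \<phi> :: "'a \<Rightarrow> real" assume \<phi>: "\<phi> \<in> test_functions ?\<Omega>"
  from \<phi> obtain K where K: "smooth \<phi>" "compact K" "K \<subseteq> ?\<Omega>" "\<And>x. x \<notin> K \<Longrightarrow> \<phi> x = 0"
    by (rule test_functionsE) blast
  let ?\<Psi> = "\<lambda>x. \<phi> x * g x + D v \<phi> x * f x"
  have D0: "x \<notin> K \<Longrightarrow> D v \<phi> x = 0" for x by (rule D_zero_outside[OF K(2,4)])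
  have c\<Psi>: "continuous_on UNIV ?\<Psi>"
    by (intro continuous_intros cont cf smooth_continuous smooth_D K(1))
  have "(\<integral>x. ?\<Psi> x \<partial>lborel) = 0"
  proof (rule integral_directional_derivative_eq_0[OF _ _ c\<Psi> K(2), of "\<lambda>x. \<phi> x * f x" v])
    fix x t
    have "((\<lambda>x. \<phi> x * f x) has_derivative (\<lambda>h. \<phi> y * F y h + D h \<phi> y * f y)) (at y)" for y
      by (intro has_derivative_mult has_derivative_D smooth_differentiable K(1) deriv)
    moreover have "((\<lambda>t. x + t *\<^sub>R v) has_derivative (\<lambda>h. h *\<^sub>R v)) (at t)"
      by (auto intro!: derivative_eq_intros)
    ultimately have d: "((\<lambda>t. \<phi> (x + t *\<^sub>R v) * f (x + t *\<^sub>R v)) has_derivative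
      (\<lambda>h. \<phi> (x + t *\<^sub>R v) * F (x + t *\<^sub>R v) (h *\<^sub>R v) + D (h *\<^sub>R v) \<phi> (x + t *\<^sub>R v) * f (x + t *\<^sub>R v))) (at t)"
      by (rule has_derivative_compose[rotated])
    have h: "D (h *\<^sub>R v) \<phi> y = h * D v \<phi> y" "F y (h *\<^sub>R v) = h * g y" for h y
      using linear_frechet_derivative[OF smooth_differentiable[OF K(1)], of y] has_derivative_linear[OF deriv, of y] g
      by (auto simp: linear_cmul)
    show "((\<lambda>t. \<phi> (x + t *\<^sub>R v) * f (x + t *\<^sub>R v)) has_real_derivative ?\<Psi> (x + t *\<^sub>R v)) (at t)"
      unfolding has_field_derivative_def
      by (rule has_derivative_eq_rhs[OF d]) (simp add: fun_eq_iff h algebra_simps)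
  next
    show "continuous_on UNIV (\<lambda>x. \<phi> x * f x)" by (intro continuous_intros cf smooth_continuous K(1))
  qed (use K(4) D0 in auto)
  moreover have "?\<Psi> \<in> borel_measurable lborel" using c\<Psi> by (simp add: borel_measurable_continuous_onI)
  ultimately have "(\<integral>x. ?\<Psi> x \<partial>lebesgue) = 0" by (simp only: integral_completion)
  \<comment> \<open>The integrand vanishes off the support of \<phi>, so restriction to the box
    changes nothing.\<close>
  moreover have "(\<lambda>x. indicator ?\<Omega> x *\<^sub>R ?\<Psi> x) = ?\<Psi>"
  proof
    fix x show "indicator ?\<Omega> x *\<^sub>R ?\<Psi> x = ?\<Psi> x"
    proof (cases "x \<in> ?\<Omega>")
      case False
      then have "x \<notin> K" using K(3) by blast
      then show ?thesis by (simp add: K(4) D0)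
    qed simp
  qed
  moreover have "(\<integral>x. ?\<Psi> x \<partial>lebesgue_on ?\<Omega>) = (\<integral>x. indicator ?\<Omega> x *\<^sub>R ?\<Psi> x \<partial>lebesgue)"
    by (rule integral_restrict_space) simp
  ultimately have "(\<integral>x. ?\<Psi> x \<partial>lebesgue_on ?\<Omega>) = 0" by (simp only:)
  moreover have "integrable (lebesgue_on ?\<Omega>) (\<lambda>x. \<phi> x *\<^sub>R g x)" "integrable (lebesgue_on ?\<Omega>) (\<lambda>x. D v \<phi> x *\<^sub>R f x)"
    by (intro L1_loc_integrable_test test_functions_D \<phi> L cf cont box_lebesgue)+
  ultimately show "(LINT x|lebesgue_on ?\<Omega>. D v \<phi> x *\<^sub>R f x) = - (LINT x|lebesgue_on ?\<Omega>. \<phi> x *\<^sub>R g x)"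
    by simp
qed

section \<open>Functions of one variable on the strip\<close>

lemma Basis_real2: "(Basis :: (real^2) set) = {axis 1 1, axis 2 1}"
  by (auto simp: Basis_vec_def UNIV_2)

lemma Basis_cases: "v \<in> (Basis :: (real^2) set) \<Longrightarrow> v = axis 1 1 \<or> v = axis 2 1"
  by (simp add: Basis_real2)

lemma interval_I_box: "interval_I l = box (- l / 2) (l / 2)"
  by (simp add: interval_I_def)

definition Slo :: "real \<Rightarrow> real^2" where "Slo l = vector [- l / 2, - 1 / 2]"
definition Shi :: "real \<Rightarrow> real^2" where "Shi l = vector [l / 2, 1 / 2]"

lemma S_nth [simp]: "Slo l $ 1 = - l / 2" "Slo l $ 2 = - 1 / 2" "Shi l $ 1 = l / 2" "Shi l $ 2 = 1 / 2"
  by (simp_all add: Slo_def Shi_def)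

lemma strip_S_box: "strip_S l = box (Slo l) (Shi l)"
  by (auto simp: strip_S_def mem_box_cart forall_2 interval_I_def)

abbreviation MI :: "real \<Rightarrow> real measure" where "MI l \<equiv> lebesgue_on (interval_I l)"
abbreviation MS :: "real \<Rightarrow> (real^2) measure" where "MS l \<equiv> lebesgue_on (strip_S l)"

lemma interval_I_lebesgue: "interval_I l \<in> sets lebesgue"
  by (simp add: interval_I_box)

lemma strip_S_lebesgue: "strip_S l \<in> sets lebesgue"
  by (simp add: strip_S_box)

lemma finite_MI: "finite_measure (MI l)"
  unfolding interval_I_box by (rule finite_measure_box)

lemma finite_MS: "finite_measure (MS l)"
  unfolding strip_S_box by (rule finite_measure_box)

section \<open>Projection of Lebesgue measure onto the first coordinate\<close>

definition slab :: "(real^2) set" where "slab = {x. - 1 / 2 < x $ 2 \<and> x $ 2 < 1 / 2}"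

lemma slab_borel: "slab \<in> sets borel"
proof -
  have eq: "slab = {x. - 1 / 2 < x $ 2} \<inter> {x. x $ 2 < 1 / 2}" by (auto simp: slab_def)
  show ?thesis unfolding eq by (intro sets.Int borel_open open_Collect_less continuous_intros)
qed

text \<open>The slab is unbounded in x_1 so that its projection is a measure on the whole line.
  Having unit width, it gives the projection the right value on intervals, which determines the
  measure.\<close>

lemma emeasure_slab:
  assumes A: "A \<in> sets borel"
  shows "emeasure lborel ((\<lambda>x::real^2. x $ 1) -` A \<inter> slab) = emeasure lborel A"
proof -
  let ?N = "distr (density lborel (indicator slab)) borel (\<lambda>x::real^2. x $ 1)"
  have m: "(\<lambda>x::real^2. x $ 1) \<in> borel_measurable borel" by (intro borel_measurable_continuous_onI continuous_intros)
  have N: "emeasure ?N B = emeasure lborel ((\<lambda>x::real^2. x $ 1) -` B \<inter> slab)" if "B \<in> sets borel" for B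
  proof -
    have s: "(\<lambda>x::real^2. x $ 1) -` B \<in> sets borel" using measurable_sets[OF m that] by simp
    have "emeasure ?N B = emeasure (density lborel (indicator slab)) ((\<lambda>x::real^2. x $ 1) -` B)"
      using m that by (subst emeasure_distr) auto
    also have "\<dots> = (\<integral>\<^sup>+x. indicator slab x * indicator ((\<lambda>x::real^2. x $ 1) -` B) x \<partial>lborel)"
      using s slab_borel by (subst emeasure_density) auto
    also have "\<dots> = (\<integral>\<^sup>+x. indicator ((\<lambda>x::real^2. x $ 1) -` B \<inter> slab) x \<partial>lborel)"
      by (intro nn_integral_cong) (auto simp: indicator_def)
    also have "\<dots> = emeasure lborel ((\<lambda>x::real^2. x $ 1) -` B \<inter> slab)"
      using s slab_borel by (intro nn_integral_indicator) auto
    finally show ?thesis .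
  qed
  have "lborel = ?N"
  proof (rule lborel_eqI)
    fix c d :: real assume "\<And>b. b \<in> Basis \<Longrightarrow> c \<bullet> b \<le> d \<bullet> b"
    then have cd: "c \<le> d" by simp
    have "(\<lambda>x::real^2. x $ 1) -` box c d \<inter> slab = box (vector [c, - 1 / 2]) (vector [d, 1 / 2])"
      by (auto simp: slab_def mem_box_cart forall_2)
    then have "emeasure ?N (box c d) = emeasure lborel (box (vector [c, - 1 / 2]) (vector [d, 1 / 2]) :: (real^2) set)"
      using N[of "box c d"] by simp
    also have "\<dots> = ennreal (d - c)"
      using cd by (subst emeasure_lborel_box) (auto simp: Basis_real2 inner_axis axis_eq_axis)
    finally show "emeasure ?N (box c d) = ennreal (\<Prod>b\<in>Basis. (d - c) \<bullet> b)" by simp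
  qed simp
  with N[OF A] show ?thesis by simp
qed

text \<open>A Lebesgue set is a Borel set up to a null set, and preimages of null sets are null by
  the Borel case.\<close>

lemma fst_preimage:
  assumes A: "A \<in> sets lebesgue" "A \<subseteq> interval_I l"
  shows "(\<lambda>x::real^2. x $ 1) -` A \<inter> strip_S l \<in> sets lebesgue"
    "emeasure lebesgue ((\<lambda>x::real^2. x $ 1) -` A \<inter> strip_S l) = emeasure lebesgue A"
proof -
  let ?p = "\<lambda>x::real^2. x $ 1"
  have m: "?p \<in> borel_measurable borel" by (intro borel_measurable_continuous_onI continuous_intros)
  have eq: "?p -` A \<inter> strip_S l = ?p -` A \<inter> slab"
    using A(2) by (auto simp: strip_S_def slab_def)
  obtain S N N' where *: "A = S \<union> N" "N \<subseteq> N'" "N' \<in> null_sets lborel" "S \<in> sets lborel"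
    using sets_completionE[OF A(1)] by blast
  have borel: "?p -` B \<inter> slab \<in> sets borel" if "B \<in> sets borel" for B
    using measurable_sets[OF m that] slab_borel by simp
  have N': "?p -` N' \<inter> slab \<in> null_sets lborel"
    using *(3) emeasure_slab[of N'] borel[of N'] by (auto simp: null_sets_def)
  have dec: "?p -` A \<inter> slab = (?p -` S \<inter> slab) \<union> (?p -` N \<inter> slab)" using * by auto
  have sub: "?p -` N \<inter> slab \<subseteq> ?p -` N' \<inter> slab" using * by auto
  show "?p -` A \<inter> strip_S l \<in> sets lebesgue"
    unfolding eq by (rule sets_completionI[OF dec sub N']) (use borel *(4) in auto)
  have n1: "?p -` N \<inter> slab \<in> null_sets lebesgue"
    using null_sets_completion_subset[OF sub] N' by (simp add: null_sets_completionI)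
  have n2: "N \<in> null_sets lebesgue"
    using null_sets_completion_subset[OF *(2)] *(3) by (simp add: null_sets_completionI)
  have "emeasure lebesgue (?p -` A \<inter> slab) = emeasure lebesgue (?p -` S \<inter> slab)"
    unfolding dec by (rule emeasure_Un_null_set[OF _ n1]) (use borel[of S] *(4) in auto)
  also have "\<dots> = emeasure lborel (?p -` S \<inter> slab)"
    using borel[of S] *(4) by simp
  also have "\<dots> = emeasure lborel S" using emeasure_slab *(4) by simp
  also have "\<dots> = emeasure lebesgue S" using *(4) by simp
  also have "\<dots> = emeasure lebesgue A"
    unfolding *(1) by (rule emeasure_Un_null_set[OF _ n2, symmetric]) (use *(4) in auto)
  finally show "emeasure lebesgue (?p -` A \<inter> strip_S l) = emeasure lebesgue A" by (simp add: eq)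
qed

lemma measurable_fst: "(\<lambda>x. x $ 1) \<in> measurable (MS l) (MI l)"
proof (rule measurableI)
  show "x $ 1 \<in> space (MI l)" if "x \<in> space (MS l)" for x :: "real^2" using that by (simp add: strip_S_def)
  fix A assume "A \<in> sets (MI l)"
  then have "A \<in> sets lebesgue" "A \<subseteq> interval_I l"
    using interval_I_lebesgue[of l] by (auto simp: sets_restrict_space)
  from fst_preimage(1)[OF this] show "(\<lambda>x. x $ 1) -` A \<inter> space (MS l) \<in> sets (MS l)"
    by (auto simp: sets_restrict_space image_iff)
qed

text \<open>The cross-section has length 1, so integrals over the strip of functions of x_1 carry no
  factor.\<close>

lemma distr_fst: "distr (MS l) (MI l) (\<lambda>x. x $ 1) = MI l"
proof (rule measure_eqI)
  fix A assume "A \<in> sets (distr (MS l) (MI l) (\<lambda>x. x $ 1))"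
  then have As: "A \<in> sets (MI l)" by simp
  then have A: "A \<in> sets lebesgue" "A \<subseteq> interval_I l"
    using interval_I_lebesgue[of l] by (auto simp: sets_restrict_space)
  have "emeasure (distr (MS l) (MI l) (\<lambda>x. x $ 1)) A = emeasure (MS l) ((\<lambda>x. x $ 1) -` A \<inter> strip_S l)"
    using As by (simp add: emeasure_distr[OF measurable_fst])
  also have "\<dots> = emeasure lebesgue ((\<lambda>x. x $ 1) -` A \<inter> strip_S l)"
    by (rule emeasure_restrict_space) (use strip_S_lebesgue in auto)
  also have "\<dots> = emeasure lebesgue A" by (rule fst_preimage(2)[OF A])
  also have "\<dots> = emeasure (MI l) A"
    by (rule emeasure_restrict_space[symmetric]) (use A interval_I_lebesgue in auto)
  finally show "emeasure (distr (MS l) (MI l) (\<lambda>x. x $ 1)) A = emeasure (MI l) A" .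
qed simp

lemma measurable_lift: "f \<in> measurable (MI l) N \<Longrightarrow> (\<lambda>x. f (x $ 1)) \<in> measurable (MS l) N"
  by (rule measurable_compose[OF measurable_fst])

lemma integral_lift:
  fixes f :: "real \<Rightarrow> real"
  assumes "f \<in> borel_measurable (MI l)"
  shows "(\<integral>x. f (x $ 1) \<partial>MS l) = (\<integral>t. f t \<partial>MI l)"
  using integral_distr[OF measurable_fst assms] by (simp add: distr_fst)

lemma integrable_lift:
  fixes f :: "real \<Rightarrow> real"
  assumes "integrable (MI l) f"
  shows "integrable (MS l) (\<lambda>x. f (x $ 1))"
  by (rule integrable_distr[OF measurable_fst]) (simp add: distr_fst assms)

lemma sqi_lift: "sqi (MI l) f \<Longrightarrow> sqi (MS l) (\<lambda>x. f (x $ 1))"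
  unfolding sqi_def using measurable_lift integrable_lift[of l "\<lambda>t. (f t)\<^sup>2"] by auto

lemma AE_lift:
  assumes "AE t in MI l. P t"
  shows "AE x in MS l. P (x $ 1)"
proof -
  have "AE t in distr (MS l) (MI l) (\<lambda>x. x $ 1). P t" using assms by (simp only: distr_fst)
  then show ?thesis by (rule AE_distrD[OF measurable_fst])
qed

section \<open>Primitives of square-integrable functions\<close>

definition prim :: "real \<Rightarrow> (real \<Rightarrow> real) \<Rightarrow> real \<Rightarrow> real" where
  "prim l g t = (LINT s|MI l. indicator {..t} s * g s)"

lemma indicator_MI_measurable [measurable]: "(indicator {..t} :: real \<Rightarrow> real) \<in> borel_measurable (MI l)"
  by (intro measurable_restrict_space1 measurable_completion) simp

lemma sqi_indicator: "sqi (MI l) (indicator {..t})"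
  by (rule finite_measure.sqi_bounded[OF finite_MI indicator_MI_measurable, where C = 1]) (simp add: indicator_def)

lemma prim_diff:
  assumes "sqi (MI l) g" "sqi (MI l) h"
  shows "prim l (\<lambda>s. g s - h s) t = prim l g t - prim l h t"
  using sqi_mult_integrable[OF sqi_indicator assms(1)] sqi_mult_integrable[OF sqi_indicator assms(2)]
  by (simp add: prim_def right_diff_distrib)

lemma measure_MI: "l > 0 \<Longrightarrow> (\<integral>x. c \<partial>MI l) = c * l"
  by (simp add: interval_I_box measure_restrict_space)

text \<open>Cauchy-Schwarz against an indicator. Primitives thus depend continuously on the
  integrand, from L2 to the uniform norm.\<close>

lemma prim_bound:
  assumes "sqi (MI l) g" "l > 0"
  shows "\<bar>prim l g t\<bar> \<le> sqrt l * sqrt (\<integral>s. (g s)\<^sup>2 \<partial>MI l)"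
proof -
  have "\<bar>prim l g t\<bar> \<le> sqrt (\<integral>s. (indicator {..t} s)\<^sup>2 \<partial>MI l) * sqrt (\<integral>s. (g s)\<^sup>2 \<partial>MI l)"
    unfolding prim_def by (rule Cauchy_Schwarz_integral[OF sqi_indicator assms(1)])
  also have "(\<integral>s. (indicator {..t} s)\<^sup>2 \<partial>MI l) \<le> (\<integral>s. (1::real) \<partial>MI l)"
    by (intro integral_mono sqi_square[OF sqi_indicator] finite_measure.integrable_const[OF finite_MI]) (auto simp: indicator_def)
  then have "sqrt (\<integral>s. (indicator {..t} s)\<^sup>2 \<partial>MI l) \<le> sqrt l"
    using measure_MI[OF assms(2), of 1] by (intro real_sqrt_le_mono) linarith
  then have "sqrt (\<integral>s. (indicator {..t} s)\<^sup>2 \<partial>MI l) * sqrt (\<integral>s. (g s)\<^sup>2 \<partial>MI l) \<le> sqrt l * sqrt (\<integral>s. (g s)\<^sup>2 \<partial>MI l)"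
    by (intro mult_right_mono) auto
  finally show ?thesis .
qed

lemma antiderivative_exists:
  fixes g :: "real \<Rightarrow> real"
  assumes "continuous_on UNIV g"
  shows "\<exists>G. (\<forall>t. (G has_real_derivative g t) (at t)) \<and> G c = 0"
proof -
  have "isCont g x" for x using assms by (simp add: continuous_on_eq_continuous_at)
  with einterval_antiderivative[of "-\<infinity>" "\<infinity>" g] obtain G where
    "\<And>t. (G has_vector_derivative g t) (at t)" by auto
  then have "\<And>t. ((\<lambda>t. G t - G c) has_real_derivative g t) (at t)"
    by (auto simp: has_real_derivative_iff_has_vector_derivative intro!: derivative_eq_intros)
  then show ?thesis by (intro exI[of _ "\<lambda>t. G t - G c"]) simp
qed

lemma integral_MI_interval:
  fixes g :: "real \<Rightarrow> real"
  assumes g: "continuous_on UNIV g" and G: "\<And>t. (G has_real_derivative g t) (at t)"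
    and cd: "- l / 2 \<le> c" "c \<le> d" "d \<le> l / 2"
  shows "(\<integral>s. indicator {c..d} s * g s \<partial>MI l) = G d - G c"
proof -
  have gm: "g \<in> borel_measurable borel" using g by (rule borel_measurable_continuous_onI)
  have "(\<integral>s. indicator {c..d} s * g s \<partial>MI l) = (\<integral>s. indicator (interval_I l) s *\<^sub>R (indicator {c..d} s * g s) \<partial>lebesgue)"
    by (rule integral_restrict_space) (simp add: interval_I_lebesgue)
  also have "\<dots> = (\<integral>s. indicator (interval_I l) s *\<^sub>R (indicator {c..d} s * g s) \<partial>lborel)"
    using gm by (intro integral_completion) (auto simp: interval_I_def)
  also have "\<dots> = (\<integral>s. g s * indicator {c..d} s \<partial>lborel)"
  proof (rule integral_cong_AE)
    \<comment> \<open>The closed interval may contain the endpoints of I, which the open interval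
      omits.\<close>
    have "AE s in lborel. s \<noteq> - l / 2 \<and> s \<noteq> l / 2"
      using AE_lborel_singleton[of "- l / 2"] AE_lborel_singleton[of "l / 2"] by eventually_elim simp
    then show "AE s in lborel. indicator (interval_I l) s *\<^sub>R (indicator {c..d} s * g s) = g s * indicator {c..d} s"
      by eventually_elim (use cd in \<open>auto simp: indicator_def interval_I_def\<close>)
  qed (use gm in \<open>auto simp: interval_I_def\<close>)
  also have "\<dots> = G d - G c"
    using cd(2) G g by (intro integral_FTC_Icc_real) (auto simp: continuous_on_eq_continuous_at)
  finally show ?thesis .
qed

lemma prim_continuous:
  fixes g :: "real \<Rightarrow> real"
  assumes g: "continuous_on UNIV g" and G: "\<And>t. (G has_real_derivative g t) (at t)" "G (- l / 2) = 0"
    and t: "t \<in> interval_I l"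
  shows "prim l g t = G t"
proof -
  have "prim l g t = (\<integral>s. indicator {- l / 2..t} s * g s \<partial>MI l)"
    unfolding prim_def by (intro Bochner_Integration.integral_cong) (auto simp: indicator_def interval_I_def)
  also have "\<dots> = G t" using integral_MI_interval[OF g G(1), of l "- l / 2" t] t G(2) by (simp add: interval_I_def)
  finally show ?thesis .
qed

lemma sqi_continuous_MI: "continuous_on UNIV (h :: real \<Rightarrow> real) \<Longrightarrow> sqi (MI l) h"
  unfolding interval_I_box by (rule continuous_sqi_box)

lemma sqi_continuous_MS: "continuous_on UNIV (h :: real^2 \<Rightarrow> real) \<Longrightarrow> sqi (MS l) h"
  unfolding strip_S_box by (rule continuous_sqi_box)

lemma smooth_approx_sequence:
  assumes "sqi (MI l) g"
  shows "\<exists>\<phi>. (\<forall>n. \<phi> n \<in> test_functions (interval_I l)) \<and> (\<lambda>n::nat. \<integral>x. (g x - \<phi> n x)\<^sup>2 \<partial>MI l) \<longlonglongrightarrow> 0"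
proof -
  have "test_approx (interval_I l) g" using test_functions_dense assms unfolding interval_I_box by blast
  then have "\<forall>n. \<exists>\<phi>\<in>test_functions (interval_I l). (\<integral>x. (g x - \<phi> x)\<^sup>2 \<partial>MI l) \<le> 1 / real (Suc n)"
    unfolding test_approx_def by simp
  then obtain \<phi> where \<phi>: "\<And>n. \<phi> n \<in> test_functions (interval_I l)" "\<And>n. (\<integral>x. (g x - \<phi> n x)\<^sup>2 \<partial>MI l) \<le> 1 / real (Suc n)"
    by metis
  have "(\<lambda>n. \<integral>x. (g x - \<phi> n x)\<^sup>2 \<partial>MI l) \<longlonglongrightarrow> 0"
    by (rule tendsto_sandwich[OF _ _ tendsto_const LIMSEQ_inverse_real_of_nat])
      (use \<phi>(2) in \<open>auto simp: inverse_eq_divide intro!: always_eventually\<close>)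
  with \<phi>(1) show ?thesis by blast
qed

text \<open>Test functions approximating g have classical primitives that converge uniformly to
  \<open>prim l g\<close>. Their liftings to the strip are classical too, so the derivative claims
  follow from \<open>is_weak_deriv_limit\<close>.\<close>

lemma prim_weak_deriv:
  assumes g: "sqi (MI l) g" and l: "l > 0"
  shows "sqi (MI l) (prim l g)" "is_weak_deriv (interval_I l) 1 (prim l g) g"
    "is_weak_deriv (strip_S l) (axis 1 1) (\<lambda>x. prim l g (x $ 1)) (\<lambda>x. g (x $ 1))"
    "is_weak_deriv (strip_S l) (axis 2 1) (\<lambda>x. prim l g (x $ 1)) (\<lambda>x. 0)"
proof -
  obtain \<phi> where \<phi>: "\<And>n. \<phi> n \<in> test_functions (interval_I l)" "(\<lambda>n::nat. \<integral>x. (g x - \<phi> n x)\<^sup>2 \<partial>MI l) \<longlonglongrightarrow> 0"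
    using smooth_approx_sequence[OF g] by blast
  have c\<phi>: "continuous_on UNIV (\<phi> n)" for n
    using \<phi>(1)[of n] by (rule test_functionsE) (rule smooth_continuous)
  have s\<phi>: "sqi (MI l) (\<phi> n)" for n by (rule sqi_continuous_MI[OF c\<phi>])
  have "\<exists>G. (\<forall>t. (G has_real_derivative \<phi> n t) (at t)) \<and> G (- l / 2) = 0" for n by (rule antiderivative_exists[OF c\<phi>])
  then obtain G where G: "\<And>n t. (G n has_real_derivative \<phi> n t) (at t)" "\<And>n. G n (- l / 2) = 0" by metis
  have cG: "continuous_on UNIV (G n)" for n
    by (intro continuous_at_imp_continuous_on ballI DERIV_isCont[OF G(1)])
  define r where "r n = sqrt l * sqrt (\<integral>x. (g x - \<phi> n x)\<^sup>2 \<partial>MI l)" for n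
  have rlim: "r \<longlonglongrightarrow> 0"
    using tendsto_mult[OF tendsto_const tendsto_real_sqrt[OF \<phi>(2)], of "sqrt l"] by (simp add: r_def[abs_def])
  have bound: "\<bar>prim l g t - G n t\<bar> \<le> r n" if "t \<in> interval_I l" for t n
    using prim_bound[OF sqi_diff[OF g s\<phi>[of n]] l, of t] prim_continuous[OF c\<phi> G that, of n]
    by (simp add: prim_diff[OF g s\<phi>] r_def)
  have lim: "(\<lambda>n. G n t) \<longlonglongrightarrow> prim l g t" if "t \<in> interval_I l" for t
  proof -
    have "(\<lambda>n. prim l g t - G n t) \<longlonglongrightarrow> 0"
      by (rule Lim_null_comparison[OF always_eventually[OF allI] rlim]) (use bound[OF that] in simp)
    from tendsto_diff[OF tendsto_const[of "prim l g t"] this] show ?thesis by simp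
  qed
  have Gm: "G n \<in> borel_measurable (MI l)" for n using sqi_continuous_MI[OF cG] by (simp add: sqi_def)
  have pm: "prim l g \<in> borel_measurable (MI l)"
    by (rule borel_measurable_LIMSEQ_metric[OF Gm]) (use lim in simp)
  define R where "R = sqrt l * sqrt (\<integral>s. (g s)\<^sup>2 \<partial>MI l)"
  show sp: "sqi (MI l) (prim l g)"
    by (rule finite_measure.sqi_bounded[OF finite_MI pm, where C = R]) (use prim_bound[OF g l] in \<open>simp add: R_def\<close>)
  have "\<exists>C. \<forall>n. r n \<le> C" using convergent_imp_Bseq[of r] rlim
    by (auto simp: convergent_def Bseq_def) (meson abs_le_D1)
  then obtain C where C: "\<And>n. r n \<le> C" by blast
  have sC: "sqi (MI l) (\<lambda>_. C)" by (simp add: sqi_continuous_MI)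
  have limG: "(\<lambda>n. \<integral>x. (prim l g x - G n x)\<^sup>2 \<partial>MI l) \<longlonglongrightarrow> 0"
  proof (rule L2_dominated_convergence[OF Gm pm sC])
    show "AE x in MI l. \<bar>prim l g x - G i x\<bar> \<le> C" for i
      by (intro AE_I2) (use bound C order_trans in \<open>simp, blast\<close>)
    show "AE x in MI l. (\<lambda>i. G i x) \<longlonglongrightarrow> prim l g x" by (intro AE_I2 lim) simp
  qed
  show "is_weak_deriv (interval_I l) 1 (prim l g) g"
    unfolding interval_I_box
  proof (rule is_weak_deriv_limit)
    show "is_weak_deriv (box (- l / 2) (l / 2)) 1 (G n) (\<phi> n)" for n
      by (rule classical_is_weak_deriv[OF G(1)[unfolded has_field_derivative_def]]) (simp_all add: c\<phi>)
    show "sqi (lebesgue_on (box (- l / 2) (l / 2))) (G n)" for n by (rule continuous_sqi_box[OF cG])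
    show "sqi (lebesgue_on (box (- l / 2) (l / 2))) (\<phi> n)" for n by (rule continuous_sqi_box[OF c\<phi>])
  qed (use sp g limG \<phi>(2) in \<open>simp_all only: interval_I_box\<close>)
  have liftlim: "(\<lambda>n. \<integral>x. (h (x $ 1) - H n (x $ 1))\<^sup>2 \<partial>MS l) \<longlonglongrightarrow> 0"
    if "(\<lambda>n. \<integral>t. (h t - H n t)\<^sup>2 \<partial>MI l) \<longlonglongrightarrow> 0" "h \<in> borel_measurable (MI l)" "\<And>n. H n \<in> borel_measurable (MI l)"
    for h and H :: "nat \<Rightarrow> real \<Rightarrow> real"
  proof -
    have "(\<integral>x. (h (x $ 1) - H n (x $ 1))\<^sup>2 \<partial>MS l) = (\<integral>t. (h t - H n t)\<^sup>2 \<partial>MI l)" for n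
      by (rule integral_lift[of "\<lambda>t. (h t - H n t)\<^sup>2"]) (use that in measurable)
    with that(1) show ?thesis by simp
  qed
  have d1: "((\<lambda>x::real^2. G n (x $ 1)) has_derivative (\<lambda>h. \<phi> n (x $ 1) * (h $ 1))) (at x)" for n x
    by (rule has_derivative_compose[OF _ G(1)[unfolded has_field_derivative_def], of "\<lambda>x. x $ 1"])
      (intro bounded_linear_imp_has_derivative bounded_linear_vec_nth)
  have cl: "continuous_on UNIV (\<lambda>x::real^2. h (x $ 1))" if "continuous_on UNIV h" for h :: "real \<Rightarrow> real"
    by (rule continuous_on_compose2[OF that]) (auto intro: continuous_intros)
  have s1: "sqi (MS l) (\<lambda>x. prim l g (x $ 1))" "sqi (MS l) (\<lambda>x. g (x $ 1))" using sqi_lift sp g by auto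
  have s2: "sqi (MS l) (\<lambda>x. G n (x $ 1))" "sqi (MS l) (\<lambda>x. \<phi> n (x $ 1))" for n
    by (intro sqi_continuous_MS cl cG c\<phi>)+
  note gm = sqi_measurable[OF g] and \<phi>m = sqi_measurable[OF s\<phi>]
  show "is_weak_deriv (strip_S l) (axis 1 1) (\<lambda>x. prim l g (x $ 1)) (\<lambda>x. g (x $ 1))"
    unfolding strip_S_box
  proof (rule is_weak_deriv_limit[where F = "\<lambda>n x. G n (x $ 1)" and G = "\<lambda>n x. \<phi> n (x $ 1)"])
    show "is_weak_deriv (box (Slo l) (Shi l)) (axis 1 1) (\<lambda>x. G n (x $ 1)) (\<lambda>x. \<phi> n (x $ 1))" for n
      by (rule classical_is_weak_deriv[OF d1]) (simp_all add: cl[OF c\<phi>])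
  qed (unfold strip_S_box[symmetric], (rule s1 s2 liftlim[OF limG pm Gm] liftlim[OF \<phi>(2) gm \<phi>m])+)
  show "is_weak_deriv (strip_S l) (axis 2 1) (\<lambda>x. prim l g (x $ 1)) (\<lambda>x. 0)"
    unfolding strip_S_box
  proof (rule is_weak_deriv_limit[where F = "\<lambda>n x. G n (x $ 1)" and G = "\<lambda>n x. 0"])
    show "is_weak_deriv (box (Slo l) (Shi l)) (axis 2 1) (\<lambda>x. G n (x $ 1)) (\<lambda>x. 0)" for n
      by (rule classical_is_weak_deriv[OF d1]) (simp_all add: axis_def)
    show "sqi (lebesgue_on (box (Slo l) (Shi l))) (\<lambda>x. 0)" by (simp add: continuous_sqi_box)
    show "sqi (lebesgue_on (box (Slo l) (Shi l))) (\<lambda>x. 0)" by (simp add: continuous_sqi_box)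
  qed (unfold strip_S_box[symmetric], (rule s1 s2 liftlim[OF limG pm Gm] | simp)+)
qed

section \<open>The du Bois-Reymond lemma\<close>

lemma compact_subset_interval:
  fixes K :: "real set"
  assumes "compact K" "K \<subseteq> {a<..<b}" "a < b"
  shows "\<exists>c d. a < c \<and> c \<le> d \<and> d < b \<and> K \<subseteq> {c..d}"
proof (cases "K = {}")
  case True
  then show ?thesis using assms(3) dense[OF assms(3)] by fastforce
next
  case False
  obtain c where c: "c \<in> K" "\<And>x. x \<in> K \<Longrightarrow> c \<le> x" using compact_attains_inf[OF assms(1) False] by blast
  obtain d where d: "d \<in> K" "\<And>x. x \<in> K \<Longrightarrow> x \<le> d" using compact_attains_sup[OF assms(1) False] by blast
  show ?thesis using c d assms(2) by (intro exI[of _ c] exI[of _ d]) auto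
qed

lemma constant_where_derivative_vanishes:
  fixes G :: "real \<Rightarrow> real"
  assumes "\<And>t. (G has_real_derivative g t) (at t)" "\<And>t. x < t \<Longrightarrow> t < y \<Longrightarrow> g t = 0" "x \<le> y"
  shows "G y = G x"
proof (cases "x = y")
  case False
  then have "x < y" using assms(3) by simp
  then obtain z where "x < z" "z < y" "G y - G x = (y - x) * g z"
    using MVT2[of x y G g] assms(1) by blast
  then show ?thesis using assms(2)[of z] by simp
qed simp

text \<open>The antiderivative vanishing at the left end of the support is zero to the left of it,
  and the mean-zero condition makes it return to zero at the right end.\<close>

lemma test_antiderivative:
  assumes l: "l > 0" and \<psi>: "\<psi> \<in> test_functions (interval_I l)" and zero: "(\<integral>t. \<psi> t \<partial>MI l) = 0"
  shows "\<exists>\<Phi>\<in>test_functions (interval_I l). \<forall>t. D 1 \<Phi> t = \<psi> t"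
proof -
  from \<psi> obtain K where K: "smooth \<psi>" "compact K" "K \<subseteq> interval_I l" "\<And>x. x \<notin> K \<Longrightarrow> \<psi> x = 0"
    by (rule test_functionsE) blast
  obtain c d where cd: "- l / 2 < c" "c \<le> d" "d < l / 2" "K \<subseteq> {c..d}"
    using compact_subset_interval[OF K(2), of "- l / 2" "l / 2"] K(3) l by (auto simp: interval_I_def)
  have c\<psi>: "continuous_on UNIV \<psi>" by (rule smooth_continuous[OF K(1)])
  obtain \<Phi> where \<Phi>: "\<And>t. (\<Phi> has_real_derivative \<psi> t) (at t)" "\<Phi> c = 0"
    using antiderivative_exists[OF c\<psi>] by blast
  have der: "(\<Phi> has_derivative (\<lambda>v. v * \<psi> t)) (at t)" for t
    using \<Phi>(1)[of t] by (simp add: has_field_derivative_def mult_commute_abs)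
  have Deq: "D v \<Phi> t = v * \<psi> t" for v t by (rule D_eqI[OF der])
  have "C_k k \<Phi>" for k
  proof (cases k)
    case 0
    then show ?thesis using DERIV_isCont[OF \<Phi>(1)] by (simp add: continuous_at_imp_continuous_on)
  next
    case (Suc m)
    have "C_k m (\<lambda>t. v * \<psi> t)" for v using K(1) C_k_cmult unfolding smooth_def by blast
    moreover have "\<Phi> differentiable at t" for t using der differentiable_def by blast
    ultimately show ?thesis by (simp add: Suc Deq)
  qed
  then have s: "smooth \<Phi>" by (simp add: smooth_def)
  have "(\<integral>t. indicator {c..d} t * \<psi> t \<partial>MI l) = \<Phi> d - \<Phi> c"
    by (rule integral_MI_interval[OF c\<psi> \<Phi>(1)]) (use cd in auto)
  moreover have "indicator {c..d} t * \<psi> t = \<psi> t" for t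
  proof (cases "t \<in> {c..d}")
    case False
    then have "t \<notin> K" using cd(4) by blast
    then show ?thesis using K(4) by simp
  qed simp
  ultimately have \<Phi>d: "\<Phi> d = 0" using zero \<Phi>(2) by simp
  have z: "\<psi> t = 0" if "t < c \<or> d < t" for t
  proof -
    have "t \<notin> K" using that cd(4) by auto
    then show ?thesis by (rule K(4))
  qed
  have "\<Phi> t = 0" if "t \<notin> {c..d}" for t
  proof (cases "t < c")
    case True
    have "\<Phi> c = \<Phi> t" by (rule constant_where_derivative_vanishes[OF \<Phi>(1)]) (use True z in auto)
    then show ?thesis using \<Phi>(2) by simp
  next
    case False
    then have "d < t" using that by auto
    have "\<Phi> t = \<Phi> d" by (rule constant_where_derivative_vanishes[OF \<Phi>(1)]) (use \<open>d < t\<close> z in auto)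
    then show ?thesis using \<Phi>d by simp
  qed
  then have "\<Phi> \<in> test_functions (interval_I l)"
    by (intro test_functionsI[OF s, of "{c..d}"]) (use cd in \<open>auto simp: interval_I_def\<close>)
  then show ?thesis using Deq by (intro bexI[of _ \<Phi>]) auto
qed

text \<open>Subtracting from \<phi> its integral times a test function \<omega> of mass 1 gives the
  derivative of a test function. Testing with that antiderivative shows that f and the constant c =
  \<integral> \<omega> f have the same pairing with \<phi>.\<close>

lemma du_Bois_Reymond:
  assumes l: "l > 0" and w: "is_weak_deriv (interval_I l) 1 f (\<lambda>_. 0 :: real)"
  shows "\<exists>c. AE t in MI l. f t = c"
proof -
  have f: "f \<in> L1_loc (interval_I l)" using w by (simp add: is_weak_deriv_def)
  have one: "(\<lambda>_. 1::real) \<in> L1_loc (interval_I l)"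
    unfolding interval_I_box by (intro sqi_L1_loc continuous_sqi_box) simp
  \<comment> \<open>Otherwise every test function would have integral zero, and the fundamental
    lemma would make the constant 1 vanish.\<close>
  have "\<exists>\<omega>\<in>test_functions (interval_I l). (\<integral>t. \<omega> t \<partial>MI l) \<noteq> 0"
  proof (rule ccontr)
    assume "\<not> ?thesis"
    then have "AE t in MI l. (1::real) = 0"
      unfolding interval_I_box by (intro fundamental_lemma one[unfolded interval_I_box]) (auto dest: ctest_test)
    then have "(\<integral>t. 1 \<partial>MI l) = (0::real)" by (intro integral_eq_zero_AE) auto
    then show False using measure_MI[OF l, of 1] l by simp
  qed
  then obtain \<omega>0 where \<omega>0: "\<omega>0 \<in> test_functions (interval_I l)" "(\<integral>t. \<omega>0 t \<partial>MI l) \<noteq> 0" by blast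
  define \<omega> where "\<omega> t = inverse (\<integral>t. \<omega>0 t \<partial>MI l) * \<omega>0 t" for t
  have \<omega>: "\<omega> \<in> test_functions (interval_I l)" "(\<integral>t. \<omega> t \<partial>MI l) = 1"
    using \<omega>0 by (auto simp: \<omega>_def[abs_def] intro: test_functions_cmult)
  have it: "integrable (MI l) (\<lambda>t. \<phi> t * h t)" if "\<phi> \<in> test_functions (interval_I l)" "h \<in> L1_loc (interval_I l)"
    for \<phi> and h :: "real \<Rightarrow> real"
    using L1_loc_integrable_test[OF that(2,1) interval_I_lebesgue] by simp
  have i1: "integrable (MI l) \<phi>" if "\<phi> \<in> test_functions (interval_I l)" for \<phi> using it[OF that one] by simp
  define c where "c = (\<integral>t. \<omega> t * f t \<partial>MI l)"
  have "AE t in MI l. f t + - c * 1 = 0"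
    unfolding interval_I_box
  proof (rule fundamental_lemma)
    show "(\<lambda>t. f t + - c * 1) \<in> L1_loc (box (- l / 2) (l / 2))"
      using L1_loc_add[OF f L1_loc_scaleR[OF one, of "- c"]] by (simp add: interval_I_box)
    fix \<phi> assume "\<phi> \<in> ctest (box (- l / 2) (l / 2))"
    then have \<phi>: "\<phi> \<in> test_functions (interval_I l)" unfolding interval_I_box by (rule ctest_test)
    define m where "m = (\<integral>t. \<phi> t \<partial>MI l)"
    have \<psi>: "(\<lambda>t. \<phi> t + - m * \<omega> t) \<in> test_functions (interval_I l)"
      by (intro test_functions_add test_functions_cmult \<phi> \<omega>)
    have "(\<integral>t. \<phi> t + - m * \<omega> t \<partial>MI l) = (\<integral>t. \<phi> t \<partial>MI l) + - m * (\<integral>t. \<omega> t \<partial>MI l)"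
      using i1[OF \<phi>] i1[OF \<omega>(1)] by simp
    then have "(\<integral>t. \<phi> t + - m * \<omega> t \<partial>MI l) = 0" by (simp add: \<omega>(2) m_def)
    from test_antiderivative[OF l \<psi> this] obtain \<Phi> where \<Phi>: "\<Phi> \<in> test_functions (interval_I l)"
      "\<And>t. D 1 \<Phi> t = \<phi> t + - m * \<omega> t" by blast
    have "(LINT t|MI l. D 1 \<Phi> t *\<^sub>R f t) = - (LINT t|MI l. \<Phi> t *\<^sub>R 0)"
      using w \<Phi>(1) unfolding is_weak_deriv_def by blast
    then have "(\<integral>t. \<phi> t * f t + - m * (\<omega> t * f t) \<partial>MI l) = 0"
      by (simp add: \<Phi>(2) algebra_simps)
    then have "(\<integral>t. \<phi> t * f t \<partial>MI l) + - m * c = 0"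
      using it[OF \<phi> f] it[OF \<omega>(1) f] by (simp add: c_def)
    moreover have "(\<integral>t. \<phi> t * (f t + - c * 1) \<partial>MI l) = (\<integral>t. \<phi> t * f t \<partial>MI l) + - c * m"
      using it[OF \<phi> f] i1[OF \<phi>] by (simp add: distrib_left right_diff_distrib m_def mult.commute)
    ultimately show "(\<integral>t. \<phi> t * (f t + - c * 1) \<partial>lebesgue_on (box (- l / 2) (l / 2))) = 0"
      by (simp add: interval_I_box mult.commute)
  qed
  then have "AE t in MI l. f t = c" by eventually_elim simp
  then show ?thesis by blast
qed

text \<open>After subtraction of the primitive the weak derivative is zero, so du Bois-Reymond
  applies.\<close>

lemma W12_interval_representation:
  assumes l: "l > 0" and w: "is_weak_deriv (interval_I l) 1 f g" and g: "sqi (MI l) g"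
  shows "\<exists>c. AE t in MI l. f t = prim l g t + c"
proof -
  have "is_weak_deriv (interval_I l) 1 (\<lambda>t. f t + (-1) *\<^sub>R prim l g t) (\<lambda>t. g t + (-1) *\<^sub>R g t)"
    using w prim_weak_deriv(2)[OF g l] unfolding interval_I_box by (intro is_weak_deriv_add is_weak_deriv_scaleR)
  then have "is_weak_deriv (interval_I l) 1 (\<lambda>t. f t - prim l g t) (\<lambda>_. 0)" by simp
  from du_Bois_Reymond[OF l this] obtain c where "AE t in MI l. f t - prim l g t = c" by blast
  then have "AE t in MI l. f t = prim l g t + c" by eventually_elim simp
  then show ?thesis by blast
qed

lemma is_weak_deriv_const: "is_weak_deriv (box a b) v (\<lambda>x::'a::euclidean_space. c :: real) (\<lambda>x. 0)"
  by (rule classical_is_weak_deriv[where F = "\<lambda>_ _. 0"]) auto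

text \<open>Representing f by a primitive plus a constant reduces the claim to
  \<open>prim_weak_deriv\<close>.\<close>

lemma weak_deriv_lift:
  assumes l: "l > 0" and w: "is_weak_deriv (interval_I l) 1 f g" and g: "sqi (MI l) g"
  shows "is_weak_deriv (strip_S l) (axis 1 1) (\<lambda>x. f (x $ 1)) (\<lambda>x. g (x $ 1))"
    "is_weak_deriv (strip_S l) (axis 2 1) (\<lambda>x. f (x $ 1)) (\<lambda>x. 0)"
proof -
  obtain c where c: "AE t in MI l. f t = prim l g t + c" using W12_interval_representation[OF assms] by blast
  have "AE t in MI l. prim l g t + c = f t" using c by eventually_elim simp
  then have ae: "AE x in lebesgue_on (box (Slo l) (Shi l)). prim l g (x $ 1) + c = f (x $ 1)"
    unfolding strip_S_box[symmetric] by (rule AE_lift)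
  note p = prim_weak_deriv(3,4)[OF g l, unfolded strip_S_box]
  show "is_weak_deriv (strip_S l) (axis 1 1) (\<lambda>x. f (x $ 1)) (\<lambda>x. g (x $ 1))"
    unfolding strip_S_box
    by (rule weak_deriv_cong_AE[OF is_weak_deriv_add[OF p(1) is_weak_deriv_const[where c = c]] ae]) simp
  show "is_weak_deriv (strip_S l) (axis 2 1) (\<lambda>x. f (x $ 1)) (\<lambda>x. 0)"
    unfolding strip_S_box
    by (rule weak_deriv_cong_AE[OF is_weak_deriv_add[OF p(2) is_weak_deriv_const[where c = c]] ae]) simp
qed

section \<open>Weak convergence in Sobolev spaces\<close>

text \<open>A seminorm built from finitely many L2 components covers both Sobolev spaces on the
  strip. The components come from chosen weak derivatives, so they are linear only up to null
  sets.\<close>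

locale l2_components =
  fixes V :: "('a \<Rightarrow> 'b::real_vector) set" and M :: "'a measure" and n :: nat
    and Dj :: "nat \<Rightarrow> ('a \<Rightarrow> 'b) \<Rightarrow> 'a \<Rightarrow> real" and N :: "('a \<Rightarrow> 'b) \<Rightarrow> real"
  assumes V_add: "f \<in> V \<Longrightarrow> g \<in> V \<Longrightarrow> (\<lambda>x. f x + g x) \<in> V"
    and V_scale: "f \<in> V \<Longrightarrow> (\<lambda>x. c *\<^sub>R f x) \<in> V"
    and Dj_sqi: "j < n \<Longrightarrow> f \<in> V \<Longrightarrow> sqi M (Dj j f)"
    and Dj_add: "j < n \<Longrightarrow> f \<in> V \<Longrightarrow> g \<in> V \<Longrightarrow> AE x in M. Dj j (\<lambda>x. f x + g x) x = Dj j f x + Dj j g x"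
    and Dj_scale: "j < n \<Longrightarrow> f \<in> V \<Longrightarrow> AE x in M. Dj j (\<lambda>x. c *\<^sub>R f x) x = c * Dj j f x"
    and N_eq: "f \<in> V \<Longrightarrow> N f = sqrt (\<Sum>j<n. \<integral>x. (Dj j f x)\<^sup>2 \<partial>M)"
begin

definition ip :: "('a \<Rightarrow> 'b) \<Rightarrow> ('a \<Rightarrow> 'b) \<Rightarrow> real" where
  "ip f g = (\<Sum>j<n. \<integral>x. Dj j f x * Dj j g x \<partial>M)"

lemma N_ip: "f \<in> V \<Longrightarrow> N f = sqrt (ip f f)"
  by (simp add: N_eq ip_def power2_eq_square)

lemma ip_nonneg: "ip f f \<ge> 0"
  unfolding ip_def by (intro sum_nonneg) simp

lemma Dj_measurable: "j < n \<Longrightarrow> f \<in> V \<Longrightarrow> Dj j f \<in> borel_measurable M"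
  using Dj_sqi by (simp add: sqi_def)

lemma Dj_lin:
  assumes "j < n" "f \<in> V" "g \<in> V"
  shows "AE x in M. Dj j (\<lambda>x. f x + s *\<^sub>R g x) x = Dj j f x + s * Dj j g x"
  using Dj_add[OF assms(1,2) V_scale[OF assms(3), of s]] Dj_scale[OF assms(1,3), of s]
  by eventually_elim simp

lemma integral_Dj_lin:
  assumes "j < n" "f \<in> V" "g \<in> V" "sqi M \<psi>"
  shows "(\<integral>x. Dj j (\<lambda>x. f x + s *\<^sub>R g x) x * \<psi> x \<partial>M) = (\<integral>x. Dj j f x * \<psi> x \<partial>M) + s * (\<integral>x. Dj j g x * \<psi> x \<partial>M)"
proof -
  note m = Dj_measurable[OF assms(1)] and \<psi>m = sqi_measurable[OF assms(4)]
  have "(\<integral>x. Dj j (\<lambda>x. f x + s *\<^sub>R g x) x * \<psi> x \<partial>M) = (\<integral>x. Dj j f x * \<psi> x + s * (Dj j g x * \<psi> x) \<partial>M)"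
  proof (rule integral_cong_AE)
    show "(\<lambda>x. Dj j (\<lambda>x. f x + s *\<^sub>R g x) x * \<psi> x) \<in> borel_measurable M"
      using m[OF V_add[OF assms(2) V_scale[OF assms(3)]]] \<psi>m by measurable
    show "(\<lambda>x. Dj j f x * \<psi> x + s * (Dj j g x * \<psi> x)) \<in> borel_measurable M"
      using m[OF assms(2)] m[OF assms(3)] \<psi>m by measurable
    show "AE x in M. Dj j (\<lambda>x. f x + s *\<^sub>R g x) x * \<psi> x = Dj j f x * \<psi> x + s * (Dj j g x * \<psi> x)"
      using Dj_lin[OF assms(1-3), of s] by eventually_elim (simp add: algebra_simps)
  qed
  also have "\<dots> = (\<integral>x. Dj j f x * \<psi> x \<partial>M) + s * (\<integral>x. Dj j g x * \<psi> x \<partial>M)"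
    using sqi_mult_integrable[OF Dj_sqi[OF assms(1,2)] assms(4)] sqi_mult_integrable[OF Dj_sqi[OF assms(1,3)] assms(4)]
    by simp
  finally show ?thesis .
qed

lemma ip_lin: "f \<in> V \<Longrightarrow> g \<in> V \<Longrightarrow> h \<in> V \<Longrightarrow> ip (\<lambda>x. f x + s *\<^sub>R g x) h = ip f h + s * ip g h"
  unfolding ip_def by (simp add: integral_Dj_lin Dj_sqi sum.distrib sum_distrib_left)

lemma ip_commute: "ip f g = ip g f"
  by (simp add: ip_def mult.commute)

lemma ip_quad:
  assumes "f \<in> V" "g \<in> V"
  shows "ip (\<lambda>x. f x + s *\<^sub>R g x) (\<lambda>x. f x + s *\<^sub>R g x) = ip f f + 2 * s * ip f g + s\<^sup>2 * ip g g"
proof -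
  let ?h = "\<lambda>x. f x + s *\<^sub>R g x"
  have h: "?h \<in> V" by (intro V_add V_scale assms)
  have "ip ?h ?h = ip f ?h + s * ip g ?h" by (rule ip_lin[OF assms h])
  also have "ip f ?h = ip f f + s * ip g f" unfolding ip_commute[of f ?h] by (rule ip_lin[OF assms assms(1)])
  also have "ip g ?h = ip f g + s * ip g g" unfolding ip_commute[of g ?h] by (rule ip_lin[OF assms assms(2)])
  finally show ?thesis by (simp add: ip_commute[of g f] power2_eq_square algebra_simps)
qed

text \<open>Asymptotic orthogonality and boundedness force weak convergence: otherwise sums of \<open>m\<close> almost
  orthogonal terms have norm of order \<open>\<surd>m\<close>, while a functional grows like \<open>m\<close> on them. This
  avoids completeness and the Riesz representation theorem.\<close>

theorem weakly_convergesI: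
  assumes f0: "f0 \<in> V" and f: "\<forall>\<^sub>F i in F. f i \<in> V"
    and weak: "\<And>j \<psi>. j < n \<Longrightarrow> sqi M \<psi> \<Longrightarrow> ((\<lambda>i. \<integral>x. Dj j (f i) x * \<psi> x \<partial>M) \<longlongrightarrow> (\<integral>x. Dj j f0 x * \<psi> x \<partial>M)) F"
    and bdd: "\<forall>\<^sub>F i in F. (\<Sum>j<n. \<integral>x. (Dj j (f i) x)\<^sup>2 \<partial>M) \<le> C"
  shows "weakly_converges V N f f0 F"
  unfolding weakly_converges_def
proof (intro conjI allI impI f0 f)
  fix L assume L: "bounded_linear_functional V N L"
  then have Ladd: "\<And>f g. f \<in> V \<Longrightarrow> g \<in> V \<Longrightarrow> L (\<lambda>x. f x + g x) = L f + L g"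
    and Lsc: "\<And>f c. f \<in> V \<Longrightarrow> L (\<lambda>x. c *\<^sub>R f x) = c * L f"
    unfolding bounded_linear_functional_def by blast+
  obtain K where K: "\<And>f. f \<in> V \<Longrightarrow> \<bar>L f\<bar> \<le> K * N f" using L unfolding bounded_linear_functional_def by blast
  have Llin: "L (\<lambda>x. f x + s *\<^sub>R g x) = L f + s * L g" if "f \<in> V" "g \<in> V" for f g s
    using Ladd[OF that(1) V_scale[OF that(2)]] Lsc[OF that(2)] by simp
  define r where "r i = (\<lambda>x. f i x + (-1) *\<^sub>R f0 x)" for i
  \<comment> \<open>From |a - b|^2 \<le> 2 |a|^2 + 2 |b|^2 for the inner product
    \<open>ip\<close>.\<close>
  define B where "B = 2 * \<bar>C\<bar> + 2 * ip f0 f0"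
  have B: "B \<ge> 0" using ip_nonneg[of f0] by (simp add: B_def)
  have rV: "\<forall>\<^sub>F i in F. r i \<in> V"
    using f by eventually_elim (simp only: r_def V_add V_scale f0)
  have Lr: "\<forall>\<^sub>F i in F. L (r i) = L (f i) - L f0"
    using f by eventually_elim (simp only: r_def Llin f0)
  have rB: "\<forall>\<^sub>F i in F. ip (r i) (r i) \<le> B"
    using f bdd
  proof eventually_elim
    case (elim i)
    have "0 \<le> ip (\<lambda>x. f i x + 1 *\<^sub>R f0 x) (\<lambda>x. f i x + 1 *\<^sub>R f0 x)" by (rule ip_nonneg)
    then have "- 2 * ip (f i) f0 \<le> ip (f i) (f i) + ip f0 f0" unfolding ip_quad[OF elim(1) f0] by simp
    moreover have "ip (r i) (r i) = ip (f i) (f i) - 2 * ip (f i) f0 + ip f0 f0"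
      unfolding r_def ip_quad[OF elim(1) f0] by simp
    moreover have "ip (f i) (f i) \<le> \<bar>C\<bar>" using elim(2) by (simp add: ip_def power2_eq_square)
    ultimately show ?case by (simp add: B_def)
  qed
  have orth: "((\<lambda>i. ip (r i) v) \<longlongrightarrow> 0) F" if v: "v \<in> V" for v
  proof -
    have "((\<lambda>i. \<Sum>j<n. (\<integral>x. Dj j (f i) x * Dj j v x \<partial>M) - (\<integral>x. Dj j f0 x * Dj j v x \<partial>M)) \<longlongrightarrow>
       (\<Sum>j<n. (\<integral>x. Dj j f0 x * Dj j v x \<partial>M) - (\<integral>x. Dj j f0 x * Dj j v x \<partial>M))) F"
      using v by (intro tendsto_sum tendsto_diff tendsto_const weak Dj_sqi) auto
    then have "((\<lambda>i. ip (f i) v - ip f0 v) \<longlongrightarrow> 0) F" by (simp add: ip_def sum_subtractf)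
    moreover have "\<forall>\<^sub>F i in F. ip (f i) v - ip f0 v = ip (r i) v"
      using f by eventually_elim (simp only: r_def ip_lin[OF _ f0 v])
    ultimately show ?thesis by (rule Lim_transform_eventually)
  qed
  have "((\<lambda>i. L (r i)) \<longlongrightarrow> 0) F"
  proof (rule ccontr)
    assume "\<not> ?thesis"
    then obtain \<delta> where \<delta>: "\<delta> > 0" "\<not> (\<forall>\<^sub>F i in F. \<bar>L (r i)\<bar> < \<delta>)"
      unfolding tendsto_iff by auto
    \<comment> \<open>The induction adds a term r_i that is nearly orthogonal to the sum so far: the
      functional gains at least \<delta>, the squared norm at most B + 1.\<close>
    have chain: "\<exists>v\<in>V. L v \<ge> real m * \<delta> \<and> ip v v \<le> real m * (B + 1)" for m
    proof (induction m)
      case 0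
      let ?z = "\<lambda>x. f0 x + (-1) *\<^sub>R f0 x"
      have "?z \<in> V" by (intro V_add V_scale f0)
      moreover have "L ?z = 0" using Llin[OF f0 f0, of "-1"] by simp
      moreover have "ip ?z ?z = 0" unfolding ip_quad[OF f0 f0] by simp
      ultimately show ?case
        unfolding of_nat_0 mult_zero_left by (intro bexI[of _ ?z] conjI) (simp_all only: order_refl)
    next
      case (Suc m)
      then obtain v where v: "v \<in> V" "L v \<ge> real m * \<delta>" "ip v v \<le> real m * (B + 1)" by blast
      have "\<forall>\<^sub>F i in F. \<bar>ip (r i) v\<bar> < 1 / 2"
        using orth[OF v(1)] by (auto simp: tendsto_iff dest: spec[of _ "1 / 2"])
      with rV rB have "\<forall>\<^sub>F i in F. r i \<in> V \<and> ip (r i) (r i) \<le> B \<and> \<bar>ip (r i) v\<bar> < 1 / 2"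
        by eventually_elim simp
      moreover have "\<exists>\<^sub>F i in F. \<not> \<bar>L (r i)\<bar> < \<delta>" using \<delta>(2) by (simp add: frequently_def)
      ultimately have "\<exists>\<^sub>F i in F. \<not> \<bar>L (r i)\<bar> < \<delta> \<and> (r i \<in> V \<and> ip (r i) (r i) \<le> B \<and> \<bar>ip (r i) v\<bar> < 1 / 2)"
        by (rule frequently_eventually_frequently[rotated])
      from frequently_ex[OF this] obtain i where
        "\<not> \<bar>L (r i)\<bar> < \<delta> \<and> (r i \<in> V \<and> ip (r i) (r i) \<le> B \<and> \<bar>ip (r i) v\<bar> < 1 / 2)" by (rule exE)
      then have i: "\<bar>L (r i)\<bar> \<ge> \<delta>" "r i \<in> V" "ip (r i) (r i) \<le> B" "\<bar>ip (r i) v\<bar> < 1 / 2"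
        by (simp_all only: not_less)
      \<comment> \<open>The sign makes the contributions to the functional add up.\<close>
      define s where "s = (if L (r i) \<ge> 0 then 1 else - 1 :: real)"
      have s: "s * L (r i) = \<bar>L (r i)\<bar>" "\<bar>s\<bar> = 1" "s\<^sup>2 = 1" by (auto simp: s_def)
      let ?w = "\<lambda>x. v x + s *\<^sub>R r i x"
      have "?w \<in> V" by (intro V_add V_scale v i)
      moreover have "L ?w \<ge> real (Suc m) * \<delta>"
        using Llin[OF v(1) i(2), of s] s i(1) v(2) by (simp add: algebra_simps)
      moreover have "ip ?w ?w \<le> real (Suc m) * (B + 1)"
      proof -
        have "\<bar>s * ip v (r i)\<bar> < 1 / 2" unfolding abs_mult s(2) using i(4) by (simp add: ip_commute)
        then have "2 * s * ip v (r i) < 1" by linarith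
        moreover have "ip ?w ?w = ip v v + 2 * s * ip v (r i) + ip (r i) (r i)"
          unfolding ip_quad[OF v(1) i(2)] s(3) by simp
        ultimately have "ip ?w ?w \<le> real m * (B + 1) + 1 + B" using v(3) i(3) by linarith
        then show ?thesis by (simp add: algebra_simps)
      qed
      ultimately show ?case by blast
    qed
    \<comment> \<open>Boundedness of the functional gives m^2 \<delta>^2 \<le> K^2 m (B + 1), which
      fails for this m.\<close>
    obtain m where m: "real m > K\<^sup>2 * (B + 1) / \<delta>\<^sup>2" using reals_Archimedean2 by blast
    obtain v where v: "v \<in> V" "L v \<ge> real m * \<delta>" "ip v v \<le> real m * (B + 1)" using chain[of m] by blast
    have d2: "\<delta>\<^sup>2 > 0" using \<delta>(1) by simp
    have "0 \<le> K\<^sup>2 * (B + 1) / \<delta>\<^sup>2" using B by simp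
    then have m0: "real m > 0" using m by linarith
    have "0 \<le> real m * \<delta>" using \<delta>(1) by simp
    moreover have "real m * \<delta> \<le> K * sqrt (ip v v)"
      using v(2) K[OF v(1)] unfolding N_ip[OF v(1)] by linarith
    ultimately have "(real m * \<delta>)\<^sup>2 \<le> (K * sqrt (ip v v))\<^sup>2" by (rule power_mono[rotated])
    also have "\<dots> = K\<^sup>2 * ip v v" using ip_nonneg[of v] by (simp add: power_mult_distrib)
    also have "\<dots> \<le> K\<^sup>2 * (real m * (B + 1))" using v(3) by (intro mult_left_mono) auto
    finally have "real m * (real m * \<delta>\<^sup>2) \<le> real m * (K\<^sup>2 * (B + 1))"
      by (simp add: power2_eq_square algebra_simps)
    then have "real m * \<delta>\<^sup>2 \<le> K\<^sup>2 * (B + 1)" using m0 by simp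
    then show False using m d2 by (simp add: pos_divide_less_eq)
  qed
  then have "((\<lambda>i. L (r i) + L f0) \<longlongrightarrow> 0 + L f0) F" by (intro tendsto_intros)
  moreover have "\<forall>\<^sub>F i in F. L (r i) + L f0 = L (f i)" using Lr by eventually_elim simp
  ultimately show "((\<lambda>i. L (f i)) \<longlongrightarrow> L f0) F" by (simp add: Lim_transform_eventually)
qed

text \<open>Pairing one component with \<psi> is a bounded functional, by Cauchy-Schwarz and because
  the whole norm controls each component.\<close>

theorem weakly_convergesD:
  assumes "weakly_converges V N f f0 F" "j < n" "sqi M \<psi>"
  shows "((\<lambda>i. \<integral>x. Dj j (f i) x * \<psi> x \<partial>M) \<longlongrightarrow> (\<integral>x. Dj j f0 x * \<psi> x \<partial>M)) F"
proof -
  let ?L = "\<lambda>f. \<integral>x. Dj j f x * \<psi> x \<partial>M"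
  have "bounded_linear_functional V N ?L"
    unfolding bounded_linear_functional_def
  proof (intro conjI ballI allI)
    show "?L (\<lambda>x. f x + g x) = ?L f + ?L g" if "f \<in> V" "g \<in> V" for f g
      using integral_Dj_lin[OF assms(2) that assms(3), of 1] by simp
    show "?L (\<lambda>x. c *\<^sub>R f x) = c * ?L f" if "f \<in> V" for c f
    proof -
      have "?L (\<lambda>x. f x + (c - 1) *\<^sub>R f x) = ?L f + (c - 1) * ?L f"
        by (rule integral_Dj_lin[OF assms(2) that that assms(3)])
      moreover have "(\<lambda>x. f x + (c - 1) *\<^sub>R f x) = (\<lambda>x. c *\<^sub>R f x)" by (simp add: algebra_simps)
      ultimately show ?thesis by (simp add: algebra_simps)
    qed
    have "\<bar>?L f\<bar> \<le> sqrt (\<integral>x. (\<psi> x)\<^sup>2 \<partial>M) * N f" if "f \<in> V" for f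
    proof -
      have "(\<integral>x. (Dj j f x)\<^sup>2 \<partial>M) \<le> (\<Sum>j<n. \<integral>x. (Dj j f x)\<^sup>2 \<partial>M)"
        using assms(2) by (intro member_le_sum) auto
      then have "sqrt (\<integral>x. (Dj j f x)\<^sup>2 \<partial>M) \<le> N f" unfolding N_eq[OF that] by (rule real_sqrt_le_mono)
      then have "sqrt (\<integral>x. (Dj j f x)\<^sup>2 \<partial>M) * sqrt (\<integral>x. (\<psi> x)\<^sup>2 \<partial>M) \<le> N f * sqrt (\<integral>x. (\<psi> x)\<^sup>2 \<partial>M)"
        by (intro mult_right_mono) auto
      then show ?thesis using Cauchy_Schwarz_integral[OF Dj_sqi[OF assms(2) that] assms(3)] by (simp add: mult.commute)
    qed
    then show "\<exists>C. \<forall>f\<in>V. \<bar>?L f\<bar> \<le> C * N f" by blast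
  qed
  then show ?thesis using assms(1) unfolding weakly_converges_def by blast
qed

end

section \<open>Strong convergence, bounded derivatives and weak convergence\<close>

lemma strong_imp_weak_L2:
  assumes s: "\<forall>\<^sub>F i in F. sqi M (g i)" "sqi M g0" "sqi M \<psi>"
    and lim: "((\<lambda>i. \<integral>x. (g i x - g0 x)\<^sup>2 \<partial>M) \<longlongrightarrow> 0) F"
  shows "((\<lambda>i. \<integral>x. g i x * \<psi> x \<partial>M) \<longlongrightarrow> (\<integral>x. g0 x * \<psi> x \<partial>M)) F"
proof -
  have "((\<lambda>i. sqrt (\<integral>x. (g i x - g0 x)\<^sup>2 \<partial>M) * sqrt (\<integral>x. (\<psi> x)\<^sup>2 \<partial>M)) \<longlongrightarrow> 0) F"
    using tendsto_mult[OF tendsto_real_sqrt[OF lim] tendsto_const, of "sqrt (\<integral>x. (\<psi> x)\<^sup>2 \<partial>M)"] by simp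
  moreover have "\<forall>\<^sub>F i in F. norm ((\<integral>x. g i x * \<psi> x \<partial>M) - (\<integral>x. g0 x * \<psi> x \<partial>M)) \<le>
      sqrt (\<integral>x. (g i x - g0 x)\<^sup>2 \<partial>M) * sqrt (\<integral>x. (\<psi> x)\<^sup>2 \<partial>M)"
    using s(1)
  proof eventually_elim
    case (elim i)
    have "(\<integral>x. g i x * \<psi> x \<partial>M) - (\<integral>x. g0 x * \<psi> x \<partial>M) = (\<integral>x. (g i x - g0 x) * \<psi> x \<partial>M)"
      using sqi_mult_integrable[OF elim s(3)] sqi_mult_integrable[OF s(2,3)] by (simp add: left_diff_distrib)
    then show ?case using Cauchy_Schwarz_integral[OF sqi_diff[OF elim s(2)] s(3)] by simp
  qed
  ultimately have "((\<lambda>i. (\<integral>x. g i x * \<psi> x \<partial>M) - (\<integral>x. g0 x * \<psi> x \<partial>M)) \<longlongrightarrow> 0) F"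
    by (rule Lim_null_comparison[rotated])
  then show ?thesis by (simp add: LIM_zero_iff)
qed

text \<open>Against a test function, integration by parts moves the derivative away and strong
  convergence suffices. The uniform L2 bound on the derivatives allows \<psi> to be replaced by a
  test function up to a small error.\<close>

lemma weak_deriv_weak_L2:
  fixes a b :: "'a::euclidean_space"
  defines "M \<equiv> lebesgue_on (box a b)"
  assumes w: "\<forall>\<^sub>F i in F. is_weak_deriv (box a b) v (g i) (h i) \<and> sqi M (g i) \<and> sqi M (h i) \<and> (\<integral>x. (h i x)\<^sup>2 \<partial>M) \<le> C"
    and w0: "is_weak_deriv (box a b) v g0 h0" "sqi M g0" "sqi M h0"
    and lim: "((\<lambda>i. \<integral>x. (g i x - g0 x)\<^sup>2 \<partial>M) \<longlongrightarrow> 0) F"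
    and \<psi>: "sqi M \<psi>"
  shows "((\<lambda>i. \<integral>x. h i x * \<psi> x \<partial>M) \<longlongrightarrow> (\<integral>x. h0 x * \<psi> x \<partial>M)) F"
proof (rule tendstoI)
  fix e :: real assume e: "e > 0"
  \<comment> \<open>Bounds the L2 norm of h_i - h_0; the summand 1 keeps it positive for the
    division below.\<close>
  define B where "B = sqrt (2 * \<bar>C\<bar> + 2 * (\<integral>x. (h0 x)\<^sup>2 \<partial>M)) + 1"
  have B: "B > 0" by (simp add: B_def add_nonneg_pos)
  have "(e / (2 * B))\<^sup>2 > 0" using e B by simp
  then obtain \<phi> where \<phi>: "\<phi> \<in> test_functions (box a b)" "(\<integral>x. (\<psi> x - \<phi> x)\<^sup>2 \<partial>M) \<le> (e / (2 * B))\<^sup>2"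
    using test_functions_dense[of a b \<psi>] \<psi> unfolding test_approx_def M_def by blast
  have s\<phi>: "sqi M \<phi>" unfolding M_def by (rule sqi_test[OF \<phi>(1)])
  have sD: "sqi M (D v \<phi>)" unfolding M_def by (rule sqi_test[OF test_functions_D[OF \<phi>(1)]])
  have "\<forall>\<^sub>F i in F. sqi M (g i)" using w by eventually_elim simp
  from strong_imp_weak_L2[OF this w0(2) sD lim]
  have "\<forall>\<^sub>F i in F. \<bar>(\<integral>x. g i x * D v \<phi> x \<partial>M) - (\<integral>x. g0 x * D v \<phi> x \<partial>M)\<bar> < e / 2"
    using e unfolding tendsto_iff dist_real_def by (simp del: less_divide_eq_numeral1)
  with w show "\<forall>\<^sub>F i in F. dist (\<integral>x. h i x * \<psi> x \<partial>M) (\<integral>x. h0 x * \<psi> x \<partial>M) < e"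
  proof eventually_elim
    case (elim i)
    have "is_weak_deriv (box a b) v (g i) (h i)" using elim by blast
    then have 1: "(\<integral>x. D v \<phi> x * g i x \<partial>M) = - (\<integral>x. \<phi> x * h i x \<partial>M)"
      using \<phi>(1) by (simp add: is_weak_deriv_def M_def)
    have 2: "(\<integral>x. D v \<phi> x * g0 x \<partial>M) = - (\<integral>x. \<phi> x * h0 x \<partial>M)"
      using w0(1) \<phi>(1) by (simp add: is_weak_deriv_def M_def)
    have t: "\<bar>(\<integral>x. h i x * \<phi> x \<partial>M) - (\<integral>x. h0 x * \<phi> x \<partial>M)\<bar> < e / 2"
      using elim(2) 1 2 by (simp add: mult.commute abs_minus_commute)
    have hi: "sqi M (h i)" using elim by blast
    have sd: "sqi M (\<lambda>x. h i x - h0 x)" by (rule sqi_diff[OF hi w0(3)])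
    have s\<psi>: "sqi M (\<lambda>x. \<psi> x - \<phi> x)" by (rule sqi_diff[OF \<psi> s\<phi>])
    have eq: "((\<integral>x. h i x * \<psi> x \<partial>M) - (\<integral>x. h0 x * \<psi> x \<partial>M)) - ((\<integral>x. h i x * \<phi> x \<partial>M) - (\<integral>x. h0 x * \<phi> x \<partial>M))
       = (\<integral>x. (h i x - h0 x) * (\<psi> x - \<phi> x) \<partial>M)"
    proof -
      note ii = sqi_mult_integrable[OF hi \<psi>] sqi_mult_integrable[OF w0(3) \<psi>] sqi_mult_integrable[OF hi s\<phi>] sqi_mult_integrable[OF w0(3) s\<phi>]
      have "(\<integral>x. (h i x - h0 x) * (\<psi> x - \<phi> x) \<partial>M) = (\<integral>x. (h i x * \<psi> x - h0 x * \<psi> x) - (h i x * \<phi> x - h0 x * \<phi> x) \<partial>M)"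
        by (simp add: algebra_simps)
      also have "\<dots> = ((\<integral>x. h i x * \<psi> x \<partial>M) - (\<integral>x. h0 x * \<psi> x \<partial>M)) - ((\<integral>x. h i x * \<phi> x \<partial>M) - (\<integral>x. h0 x * \<phi> x \<partial>M))"
        using ii by (simp only: Bochner_Integration.integral_diff Bochner_Integration.integrable_diff)
      finally show ?thesis by simp
    qed
    have "(\<integral>x. (h i x - h0 x)\<^sup>2 \<partial>M) \<le> 2 * (\<integral>x. (h i x)\<^sup>2 \<partial>M) + 2 * (\<integral>x. (- 1 * h0 x)\<^sup>2 \<partial>M)"
      using integral_square_add_le[OF hi sqi_cmult[OF w0(3), of "-1"]] by simp
    also have "\<dots> \<le> 2 * \<bar>C\<bar> + 2 * (\<integral>x. (h0 x)\<^sup>2 \<partial>M)" using elim by auto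
    finally have "sqrt (\<integral>x. (h i x - h0 x)\<^sup>2 \<partial>M) \<le> sqrt (2 * \<bar>C\<bar> + 2 * (\<integral>x. (h0 x)\<^sup>2 \<partial>M))" by (rule real_sqrt_le_mono)
    then have b1: "sqrt (\<integral>x. (h i x - h0 x)\<^sup>2 \<partial>M) \<le> B" unfolding B_def by linarith
    have b2: "sqrt (\<integral>x. (\<psi> x - \<phi> x)\<^sup>2 \<partial>M) \<le> e / (2 * B)"
      using real_sqrt_le_mono[OF \<phi>(2)] e B by simp
    have "\<bar>\<integral>x. (h i x - h0 x) * (\<psi> x - \<phi> x) \<partial>M\<bar> \<le> B * (e / (2 * B))"
      by (rule order_trans[OF Cauchy_Schwarz_integral[OF sd s\<psi>] mult_mono[OF b1 b2]]) (use B in auto)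
    also have "\<dots> = e / 2" using B by simp
    finally show ?case using eq t unfolding dist_real_def by linarith
  qed
qed

section \<open>Linear structure of the Sobolev spaces\<close>

lemma L2_cong_AE:
  fixes f g :: "'a::euclidean_space \<Rightarrow> 'b::euclidean_space"
  assumes f: "f \<in> L2 \<Omega>" and \<Omega>: "\<Omega> \<in> sets lebesgue" and eq: "AE x in lebesgue_on \<Omega>. f x = g x"
  shows "g \<in> L2 \<Omega>"
proof -
  have fm: "f \<in> borel_measurable (lebesgue_on \<Omega>)" using f by (simp add: L2_def)
  have "AE x in lebesgue. x \<in> \<Omega> \<longrightarrow> f x = g x" using eq \<Omega> by (simp add: AE_restrict_space_iff)
  then have "AE x in lebesgue. (if x \<in> \<Omega> then f x else 0) = (if x \<in> \<Omega> then g x else 0)"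
    by eventually_elim simp
  then have "(\<lambda>x. if x \<in> \<Omega> then g x else 0) \<in> borel_measurable lebesgue"
    by (rule borel_measurable_AE[rotated]) (use fm \<Omega> in \<open>simp add: borel_measurable_if\<close>)
  then have gm: "g \<in> borel_measurable (lebesgue_on \<Omega>)" using \<Omega> by (simp add: borel_measurable_if)
  have "integrable (lebesgue_on \<Omega>) (\<lambda>x. (norm (g x))\<^sup>2) \<longleftrightarrow> integrable (lebesgue_on \<Omega>) (\<lambda>x. (norm (f x))\<^sup>2)"
    by (rule integrable_cong_AE) (use fm gm eq in \<open>auto elim: eventually_mono\<close>)
  then show ?thesis using f gm by (simp add: L2_def)
qed

lemma L2_add:
  fixes f g :: "'a::euclidean_space \<Rightarrow> 'b::euclidean_space"
  assumes "f \<in> L2 \<Omega>" "g \<in> L2 \<Omega>"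
  shows "(\<lambda>x. f x + g x) \<in> L2 \<Omega>"
proof -
  have m: "f \<in> borel_measurable (lebesgue_on \<Omega>)" "g \<in> borel_measurable (lebesgue_on \<Omega>)"
    using assms by (auto simp: L2_def)
  have "integrable (lebesgue_on \<Omega>) (\<lambda>x. (norm (f x + g x))\<^sup>2)"
  proof (rule Bochner_Integration.integrable_bound)
    show "integrable (lebesgue_on \<Omega>) (\<lambda>x. 2 * (norm (f x))\<^sup>2 + 2 * (norm (g x))\<^sup>2)" using assms by (simp add: L2_def)
    show "(\<lambda>x. (norm (f x + g x))\<^sup>2) \<in> borel_measurable (lebesgue_on \<Omega>)" using m by measurable
    have "(norm (f x + g x))\<^sup>2 \<le> 2 * (norm (f x))\<^sup>2 + 2 * (norm (g x))\<^sup>2" for x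
    proof -
      have "(norm (f x + g x))\<^sup>2 \<le> (norm (f x) + norm (g x))\<^sup>2" by (intro power_mono norm_triangle_ineq) simp
      also have "\<dots> \<le> 2 * (norm (f x))\<^sup>2 + 2 * (norm (g x))\<^sup>2"
        using sum_squares_bound[of "norm (f x)" "norm (g x)"] by (simp add: power2_sum)
      finally show ?thesis .
    qed
    then show "AE x in lebesgue_on \<Omega>. norm ((norm (f x + g x))\<^sup>2) \<le> norm (2 * (norm (f x))\<^sup>2 + 2 * (norm (g x))\<^sup>2)"
      by (intro AE_I2) simp
  qed
  then show ?thesis using m by (simp add: L2_def)
qed

lemma L2_scaleR:
  fixes f :: "'a::euclidean_space \<Rightarrow> 'b::euclidean_space"
  shows "f \<in> L2 \<Omega> \<Longrightarrow> (\<lambda>x. c *\<^sub>R f x) \<in> L2 \<Omega>"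
  by (auto simp: L2_def power_mult_distrib)

text \<open>By uniqueness the chosen weak derivative agrees almost everywhere with a
  square-integrable one, so the existential in \<open>W12\<close> may be replaced by the
  choice.\<close>

lemma W12_iff:
  fixes f :: "'a::euclidean_space \<Rightarrow> 'b::euclidean_space"
  shows "f \<in> W12 (box a b) \<longleftrightarrow> f \<in> L2 (box a b) \<and>
    (\<forall>v\<in>Basis. is_weak_deriv (box a b) v f (weak_deriv (box a b) v f) \<and> weak_deriv (box a b) v f \<in> L2 (box a b))"
proof
  assume f: "f \<in> W12 (box a b)"
  have "is_weak_deriv (box a b) v f (weak_deriv (box a b) v f) \<and> weak_deriv (box a b) v f \<in> L2 (box a b)"
    if v: "v \<in> Basis" for v
  proof -
    obtain g where g: "g \<in> L2 (box a b)" "is_weak_deriv (box a b) v f g" using f v by (auto simp: W12_def)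
    have "AE x in lebesgue_on (box a b). g x = weak_deriv (box a b) v f x"
      by (rule is_weak_deriv_unique[OF g(2) weak_deriv_is[OF g(2)]])
    then show ?thesis using L2_cong_AE[OF g(1) box_lebesgue] weak_deriv_is[OF g(2)] by blast
  qed
  then show "f \<in> L2 (box a b) \<and>
    (\<forall>v\<in>Basis. is_weak_deriv (box a b) v f (weak_deriv (box a b) v f) \<and> weak_deriv (box a b) v f \<in> L2 (box a b))"
    using f by (auto simp: W12_def)
qed (auto simp: W12_def)

lemma W12_D:
  fixes f :: "'a::euclidean_space \<Rightarrow> 'b::euclidean_space"
  assumes "f \<in> W12 (box a b)"
  shows "f \<in> L2 (box a b)" and "v \<in> Basis \<Longrightarrow> is_weak_deriv (box a b) v f (weak_deriv (box a b) v f)"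
    and "v \<in> Basis \<Longrightarrow> weak_deriv (box a b) v f \<in> L2 (box a b)"
  using assms by (simp_all add: W12_iff)

lemma W12_I:
  fixes f :: "'a::euclidean_space \<Rightarrow> 'b::euclidean_space"
  assumes "f \<in> L2 \<Omega>" "\<And>v. v \<in> Basis \<Longrightarrow> is_weak_deriv \<Omega> v f (g v)" "\<And>v. v \<in> Basis \<Longrightarrow> g v \<in> L2 \<Omega>"
  shows "f \<in> W12 \<Omega>"
  using assms by (auto simp: W12_def)

lemma W12_cong_AE:
  fixes f f' :: "'a::euclidean_space \<Rightarrow> 'b::euclidean_space"
  assumes "f \<in> W12 (box a b)" "AE x in lebesgue_on (box a b). f x = f' x"
  shows "f' \<in> W12 (box a b)"
  by (rule W12_I[where g = "\<lambda>v. weak_deriv (box a b) v f"])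
    (auto intro: L2_cong_AE[OF W12_D(1)[OF assms(1)] box_lebesgue assms(2)] W12_D(3)[OF assms(1)]
      weak_deriv_cong_AE[OF W12_D(2)[OF assms(1)] assms(2)])

lemma weak_deriv_add_AE:
  fixes f g :: "'a::euclidean_space \<Rightarrow> 'b::euclidean_space"
  assumes "f \<in> W12 (box a b)" "g \<in> W12 (box a b)" "v \<in> Basis"
  shows "AE x in lebesgue_on (box a b). weak_deriv (box a b) v (\<lambda>x. f x + g x) x =
    weak_deriv (box a b) v f x + weak_deriv (box a b) v g x"
  by (rule weak_deriv_AE[OF is_weak_deriv_add[OF W12_D(2)[OF assms(1,3)] W12_D(2)[OF assms(2,3)]]])

lemma weak_deriv_scaleR_AE:
  fixes f :: "'a::euclidean_space \<Rightarrow> 'b::euclidean_space"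
  assumes "f \<in> W12 (box a b)" "v \<in> Basis"
  shows "AE x in lebesgue_on (box a b). weak_deriv (box a b) v (\<lambda>x. c *\<^sub>R f x) x = c *\<^sub>R weak_deriv (box a b) v f x"
  by (rule weak_deriv_AE[OF is_weak_deriv_scaleR[OF W12_D(2)[OF assms]]])

lemma W12_add:
  fixes f g :: "'a::euclidean_space \<Rightarrow> 'b::euclidean_space"
  assumes "f \<in> W12 (box a b)" "g \<in> W12 (box a b)"
  shows "(\<lambda>x. f x + g x) \<in> W12 (box a b)"
  by (rule W12_I[where g = "\<lambda>v x. weak_deriv (box a b) v f x + weak_deriv (box a b) v g x"])
    (rule L2_add is_weak_deriv_add W12_D[OF assms(1)] W12_D[OF assms(2)] | assumption)+

lemma W12_scaleR:
  fixes f :: "'a::euclidean_space \<Rightarrow> 'b::euclidean_space"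
  assumes "f \<in> W12 (box a b)"
  shows "(\<lambda>x. c *\<^sub>R f x) \<in> W12 (box a b)"
  by (rule W12_I[where g = "\<lambda>v x. c *\<^sub>R weak_deriv (box a b) v f x"])
    (rule L2_scaleR is_weak_deriv_scaleR W12_D[OF assms] | assumption)+

lemma W22_D:
  assumes "f \<in> W22 \<Omega>"
  shows "f \<in> W12 \<Omega>" "v \<in> Basis \<Longrightarrow> weak_deriv \<Omega> v f \<in> W12 \<Omega>"
  using assms by (auto simp: W22_def)

lemma W22_add:
  fixes f g :: "'a::euclidean_space \<Rightarrow> 'b::euclidean_space"
  assumes "f \<in> W22 (box a b)" "g \<in> W22 (box a b)"
  shows "(\<lambda>x. f x + g x) \<in> W22 (box a b)"
  unfolding W22_def
proof (intro CollectI conjI ballI)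
  show "(\<lambda>x. f x + g x) \<in> W12 (box a b)" by (intro W12_add W22_D assms)
  fix v :: 'a assume v: "v \<in> Basis"
  have "AE x in lebesgue_on (box a b). weak_deriv (box a b) v f x + weak_deriv (box a b) v g x =
      weak_deriv (box a b) v (\<lambda>x. f x + g x) x"
    using weak_deriv_add_AE[OF W22_D(1)[OF assms(1)] W22_D(1)[OF assms(2)] v] by eventually_elim simp
  then show "weak_deriv (box a b) v (\<lambda>x. f x + g x) \<in> W12 (box a b)"
    by (rule W12_cong_AE[rotated]) (intro W12_add W22_D assms v)
qed

lemma W22_scaleR:
  fixes f :: "'a::euclidean_space \<Rightarrow> 'b::euclidean_space"
  assumes "f \<in> W22 (box a b)"
  shows "(\<lambda>x. c *\<^sub>R f x) \<in> W22 (box a b)"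
  unfolding W22_def
proof (intro CollectI conjI ballI)
  show "(\<lambda>x. c *\<^sub>R f x) \<in> W12 (box a b)" by (intro W12_scaleR W22_D assms)
  fix v :: 'a assume v: "v \<in> Basis"
  have "AE x in lebesgue_on (box a b). c *\<^sub>R weak_deriv (box a b) v f x = weak_deriv (box a b) v (\<lambda>x. c *\<^sub>R f x) x"
    using weak_deriv_scaleR_AE[OF W22_D(1)[OF assms] v, of c] by eventually_elim simp
  then show "weak_deriv (box a b) v (\<lambda>x. c *\<^sub>R f x) \<in> W12 (box a b)"
    by (rule W12_cong_AE[rotated]) (intro W12_scaleR W22_D assms v)
qed

text \<open>The inner derivative is replaced inside \<open>weak_deriv\<close> by a sum that equals
  it almost everywhere; \<open>weak_deriv_eq_cong\<close> makes this a rewriting.\<close>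

lemma weak_deriv2_add_AE:
  fixes f g :: "'a::euclidean_space \<Rightarrow> 'b::euclidean_space"
  assumes "f \<in> W22 (box a b)" "g \<in> W22 (box a b)" "v \<in> Basis" "w \<in> Basis"
  shows "AE x in lebesgue_on (box a b). weak_deriv (box a b) w (weak_deriv (box a b) v (\<lambda>x. f x + g x)) x =
    weak_deriv (box a b) w (weak_deriv (box a b) v f) x + weak_deriv (box a b) w (weak_deriv (box a b) v g) x"
  unfolding weak_deriv_eq_cong[OF weak_deriv_add_AE[OF W22_D(1)[OF assms(1)] W22_D(1)[OF assms(2)] assms(3)]]
  by (rule weak_deriv_add_AE[OF W22_D(2)[OF assms(1,3)] W22_D(2)[OF assms(2,3)] assms(4)])

lemma weak_deriv2_scaleR_AE:
  fixes f :: "'a::euclidean_space \<Rightarrow> 'b::euclidean_space"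
  assumes "f \<in> W22 (box a b)" "v \<in> Basis" "w \<in> Basis"
  shows "AE x in lebesgue_on (box a b). weak_deriv (box a b) w (weak_deriv (box a b) v (\<lambda>x. c *\<^sub>R f x)) x =
    c *\<^sub>R weak_deriv (box a b) w (weak_deriv (box a b) v f) x"
  unfolding weak_deriv_eq_cong[OF weak_deriv_scaleR_AE[OF W22_D(1)[OF assms(1)] assms(2)]]
  by (rule weak_deriv_scaleR_AE[OF W22_D(2)[OF assms(1,2)] assms(3)])

section \<open>Components of the two Sobolev norms on the strip\<close>

lemma axis_Basis: "axis (i::2) (1::real) \<in> Basis"
  by (simp add: axis_in_Basis_iff)

lemma axis_12: "axis 1 (1::real) \<noteq> axis (2::2) 1"
  by (simp add: axis_eq_axis)

text \<open>Both mixed derivatives are listed, since the norm sums over ordered pairs of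
  directions.\<close>

definition D22 :: "real \<Rightarrow> nat \<Rightarrow> (real^2 \<Rightarrow> real) \<Rightarrow> real^2 \<Rightarrow> real" where
  "D22 l j w = [w, partial l 1 w, partial l 2 w,
     partial l 1 (partial l 1 w), partial l 2 (partial l 1 w),
     partial l 1 (partial l 2 w), partial l 2 (partial l 2 w)] ! j"

lemma less7: "j < (7::nat) \<longleftrightarrow> j = 0 \<or> j = 1 \<or> j = 2 \<or> j = 3 \<or> j = 4 \<or> j = 5 \<or> j = 6"
  by auto

lemma D22_simps [simp]:
  "D22 l 0 w = w" "D22 l (Suc 0) w = partial l 1 w" "D22 l 1 w = partial l 1 w" "D22 l 2 w = partial l 2 w"
  "D22 l 3 w = partial l 1 (partial l 1 w)" "D22 l 4 w = partial l 2 (partial l 1 w)"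
  "D22 l 5 w = partial l 1 (partial l 2 w)" "D22 l 6 w = partial l 2 (partial l 2 w)"
  by (simp_all add: D22_def eval_nat_numeral)

lemma W22_S_sqi:
  assumes "w \<in> W22 (strip_S l)"
  shows "sqi (MS l) w" "sqi (MS l) (partial l i w)" "sqi (MS l) (partial l j (partial l i w))"
    "is_weak_deriv (strip_S l) (axis i 1) w (partial l i w)"
    "is_weak_deriv (strip_S l) (axis j 1) (partial l i w) (partial l j (partial l i w))"
proof -
  note w = W22_D(1)[OF assms] W22_D(2)[OF assms axis_Basis]
  note w1 = W12_D[OF w(1)[unfolded strip_S_box]] and w2 = W12_D[OF w(2)[unfolded strip_S_box]]
  show "sqi (MS l) w" "sqi (MS l) (partial l i w)" "sqi (MS l) (partial l j (partial l i w))"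
    using w1(1) w1(3)[OF axis_Basis] w2(3)[OF axis_Basis] by (simp_all add: strip_S_box flip: L2_eq_sqi)
  show "is_weak_deriv (strip_S l) (axis i 1) w (partial l i w)"
    "is_weak_deriv (strip_S l) (axis j 1) (partial l i w) (partial l j (partial l i w))"
    using w1(2)[OF axis_Basis] w2(2)[OF axis_Basis] by (simp_all add: strip_S_box)
qed

interpretation W22S: l2_components "W22 (strip_S l)" "MS l" 7 "D22 l" "W22_norm (strip_S l)" for l
proof
  fix f g :: "real^2 \<Rightarrow> real" and c :: real and j :: nat
  show "f \<in> W22 (strip_S l) \<Longrightarrow> g \<in> W22 (strip_S l) \<Longrightarrow> (\<lambda>x. f x + g x) \<in> W22 (strip_S l)"
    unfolding strip_S_box by (rule W22_add)
  show "f \<in> W22 (strip_S l) \<Longrightarrow> (\<lambda>x. c *\<^sub>R f x) \<in> W22 (strip_S l)"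
    unfolding strip_S_box by (rule W22_scaleR)
  show "sqi (MS l) (D22 l j f)" if "j < 7" "f \<in> W22 (strip_S l)"
    using that(1) W22_S_sqi[OF that(2)] unfolding less7 by (elim disjE) simp_all
  show "AE x in MS l. D22 l j (\<lambda>x. f x + g x) x = D22 l j f x + D22 l j g x"
    if "j < 7" "f \<in> W22 (strip_S l)" "g \<in> W22 (strip_S l)"
  proof -
    note a1 = weak_deriv_add_AE[OF W22_D(1)[OF that(2)[unfolded strip_S_box]] W22_D(1)[OF that(3)[unfolded strip_S_box]] axis_Basis, folded strip_S_box]
    note a2 = weak_deriv2_add_AE[OF that(2)[unfolded strip_S_box] that(3)[unfolded strip_S_box] axis_Basis axis_Basis, folded strip_S_box]
    show ?thesis using that(1) unfolding less7
      by (elim disjE) (simp_all only: D22_simps, simp, (rule a1 a2)+)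
  qed
  show "AE x in MS l. D22 l j (\<lambda>x. c *\<^sub>R f x) x = c * D22 l j f x" if "j < 7" "f \<in> W22 (strip_S l)"
  proof -
    note a1 = weak_deriv_scaleR_AE[OF W22_D(1)[OF that(2)[unfolded strip_S_box]] axis_Basis, folded strip_S_box, unfolded real_scaleR_def]
    note a2 = weak_deriv2_scaleR_AE[OF that(2)[unfolded strip_S_box] axis_Basis axis_Basis, folded strip_S_box, unfolded real_scaleR_def]
    show ?thesis using that(1) unfolding less7 real_scaleR_def
      by (elim disjE) (simp_all only: D22_simps, simp, (rule a1 a2)+)
  qed
  show "W22_norm (strip_S l) f = sqrt (\<Sum>j<7. \<integral>x. (D22 l j f x)\<^sup>2 \<partial>MS l)"
    by (simp add: W22_norm_def Basis_real2 axis_12 eval_nat_numeral) (simp add: D22_def)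
qed

definition D12 :: "real \<Rightarrow> nat \<Rightarrow> (real^2 \<Rightarrow> real^2) \<Rightarrow> real^2 \<Rightarrow> real" where
  "D12 l j f = [\<lambda>x. f x $ 1, \<lambda>x. f x $ 2,
     \<lambda>x. weak_deriv (strip_S l) (axis 1 1) f x $ 1, \<lambda>x. weak_deriv (strip_S l) (axis 1 1) f x $ 2,
     \<lambda>x. weak_deriv (strip_S l) (axis 2 1) f x $ 1, \<lambda>x. weak_deriv (strip_S l) (axis 2 1) f x $ 2] ! j"

lemma less6: "j < (6::nat) \<longleftrightarrow> j = 0 \<or> j = 1 \<or> j = 2 \<or> j = 3 \<or> j = 4 \<or> j = 5"
  by auto

lemma D12_simps [simp]:
  "D12 l 0 f = (\<lambda>x. f x $ 1)" "D12 l 1 f = (\<lambda>x. f x $ 2)" "D12 l (Suc 0) f = (\<lambda>x. f x $ 2)"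
  "D12 l 2 f = (\<lambda>x. weak_deriv (strip_S l) (axis 1 1) f x $ 1)"
  "D12 l 3 f = (\<lambda>x. weak_deriv (strip_S l) (axis 1 1) f x $ 2)"
  "D12 l 4 f = (\<lambda>x. weak_deriv (strip_S l) (axis 2 1) f x $ 1)"
  "D12 l 5 f = (\<lambda>x. weak_deriv (strip_S l) (axis 2 1) f x $ 2)"
  by (simp_all add: D12_def eval_nat_numeral)

lemma L2_component:
  fixes f :: "'a::euclidean_space \<Rightarrow> real^2"
  assumes "f \<in> L2 \<Omega>"
  shows "sqi (lebesgue_on \<Omega>) (\<lambda>x. f x $ i)"
proof -
  have m: "f \<in> borel_measurable (lebesgue_on \<Omega>)" using assms by (simp add: L2_def)
  have m1: "(\<lambda>x. f x $ i) \<in> borel_measurable (lebesgue_on \<Omega>)"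
    using borel_measurable_inner[OF m borel_measurable_const[of "axis i 1"]] by (simp add: inner_axis)
  have "sqi (lebesgue_on \<Omega>) (\<lambda>x. norm (f x))" using assms m by (simp add: sqi_def L2_def)
  then show ?thesis
    by (rule sqi_dominated[OF _ m1]) (use component_le_norm_cart in \<open>auto intro!: AE_I2\<close>)
qed

lemma norm_square_real2: "(norm (x :: real^2))\<^sup>2 = (x $ 1)\<^sup>2 + (x $ 2)\<^sup>2"
  by (simp add: norm_vec_def L2_set_def sum_2)

lemma integral_norm_square:
  fixes f :: "'a::euclidean_space \<Rightarrow> real^2"
  assumes "f \<in> L2 \<Omega>"
  shows "(\<integral>x. (norm (f x))\<^sup>2 \<partial>lebesgue_on \<Omega>) = (\<integral>x. (f x $ 1)\<^sup>2 \<partial>lebesgue_on \<Omega>) + (\<integral>x. (f x $ 2)\<^sup>2 \<partial>lebesgue_on \<Omega>)"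
  unfolding norm_square_real2
  by (rule Bochner_Integration.integral_add) (rule sqi_square[OF L2_component[OF assms]])+

interpretation W12S: l2_components "W12 (strip_S l)" "MS l" 6 "D12 l" "W12_norm (strip_S l)" for l
proof
  fix f g :: "real^2 \<Rightarrow> real^2" and c :: real and j :: nat
  have L: "f \<in> L2 (strip_S l)" "weak_deriv (strip_S l) (axis i 1) f \<in> L2 (strip_S l)" if "f \<in> W12 (strip_S l)" for i
    using W12_D(1)[OF that[unfolded strip_S_box]] W12_D(3)[OF that[unfolded strip_S_box] axis_Basis]
    by (simp_all add: strip_S_box)
  show "f \<in> W12 (strip_S l) \<Longrightarrow> g \<in> W12 (strip_S l) \<Longrightarrow> (\<lambda>x. f x + g x) \<in> W12 (strip_S l)"
    unfolding strip_S_box by (rule W12_add)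
  show "f \<in> W12 (strip_S l) \<Longrightarrow> (\<lambda>x. c *\<^sub>R f x) \<in> W12 (strip_S l)"
    unfolding strip_S_box by (rule W12_scaleR)
  show "sqi (MS l) (D12 l j f)" if "j < 6" "f \<in> W12 (strip_S l)"
    using that(1) L2_component[OF L(1)[OF that(2)]] L2_component[OF L(2)[OF that(2)]]
    unfolding less6 by (elim disjE) simp_all
  show "AE x in MS l. D12 l j (\<lambda>x. f x + g x) x = D12 l j f x + D12 l j g x"
    if "j < 6" "f \<in> W12 (strip_S l)" "g \<in> W12 (strip_S l)"
  proof -
    have a1: "AE x in MS l. weak_deriv (strip_S l) (axis i 1) (\<lambda>x. f x + g x) x $ k =
       weak_deriv (strip_S l) (axis i 1) f x $ k + weak_deriv (strip_S l) (axis i 1) g x $ k" for i k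
      using weak_deriv_add_AE[OF that(2,3)[unfolded strip_S_box] axis_Basis[of i]] unfolding strip_S_box[symmetric]
      by eventually_elim simp
    show ?thesis using that(1) unfolding less6
      by (elim disjE) (simp_all only: D12_simps, simp, simp, (rule a1)+)
  qed
  show "AE x in MS l. D12 l j (\<lambda>x. c *\<^sub>R f x) x = c * D12 l j f x" if "j < 6" "f \<in> W12 (strip_S l)"
  proof -
    have a1: "AE x in MS l. weak_deriv (strip_S l) (axis i 1) (\<lambda>x. c *\<^sub>R f x) x $ k =
       c * weak_deriv (strip_S l) (axis i 1) f x $ k" for i k
      using weak_deriv_scaleR_AE[where c = c, OF that(2)[unfolded strip_S_box] axis_Basis[of i]] unfolding strip_S_box[symmetric]
      by eventually_elim simp
    show ?thesis using that(1) unfolding less6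
      by (elim disjE) (simp_all only: D12_simps, simp, simp, (rule a1)+)
  qed
  show "W12_norm (strip_S l) f = sqrt (\<Sum>j<6. \<integral>x. (D12 l j f x)\<^sup>2 \<partial>MS l)" if "f \<in> W12 (strip_S l)"
    using integral_norm_square[OF L(1)[OF that]] integral_norm_square[OF L(2)[OF that]]
    by (simp add: W12_norm_def Basis_real2 axis_12 eval_nat_numeral) (simp add: D12_def)
qed

lemma is_weak_deriv_vector:
  assumes "is_weak_deriv (box a b) v f1 g1" "is_weak_deriv (box a b) v f2 g2"
  shows "is_weak_deriv (box a b) v (\<lambda>x. vector [f1 x, f2 x] :: real^2) (\<lambda>x. vector [g1 x, g2 x])"
proof -
  have sc: "is_weak_deriv (box a b) v (\<lambda>x. f x *\<^sub>R c) (\<lambda>x. g x *\<^sub>R c)"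
    if w: "is_weak_deriv (box a b) v f g" for f g :: "'a \<Rightarrow> real" and c :: "real^2"
    unfolding is_weak_deriv_def
  proof (intro conjI ballI)
    show "(\<lambda>x. f x *\<^sub>R c) \<in> L1_loc (box a b)" "(\<lambda>x. g x *\<^sub>R c) \<in> L1_loc (box a b)"
      using w by (auto simp: is_weak_deriv_def L1_loc_def)
    fix \<phi> :: "'a \<Rightarrow> real" assume \<phi>: "\<phi> \<in> test_functions (box a b)"
    have i: "integrable (lebesgue_on (box a b)) (\<lambda>x. \<psi> x * h x)"
      if "\<psi> \<in> test_functions (box a b)" "h \<in> L1_loc (box a b)" for \<psi> and h :: "'a \<Rightarrow> real"
      using L1_loc_integrable_test[OF that(2,1)] by simp
    have L: "f \<in> L1_loc (box a b)" "g \<in> L1_loc (box a b)" using w by (auto simp: is_weak_deriv_def)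
    have eq: "(LINT x|lebesgue_on (box a b). D v \<phi> x * f x) = - (LINT x|lebesgue_on (box a b). \<phi> x * g x)"
      using w \<phi> by (simp add: is_weak_deriv_def)
    have "(LINT x|lebesgue_on (box a b). D v \<phi> x *\<^sub>R f x *\<^sub>R c) = (LINT x|lebesgue_on (box a b). D v \<phi> x * f x) *\<^sub>R c"
      using i[OF test_functions_D[OF \<phi>] L(1)] by simp
    moreover have "(LINT x|lebesgue_on (box a b). \<phi> x *\<^sub>R g x *\<^sub>R c) = (LINT x|lebesgue_on (box a b). \<phi> x * g x) *\<^sub>R c"
      using i[OF \<phi> L(2)] by simp
    ultimately show "(LINT x|lebesgue_on (box a b). D v \<phi> x *\<^sub>R f x *\<^sub>R c) = - (LINT x|lebesgue_on (box a b). \<phi> x *\<^sub>R g x *\<^sub>R c)"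
      using eq by simp
  qed
  have v: "vector [s, t] = s *\<^sub>R axis 1 1 + t *\<^sub>R (axis 2 1 :: real^2)" for s t
    by (simp add: vec_eq_iff forall_2 axis_def)
  show ?thesis unfolding v by (intro is_weak_deriv_add sc assms)
qed

lemma L2_vector:
  assumes "sqi (lebesgue_on \<Omega>) f1" "sqi (lebesgue_on \<Omega>) f2"
  shows "(\<lambda>x::'a::euclidean_space. vector [f1 x, f2 x] :: real^2) \<in> L2 \<Omega>"
proof -
  have v: "vector [s, t] = s *\<^sub>R axis 1 1 + t *\<^sub>R (axis 2 1 :: real^2)" for s t
    by (simp add: vec_eq_iff forall_2 axis_def)
  have "(\<lambda>x. vector [f1 x, f2 x] :: real^2) \<in> borel_measurable (lebesgue_on \<Omega>)"
    unfolding v using assms[THEN sqi_measurable] by measurable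
  then show ?thesis using assms by (simp add: L2_def norm_square_real2 sqi_def)
qed

lemma measurable_cong_AE_on:
  fixes f g :: "'a::euclidean_space \<Rightarrow> 'b::euclidean_space"
  assumes fm: "f \<in> borel_measurable (lebesgue_on \<Omega>)" and \<Omega>: "\<Omega> \<in> sets lebesgue" and eq: "AE x in lebesgue_on \<Omega>. f x = g x"
  shows "g \<in> borel_measurable (lebesgue_on \<Omega>)"
proof -
  have "AE x in lebesgue. x \<in> \<Omega> \<longrightarrow> f x = g x" using eq \<Omega> by (simp add: AE_restrict_space_iff)
  then have "AE x in lebesgue. (if x \<in> \<Omega> then f x else 0) = (if x \<in> \<Omega> then g x else 0)"
    by eventually_elim simp
  then have "(\<lambda>x. if x \<in> \<Omega> then g x else 0) \<in> borel_measurable lebesgue"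
    by (rule borel_measurable_AE[rotated]) (use fm \<Omega> in \<open>simp add: borel_measurable_if\<close>)
  then show ?thesis using \<Omega> by (simp add: borel_measurable_if)
qed

section \<open>The liminf inequality\<close>

lemma abs_fst_snd_le_norm: "\<bar>fst p\<bar> \<le> norm p" "\<bar>snd p\<bar> \<le> norm p" for p :: "real \<times> real"
  using norm_fst_le[of "fst p" "snd p"] norm_snd_le[of "snd p" "fst p"] by simp_all

context sym_form
begin

text \<open>The subgradient inequality, taken at each of the two points, bounds the difference from
  both sides. Continuity follows, and with it measurability of the limit energy density.\<close>

lemma qb_lipschitz:
  "\<exists>K>0. \<forall>m y. \<bar>qb (fst y) (snd y) - qb (fst m) (snd m)\<bar> \<le> K * (norm m + norm y) * norm (y - m)"
proof -
  obtain K p1 p2 where K: "K > 0"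
    "\<And>x y x' y'. qb x' y' \<ge> qb x y + p1 x y * (x' - x) + p2 x y * (y' - y)"
    "\<And>x y. \<bar>p1 x y\<bar> \<le> K * norm (x, y)" "\<And>x y. \<bar>p2 x y\<bar> \<le> K * norm (x, y)"
    using qb_subgradient by blast
  have one: "qb (fst y) (snd y) - qb (fst m) (snd m) \<ge> - (2 * K * norm m * norm (y - m))" for m y :: "real \<times> real"
  proof -
    have d: "\<bar>fst y - fst m\<bar> \<le> norm (y - m)" "\<bar>snd y - snd m\<bar> \<le> norm (y - m)"
      using abs_fst_snd_le_norm[of "y - m"] by simp_all
    have a: "\<bar>p1 (fst m) (snd m) * (fst y - fst m)\<bar> \<le> (K * norm m) * norm (y - m)"
      unfolding abs_mult using K(3)[of "fst m" "snd m"] K(1)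
      by (intro mult_mono d) simp_all
    have b: "\<bar>p2 (fst m) (snd m) * (snd y - snd m)\<bar> \<le> (K * norm m) * norm (y - m)"
      unfolding abs_mult using K(4)[of "fst m" "snd m"] K(1)
      by (intro mult_mono d) simp_all
    show ?thesis using K(2)[of "fst m" "snd m" "fst y" "snd y"] a b by (simp add: abs_le_iff)
  qed
  have "\<bar>qb (fst y) (snd y) - qb (fst m) (snd m)\<bar> \<le> 2 * K * (norm m + norm y) * norm (y - m)" for m y
  proof -
    have nn: "0 \<le> 2 * K * norm m * norm (y - m)" "0 \<le> 2 * K * norm y * norm (y - m)" using K(1) by auto
    have "2 * K * (norm m + norm y) * norm (y - m) = 2 * K * norm m * norm (y - m) + 2 * K * norm y * norm (y - m)"
      by (simp add: algebra_simps)
    then show ?thesis using one[of m y] one[of y m] nn unfolding norm_minus_commute[of m y] by linarith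
  qed
  then show ?thesis using K(1) by (intro exI[of _ "2 * K"]) auto
qed

lemma qb_tendsto:
  assumes "((\<lambda>i. y i) \<longlongrightarrow> m) F"
  shows "((\<lambda>i. qb (fst (y i)) (snd (y i))) \<longlongrightarrow> qb (fst m) (snd m)) F"
proof -
  obtain K where K: "K > 0" "\<And>m y. \<bar>qb (fst y) (snd y) - qb (fst m) (snd m)\<bar> \<le> K * (norm m + norm y) * norm (y - m)"
    using qb_lipschitz by blast
  have "((\<lambda>i. K * (norm m + norm (y i)) * norm (y i - m)) \<longlongrightarrow> K * (norm m + norm m) * norm (m - m)) F"
    by (intro tendsto_intros assms)
  then have z: "((\<lambda>i. K * (norm m + norm (y i)) * norm (y i - m)) \<longlongrightarrow> 0) F" by simp
  have "((\<lambda>i. qb (fst (y i)) (snd (y i)) - qb (fst m) (snd m)) \<longlongrightarrow> 0) F"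
    by (rule Lim_null_comparison[OF always_eventually[OF allI] z]) (simp only: real_norm_def K(2))
  then show ?thesis by (simp add: LIM_zero_iff)
qed

lemma qb_continuous: "continuous_on UNIV (\<lambda>p. qb (fst p) (snd p))"
  unfolding continuous_on_def by (intro ballI qb_tendsto tendsto_ident_at)

lemma qb_measurable:
  assumes "f \<in> borel_measurable M" "g \<in> borel_measurable M"
  shows "(\<lambda>x. qb (f x) (g x)) \<in> borel_measurable M"
proof -
  have "(\<lambda>x. (f x, g x)) \<in> borel_measurable M" using assms by measurable
  from measurable_compose[OF this borel_measurable_continuous_onI[OF qb_continuous]] show ?thesis by simp
qed

lemma qb_integrable:
  assumes "sqi M f" "sqi M g"
  shows "integrable M (\<lambda>x. qb (f x) (g x))"
proof -
  obtain C where C: "C > 0" "\<And>x y. 0 \<le> qb x y" "\<And>x y. qb x y \<le> C * (x\<^sup>2 + y\<^sup>2)" using qb_bounds by blast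
  show ?thesis
  proof (rule Bochner_Integration.integrable_bound)
    show "integrable M (\<lambda>x. C * ((f x)\<^sup>2 + (g x)\<^sup>2))" using assms by (simp add: sqi_def)
    show "(\<lambda>x. qb (f x) (g x)) \<in> borel_measurable M" using assms by (intro qb_measurable sqi_measurable)
    show "AE x in M. norm (qb (f x) (g x)) \<le> norm (C * ((f x)\<^sup>2 + (g x)\<^sup>2))"
      using C by (intro AE_I2) (simp add: abs_of_nonneg)
  qed
qed

text \<open>The subgradients are arbitrary selections without known measurability. Evaluated along
  simple functions approximating (\<kappa>, \<tau>) they take finitely many values, so the affine
  minorants have simple, hence square-integrable, slopes.\<close>

lemma qb_simple_approx:
  assumes fin: "finite_measure M" and s: "sqi M \<kappa>" "sqi M \<tau>" and e: "e > 0"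
  shows "\<exists>c a b. sqi M a \<and> sqi M b \<and> integrable M c \<and> (\<forall>x k t. c x + a x * k + b x * t \<le> qb k t) \<and>
    (\<integral>x. c x + a x * \<kappa> x + b x * \<tau> x \<partial>M) > (\<integral>x. qb (\<kappa> x) (\<tau> x) \<partial>M) - e"
proof -
  interpret finite_measure M by (rule fin)
  obtain K p1 p2 where K: "K > 0"
    "\<And>x y x' y'. qb x' y' \<ge> qb x y + p1 x y * (x' - x) + p2 x y * (y' - y)"
    "\<And>x y. \<bar>p1 x y\<bar> \<le> K * norm (x, y)" "\<And>x y. \<bar>p2 x y\<bar> \<le> K * norm (x, y)"
    using qb_subgradient by blast
  obtain C where C: "C > 0" "\<And>x y. 0 \<le> qb x y" "\<And>x y. qb x y \<le> C * (x\<^sup>2 + y\<^sup>2)" using qb_bounds by blast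
  define m where "m x = (\<kappa> x, \<tau> x)" for x
  note sm = s[THEN sqi_measurable]
  have mm: "m \<in> borel_measurable M" unfolding m_def using sm by measurable
  obtain \<sigma> where \<sigma>: "\<And>i. simple_function M (\<sigma> i)" "\<And>x. x \<in> space M \<Longrightarrow> (\<lambda>i. \<sigma> i x) \<longlonglongrightarrow> m x"
    "\<And>i x. x \<in> space M \<Longrightarrow> dist (\<sigma> i x) 0 \<le> 2 * dist (m x) 0"
    using borel_measurable_implies_sequence_metric[OF mm, of 0] by blast
  define q where "q i x = qb (fst (\<sigma> i x)) (snd (\<sigma> i x))" for i x
  define a where "a i x = p1 (fst (\<sigma> i x)) (snd (\<sigma> i x))" for i x
  define b where "b i x = p2 (fst (\<sigma> i x)) (snd (\<sigma> i x))" for i x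
  have simple: "simple_function M (\<lambda>x. h (fst (\<sigma> i x)) (snd (\<sigma> i x)))" for h :: "real \<Rightarrow> real \<Rightarrow> real" and i
    by (rule simple_function_compose1[OF \<sigma>(1), of "\<lambda>p. h (fst p) (snd p)"])
  have simple_sqi: "sqi M h" if h: "simple_function M h" for h :: "_ \<Rightarrow> real"
  proof (rule sqi_bounded[of _ "Max (abs ` h ` space M)"])
    show "h \<in> borel_measurable M" using h by (rule borel_measurable_simple_function)
    show "AE x in M. \<bar>h x\<bar> \<le> Max (abs ` h ` space M)"
      using simple_functionD(1)[OF h] by (intro AE_I2 Max_ge) auto
  qed
  have sq: "sqi M (q i)" "sqi M (a i)" "sqi M (b i)" "sqi M (\<lambda>x. fst (\<sigma> i x))" "sqi M (\<lambda>x. snd (\<sigma> i x))" for i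
    unfolding q_def a_def b_def
    using simple_sqi[OF simple[of qb]] simple_sqi[OF simple[of p1]] simple_sqi[OF simple[of p2]]
      simple_sqi[OF simple[of "\<lambda>x y. x"]] simple_sqi[OF simple[of "\<lambda>x y. y"]] by blast+
  define c where "c i x = q i x - a i x * fst (\<sigma> i x) - b i x * snd (\<sigma> i x)" for i x
  have ci: "integrable M (c i)" for i
    unfolding c_def using sqi_integrable[OF sq(1)] sqi_mult_integrable[OF sq(2,4)] sqi_mult_integrable[OF sq(3,5)] by simp
  have le: "c i x + a i x * k + b i x * t \<le> qb k t" for i x k t
    using K(2)[of "fst (\<sigma> i x)" "snd (\<sigma> i x)" k t] by (simp add: c_def q_def a_def b_def algebra_simps)
  \<comment> \<open>The value at the simple function contributes 4 C, by |\<sigma>| \<le> 2 |m|;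
    each of the two slope terms contributes 2 K |m| times 3 |m|.\<close>
  let ?W = "\<lambda>x. (4 * C + 12 * K) * ((\<kappa> x)\<^sup>2 + (\<tau> x)\<^sup>2)"
  have nm: "(norm (m x))\<^sup>2 = (\<kappa> x)\<^sup>2 + (\<tau> x)\<^sup>2" for x by (simp add: m_def norm_Pair)
  have "(\<lambda>i. \<integral>x. c i x + a i x * \<kappa> x + b i x * \<tau> x \<partial>M) \<longlonglongrightarrow> (\<integral>x. qb (\<kappa> x) (\<tau> x) \<partial>M)"
  proof (rule integral_dominated_convergence)
    show "integrable M ?W" using s by (simp add: sqi_def)
    show "(\<lambda>x. qb (\<kappa> x) (\<tau> x)) \<in> borel_measurable M" by (intro qb_measurable sm)
    show "(\<lambda>x. c i x + a i x * \<kappa> x + b i x * \<tau> x) \<in> borel_measurable M" for i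
      using borel_measurable_integrable[OF ci[of i]] sq(2)[of i, THEN sqi_measurable] sq(3)[of i, THEN sqi_measurable] sm by measurable
    have p: "\<bar>a i x * (\<kappa> x - fst (\<sigma> i x))\<bar> \<le> 2 * K * norm (m x) * norm (m x - \<sigma> i x)"
        "\<bar>b i x * (\<tau> x - snd (\<sigma> i x))\<bar> \<le> 2 * K * norm (m x) * norm (m x - \<sigma> i x)" if "x \<in> space M" for i x
    proof -
      have n: "norm (\<sigma> i x) \<le> 2 * norm (m x)" using \<sigma>(3)[OF that] by simp
      then have "K * norm (\<sigma> i x) \<le> 2 * K * norm (m x)" using K(1) by simp
      then have "\<bar>a i x\<bar> \<le> 2 * K * norm (m x)" "\<bar>b i x\<bar> \<le> 2 * K * norm (m x)"
        using K(3)[of "fst (\<sigma> i x)" "snd (\<sigma> i x)"] K(4)[of "fst (\<sigma> i x)" "snd (\<sigma> i x)"] by (auto simp: a_def b_def)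
      moreover have "\<bar>\<kappa> x - fst (\<sigma> i x)\<bar> \<le> norm (m x - \<sigma> i x)" "\<bar>\<tau> x - snd (\<sigma> i x)\<bar> \<le> norm (m x - \<sigma> i x)"
        using abs_fst_snd_le_norm[of "m x - \<sigma> i x"] by (simp_all add: m_def)
      ultimately show "\<bar>a i x * (\<kappa> x - fst (\<sigma> i x))\<bar> \<le> 2 * K * norm (m x) * norm (m x - \<sigma> i x)"
        "\<bar>b i x * (\<tau> x - snd (\<sigma> i x))\<bar> \<le> 2 * K * norm (m x) * norm (m x - \<sigma> i x)"
        unfolding abs_mult using K(1) by (auto intro!: mult_mono)
    qed
    have split: "c i x + a i x * \<kappa> x + b i x * \<tau> x = q i x + a i x * (\<kappa> x - fst (\<sigma> i x)) + b i x * (\<tau> x - snd (\<sigma> i x))" for i x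
      by (simp add: c_def algebra_simps)
    show "AE x in M. (\<lambda>i. c i x + a i x * \<kappa> x + b i x * \<tau> x) \<longlonglongrightarrow> qb (\<kappa> x) (\<tau> x)"
    proof (rule AE_I2)
      fix x assume x: "x \<in> space M"
      have "(\<lambda>i. 2 * K * norm (m x) * norm (m x - \<sigma> i x)) \<longlonglongrightarrow> 2 * K * norm (m x) * norm (m x - m x)"
        by (intro tendsto_intros \<sigma>(2) x)
      then have z: "(\<lambda>i. 2 * K * norm (m x) * norm (m x - \<sigma> i x)) \<longlonglongrightarrow> 0" by simp
      have "(\<lambda>i. a i x * (\<kappa> x - fst (\<sigma> i x))) \<longlonglongrightarrow> 0" "(\<lambda>i. b i x * (\<tau> x - snd (\<sigma> i x))) \<longlonglongrightarrow> 0"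
        by (rule Lim_null_comparison[OF always_eventually[OF allI] z], use p[OF x] in simp)+
      moreover have "(\<lambda>i. q i x) \<longlonglongrightarrow> qb (\<kappa> x) (\<tau> x)"
        using qb_tendsto[OF \<sigma>(2)[OF x]] by (simp add: q_def m_def)
      ultimately have "(\<lambda>i. q i x + a i x * (\<kappa> x - fst (\<sigma> i x)) + b i x * (\<tau> x - snd (\<sigma> i x))) \<longlonglongrightarrow> qb (\<kappa> x) (\<tau> x) + 0 + 0"
        by (intro tendsto_add)
      then show "(\<lambda>i. c i x + a i x * \<kappa> x + b i x * \<tau> x) \<longlonglongrightarrow> qb (\<kappa> x) (\<tau> x)" by (simp add: split)
    qed
    show "AE x in M. norm (c i x + a i x * \<kappa> x + b i x * \<tau> x) \<le> ?W x" for i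
    proof (rule AE_I2)
      fix x assume x: "x \<in> space M"
      have n: "norm (\<sigma> i x) \<le> 2 * norm (m x)" using \<sigma>(3)[OF x] by simp
      have "norm (m x - \<sigma> i x) \<le> 3 * norm (m x)" using norm_triangle_ineq4[of "m x" "\<sigma> i x"] n by linarith
      then have "2 * K * norm (m x) * norm (m x - \<sigma> i x) \<le> 2 * K * norm (m x) * (3 * norm (m x))"
        using K(1) by (intro mult_left_mono) auto
      then have "2 * K * norm (m x) * norm (m x - \<sigma> i x) \<le> 6 * K * (norm (m x))\<^sup>2" by (simp add: power2_eq_square)
      then have ab: "\<bar>a i x * (\<kappa> x - fst (\<sigma> i x))\<bar> \<le> 6 * K * (norm (m x))\<^sup>2"
        "\<bar>b i x * (\<tau> x - snd (\<sigma> i x))\<bar> \<le> 6 * K * (norm (m x))\<^sup>2" using p[OF x, of i] by linarith+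
      have "(fst (\<sigma> i x))\<^sup>2 + (snd (\<sigma> i x))\<^sup>2 = (norm (\<sigma> i x))\<^sup>2" by (cases "\<sigma> i x") (simp add: norm_Pair)
      also have "\<dots> \<le> (2 * norm (m x))\<^sup>2" using n by (intro power_mono) auto
      finally have "(fst (\<sigma> i x))\<^sup>2 + (snd (\<sigma> i x))\<^sup>2 \<le> 4 * (norm (m x))\<^sup>2" by simp
      then have "C * ((fst (\<sigma> i x))\<^sup>2 + (snd (\<sigma> i x))\<^sup>2) \<le> C * (4 * (norm (m x))\<^sup>2)" using C(1) by (intro mult_left_mono) auto
      then have "\<bar>q i x\<bar> \<le> 4 * C * (norm (m x))\<^sup>2"
        using C(2,3)[of "fst (\<sigma> i x)" "snd (\<sigma> i x)"] by (simp add: q_def)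
      then have "\<bar>c i x + a i x * \<kappa> x + b i x * \<tau> x\<bar> \<le> 4 * C * (norm (m x))\<^sup>2 + 6 * K * (norm (m x))\<^sup>2 + 6 * K * (norm (m x))\<^sup>2"
        unfolding split using ab by linarith
      then show "norm (c i x + a i x * \<kappa> x + b i x * \<tau> x) \<le> ?W x" unfolding nm[symmetric] by (simp add: algebra_simps)
    qed
  qed
  then have "\<forall>\<^sub>F i in sequentially. (\<integral>x. c i x + a i x * \<kappa> x + b i x * \<tau> x \<partial>M) > (\<integral>x. qb (\<kappa> x) (\<tau> x) \<partial>M) - e"
    using e by (intro order_tendstoD) auto
  then obtain i where "(\<integral>x. c i x + a i x * \<kappa> x + b i x * \<tau> x \<partial>M) > (\<integral>x. qb (\<kappa> x) (\<tau> x) \<partial>M) - e"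
    by (auto dest: eventually_happens)
  then show ?thesis by (intro exI[of _ "c i"] exI[of _ "a i"] exI[of _ "b i"] conjI allI sq ci le)
qed

text \<open>The integral of an affine minorant with square-integrable slopes is continuous under
  weak convergence, and its limit falls short of the limit energy by less than e.\<close>

lemma qb_weak_lsc:
  assumes fin: "finite_measure M" and s: "sqi M \<kappa>" "sqi M \<tau>" and e: "e > 0"
    and kt: "\<forall>\<^sub>F i in F. sqi M (k i) \<and> sqi M (t i)"
    and weak: "\<And>\<psi>. sqi M \<psi> \<Longrightarrow> ((\<lambda>i. \<integral>x. k i x * \<psi> x \<partial>M) \<longlongrightarrow> (\<integral>x. \<kappa> x * \<psi> x \<partial>M)) F"
      "\<And>\<psi>. sqi M \<psi> \<Longrightarrow> ((\<lambda>i. \<integral>x. t i x * \<psi> x \<partial>M) \<longlongrightarrow> (\<integral>x. \<tau> x * \<psi> x \<partial>M)) F"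
  shows "\<forall>\<^sub>F i in F. (\<integral>x. qb (k i x) (t i x) \<partial>M) > (\<integral>x. qb (\<kappa> x) (\<tau> x) \<partial>M) - e"
proof -
  obtain c a b where *: "sqi M a" "sqi M b" "integrable M c" "\<And>x k t. c x + a x * k + b x * t \<le> qb k t"
    "(\<integral>x. c x + a x * \<kappa> x + b x * \<tau> x \<partial>M) > (\<integral>x. qb (\<kappa> x) (\<tau> x) \<partial>M) - e"
    using qb_simple_approx[OF fin s e] by blast
  have split: "(\<integral>x. c x + a x * f x + b x * g x \<partial>M) = (\<integral>x. c x \<partial>M) + (\<integral>x. f x * a x \<partial>M) + (\<integral>x. g x * b x \<partial>M)"
    if "sqi M f" "sqi M g" for f g
    using *(3) sqi_mult_integrable[OF *(1) that(1)] sqi_mult_integrable[OF *(2) that(2)] by (simp add: mult.commute)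
  have "((\<lambda>i. (\<integral>x. c x \<partial>M) + (\<integral>x. k i x * a x \<partial>M) + (\<integral>x. t i x * b x \<partial>M)) \<longlongrightarrow>
      (\<integral>x. c x \<partial>M) + (\<integral>x. \<kappa> x * a x \<partial>M) + (\<integral>x. \<tau> x * b x \<partial>M)) F"
    by (intro tendsto_add tendsto_const weak *)
  then have "\<forall>\<^sub>F i in F. (\<integral>x. c x \<partial>M) + (\<integral>x. k i x * a x \<partial>M) + (\<integral>x. t i x * b x \<partial>M) > (\<integral>x. qb (\<kappa> x) (\<tau> x) \<partial>M) - e"
    using *(5) unfolding split[OF s] by (rule order_tendstoD)
  with kt show ?thesis
  proof eventually_elim
    case (elim i)
    have ki: "sqi M (k i)" "sqi M (t i)" using elim(1) by auto
    have "(\<integral>x. c x + a x * k i x + b x * t i x \<partial>M) \<le> (\<integral>x. qb (k i x) (t i x) \<partial>M)"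
      using *(3) sqi_mult_integrable[OF *(1) ki(1)] sqi_mult_integrable[OF *(2) ki(2)] *(4)
      by (intro Bochner_Integration.integral_mono qb_integrable ki) auto
    then show ?case using elim(2) unfolding split[OF ki] by linarith
  qed
qed

text \<open>Mixed weak derivatives commute, so the Hessian is symmetric almost everywhere and Q may
  be evaluated through \<open>S\<close>. Measurability also comes from \<open>S\<close>, because Q
  is arbitrary off symmetric matrices.\<close>

lemma J_eps_eq:
  fixes l \<epsilon> :: real and w :: "real^2 \<Rightarrow> real"
  assumes Q: "\<And>u. Q (sm u) = S u u" and w: "w \<in> W22 (strip_S l)"
  defines "u \<equiv> \<lambda>x. (partial l 1 (partial l 1 w) x, 1 / \<epsilon> * partial l 1 (partial l 2 w) x, 1 / \<epsilon>\<^sup>2 * partial l 2 (partial l 2 w) x)"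
  shows "AE x in MS l. scaled_hessian l \<epsilon> w x = sm (u x)"
    and "integrable (MS l) (\<lambda>x. S (u x) (u x))"
    and "J_eps Q l \<epsilon> w = 1 / 24 * (\<integral>x. S (u x) (u x) \<partial>MS l)"
proof -
  note d = W22_S_sqi(4,5)[OF w]
  have "AE x in lebesgue_on (box (Slo l) (Shi l)). partial l 2 (partial l 1 w) x = partial l 1 (partial l 2 w) x"
    using d[unfolded strip_S_box] unfolding strip_S_box by (intro weak_deriv_commute)
  then show ae: "AE x in MS l. scaled_hessian l \<epsilon> w x = sm (u x)"
    unfolding strip_S_box[symmetric]
    by eventually_elim (simp add: scaled_hessian_def u_def sm_def)
  note s = W22_S_sqi(3)[OF w]
  have us: "sqi (MS l) (\<lambda>x. fst (u x))" "sqi (MS l) (\<lambda>x. fst (snd (u x)))" "sqi (MS l) (\<lambda>x. snd (snd (u x)))"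
    unfolding u_def fst_conv snd_conv by (rule s sqi_cmult[OF s])+
  note um = us[THEN sqi_measurable]
  have "(\<lambda>x. (fst (u x), fst (snd (u x)), snd (snd (u x)))) \<in> borel_measurable (MS l)" using um by measurable
  then have umeas: "u \<in> borel_measurable (MS l)" by simp
  have cS: "continuous_on UNIV (\<lambda>v. S v v)" by (intro continuous_intros)
  have Sm: "(\<lambda>x. S (u x) (u x)) \<in> borel_measurable (MS l)"
    by (rule measurable_compose[OF umeas borel_measurable_continuous_onI[OF cS]])
  obtain C where C: "C > 0" "\<And>v. S v v \<le> C * (norm v)\<^sup>2" using qb_bounds by blast
  show "integrable (MS l) (\<lambda>x. S (u x) (u x))"
  proof (rule Bochner_Integration.integrable_bound[OF _ Sm])
    show "integrable (MS l) (\<lambda>x. C * ((fst (u x))\<^sup>2 + (fst (snd (u x)))\<^sup>2 + (snd (snd (u x)))\<^sup>2))"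
      using us by (simp add: sqi_def)
    have "S v v \<le> C * ((fst v)\<^sup>2 + (fst (snd v))\<^sup>2 + (snd (snd v))\<^sup>2)" for v
      using C(2)[of v] norm_vec3[of "fst v" "fst (snd v)" "snd (snd v)"] by simp
    then show "AE x in MS l. norm (S (u x) (u x)) \<le> norm (C * ((fst (u x))\<^sup>2 + (fst (snd (u x)))\<^sup>2 + (snd (snd (u x)))\<^sup>2))"
      using C(1) nonneg by (intro AE_I2) (simp add: abs_of_nonneg)
  qed
  have ae2: "AE x in MS l. S (u x) (u x) = Q (scaled_hessian l \<epsilon> w x)" using ae by eventually_elim (simp add: Q)
  have "(\<integral>x. Q (scaled_hessian l \<epsilon> w x) \<partial>MS l) = (\<integral>x. S (u x) (u x) \<partial>MS l)"
    by (rule integral_cong_AE[OF measurable_cong_AE_on[OF Sm strip_S_lebesgue ae2] Sm]) (use ae2 in \<open>auto elim: eventually_mono\<close>)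
  then show "J_eps Q l \<epsilon> w = 1 / 24 * (\<integral>x. S (u x) (u x) \<partial>MS l)" by (simp add: J_eps_def)
qed

lemma J_eps_ge:
  assumes Q: "\<And>u. Q (sm u) = S u u" and w: "w \<in> W22_det l \<epsilon>"
  shows "J_eps Q l \<epsilon> w \<ge> 1 / 24 * (\<integral>x. qb (partial l 1 (partial l 1 w) x) (1 / \<epsilon> * partial l 1 (partial l 2 w) x) \<partial>MS l)"
proof -
  have W: "w \<in> W22 (strip_S l)" using w by (simp add: W22_det_def W22_mean0_def)
  note J = J_eps_eq[where l = l and \<epsilon> = \<epsilon>, OF Q W]
  let ?k = "partial l 1 (partial l 1 w)" and ?t = "\<lambda>x. 1 / \<epsilon> * partial l 1 (partial l 2 w) x"
  let ?u = "\<lambda>x. (?k x, ?t x, 1 / \<epsilon>\<^sup>2 * partial l 2 (partial l 2 w) x)"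
  have "AE x in MS l. det (scaled_hessian l \<epsilon> w x) = 0" using w by (simp add: W22_det_def)
  with J(1) have "AE x in MS l. qb (?k x) (?t x) \<le> S (?u x) (?u x)"
  proof eventually_elim
    case (elim x)
    then have "dtb (?u x) (?u x) = 0" by (simp only: det_sm)
    then have "ff (?u x) = S (?u x) (?u x)" unfolding ff_def by simp
    then show ?case using qb_le by metis
  qed
  moreover have "integrable (MS l) (\<lambda>x. qb (?k x) (?t x))"
    by (intro qb_integrable sqi_cmult W22_S_sqi(3)[OF W])
  ultimately have "(\<integral>x. qb (?k x) (?t x) \<partial>MS l) \<le> (\<integral>x. S (?u x) (?u x) \<partial>MS l)"
    using J(2) by (intro integral_mono_AE)
  then show ?thesis unfolding J(3) by simp
qed

end

section \<open>Scaled gradients and the limit pair\<close>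

lemma W22_I_facts:
  assumes "w \<in> W22 (interval_I l)"
  shows "sqi (MI l) w" "sqi (MI l) (deriv_I l w)" "sqi (MI l) (deriv_I l (deriv_I l w))"
    "is_weak_deriv (interval_I l) 1 w (deriv_I l w)"
    "is_weak_deriv (interval_I l) 1 (deriv_I l w) (deriv_I l (deriv_I l w))"
proof -
  have B: "(1::real) \<in> Basis" by simp
  note w = W22_D(1)[OF assms] W22_D(2)[OF assms B]
  note w1 = W12_D[OF w(1)[unfolded interval_I_box]] and w2 = W12_D[OF w(2)[unfolded interval_I_box]]
  show "sqi (MI l) w" "sqi (MI l) (deriv_I l w)" "sqi (MI l) (deriv_I l (deriv_I l w))"
    using w1(1) w1(3)[OF B] w2(3)[OF B] by (simp_all add: interval_I_box flip: L2_eq_sqi)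
  show "is_weak_deriv (interval_I l) 1 w (deriv_I l w)"
    "is_weak_deriv (interval_I l) 1 (deriv_I l w) (deriv_I l (deriv_I l w))"
    using w1(2)[OF B] w2(2)[OF B] by (simp_all add: interval_I_box)
qed

lemma W12_I_facts:
  assumes "w \<in> W12 (interval_I l)"
  shows "sqi (MI l) w" "sqi (MI l) (deriv_I l w)" "is_weak_deriv (interval_I l) 1 w (deriv_I l w)"
proof -
  have B: "(1::real) \<in> Basis" by simp
  note w1 = W12_D[OF assms[unfolded interval_I_box]]
  show "sqi (MI l) w" "sqi (MI l) (deriv_I l w)" using w1(1) w1(3)[OF B] by (simp_all add: interval_I_box flip: L2_eq_sqi)
  show "is_weak_deriv (interval_I l) 1 w (deriv_I l w)" using w1(2)[OF B] by (simp add: interval_I_box)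
qed

lemma scaled_grad_deriv:
  assumes w: "w \<in> W22 (strip_S l)"
  shows "AE x in MS l. weak_deriv (strip_S l) (axis i 1) (scaled_grad l \<epsilon> w) x =
      vector [partial l i (partial l 1 w) x, 1 / \<epsilon> * partial l i (partial l 2 w) x]"
    and "is_weak_deriv (strip_S l) (axis i 1) (scaled_grad l \<epsilon> w)
      (\<lambda>x. vector [partial l i (partial l 1 w) x, 1 / \<epsilon> * partial l i (partial l 2 w) x])"
proof -
  note d = W22_S_sqi(5)[OF w]
  have "is_weak_deriv (strip_S l) (axis i 1) (\<lambda>x. 1 / \<epsilon> * partial l 2 w x) (\<lambda>x. 1 / \<epsilon> * partial l i (partial l 2 w) x)"
    using is_weak_deriv_scaleR[OF d[of i 2, unfolded strip_S_box], of "1 / \<epsilon>"] by (simp only: strip_S_box real_scaleR_def)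
  from is_weak_deriv_vector[OF d[of i 1, unfolded strip_S_box] this[unfolded strip_S_box]]
  show r: "is_weak_deriv (strip_S l) (axis i 1) (scaled_grad l \<epsilon> w)
      (\<lambda>x. vector [partial l i (partial l 1 w) x, 1 / \<epsilon> * partial l i (partial l 2 w) x])"
    unfolding scaled_grad_def[abs_def] strip_S_box .
  show "AE x in MS l. weak_deriv (strip_S l) (axis i 1) (scaled_grad l \<epsilon> w) x =
      vector [partial l i (partial l 1 w) x, 1 / \<epsilon> * partial l i (partial l 2 w) x]"
    using weak_deriv_AE[OF r[unfolded strip_S_box]] by (simp only: strip_S_box)
qed

lemma limit_grad_deriv:
  assumes l: "l > 0" and w: "w \<in> W22 (interval_I l)" and \<theta>: "\<theta> \<in> W12 (interval_I l)"
  shows "is_weak_deriv (strip_S l) (axis 1 1) (\<lambda>x. vector [deriv_I l w (x $ 1), \<theta> (x $ 1)] :: real^2)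
      (\<lambda>x. vector [deriv_I l (deriv_I l w) (x $ 1), deriv_I l \<theta> (x $ 1)])"
    "is_weak_deriv (strip_S l) (axis 2 1) (\<lambda>x. vector [deriv_I l w (x $ 1), \<theta> (x $ 1)] :: real^2) (\<lambda>x. vector [0, 0])"
proof -
  note wf = W22_I_facts[OF w] and tf = W12_I_facts[OF \<theta>]
  show "is_weak_deriv (strip_S l) (axis 1 1) (\<lambda>x. vector [deriv_I l w (x $ 1), \<theta> (x $ 1)] :: real^2)
      (\<lambda>x. vector [deriv_I l (deriv_I l w) (x $ 1), deriv_I l \<theta> (x $ 1)])"
    using is_weak_deriv_vector[OF weak_deriv_lift(1)[OF l wf(5,3), unfolded strip_S_box] weak_deriv_lift(1)[OF l tf(3,2), unfolded strip_S_box]]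
    unfolding strip_S_box .
  show "is_weak_deriv (strip_S l) (axis 2 1) (\<lambda>x. vector [deriv_I l w (x $ 1), \<theta> (x $ 1)] :: real^2) (\<lambda>x. vector [0, 0])"
    using is_weak_deriv_vector[OF weak_deriv_lift(2)[OF l wf(5,3), unfolded strip_S_box] weak_deriv_lift(2)[OF l tf(3,2), unfolded strip_S_box]]
    unfolding strip_S_box .
qed

lemma (in sym_form) J_lim_eq:
  assumes Q: "\<And>u. Q (sm u) = S u u" and w: "w \<in> W22 (interval_I l)" and \<theta>: "\<theta> \<in> W12 (interval_I l)"
  shows "J_lim Q l w \<theta> = 1 / 24 * (\<integral>x. qb (deriv_I l (deriv_I l w) (x $ 1)) (deriv_I l \<theta> (x $ 1)) \<partial>MS l)"
proof -
  have "(\<lambda>t. qb (deriv_I l (deriv_I l w) t) (deriv_I l \<theta> t)) \<in> borel_measurable (MI l)"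
    by (intro qb_measurable sqi_measurable W22_I_facts[OF w] W12_I_facts[OF \<theta>])
  from integral_lift[OF this] show ?thesis by (simp add: J_lim_def Q_bar_eq[OF Q])
qed

theorem (in sym_form) liminf_inequality:
  assumes Q: "\<And>u. Q (sm u) = S u u" and l: "l > 0"
    and w\<epsilon>: "\<And>\<epsilon>. \<epsilon> > 0 \<Longrightarrow> w\<epsilon> \<epsilon> \<in> W22_det l \<epsilon>"
    and w: "w \<in> W22_mean0 (interval_I l)" and \<theta>: "\<theta> \<in> W12_mean0 (interval_I l)"
    and conv: "ribbon_converges l w\<epsilon> w \<theta>"
  shows "Liminf (at_right 0) (\<lambda>\<epsilon>. ereal (J_eps Q l \<epsilon> (w\<epsilon> \<epsilon>))) \<ge> ereal (J_lim Q l w \<theta>)"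
proof -
  have W: "w \<in> W22 (interval_I l)" and T: "\<theta> \<in> W12 (interval_I l)" using w \<theta> by (auto simp: W22_mean0_def W12_mean0_def)
  let ?\<kappa> = "\<lambda>x::real^2. deriv_I l (deriv_I l w) (x $ 1)" and ?\<tau> = "\<lambda>x::real^2. deriv_I l \<theta> (x $ 1)"
  let ?k = "\<lambda>\<epsilon>. partial l 1 (partial l 1 (w\<epsilon> \<epsilon>))" and ?t = "\<lambda>\<epsilon> x. 1 / \<epsilon> * partial l 1 (partial l 2 (w\<epsilon> \<epsilon>)) x"
  have W\<epsilon>: "w\<epsilon> \<epsilon> \<in> W22 (strip_S l)" if "\<epsilon> > 0" for \<epsilon> using w\<epsilon>[OF that] by (simp add: W22_det_def W22_mean0_def)
  have pos: "\<forall>\<^sub>F \<epsilon> in at_right (0::real). \<epsilon> > 0" by (rule eventually_at_right_less)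
  have s: "sqi (MS l) ?\<kappa>" "sqi (MS l) ?\<tau>" by (intro sqi_lift W22_I_facts[OF W] W12_I_facts[OF T])+
  have kt: "\<forall>\<^sub>F \<epsilon> in at_right 0. sqi (MS l) (?k \<epsilon>) \<and> sqi (MS l) (?t \<epsilon>)"
    using pos by eventually_elim (intro conjI sqi_cmult W22_S_sqi(3) W\<epsilon>)
  let ?G = "\<lambda>\<epsilon>. scaled_grad l \<epsilon> (w\<epsilon> \<epsilon>)" and ?Glim = "\<lambda>x::real^2. vector [deriv_I l w (x $ 1), \<theta> (x $ 1)] :: real^2"
  have wc: "weakly_converges (W12 (strip_S l)) (W12_norm (strip_S l)) ?G ?Glim (at_right 0)"
    using conv by (simp add: ribbon_converges_def)
  have G0: "?Glim \<in> W12 (strip_S l)" and GW: "\<forall>\<^sub>F \<epsilon> in at_right 0. ?G \<epsilon> \<in> W12 (strip_S l)"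
    using wc by (auto simp: weakly_converges_def)
  have l0: "AE x in MS l. weak_deriv (strip_S l) (axis 1 1) ?Glim x = vector [?\<kappa> x, ?\<tau> x]"
    using weak_deriv_AE[OF limit_grad_deriv(1)[OF l W T, unfolded strip_S_box]] by (simp only: strip_S_box)
  have eqI: "(\<integral>x. f x * \<psi> x \<partial>MS l) = (\<integral>x. g x * \<psi> x \<partial>MS l)"
    if "sqi (MS l) f" "sqi (MS l) g" "sqi (MS l) \<psi>" "AE x in MS l. f x = g x" for f g \<psi>
  proof (rule integral_cong_AE)
    show "AE x in MS l. f x * \<psi> x = g x * \<psi> x" using that(4) by eventually_elim simp
  qed (use that(1-3)[THEN sqi_measurable] in measurable)
  have weak: "((\<lambda>\<epsilon>. \<integral>x. f \<epsilon> x * \<psi> x \<partial>MS l) \<longlongrightarrow> (\<integral>x. f0 x * \<psi> x \<partial>MS l)) (at_right 0)"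
    if "sqi (MS l) \<psi>" "j < 6" "sqi (MS l) f0" "AE x in MS l. D12 l j ?Glim x = f0 x"
      "\<And>\<epsilon>. \<epsilon> > 0 \<Longrightarrow> sqi (MS l) (f \<epsilon>)" "\<And>\<epsilon>. \<epsilon> > 0 \<Longrightarrow> AE x in MS l. D12 l j (?G \<epsilon>) x = f \<epsilon> x" for \<psi> j f0 f
  proof -
    have "((\<lambda>\<epsilon>. \<integral>x. D12 l j (?G \<epsilon>) x * \<psi> x \<partial>MS l) \<longlongrightarrow> (\<integral>x. D12 l j ?Glim x * \<psi> x \<partial>MS l)) (at_right 0)"
      by (rule W12S.weakly_convergesD[OF wc that(2,1)])
    moreover have "(\<integral>x. D12 l j ?Glim x * \<psi> x \<partial>MS l) = (\<integral>x. f0 x * \<psi> x \<partial>MS l)"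
      by (rule eqI[OF W12S.Dj_sqi[OF that(2) G0] that(3,1,4)])
    moreover have "\<forall>\<^sub>F \<epsilon> in at_right 0. (\<integral>x. D12 l j (?G \<epsilon>) x * \<psi> x \<partial>MS l) = (\<integral>x. f \<epsilon> x * \<psi> x \<partial>MS l)"
      using GW pos by eventually_elim (intro eqI W12S.Dj_sqi that)
    ultimately show ?thesis by (simp add: Lim_transform_eventually)
  qed
  note gd = scaled_grad_deriv(1)[OF W\<epsilon>, of _ 1]
  \<comment> \<open>Component 2 of the scaled gradient is the x_1-derivative of its first entry;
    component 3, used for \<tau>, is that of its second entry.\<close>
  have wk: "((\<lambda>\<epsilon>. \<integral>x. ?k \<epsilon> x * \<psi> x \<partial>MS l) \<longlongrightarrow> (\<integral>x. ?\<kappa> x * \<psi> x \<partial>MS l)) (at_right 0)" if "sqi (MS l) \<psi>" for \<psi>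
  proof (rule weak[OF that, of 2])
    show "AE x in MS l. D12 l 2 ?Glim x = ?\<kappa> x" using l0 by eventually_elim simp
    show "sqi (MS l) (?k \<epsilon>)" if "\<epsilon> > 0" for \<epsilon> by (rule W22_S_sqi(3)[OF W\<epsilon>[OF that]])
    show "AE x in MS l. D12 l 2 (?G \<epsilon>) x = ?k \<epsilon> x" if "\<epsilon> > 0" for \<epsilon>
      using gd[OF that, of \<epsilon>] by eventually_elim simp
  qed (simp_all add: s)
  have wt: "((\<lambda>\<epsilon>. \<integral>x. ?t \<epsilon> x * \<psi> x \<partial>MS l) \<longlongrightarrow> (\<integral>x. ?\<tau> x * \<psi> x \<partial>MS l)) (at_right 0)" if "sqi (MS l) \<psi>" for \<psi>
  proof (rule weak[OF that, of 3])
    show "AE x in MS l. D12 l 3 ?Glim x = ?\<tau> x" using l0 by eventually_elim simp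
    show "sqi (MS l) (?t \<epsilon>)" if "\<epsilon> > 0" for \<epsilon> by (rule sqi_cmult[OF W22_S_sqi(3)[OF W\<epsilon>[OF that]]])
    show "AE x in MS l. D12 l 3 (?G \<epsilon>) x = ?t \<epsilon> x" if "\<epsilon> > 0" for \<epsilon>
      using gd[OF that, of \<epsilon>] by eventually_elim simp
  qed (simp_all add: s)
  show ?thesis
    unfolding le_Liminf_iff
  proof (intro allI impI)
    fix y assume y: "y < ereal (J_lim Q l w \<theta>)"
    obtain r where r: "y < ereal r" "r < J_lim Q l w \<theta>" using ereal_dense2[OF y] by auto
    \<comment> \<open>The energy gap, freed from the factor 1/24 common to both functionals.\<close>
    have "24 * (J_lim Q l w \<theta> - r) > 0" using r by simp
    from qb_weak_lsc[OF finite_MS s this kt wk wt]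
    have "\<forall>\<^sub>F \<epsilon> in at_right 0. (\<integral>x. qb (?k \<epsilon> x) (?t \<epsilon> x) \<partial>MS l) > (\<integral>x. qb (?\<kappa> x) (?\<tau> x) \<partial>MS l) - 24 * (J_lim Q l w \<theta> - r)" .
    with pos show "\<forall>\<^sub>F \<epsilon> in at_right 0. y < ereal (J_eps Q l \<epsilon> (w\<epsilon> \<epsilon>))"
    proof eventually_elim
      case (elim \<epsilon>)
      have "r < 1 / 24 * (\<integral>x. qb (?k \<epsilon> x) (?t \<epsilon> x) \<partial>MS l)"
        using elim(2) J_lim_eq[OF Q W T] by (simp add: field_simps)
      then have "r < J_eps Q l \<epsilon> (w\<epsilon> \<epsilon>)" using J_eps_ge[OF Q w\<epsilon>[OF elim(1)]] by linarith
      then show ?case using r(1) by (meson ereal_less_eq(3) less_imp_le less_le_trans)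
    qed
  qed
qed

section \<open>Profiles of determinant zero\<close>

lemma pairwise_zero_cases:
  fixes c :: "nat \<Rightarrow> real"
  assumes "\<And>i j. i < m \<Longrightarrow> j < m \<Longrightarrow> i \<noteq> j \<Longrightarrow> c i = 0 \<or> c j = 0"
  obtains "\<And>i. i < m \<Longrightarrow> c i = 0" | j where "j < m" "\<And>i. i < m \<Longrightarrow> i \<noteq> j \<Longrightarrow> c i = 0"
proof (cases "\<exists>j<m. c j \<noteq> 0")
  case True
  then obtain j where j: "j < m" "c j \<noteq> 0" by blast
  have "c i = 0" if "i < m" "i \<noteq> j" for i using assms[OF that(1) j(1) that(2)] j(2) by blast
  with j(1) show ?thesis by (rule that(2))
next
  case False
  then show ?thesis by (intro that(1)) blast
qed

text \<open>All cross terms vanish because at most one coefficient is nonzero. It serves for the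
  determinant, for the energy and for plain squares.\<close>

lemma bilinear_pairwise_zero:
  fixes T :: "'a::real_vector \<Rightarrow> 'a \<Rightarrow> real" and m :: nat
  assumes T: "bilinear T" and z: "\<And>i j. i < m \<Longrightarrow> j < m \<Longrightarrow> i \<noteq> j \<Longrightarrow> c i = 0 \<or> c j = (0::real)"
  shows "T (\<Sum>j<m. c j *\<^sub>R r j) (\<Sum>j<m. c j *\<^sub>R r j) = (\<Sum>j<m. (c j)\<^sup>2 * T (r j) (r j))"
proof (rule pairwise_zero_cases[of m c])
  show "c i = 0 \<or> c j = 0" if "i < m" "j < m" "i \<noteq> j" for i j by (rule z[OF that])
next
  assume "\<And>i. i < m \<Longrightarrow> c i = 0"
  then show ?thesis using T by (simp add: bilinear_lzero)
next
  fix j assume j: "j < m" "\<And>i. i < m \<Longrightarrow> i \<noteq> j \<Longrightarrow> c i = 0"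
  have "(\<Sum>i<m. c i *\<^sub>R r i) = c j *\<^sub>R r j"
    by (subst sum.remove[of _ j]) (use j in \<open>auto intro!: sum.neutral\<close>)
  moreover have "(\<Sum>i<m. (c i)\<^sup>2 * T (r i) (r i)) = (c j)\<^sup>2 * T (r j) (r j)"
    by (subst sum.remove[of _ j]) (use j in \<open>auto intro!: sum.neutral\<close>)
  ultimately show ?thesis using T by (simp add: bilinear_lmul bilinear_rmul power2_eq_square)
qed

lemma sum_square_pairwise_zero:
  fixes c :: "nat \<Rightarrow> real"
  assumes "\<And>i j. i < m \<Longrightarrow> j < m \<Longrightarrow> i \<noteq> j \<Longrightarrow> c i = 0 \<or> c j = (0::real)"
  shows "(\<Sum>j<m. c j)\<^sup>2 = (\<Sum>j<m. (c j)\<^sup>2)"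
proof -
  have "bilinear ((*) :: real \<Rightarrow> real \<Rightarrow> real)"
    by (simp add: bilinear_conv_bounded_bilinear bounded_bilinear_mult)
  from bilinear_pairwise_zero[of "(*)" m c "\<lambda>_. 1 :: real", OF this assms]
  show ?thesis by (simp add: power2_eq_square)
qed

text \<open>For \<delta> > 0, a trapezoid that vanishes within \<delta> of the ends and equals 1 at
  distance 2 \<delta> and more: continuous, below the indicator, and leaving gaps between
  neighbouring intervals.\<close>

definition trap :: "real \<Rightarrow> real \<Rightarrow> real \<Rightarrow> real \<Rightarrow> real" where
  "trap \<delta> c d t = max 0 (min 1 (min ((t - c) / \<delta> - 1) ((d - t) / \<delta> - 1)))"

lemma trap_range: "0 \<le> trap \<delta> c d t" "trap \<delta> c d t \<le> 1"
  by (auto simp: trap_def)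

lemma trap_support:
  assumes "trap \<delta> c d t \<noteq> 0" "\<delta> > 0"
  shows "c + \<delta> < t \<and> t < d - \<delta>"
proof -
  have "1 < (t - c) / \<delta>" "1 < (d - t) / \<delta>"
  proof -
    have "max 0 (min 1 (min a b)) \<noteq> 0 \<Longrightarrow> a > 0 \<and> b > 0" for a b :: real
      by (auto simp: max_def min_def split: if_splits)
    from this[OF assms(1)[unfolded trap_def]] show "1 < (t - c) / \<delta>" "1 < (d - t) / \<delta>" by simp_all
  qed
  then show ?thesis using assms(2) by (simp add: pos_less_divide_eq)
qed

lemma trap_continuous: "\<delta> > 0 \<Longrightarrow> continuous_on A (trap \<delta> c d)"
  unfolding trap_def[abs_def] by (intro continuous_intros) auto

lemma trap_tendsto: "(\<lambda>n. trap (1 / real (Suc n)) c d t) \<longlonglongrightarrow> indicator {c<..<d} t"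
proof (cases "t \<in> {c<..<d}")
  case True
  define e where "e = min (t - c) (d - t)"
  have e: "e > 0" using True by (simp add: e_def)
  obtain n0 where n0: "real n0 > 2 / e" using reals_Archimedean2 by blast
  have "\<forall>\<^sub>F n in sequentially. trap (1 / real (Suc n)) c d t = 1"
    using eventually_ge_at_top[of n0]
  proof eventually_elim
    case (elim n)
    then have "2 / e < real (Suc n)" using n0 by linarith
    then have "2 < real (Suc n) * e" using e by (simp add: pos_divide_less_eq)
    moreover have "real (Suc n) * e \<le> real (Suc n) * (t - c)" "real (Suc n) * e \<le> real (Suc n) * (d - t)"
      by (intro mult_left_mono; simp add: e_def)+
    ultimately have "2 \<le> real (Suc n) * (t - c)" "2 \<le> real (Suc n) * (d - t)" by linarith+
    moreover have "x / (1 / real (Suc n)) = real (Suc n) * x" for x by simp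
    ultimately have "2 \<le> (t - c) / (1 / real (Suc n))" "2 \<le> (d - t) / (1 / real (Suc n))"
      by (simp_all only:)
    then show ?case by (simp add: trap_def)
  qed
  then show ?thesis using True by (simp add: tendsto_eventually)
next
  case False
  have "trap (1 / real (Suc n)) c d t = 0" for n
  proof (rule ccontr)
    assume "trap (1 / real (Suc n)) c d t \<noteq> 0"
    then have "c + 1 / real (Suc n) < t \<and> t < d - 1 / real (Suc n)" by (rule trap_support) simp
    moreover have "1 / real (Suc n) > 0" by simp
    ultimately have "c < t \<and> t < d" by linarith
    then show False using False by simp
  qed
  then show ?thesis using False by simp
qed

section \<open>Increments of primitives\<close>

lemma integral_MI_indicator:
  assumes "- l / 2 \<le> c" "c \<le> d" "d \<le> l / 2"
  shows "(\<integral>s. indicator {c<..<d} s \<partial>MI l) = d - c"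
proof -
  have "(\<integral>s. indicator {c<..<d} s \<partial>MI l) = measure (MI l) ({c<..<d} \<inter> space (MI l))" by simp
  also have "{c<..<d} \<inter> space (MI l) = {c<..<d}" using assms by (auto simp: interval_I_def)
  also have "measure (MI l) {c<..<d} = measure lebesgue {c<..<d}"
    using assms by (intro measure_restrict_space) (auto simp: interval_I_def)
  also have "\<dots> = d - c" using assms by simp
  finally show ?thesis .
qed

lemma interval_indicator_measurable: "(indicator {c<..<d} :: real \<Rightarrow> real) \<in> borel_measurable (MI l)"
  "(indicator {c<..d} :: real \<Rightarrow> real) \<in> borel_measurable (MI l)"
  by (intro measurable_restrict_space1 measurable_completion; simp)+

lemma sqi_interval_indicator: "sqi (MI l) (indicator {c<..<d})" "sqi (MI l) (indicator {c<..d})"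
  by (rule finite_measure.sqi_bounded[OF finite_MI interval_indicator_measurable(1), where C = 1], simp add: indicator_def)
    (rule finite_measure.sqi_bounded[OF finite_MI interval_indicator_measurable(2), where C = 1], simp add: indicator_def)

lemma integrable_indicator_mult:
  fixes g :: "real \<Rightarrow> real"
  assumes "integrable (MI l) g" "A \<in> sets borel"
  shows "integrable (MI l) (\<lambda>s. indicator A s * g s)"
proof (rule Bochner_Integration.integrable_bound[OF assms(1)])
  have "(indicator A :: real \<Rightarrow> real) \<in> borel_measurable (MI l)"
    using assms(2) by (intro measurable_restrict_space1 measurable_completion) simp
  then show "(\<lambda>s. indicator A s * g s) \<in> borel_measurable (MI l)"
    using borel_measurable_integrable[OF assms(1)] by measurable
qed (auto simp: indicator_def)

lemma prim_increment:
  fixes g :: "real \<Rightarrow> real"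
  assumes "integrable (MI l) g" "s \<le> t"
  shows "prim l g t - prim l g s = (\<integral>x. indicator {s<..t} x * g x \<partial>MI l)"
proof -
  have "prim l g t - prim l g s = (\<integral>x. indicator {..t} x * g x - indicator {..s} x * g x \<partial>MI l)"
    unfolding prim_def using assms(1) by (intro Bochner_Integration.integral_diff[symmetric] integrable_indicator_mult) auto
  also have "\<dots> = (\<integral>x. indicator {s<..t} x * g x \<partial>MI l)"
    using assms(2) by (intro Bochner_Integration.integral_cong) (auto simp: indicator_def)
  finally show ?thesis .
qed

text \<open>Cauchy-Schwarz on the interval from s to t gives Hoelder continuity with exponent 1/2,
  which later dictates how fine the cells must be.\<close>

lemma prim_increment_bound:
  assumes g: "sqi (MI l) g" and st: "- l / 2 \<le> s" "s \<le> t" "t \<le> l / 2"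
  shows "\<bar>prim l g t - prim l g s\<bar> \<le> sqrt (t - s) * sqrt (\<integral>x. (g x)\<^sup>2 \<partial>MI l)"
proof -
  have gi: "integrable (MI l) g" by (rule finite_measure.sqi_integrable[OF finite_MI g])
  have "(\<integral>x. (indicator {s<..t} x)\<^sup>2 \<partial>MI l) = (t - s :: real)"
  proof -
    have "(\<integral>x. (indicator {s<..t} x)\<^sup>2 \<partial>MI l) = (\<integral>x. (indicator {s<..t} x :: real) \<partial>MI l)"
      by (intro Bochner_Integration.integral_cong) (auto simp: indicator_def)
    also have "\<dots> = measure (MI l) ({s<..t} \<inter> interval_I l)" by simp
    also have "measure (MI l) ({s<..t} \<inter> interval_I l) = measure lebesgue ({s<..t} \<inter> interval_I l)"
      by (rule measure_restrict_space) (auto simp: interval_I_def)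
    also have "\<dots> = t - s"
    \<comment> \<open>The half-open interval leaves the open interval I exactly when t is its right
      end.\<close>
    proof (cases "t = l / 2")
      case True
      then have "{s<..t} \<inter> interval_I l = {s<..<t}" using st by (auto simp: interval_I_def)
      then show ?thesis using st by simp
    next
      case False
      then have "{s<..t} \<inter> interval_I l = {s<..t}" using st by (auto simp: interval_I_def)
      then show ?thesis using st by simp
    qed
    finally show ?thesis .
  qed
  then show ?thesis
    unfolding prim_increment[OF gi st(2)]
    using Cauchy_Schwarz_integral[OF sqi_interval_indicator(2)[of l s t] g] by simp
qed

lemma prim_left_end: "prim l g (- l / 2) = 0"
proof -
  have "prim l g (- l / 2) = (\<integral>s. 0 \<partial>MI l)"
    unfolding prim_def by (intro Bochner_Integration.integral_cong) (auto simp: indicator_def interval_I_def)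
  then show ?thesis by simp
qed

lemma prim_right_end: "prim l g (l / 2) = (\<integral>s. g s \<partial>MI l)"
  unfolding prim_def by (intro Bochner_Integration.integral_cong) (auto simp: indicator_def interval_I_def)

lemma sum_pairs: "(\<Sum>j<2 * n. f j) = (\<Sum>i<n. f (2 * i) + f (Suc (2 * i)))" for f :: "nat \<Rightarrow> real"
  by (induction n) simp_all

text \<open>Coordinates of the rank-one matrix a \<otimes> a with a = (1, p).\<close>

definition rv :: "real \<Rightarrow> vec3" where "rv p = (1, p, p\<^sup>2)"

context sym_form
begin

text \<open>Jensen's inequality on one cell: the subgradient inequality is taken at the cell
  averages and integrated, and the linear terms cancel.\<close>

lemma cell_Jensen:
  assumes g: "sqi (MI l) \<kappa>" "sqi (MI l) \<tau>" and st: "- l / 2 \<le> s" "s < t" "t \<le> l / 2"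
  defines "h \<equiv> t - s"
  shows "h * qb ((prim l \<kappa> t - prim l \<kappa> s) / h) ((prim l \<tau> t - prim l \<tau> s) / h) \<le>
    prim l (\<lambda>x. qb (\<kappa> x) (\<tau> x)) t - prim l (\<lambda>x. qb (\<kappa> x) (\<tau> x)) s"
proof -
  have h: "h > 0" using st by (simp add: h_def)
  obtain K0 p1 p2 where "K0 > 0" and K: "\<And>x y x' y'. qb x' y' \<ge> qb x y + p1 x y * (x' - x) + p2 x y * (y' - y)"
    and "\<And>x y. \<bar>p1 x y\<bar> \<le> K0 * norm (x, y)" "\<And>x y. \<bar>p2 x y\<bar> \<le> K0 * norm (x, y)"
    using qb_subgradient by blast
  let ?k = "(prim l \<kappa> t - prim l \<kappa> s) / h" and ?t = "(prim l \<tau> t - prim l \<tau> s) / h"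
  let ?i = "\<lambda>x. indicator {s<..t} x :: real"
  note fm = finite_measure.sqi_integrable[OF finite_MI]
  note ki = fm[OF g(1)] fm[OF g(2)] and qi = qb_integrable[OF g]
  have one: "integrable (MI l) (\<lambda>_. 1 :: real)" by (rule finite_measure.integrable_const[OF finite_MI])
  have pt: "prim l (\<lambda>_. 1) x = x + l / 2" if "- l / 2 \<le> x" "x \<le> l / 2" for x
  proof -
    have "prim l (\<lambda>_. 1) x = (\<integral>s. indicator {- l / 2..x} s * 1 \<partial>MI l)"
      unfolding prim_def by (intro Bochner_Integration.integral_cong) (auto simp: indicator_def interval_I_def)
    also have "\<dots> = x - (- l / 2)"
      by (rule integral_MI_interval[where G = "\<lambda>x. x"]) (use that in \<open>auto intro!: derivative_eq_intros\<close>)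
    finally show ?thesis by simp
  qed
  have i1: "(\<integral>x. ?i x \<partial>MI l) = h"
    using prim_increment[OF one, of s t] pt[of s] pt[of t] st by (simp add: h_def)
  have I: "integrable (MI l) ?i" "integrable (MI l) (\<lambda>x. ?i x * \<kappa> x)" "integrable (MI l) (\<lambda>x. ?i x * \<tau> x)"
    "integrable (MI l) (\<lambda>x. ?i x * qb (\<kappa> x) (\<tau> x))"
    using integrable_indicator_mult[OF one, of "{s<..t}"] by (auto intro!: integrable_indicator_mult ki qi)
  have "(\<integral>x. (qb ?k ?t - p1 ?k ?t * ?k - p2 ?k ?t * ?t) * ?i x + (p1 ?k ?t * (?i x * \<kappa> x) + p2 ?k ?t * (?i x * \<tau> x)) \<partial>MI l)
      \<le> (\<integral>x. ?i x * qb (\<kappa> x) (\<tau> x) \<partial>MI l)"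
  proof (rule Bochner_Integration.integral_mono)
    show "integrable (MI l) (\<lambda>x. (qb ?k ?t - p1 ?k ?t * ?k - p2 ?k ?t * ?t) * ?i x + (p1 ?k ?t * (?i x * \<kappa> x) + p2 ?k ?t * (?i x * \<tau> x)))"
      using I by (intro Bochner_Integration.integrable_add integrable_mult_right)
    show "integrable (MI l) (\<lambda>x. ?i x * qb (\<kappa> x) (\<tau> x))" by (rule I)
    fix x
    have "qb ?k ?t - p1 ?k ?t * ?k - p2 ?k ?t * ?t + p1 ?k ?t * \<kappa> x + p2 ?k ?t * \<tau> x \<le> qb (\<kappa> x) (\<tau> x)"
      using K[of ?k ?t "\<kappa> x" "\<tau> x"] by (simp add: right_diff_distrib)
    then show "(qb ?k ?t - p1 ?k ?t * ?k - p2 ?k ?t * ?t) * ?i x + (p1 ?k ?t * (?i x * \<kappa> x) + p2 ?k ?t * (?i x * \<tau> x)) \<le> ?i x * qb (\<kappa> x) (\<tau> x)"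
      by (cases "x \<in> {s<..t}") simp_all
  qed
  also have "(\<integral>x. (qb ?k ?t - p1 ?k ?t * ?k - p2 ?k ?t * ?t) * ?i x + (p1 ?k ?t * (?i x * \<kappa> x) + p2 ?k ?t * (?i x * \<tau> x)) \<partial>MI l)
    = (qb ?k ?t - p1 ?k ?t * ?k - p2 ?k ?t * ?t) * h + (p1 ?k ?t * (?k * h) + p2 ?k ?t * (?t * h))"
  proof -
    have "(\<integral>x. ?i x * \<kappa> x \<partial>MI l) = ?k * h" "(\<integral>x. ?i x * \<tau> x \<partial>MI l) = ?t * h"
      using prim_increment[OF ki(1), of s t] prim_increment[OF ki(2), of s t] st h by simp_all
    then show ?thesis using I i1 by (simp only: Bochner_Integration.integral_add Bochner_Integration.integrable_add integral_mult_right_zero integrable_mult_right)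
  qed
  also have "\<dots> = h * qb ?k ?t" by (simp only: left_diff_distrib mult.assoc) (simp add: mult.commute)
  also have "(\<integral>x. ?i x * qb (\<kappa> x) (\<tau> x) \<partial>MI l) = prim l (\<lambda>x. qb (\<kappa> x) (\<tau> x)) t - prim l (\<lambda>x. qb (\<kappa> x) (\<tau> x)) s"
    using prim_increment[OF qi, of s t] st by simp
  finally show ?thesis .
qed

lemma scaled_rank_one: "(x, x * p, x * p\<^sup>2) = x *\<^sub>R rv p"
  by (simp add: rv_def)

text \<open>Each of the \<open>N\<close> cells is divided in two, one part for each of the states given by
  \<open>two_state_split\<close> for the averages over the cell.\<close>

lemma two_state_partition:
  assumes g: "sqi (MI l) \<kappa>" "sqi (MI l) \<tau>" and l: "l > 0" and N: "N > 0"
  shows "\<exists>z v p. (\<forall>j. z j \<le> z (Suc j)) \<and> (\<forall>i. z (2 * i) = - l / 2 + real i * (l / real N)) \<and>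
    (\<forall>i\<le>N. (\<Sum>j<2 * i. (z (Suc j) - z j) * v j) = prim l \<kappa> (z (2 * i))) \<and>
    (\<forall>i\<le>N. (\<Sum>j<2 * i. (z (Suc j) - z j) * (v j * p j)) = prim l \<tau> (z (2 * i))) \<and>
    (\<Sum>j<2 * N. (z (Suc j) - z j) * ((v j)\<^sup>2 * S (rv (p j)) (rv (p j)))) \<le> (\<integral>x. qb (\<kappa> x) (\<tau> x) \<partial>MI l)"
proof -
  define h where "h = l / real N"
  have h: "h > 0" using l N by (simp add: h_def)
  define X where "X i = - l / 2 + real i * h" for i :: nat
  have Xh: "X (Suc i) - X i = h" for i by (simp add: X_def algebra_simps)
  have XN: "X N = l / 2" using N by (simp add: X_def h_def)
  have Xr: "- l / 2 \<le> X i" for i using h by (simp add: X_def)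
  have Xr': "X i \<le> l / 2" if "i \<le> N" for i
  proof -
    have "real i * h \<le> real N * h" using that h by (intro mult_right_mono) auto
    then show ?thesis using XN by (simp add: X_def)
  qed
  define k where "k i = (prim l \<kappa> (X (Suc i)) - prim l \<kappa> (X i)) / h" for i
  define t where "t i = (prim l \<tau> (X (Suc i)) - prim l \<tau> (X i)) / h" for i
  have "\<forall>i. \<exists>\<mu> x1 p1 x2 p2. 0 \<le> \<mu> \<and> \<mu> \<le> 1 \<and> k i = \<mu> * x1 + (1 - \<mu>) * x2 \<and> t i = \<mu> * (x1 * p1) + (1 - \<mu>) * (x2 * p2) \<and>
     \<mu> * S (x1, x1 * p1, x1 * p1\<^sup>2) (x1, x1 * p1, x1 * p1\<^sup>2) +
     (1 - \<mu>) * S (x2, x2 * p2, x2 * p2\<^sup>2) (x2, x2 * p2, x2 * p2\<^sup>2) \<le> qb (k i) (t i)"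
    by (intro allI two_state_split)
  then obtain \<mu> x1 p1 x2 p2 where sp: "\<And>i. 0 \<le> \<mu> i" "\<And>i. \<mu> i \<le> 1" "\<And>i. k i = \<mu> i * x1 i + (1 - \<mu> i) * x2 i"
     "\<And>i. t i = \<mu> i * (x1 i * p1 i) + (1 - \<mu> i) * (x2 i * p2 i)"
     "\<And>i. \<mu> i * S (x1 i, x1 i * p1 i, x1 i * (p1 i)\<^sup>2) (x1 i, x1 i * p1 i, x1 i * (p1 i)\<^sup>2) +
     (1 - \<mu> i) * S (x2 i, x2 i * p2 i, x2 i * (p2 i)\<^sup>2) (x2 i, x2 i * p2 i, x2 i * (p2 i)\<^sup>2) \<le> qb (k i) (t i)"
    unfolding choice_iff by blast
  have en: "\<mu> i * ((x1 i)\<^sup>2 * S (rv (p1 i)) (rv (p1 i))) + (1 - \<mu> i) * ((x2 i)\<^sup>2 * S (rv (p2 i)) (rv (p2 i))) \<le> qb (k i) (t i)" for i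
    using sp(5)[of i] unfolding scaled_rank_one by (simp add: S_simps power2_eq_square mult.assoc)
  \<comment> \<open>Even nodes are the cell ends; the odd node cuts its cell in proportion \<mu> to
    1 - \<mu>, so the lengths act as weights of the two states.\<close>
  define z where "z j = X (j div 2) + (if even j then 0 else \<mu> (j div 2) * h)" for j
  define v where "v j = (if even j then x1 (j div 2) else x2 (j div 2))" for j
  define p where "p j = (if even j then p1 (j div 2) else p2 (j div 2))" for j
  have z0: "z (2 * i) = X i" "z (Suc (2 * i)) = X i + \<mu> i * h" "z (Suc (Suc (2 * i))) = X i + h" for i
    using Xh[of i] by (simp_all add: z_def)
  have vp: "v (2 * i) = x1 i" "v (Suc (2 * i)) = x2 i" "p (2 * i) = p1 i" "p (Suc (2 * i)) = p2 i" for i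
    by (simp_all add: v_def p_def)
  have pair: "(\<Sum>j<2 * n. (z (Suc j) - z j) * f j) = (\<Sum>i<n. h * (\<mu> i * f (2 * i) + (1 - \<mu> i) * f (Suc (2 * i))))" for n and f :: "nat \<Rightarrow> real"
  proof -
    have "(a + m * h - a) * b + (a + h - (a + m * h)) * c = h * (m * b + (1 - m) * c)" for a b c m
      by (simp add: algebra_simps)
    then show ?thesis unfolding sum_pairs z0 by simp
  qed
  have tele: "(\<Sum>i<n. F (X (Suc i)) - F (X i)) = F (X n) - F (X 0)" for n and F :: "real \<Rightarrow> real"
    by (rule sum_lessThan_telescope[where f = "\<lambda>i. F (X i)"])
  have X0: "X 0 = - l / 2" by (simp add: X_def)
  show ?thesis
  proof (rule exI[of _ z], rule exI[of _ v], rule exI[of _ p], intro conjI allI impI)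
    show "z j \<le> z (Suc j)" for j
    proof (cases "even j")
      case True
      then obtain i where "j = 2 * i" by (rule evenE)
      then show ?thesis using z0[of i] sp(1)[of i] h by simp
    next
      case False
      then obtain i where i: "j = 2 * i + 1" by (rule oddE)
      have "\<mu> i * h \<le> 1 * h" using sp(2)[of i] h by (intro mult_right_mono) auto
      then show ?thesis using z0[of i] by (simp add: i)
    qed
    show "z (2 * i) = - l / 2 + real i * (l / real N)" for i by (simp add: z0 X_def h_def)
    show "(\<Sum>j<2 * i. (z (Suc j) - z j) * v j) = prim l \<kappa> (z (2 * i))" for i
    proof -
      have "(\<Sum>j<2 * i. (z (Suc j) - z j) * v j) = (\<Sum>i<i. prim l \<kappa> (X (Suc i)) - prim l \<kappa> (X i))"
        unfolding pair vp sp(3)[symmetric] using h by (simp add: k_def)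
      then show ?thesis unfolding tele by (simp add: z0 X0 prim_left_end[of l, simplified])
    qed
    show "(\<Sum>j<2 * i. (z (Suc j) - z j) * (v j * p j)) = prim l \<tau> (z (2 * i))" for i
    proof -
      have "(\<Sum>j<2 * i. (z (Suc j) - z j) * (v j * p j)) = (\<Sum>i<i. prim l \<tau> (X (Suc i)) - prim l \<tau> (X i))"
        unfolding pair vp sp(4)[symmetric] using h by (simp add: t_def)
      then show ?thesis unfolding tele by (simp add: z0 X0 prim_left_end[of l, simplified])
    qed
    show "(\<Sum>j<2 * N. (z (Suc j) - z j) * ((v j)\<^sup>2 * S (rv (p j)) (rv (p j)))) \<le> (\<integral>x. qb (\<kappa> x) (\<tau> x) \<partial>MI l)"
    proof -
      let ?q = "\<lambda>x. qb (\<kappa> x) (\<tau> x)"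
      have "(\<Sum>j<2 * N. (z (Suc j) - z j) * ((v j)\<^sup>2 * S (rv (p j)) (rv (p j)))) \<le> (\<Sum>i<N. h * qb (k i) (t i))"
        unfolding pair vp using en h by (intro sum_mono mult_left_mono) auto
      also have "\<dots> \<le> (\<Sum>i<N. prim l ?q (X (Suc i)) - prim l ?q (X i))"
      proof (rule sum_mono)
        fix i assume "i \<in> {..<N}"
        then have "X (Suc i) \<le> l / 2" by (intro Xr') simp
        moreover have "X i < X (Suc i)" using Xh[of i] h by linarith
        ultimately show "h * qb (k i) (t i) \<le> prim l ?q (X (Suc i)) - prim l ?q (X i)"
          using cell_Jensen[OF g, of "X i" "X (Suc i)"] Xr[of i] by (simp add: Xh k_def t_def)
      qed
      also have "\<dots> = (\<integral>x. qb (\<kappa> x) (\<tau> x) \<partial>MI l)"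
        unfolding tele XN X0 prim_right_end prim_left_end by simp
      finally show ?thesis .
    qed
  qed
qed

end

section \<open>Step functions on split cells and their trapezoidal approximation\<close>

lemma sqi_sum:
  fixes f :: "nat \<Rightarrow> 'a \<Rightarrow> real"
  assumes "\<And>j. j < m \<Longrightarrow> sqi M (f j)"
  shows "sqi M (\<lambda>x. \<Sum>j<m. f j x)"
  using assms
proof (induction m)
  case 0
  show ?case by (simp add: sqi_def)
next
  case (Suc m)
  have "sqi M (\<lambda>x. (\<Sum>j<m. f j x) + f m x)" by (rule sqi_add) (use Suc in auto)
  then show ?case by simp
qed

lemma prim_abs_le:
  fixes f :: "real \<Rightarrow> real"
  assumes "integrable (MI l) f"
  shows "\<bar>prim l f t\<bar> \<le> (\<integral>s. \<bar>f s\<bar> \<partial>MI l)"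
proof -
  have "\<bar>prim l f t\<bar> \<le> (\<integral>s. \<bar>indicator {..t} s * f s\<bar> \<partial>MI l)" unfolding prim_def by (rule integral_abs_bound)
  also have "\<dots> \<le> (\<integral>s. \<bar>f s\<bar> \<partial>MI l)"
    using integrable_indicator_mult[OF assms, of "{..t}"] assms
    by (intro Bochner_Integration.integral_mono integrable_abs) (auto simp: indicator_def)
  finally show ?thesis .
qed

lemma integral_sum_sqi:
  fixes f :: "nat \<Rightarrow> real \<Rightarrow> real"
  assumes "\<And>j. j < m \<Longrightarrow> sqi (MI l) (f j)" "sqi (MI l) g"
  shows "(\<integral>x. g x * (\<Sum>j<m. c j * f j x) \<partial>MI l) = (\<Sum>j<m. c j * (\<integral>x. g x * f j x \<partial>MI l))"
proof -
  have "(\<integral>x. g x * (\<Sum>j<m. c j * f j x) \<partial>MI l) = (\<integral>x. (\<Sum>j<m. c j * (g x * f j x)) \<partial>MI l)"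
    by (simp add: sum_distrib_left mult_ac)
  also have "\<dots> = (\<Sum>j<m. \<integral>x. c j * (g x * f j x) \<partial>MI l)"
    by (intro Bochner_Integration.integral_sum integrable_mult_right sqi_mult_integrable assms) auto
  finally show ?thesis by simp
qed

text \<open>Only the even nodes are equidistant; an odd node may coincide with a neighbour, which
  happens when a state has weight 0.\<close>

locale partition =
  fixes l :: real and N :: nat and z :: "nat \<Rightarrow> real"
  assumes l: "l > 0" and N: "N > 0"
    and step: "z j \<le> z (Suc j)" and nodes: "z (2 * i) = - l / 2 + real i * (l / real N)"
begin

lemma mono: "i \<le> j \<Longrightarrow> z i \<le> z j"
  by (rule lift_Suc_mono_le[of z, OF step])

lemma z_0: "z 0 = - l / 2" and z_N: "z (2 * N) = l / 2"
  using nodes[of 0] nodes[of N] N by simp_all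

lemma z_range: "j \<le> 2 * N \<Longrightarrow> - l / 2 \<le> z j \<and> z j \<le> l / 2"
  using mono[of 0 j] mono[of j "2 * N"] by (simp only: z_0 z_N le0 simp_thms)

definition ind :: "nat \<Rightarrow> real \<Rightarrow> real" where "ind j = indicator {z j<..<z (Suc j)}"

lemma ind_disjoint: "i \<noteq> j \<Longrightarrow> ind i s = 0 \<or> ind j s = 0"
proof (rule ccontr)
  assume "i \<noteq> j" "\<not> (ind i s = 0 \<or> ind j s = 0)"
  then have s: "z i < s" "s < z (Suc i)" "z j < s" "s < z (Suc j)" by (auto simp: ind_def indicator_def split: if_splits)
  from \<open>i \<noteq> j\<close> have "Suc i \<le> j \<or> Suc j \<le> i" by linarith
  then show False using mono[of "Suc i" j] mono[of "Suc j" i] s by auto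
qed

lemma sqi_ind: "sqi (MI l) (ind j)"
  unfolding ind_def by (rule sqi_interval_indicator)

lemma integral_ind: "j < 2 * N \<Longrightarrow> (\<integral>s. ind j s \<partial>MI l) = z (Suc j) - z j"
  unfolding ind_def using z_range[of j] z_range[of "Suc j"] step[of j] by (intro integral_MI_indicator) auto

definition st :: "(nat \<Rightarrow> real) \<Rightarrow> real \<Rightarrow> real" where "st w s = (\<Sum>j<2 * N. w j * ind j s)"

lemma sqi_st: "sqi (MI l) (st w)"
  unfolding st_def[abs_def] by (intro sqi_sum sqi_cmult sqi_ind)

lemma integral_st_square: "(\<integral>s. (st w s)\<^sup>2 \<partial>MI l) = (\<Sum>j<2 * N. (z (Suc j) - z j) * (w j)\<^sup>2)"
proof -
  have "(st w s)\<^sup>2 = 1 * (\<Sum>j<2 * N. (w j)\<^sup>2 * ind j s)" for s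
  proof -
    have "(st w s)\<^sup>2 = (\<Sum>j<2 * N. (w j * ind j s)\<^sup>2)"
      unfolding st_def by (rule sum_square_pairwise_zero) (use ind_disjoint in auto)
    also have "\<dots> = (\<Sum>j<2 * N. (w j)\<^sup>2 * ind j s)"
      by (intro sum.cong) (auto simp: ind_def indicator_def power_mult_distrib)
    finally show ?thesis by simp
  qed
  then have "(\<integral>s. (st w s)\<^sup>2 \<partial>MI l) = (\<Sum>j<2 * N. (w j)\<^sup>2 * (\<integral>s. 1 * ind j s \<partial>MI l))"
    by (simp only:) (rule integral_sum_sqi[OF sqi_ind sqi_continuous_MI], simp)
  also have "\<dots> = (\<Sum>j<2 * N. (z (Suc j) - z j) * (w j)\<^sup>2)"
    by (intro sum.cong) (auto simp: integral_ind)
  finally show ?thesis .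
qed

lemma prim_st_node:
  assumes "i \<le> N"
  shows "prim l (st w) (z (2 * i)) = (\<Sum>j<2 * i. (z (Suc j) - z j) * w j)"
proof -
  have "prim l (st w) (z (2 * i)) = (\<Sum>j<2 * N. w j * (\<integral>s. indicator {..z (2 * i)} s * ind j s \<partial>MI l))"
    unfolding prim_def st_def[abs_def] by (rule integral_sum_sqi[OF sqi_ind sqi_indicator])
  also have "\<dots> = (\<Sum>j<2 * N. if j < 2 * i then (z (Suc j) - z j) * w j else 0)"
  proof (rule sum.cong)
    fix j assume j: "j \<in> {..<2 * N}"
    show "w j * (\<integral>s. indicator {..z (2 * i)} s * ind j s \<partial>MI l) = (if j < 2 * i then (z (Suc j) - z j) * w j else 0)"
    proof (cases "j < 2 * i")
      case True
      then have "z (Suc j) \<le> z (2 * i)" by (intro mono) simp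
      then have "(\<lambda>s. indicator {..z (2 * i)} s * ind j s) = ind j" by (auto simp: ind_def indicator_def fun_eq_iff)
      then show ?thesis using integral_ind[of j] j True by simp
    next
      case False
      then have "z (2 * i) \<le> z j" by (intro mono) simp
      then have "(\<lambda>s. indicator {..z (2 * i)} s * ind j s) = (\<lambda>_. 0)" by (auto simp: ind_def indicator_def fun_eq_iff)
      then show ?thesis using False by simp
    qed
  qed simp
  also have "\<dots> = (\<Sum>j\<in>{..<2 * N} \<inter> {..<2 * i}. (z (Suc j) - z j) * w j)"
    by (subst sum.inter_restrict) (auto intro: sum.cong)
  also have "{..<2 * N} \<inter> {..<2 * i} = {..<2 * i}" using assms by auto
  finally show ?thesis .
qed

text \<open>The two primitives agree at the left end of the cell of t, and from there each moves by
  at most its L2 norm times the square root of the cell length.\<close>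

lemma prim_st_close:
  assumes g: "sqi (MI l) g" and B: "(\<Sum>j<2 * N. (z (Suc j) - z j) * (w j)\<^sup>2) \<le> B"
    and nd: "\<And>i. i \<le> N \<Longrightarrow> (\<Sum>j<2 * i. (z (Suc j) - z j) * w j) = prim l g (z (2 * i))"
    and t: "t \<in> interval_I l"
  shows "\<bar>prim l (st w) t - prim l g t\<bar> \<le> sqrt (l / real N) * (sqrt B + sqrt (\<integral>s. (g s)\<^sup>2 \<partial>MI l))"
proof -
  define h where "h = l / real N"
  have h: "h > 0" using l N by (simp add: h_def)
  have tt: "- l / 2 < t" "t < l / 2" using t by (auto simp: interval_I_def)
  define i where "i = nat \<lfloor>(t + l / 2) / h\<rfloor>"
  have q: "0 \<le> (t + l / 2) / h" using tt h by simp
  then have fl: "real i \<le> (t + l / 2) / h" "(t + l / 2) / h < real i + 1" unfolding i_def by linarith+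
  have i1: "real i * h \<le> t + l / 2" using fl(1) h by (simp add: pos_le_divide_eq)
  have i2: "t + l / 2 < (real i + 1) * h" using fl(2) h by (simp add: pos_divide_less_eq)
  have "real i * h < real N * h" using i1 tt N by (simp add: h_def)
  then have iN: "i < N" using h by simp
  have zi: "z (2 * i) = - l / 2 + real i * h" by (simp only: nodes h_def)
  have zt: "- l / 2 \<le> z (2 * i)" "z (2 * i) \<le> t" "t - z (2 * i) \<le> h"
  proof -
    have "0 \<le> real i * h" using h by simp
    moreover have "t + l / 2 < real i * h + h" using i2 by (simp add: algebra_simps)
    ultimately show "- l / 2 \<le> z (2 * i)" "z (2 * i) \<le> t" "t - z (2 * i) \<le> h"
      unfolding zi using i1 by linarith+
  qed
  have inc: "\<bar>prim l f t - prim l f (z (2 * i))\<bar> \<le> sqrt h * sqrt (\<integral>s. (f s)\<^sup>2 \<partial>MI l)" if "sqi (MI l) f" for f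
  proof -
    have "\<bar>prim l f t - prim l f (z (2 * i))\<bar> \<le> sqrt (t - z (2 * i)) * sqrt (\<integral>s. (f s)\<^sup>2 \<partial>MI l)"
      by (rule prim_increment_bound[OF that]) (use zt tt in auto)
    also have "\<dots> \<le> sqrt h * sqrt (\<integral>s. (f s)\<^sup>2 \<partial>MI l)"
      using zt by (intro mult_right_mono real_sqrt_le_mono) auto
    finally show ?thesis .
  qed
  have "prim l (st w) (z (2 * i)) = prim l g (z (2 * i))"
    using prim_st_node[of i w] nd[of i] iN by simp
  then have "\<bar>prim l (st w) t - prim l g t\<bar> \<le> sqrt h * sqrt (\<integral>s. (st w s)\<^sup>2 \<partial>MI l) + sqrt h * sqrt (\<integral>s. (g s)\<^sup>2 \<partial>MI l)"
    using inc[OF sqi_st[of w]] inc[OF g] by linarith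
  also have "\<dots> \<le> sqrt h * sqrt B + sqrt h * sqrt (\<integral>s. (g s)\<^sup>2 \<partial>MI l)"
    using B h unfolding integral_st_square by (intro add_right_mono mult_left_mono real_sqrt_le_mono) auto
  finally show ?thesis by (simp add: h_def distrib_left)
qed

definition tr :: "nat \<Rightarrow> nat \<Rightarrow> real \<Rightarrow> real" where "tr n j = trap (1 / real (Suc n)) (z j) (z (Suc j))"

lemma tr_continuous: "continuous_on UNIV (tr n j)"
  unfolding tr_def by (rule trap_continuous) simp

lemma sqi_tr: "sqi (MI l) (tr n j)"
  by (rule sqi_continuous_MI[OF tr_continuous])

lemma tr_support: "tr n j s \<noteq> 0 \<Longrightarrow> z j + 1 / real (Suc n) < s \<and> s < z (Suc j) - 1 / real (Suc n)"
  unfolding tr_def by (rule trap_support) auto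

lemma tr_separated:
  assumes "i \<noteq> j" "tr n i s \<noteq> 0" "tr n j t \<noteq> 0"
  shows "1 / real (Suc n) \<le> \<bar>s - t\<bar>"
proof -
  have e: "1 / real (Suc n) > 0" by simp
  note S = tr_support[OF assms(2)] tr_support[OF assms(3)]
  from \<open>i \<noteq> j\<close> have "Suc i \<le> j \<or> Suc j \<le> i" by linarith
  then show ?thesis
  proof
    assume "Suc i \<le> j"
    then have "z (Suc i) \<le> z j" by (rule mono)
    then show ?thesis using S e by linarith
  next
    assume "Suc j \<le> i"
    then have "z (Suc j) \<le> z i" by (rule mono)
    then show ?thesis using S e by linarith
  qed
qed

text \<open>Replacing a step by its trapezoid therefore never raises the energy, so the energy bound
  survives without an error term.\<close>

lemma tr_le_ind: "(tr n j s)\<^sup>2 \<le> ind j s"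
proof (cases "tr n j s = 0")
  case False
  from tr_support[OF this] have "z j < s \<and> s < z (Suc j)" by (smt (verit) divide_pos_pos of_nat_0_less_iff zero_less_Suc)
  moreover have "(tr n j s)\<^sup>2 \<le> 1\<^sup>2" unfolding tr_def by (intro power_mono trap_range)
  ultimately show ?thesis by (simp add: ind_def)
qed (simp add: ind_def)

lemma tr_L1: "(\<lambda>n. \<integral>s. \<bar>tr n j s - ind j s\<bar> \<partial>MI l) \<longlonglongrightarrow> 0"
proof -
  have "(\<lambda>n. \<integral>s. \<bar>tr n j s - ind j s\<bar> \<partial>MI l) \<longlonglongrightarrow> (\<integral>s. 0 \<partial>MI l)"
  proof (rule integral_dominated_convergence)
    show "integrable (MI l) (\<lambda>_. 1 :: real)" by (rule finite_measure.integrable_const[OF finite_MI])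
    show "(\<lambda>s. \<bar>tr n j s - ind j s\<bar>) \<in> borel_measurable (MI l)" for n
      using sqi_tr[THEN sqi_measurable, of n j] sqi_ind[THEN sqi_measurable, of j] by measurable
    show "AE s in MI l. (\<lambda>n. \<bar>tr n j s - ind j s\<bar>) \<longlonglongrightarrow> 0"
    proof (rule AE_I2)
      fix s
      have "(\<lambda>n. \<bar>tr n j s - ind j s\<bar>) \<longlonglongrightarrow> \<bar>ind j s - ind j s\<bar>"
        unfolding tr_def ind_def by (intro tendsto_intros trap_tendsto)
      then show "(\<lambda>n. \<bar>tr n j s - ind j s\<bar>) \<longlonglongrightarrow> 0" by simp
    qed
    have "\<bar>tr n j s - ind j s\<bar> \<le> 1" for n s
    proof -
      have "0 \<le> tr n j s" "tr n j s \<le> 1" "0 \<le> ind j s" "ind j s \<le> 1"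
        using trap_range by (auto simp: tr_def ind_def indicator_def)
      then show ?thesis by linarith
    qed
    then show "AE s in MI l. norm \<bar>tr n j s - ind j s\<bar> \<le> 1" for n by simp
  qed simp
  then show ?thesis by simp
qed

lemma prim_tr_close:
  "\<bar>prim l (\<lambda>s. \<Sum>j<2 * N. w j * tr n j s) t - prim l (st w) t\<bar> \<le> (\<Sum>j<2 * N. \<bar>w j\<bar> * (\<integral>s. \<bar>tr n j s - ind j s\<bar> \<partial>MI l))"
proof -
  note fi = finite_measure.sqi_integrable[OF finite_MI]
  let ?f = "\<lambda>s. \<Sum>j<2 * N. w j * tr n j s"
  have sf: "sqi (MI l) ?f" by (intro sqi_sum sqi_cmult sqi_tr)
  have d: "integrable (MI l) (\<lambda>s. \<bar>tr n j s - ind j s\<bar>)" for j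
    by (intro integrable_abs fi sqi_diff sqi_tr sqi_ind)
  have sd: "sqi (MI l) (\<lambda>s. ?f s - st w s)" by (rule sqi_diff[OF sf sqi_st])
  have "\<bar>prim l ?f t - prim l (st w) t\<bar> \<le> (\<integral>s. \<bar>?f s - st w s\<bar> \<partial>MI l)"
    unfolding prim_diff[OF sf sqi_st, symmetric] by (rule prim_abs_le[OF fi[OF sd]])
  also have "\<dots> \<le> (\<integral>s. (\<Sum>j<2 * N. \<bar>w j\<bar> * \<bar>tr n j s - ind j s\<bar>) \<partial>MI l)"
  proof (rule Bochner_Integration.integral_mono)
    show "integrable (MI l) (\<lambda>s. \<bar>?f s - st w s\<bar>)" by (intro integrable_abs fi sd)
    show "integrable (MI l) (\<lambda>s. \<Sum>j<2 * N. \<bar>w j\<bar> * \<bar>tr n j s - ind j s\<bar>)"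
      by (intro Bochner_Integration.integrable_sum integrable_mult_right d)
    show "\<bar>?f s - st w s\<bar> \<le> (\<Sum>j<2 * N. \<bar>w j\<bar> * \<bar>tr n j s - ind j s\<bar>)" for s
    proof -
      have "?f s - st w s = (\<Sum>j<2 * N. w j * (tr n j s - ind j s))"
        by (simp add: st_def sum_subtractf right_diff_distrib)
      then show ?thesis using sum_abs[of "\<lambda>j. w j * (tr n j s - ind j s)" "{..<2 * N}"] by (simp add: abs_mult)
    qed
  qed
  also have "\<dots> = (\<Sum>j<2 * N. \<bar>w j\<bar> * (\<integral>s. \<bar>tr n j s - ind j s\<bar> \<partial>MI l))"
    using d by (subst Bochner_Integration.integral_sum) auto
  finally show ?thesis .
qed

end

text \<open>Cell length and trapezoid slope each contribute \<eta>/2 to the uniform error of the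
  primitives. The energy costs nothing: Jensen and the split bound it for the steps, and the
  trapezoids lie below the steps.\<close>

lemma (in sym_form) profile_exists:
  assumes g: "sqi (MI l) \<kappa>" "sqi (MI l) \<tau>" and l: "l > 0" and \<eta>: "\<eta> > 0"
  shows "\<exists>(m::nat) k p \<delta>. \<delta> > 0 \<and> (\<forall>j. continuous_on UNIV (k j)) \<and>
    (\<forall>i j s t. i \<noteq> j \<longrightarrow> k i s \<noteq> 0 \<longrightarrow> k j t \<noteq> 0 \<longrightarrow> \<delta> \<le> \<bar>s - t\<bar>) \<and>
    (\<forall>t\<in>interval_I l. \<bar>prim l (\<lambda>s. \<Sum>j<m. k j s) t - prim l \<kappa> t\<bar> \<le> \<eta> \<and>
       \<bar>prim l (\<lambda>s. \<Sum>j<m. p j * k j s) t - prim l \<tau> t\<bar> \<le> \<eta>) \<and>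
    (\<integral>s. (\<Sum>j<m. (k j s)\<^sup>2 * S (rv (p j)) (rv (p j))) \<partial>MI l) \<le> (\<integral>s. qb (\<kappa> s) (\<tau> s) \<partial>MI l)"
proof -
  obtain c C where c: "c > 0" "C > 0" "\<And>u. c * (norm u)\<^sup>2 \<le> S u u" "\<And>u. S u u \<le> C * (norm u)\<^sup>2"
     "\<And>x y. 0 \<le> qb x y" "\<And>x y. qb x y \<le> C * (x\<^sup>2 + y\<^sup>2)" using qb_bounds by blast
  define E where "E = (\<integral>s. qb (\<kappa> s) (\<tau> s) \<partial>MI l)"
  have E: "E \<ge> 0" unfolding E_def using c(5) by simp
  \<comment> \<open>Coercivity bounds the step functions in L2 by sqrt (E / c), so A dominates the
    sum of the Hoelder constants in either comparison.\<close>
  define A where "A = sqrt (E / c) + sqrt (\<integral>s. (\<kappa> s)\<^sup>2 \<partial>MI l) + sqrt (\<integral>s. (\<tau> s)\<^sup>2 \<partial>MI l)"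
  have A: "A \<ge> 0" unfolding A_def using E c(1) by (intro add_nonneg_nonneg) auto
  \<comment> \<open>Chosen so that sqrt (l / N) A \<le> \<eta>/2.\<close>
  obtain N where N: "real N > l * (2 * A / \<eta>)\<^sup>2" "N > 0"
  proof -
    obtain N0 where "real N0 > l * (2 * A / \<eta>)\<^sup>2" using reals_Archimedean2 by blast
    then have "real (Suc N0) > l * (2 * A / \<eta>)\<^sup>2" by simp
    then show ?thesis by (rule that) simp
  qed
  have sA: "sqrt (l / real N) * A \<le> \<eta> / 2"
  proof -
    have "l * (2 * A / \<eta>)\<^sup>2 / real N \<le> 1" using N by (simp add: divide_le_eq)
    then have "(l * (2 * A / \<eta>)\<^sup>2 / real N) * (\<eta> / 2)\<^sup>2 \<le> 1 * (\<eta> / 2)\<^sup>2" by (intro mult_right_mono) auto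
    moreover have "(l * (2 * A / \<eta>)\<^sup>2 / real N) * (\<eta> / 2)\<^sup>2 = l / real N * A\<^sup>2"
      using \<eta> by (simp add: power_divide power_mult_distrib)
    ultimately have "l / real N * A\<^sup>2 \<le> (\<eta> / 2)\<^sup>2" by (simp only: mult_1_left)
    then have "sqrt (l / real N * A\<^sup>2) \<le> sqrt ((\<eta> / 2)\<^sup>2)" by (rule real_sqrt_le_mono)
    then show ?thesis using A \<eta> by (simp only: real_sqrt_mult real_sqrt_abs)
  qed
  obtain z v p where z: "\<And>j. z j \<le> z (Suc j)" "\<And>i. z (2 * i) = - l / 2 + real i * (l / real N)"
    and nk: "\<And>i. i \<le> N \<Longrightarrow> (\<Sum>j<2 * i. (z (Suc j) - z j) * v j) = prim l \<kappa> (z (2 * i))"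
    and nt: "\<And>i. i \<le> N \<Longrightarrow> (\<Sum>j<2 * i. (z (Suc j) - z j) * (v j * p j)) = prim l \<tau> (z (2 * i))"
    and en: "(\<Sum>j<2 * N. (z (Suc j) - z j) * ((v j)\<^sup>2 * S (rv (p j)) (rv (p j)))) \<le> E"
    using two_state_partition[OF g l N(2)] unfolding E_def by blast
  interpret partition l N z by unfold_locales (use l N z in auto)
  \<comment> \<open>The squared norm of (1, p, p^2) is at least 1 and at least p^2, so the energy
    density controls both v^2 and (v p)^2.\<close>
  have rvn: "1 \<le> S (rv x) (rv x) / c" "x\<^sup>2 \<le> S (rv x) (rv x) / c" for x
  proof -
    have "(norm (rv x))\<^sup>2 = 1 + x\<^sup>2 + (x\<^sup>2)\<^sup>2" unfolding rv_def norm_vec3 by simp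
    then have "1 \<le> (norm (rv x))\<^sup>2" "x\<^sup>2 \<le> (norm (rv x))\<^sup>2" by simp_all
    then have "c * 1 \<le> S (rv x) (rv x)" "c * x\<^sup>2 \<le> S (rv x) (rv x)"
      using c(3)[of "rv x"] c(1) mult_left_mono[of _ "(norm (rv x))\<^sup>2" c] by (meson less_imp_le order_trans)+
    then show "1 \<le> S (rv x) (rv x) / c" "x\<^sup>2 \<le> S (rv x) (rv x) / c" using c(1) by (simp_all add: pos_le_divide_eq mult.commute)
  qed
  have B: "(\<Sum>j<2 * N. (z (Suc j) - z j) * (w j)\<^sup>2) \<le> E / c"
    if w: "\<And>j. (w j)\<^sup>2 \<le> (v j)\<^sup>2 * (S (rv (p j)) (rv (p j)) / c)" for w
  proof -
    have "(\<Sum>j<2 * N. (z (Suc j) - z j) * (w j)\<^sup>2) \<le> (\<Sum>j<2 * N. (z (Suc j) - z j) * ((v j)\<^sup>2 * (S (rv (p j)) (rv (p j)) / c)))"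
      using z(1) w by (intro sum_mono mult_left_mono) auto
    also have "\<dots> = (\<Sum>j<2 * N. (z (Suc j) - z j) * ((v j)\<^sup>2 * S (rv (p j)) (rv (p j)))) / c"
      by (simp add: sum_divide_distrib)
    also have "\<dots> \<le> E / c" using en c(1) by (intro divide_right_mono) auto
    finally show ?thesis .
  qed
  have Bv: "(\<Sum>j<2 * N. (z (Suc j) - z j) * (v j)\<^sup>2) \<le> E / c"
    by (rule B) (use mult_left_mono[OF rvn(1)] in fastforce)
  have Bp: "(\<Sum>j<2 * N. (z (Suc j) - z j) * (v j * p j)\<^sup>2) \<le> E / c"
    by (rule B) (simp only: power_mult_distrib, intro mult_left_mono rvn(2) zero_le_power2)
  define a where "a n = (\<Sum>j<2 * N. (\<bar>v j\<bar> + \<bar>v j * p j\<bar>) * (\<integral>s. \<bar>tr n j s - ind j s\<bar> \<partial>MI l))" for n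
  have "a \<longlonglongrightarrow> (\<Sum>j<2 * N. (\<bar>v j\<bar> + \<bar>v j * p j\<bar>) * 0)"
    unfolding a_def[abs_def] by (intro tendsto_sum tendsto_mult tendsto_const tr_L1)
  then have "\<forall>\<^sub>F n in sequentially. a n < \<eta> / 2" using \<eta> by (intro order_tendstoD(2)) auto
  then obtain n where n: "a n < \<eta> / 2" by (auto dest: eventually_happens)
  have close: "\<bar>prim l (\<lambda>s. \<Sum>j<2 * N. w j * tr n j s) t - prim l h t\<bar> \<le> \<eta>"
    if w: "\<And>j. \<bar>w j\<bar> \<le> \<bar>v j\<bar> + \<bar>v j * p j\<bar>" and Bw: "(\<Sum>j<2 * N. (z (Suc j) - z j) * (w j)\<^sup>2) \<le> E / c"
      and nd: "\<And>i. i \<le> N \<Longrightarrow> (\<Sum>j<2 * i. (z (Suc j) - z j) * w j) = prim l h (z (2 * i))"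
      and h: "sqi (MI l) h" "sqrt (E / c) + sqrt (\<integral>s. (h s)\<^sup>2 \<partial>MI l) \<le> A" and t: "t \<in> interval_I l" for w h t
  proof -
    have "\<bar>prim l (\<lambda>s. \<Sum>j<2 * N. w j * tr n j s) t - prim l (st w) t\<bar> \<le> a n"
      using prim_tr_close[of w n t] unfolding a_def
      by (rule order_trans) (intro sum_mono mult_right_mono w, simp)
    moreover have "\<bar>prim l (st w) t - prim l h t\<bar> \<le> sqrt (l / real N) * (sqrt (E / c) + sqrt (\<integral>s. (h s)\<^sup>2 \<partial>MI l))"
      by (rule prim_st_close[OF h(1) Bw nd t])
    moreover have "sqrt (l / real N) * (sqrt (E / c) + sqrt (\<integral>s. (h s)\<^sup>2 \<partial>MI l)) \<le> sqrt (l / real N) * A"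
      using h(2) l by (intro mult_left_mono) auto
    ultimately show ?thesis using n sA by linarith
  qed
  have A1: "sqrt (E / c) + sqrt (\<integral>s. (\<kappa> s)\<^sup>2 \<partial>MI l) \<le> A" and A2: "sqrt (E / c) + sqrt (\<integral>s. (\<tau> s)\<^sup>2 \<partial>MI l) \<le> A"
    unfolding A_def by simp_all
  have cl1: "\<bar>prim l (\<lambda>s. \<Sum>j<2 * N. v j * tr n j s) t - prim l \<kappa> t\<bar> \<le> \<eta>" if "t \<in> interval_I l" for t
    by (rule close[OF _ Bv _ g(1) A1 that]) (simp, erule nk)
  have cl2: "\<bar>prim l (\<lambda>s. \<Sum>j<2 * N. (v j * p j) * tr n j s) t - prim l \<tau> t\<bar> \<le> \<eta>" if "t \<in> interval_I l" for t
    by (rule close[OF _ Bp _ g(2) A2 that]) (simp, erule nt)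
  define k where "k j s = v j * tr n j s" for j s
  have en2: "(\<integral>s. (\<Sum>j<2 * N. (k j s)\<^sup>2 * S (rv (p j)) (rv (p j))) \<partial>MI l) \<le> E"
  proof -
    let ?q = "\<lambda>j. S (rv (p j)) (rv (p j))"
    have ik: "sqi (MI l) (k j)" for j unfolding k_def[abs_def] by (intro sqi_cmult sqi_tr)
    have "(\<integral>s. (\<Sum>j<2 * N. (k j s)\<^sup>2 * ?q j) \<partial>MI l) \<le> (\<integral>s. (\<Sum>j<2 * N. (v j)\<^sup>2 * ?q j * ind j s) \<partial>MI l)"
    proof (rule Bochner_Integration.integral_mono)
      show "integrable (MI l) (\<lambda>s. \<Sum>j<2 * N. (k j s)\<^sup>2 * ?q j)"
        by (intro Bochner_Integration.integrable_sum integrable_mult_left sqi_square ik)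
      show "integrable (MI l) (\<lambda>s. \<Sum>j<2 * N. (v j)\<^sup>2 * ?q j * ind j s)"
        by (intro Bochner_Integration.integrable_sum integrable_mult_right finite_measure.sqi_integrable[OF finite_MI sqi_ind])
      show "(\<Sum>j<2 * N. (k j s)\<^sup>2 * ?q j) \<le> (\<Sum>j<2 * N. (v j)\<^sup>2 * ?q j * ind j s)" for s
      proof (rule sum_mono)
        fix j
        have "((v j)\<^sup>2 * ?q j) * (tr n j s)\<^sup>2 \<le> ((v j)\<^sup>2 * ?q j) * ind j s"
          by (intro mult_left_mono tr_le_ind mult_nonneg_nonneg nonneg zero_le_power2)
        then show "(k j s)\<^sup>2 * ?q j \<le> (v j)\<^sup>2 * ?q j * ind j s" by (simp add: k_def power_mult_distrib mult_ac)
      qed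
    qed
    also have "\<dots> = (\<Sum>j<2 * N. (v j)\<^sup>2 * ?q j * (\<integral>s. 1 * ind j s \<partial>MI l))"
      using integral_sum_sqi[of "2 * N" l ind "\<lambda>_. 1" "\<lambda>j. (v j)\<^sup>2 * ?q j", OF sqi_ind] sqi_continuous_MI[of "\<lambda>_. 1" l] by simp
    also have "\<dots> = (\<Sum>j<2 * N. (z (Suc j) - z j) * ((v j)\<^sup>2 * ?q j))"
      by (intro sum.cong) (auto simp: integral_ind)
    finally show ?thesis using en by linarith
  qed
  show ?thesis
  proof (rule exI[of _ "2 * N"], rule exI[of _ k], rule exI[of _ p], rule exI[of _ "1 / real (Suc n)"], intro conjI allI impI ballI)
    show "1 / real (Suc n) > 0" by simp
    show "continuous_on UNIV (k j)" for j unfolding k_def[abs_def] by (intro continuous_intros tr_continuous)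
    show "1 / real (Suc n) \<le> \<bar>s - t\<bar>" if "i \<noteq> j" "k i s \<noteq> 0" "k j t \<noteq> 0" for i j s t
      by (rule tr_separated[OF that(1)]) (use that in \<open>auto simp: k_def\<close>)
    show "\<bar>prim l (\<lambda>s. \<Sum>j<2 * N. k j s) t - prim l \<kappa> t\<bar> \<le> \<eta>" if "t \<in> interval_I l" for t
      unfolding k_def by (rule cl1[OF that])
    show "\<bar>prim l (\<lambda>s. \<Sum>j<2 * N. p j * k j s) t - prim l \<tau> t\<bar> \<le> \<eta>" if "t \<in> interval_I l" for t
      using cl2[OF that] by (simp add: k_def mult_ac)
    show "(\<integral>s. (\<Sum>j<2 * N. (k j s)\<^sup>2 * S (rv (p j)) (rv (p j))) \<partial>MI l) \<le> (\<integral>s. qb (\<kappa> s) (\<tau> s) \<partial>MI l)"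
      using en2 by (simp only: E_def)
  qed
qed

section \<open>Developable sheets\<close>

text \<open>\<open>H1\<close> and \<open>H0\<close> are first and second antiderivatives of the
  profiles. The condition \<open>small\<close> keeps the spread of the arguments at one point below
  the gap \<delta> between supports.\<close>

locale developable =
  fixes l \<epsilon> \<delta> :: real and m :: nat and k H1 H0 :: "nat \<Rightarrow> real \<Rightarrow> real" and p :: "nat \<Rightarrow> real"
  assumes l: "l > 0" and \<epsilon>: "\<epsilon> > 0"
    and k_cont: "continuous_on UNIV (k j)"
    and H1_deriv: "(H1 j has_real_derivative k j t) (at t)"
    and H0_deriv: "(H0 j has_real_derivative H1 j t) (at t)"
    and separated: "i \<noteq> j \<Longrightarrow> k i s \<noteq> 0 \<Longrightarrow> k j t \<noteq> 0 \<Longrightarrow> \<delta> \<le> \<bar>s - t\<bar>"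
    and small: "\<epsilon> * (\<Sum>j<m. \<bar>p j\<bar>) < \<delta>"
begin

text \<open>Constant along the straight rulings of the j-th piece. The slope contains \<epsilon>,
  which cancels the factor 1/\<epsilon> of each scaled x_2-derivative.\<close>

definition ruling :: "nat \<Rightarrow> real^2 \<Rightarrow> real" where "ruling j x = x $ 1 + \<epsilon> * p j * x $ 2"

definition comb :: "(nat \<Rightarrow> real) \<Rightarrow> (nat \<Rightarrow> real \<Rightarrow> real) \<Rightarrow> real^2 \<Rightarrow> real" where
  "comb a G x = (\<Sum>j<m. a j * G j (ruling j x))"

lemma comb_continuous:
  assumes "\<And>j. continuous_on UNIV (G j)"
  shows "continuous_on UNIV (comb a G)"
  unfolding comb_def[abs_def] ruling_def
  by (intro continuous_intros continuous_on_compose2[OF assms]) auto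

text \<open>Differentiation in x_2 multiplies the j-th coefficient by \<epsilon> p_j, so
  combinations of this kind are closed under differentiation.\<close>

lemma comb_deriv:
  assumes G: "\<And>j t. (G j has_real_derivative g j t) (at t)"
  shows "(comb a G has_derivative (\<lambda>v. comb a g x * v $ 1 + \<epsilon> * comb (\<lambda>j. a j * p j) g x * v $ 2)) (at x)"
proof -
  have r: "(ruling j has_derivative (\<lambda>v. v $ 1 + \<epsilon> * p j * v $ 2)) (at x)" for j
    unfolding ruling_def[abs_def]
    by (intro has_derivative_add has_derivative_mult_right bounded_linear_imp_has_derivative bounded_linear_vec_nth)
  have "((\<lambda>x. G j (ruling j x)) has_derivative (\<lambda>v. g j (ruling j x) * (v $ 1 + \<epsilon> * p j * v $ 2))) (at x)" for j
    by (rule has_derivative_compose[OF r G[unfolded has_field_derivative_def]])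
  then have "(comb a G has_derivative (\<lambda>v. \<Sum>j<m. a j * (g j (ruling j x) * (v $ 1 + \<epsilon> * p j * v $ 2)))) (at x)"
    unfolding comb_def[abs_def] by (intro has_derivative_sum has_derivative_mult_right)
  moreover have "(\<lambda>v::real^2. \<Sum>j<m. a j * (g j (ruling j x) * (v $ 1 + \<epsilon> * p j * v $ 2))) =
     (\<lambda>v. comb a g x * v $ 1 + \<epsilon> * comb (\<lambda>j. a j * p j) g x * v $ 2)"
    by (simp add: fun_eq_iff comb_def sum_distrib_left sum_distrib_right sum.distrib algebra_simps)
  ultimately show ?thesis by simp
qed

lemma affine_deriv: "((\<lambda>x::real^2. \<alpha> + \<beta> * x $ 1 + \<gamma> * x $ 2) has_derivative (\<lambda>v. \<beta> * v $ 1 + \<gamma> * v $ 2)) (at x)"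
proof -
  have "((\<lambda>x::real^2. \<alpha> + \<beta> * x $ 1 + \<gamma> * x $ 2) has_derivative (\<lambda>v. 0 + \<beta> * v $ 1 + \<gamma> * v $ 2)) (at x)"
    by (intro has_derivative_add has_derivative_mult_right has_derivative_const bounded_linear_imp_has_derivative bounded_linear_vec_nth)
  then show ?thesis by simp
qed

lemma comb_weak_deriv:
  assumes G: "\<And>j t. (G j has_real_derivative g j t) (at t)" and g: "\<And>j. continuous_on UNIV (g j)"
  shows "is_weak_deriv (strip_S l) (axis 1 1) (\<lambda>x. c * comb a G x - (\<alpha> + \<beta> * x $ 1 + \<gamma> * x $ 2)) (\<lambda>x. c * comb a g x - \<beta>)"
    "is_weak_deriv (strip_S l) (axis 2 1) (\<lambda>x. c * comb a G x - (\<alpha> + \<beta> * x $ 1 + \<gamma> * x $ 2))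
       (\<lambda>x. c * (\<epsilon> * comb (\<lambda>j. a j * p j) g x) - \<gamma>)"
proof -
  have d: "((\<lambda>x. c * comb a G x - (\<alpha> + \<beta> * x $ 1 + \<gamma> * x $ 2)) has_derivative
     (\<lambda>v. c * (comb a g x * v $ 1 + \<epsilon> * comb (\<lambda>j. a j * p j) g x * v $ 2) - (\<beta> * v $ 1 + \<gamma> * v $ 2))) (at x)" for x
    by (intro has_derivative_diff has_derivative_mult_right comb_deriv G affine_deriv)
  show "is_weak_deriv (strip_S l) (axis 1 1) (\<lambda>x. c * comb a G x - (\<alpha> + \<beta> * x $ 1 + \<gamma> * x $ 2)) (\<lambda>x. c * comb a g x - \<beta>)"
    unfolding strip_S_box
    by (rule classical_is_weak_deriv[OF d]) (auto simp: axis_def intro!: continuous_intros comb_continuous g)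
  show "is_weak_deriv (strip_S l) (axis 2 1) (\<lambda>x. c * comb a G x - (\<alpha> + \<beta> * x $ 1 + \<gamma> * x $ 2))
       (\<lambda>x. c * (\<epsilon> * comb (\<lambda>j. a j * p j) g x) - \<gamma>)"
    unfolding strip_S_box
    by (rule classical_is_weak_deriv[OF d]) (auto simp: axis_def intro!: continuous_intros comb_continuous g)
qed

text \<open>The affine part restores the mean-zero constraints on the function and its gradient.
  Writing the last coefficient as \<epsilon> C makes C the correction of the scaled slope.\<close>

definition sheet :: "real \<Rightarrow> real \<Rightarrow> real \<Rightarrow> real^2 \<Rightarrow> real" where
  "sheet A B C x = 1 * comb (\<lambda>_. 1) H0 x - (A + B * x $ 1 + (\<epsilon> * C) * x $ 2)"

lemma H1_cont: "continuous_on UNIV (H1 j)"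
  by (intro continuous_at_imp_continuous_on ballI DERIV_isCont[OF H1_deriv])

lemma H0_cont: "continuous_on UNIV (H0 j)"
  by (intro continuous_at_imp_continuous_on ballI DERIV_isCont[OF H0_deriv])

abbreviation "k11 \<equiv> comb (\<lambda>_. 1) k"
abbreviation "k12 \<equiv> comb p k"
abbreviation "k22 \<equiv> comb (\<lambda>j. p j * p j) k"

lemma sheet_weak_derivs:
  shows "is_weak_deriv (strip_S l) (axis 1 1) (sheet A B C) (\<lambda>x. comb (\<lambda>_. 1) H1 x - B)"
    "is_weak_deriv (strip_S l) (axis 2 1) (sheet A B C) (\<lambda>x. \<epsilon> * (comb p H1 x - C))"
    "is_weak_deriv (strip_S l) (axis 1 1) (\<lambda>x. comb (\<lambda>_. 1) H1 x - B) k11"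
    "is_weak_deriv (strip_S l) (axis 2 1) (\<lambda>x. comb (\<lambda>_. 1) H1 x - B) (\<lambda>x. \<epsilon> * k12 x)"
    "is_weak_deriv (strip_S l) (axis 1 1) (\<lambda>x. \<epsilon> * (comb p H1 x - C)) (\<lambda>x. \<epsilon> * k12 x)"
    "is_weak_deriv (strip_S l) (axis 2 1) (\<lambda>x. \<epsilon> * (comb p H1 x - C)) (\<lambda>x. \<epsilon> * (\<epsilon> * k22 x))"
proof -
  note w0 = comb_weak_deriv[where G = H0 and g = H1, OF H0_deriv H1_cont, where a = "\<lambda>_. 1" and c = 1 and \<alpha> = A and \<beta> = B and \<gamma> = "\<epsilon> * C"]
  show "is_weak_deriv (strip_S l) (axis 1 1) (sheet A B C) (\<lambda>x. comb (\<lambda>_. 1) H1 x - B)"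
    "is_weak_deriv (strip_S l) (axis 2 1) (sheet A B C) (\<lambda>x. \<epsilon> * (comb p H1 x - C))"
    using w0 by (simp_all add: sheet_def[abs_def] right_diff_distrib)
  note w1 = comb_weak_deriv[where G = H1 and g = k, OF H1_deriv k_cont, where a = "\<lambda>_. 1" and c = 1 and \<alpha> = B and \<beta> = 0 and \<gamma> = 0]
  show "is_weak_deriv (strip_S l) (axis 1 1) (\<lambda>x. comb (\<lambda>_. 1) H1 x - B) k11"
    "is_weak_deriv (strip_S l) (axis 2 1) (\<lambda>x. comb (\<lambda>_. 1) H1 x - B) (\<lambda>x. \<epsilon> * k12 x)"
    using w1 by simp_all
  note w2 = comb_weak_deriv[where G = H1 and g = k, OF H1_deriv k_cont, where a = p and c = \<epsilon> and \<alpha> = "\<epsilon> * C" and \<beta> = 0 and \<gamma> = 0]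
  show "is_weak_deriv (strip_S l) (axis 1 1) (\<lambda>x. \<epsilon> * (comb p H1 x - C)) (\<lambda>x. \<epsilon> * k12 x)"
    "is_weak_deriv (strip_S l) (axis 2 1) (\<lambda>x. \<epsilon> * (comb p H1 x - C)) (\<lambda>x. \<epsilon> * (\<epsilon> * k22 x))"
    using w2 by (simp_all add: right_diff_distrib)
qed

lemma sheet_cont: "continuous_on UNIV (sheet A B C)"
  unfolding sheet_def[abs_def] by (intro continuous_intros comb_continuous H0_cont)

lemma weak_deriv_AE_S: "is_weak_deriv (strip_S l) v f g \<Longrightarrow> AE x in MS l. weak_deriv (strip_S l) v f x = g x" for f g :: "real^2 \<Rightarrow> real"
  unfolding strip_S_box by (rule weak_deriv_AE)

lemma weak_deriv_eq_S: "AE x in MS l. f x = g x \<Longrightarrow> weak_deriv (strip_S l) v f = weak_deriv (strip_S l) v g" for f g :: "real^2 \<Rightarrow> real"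
  unfolding strip_S_box by (rule weak_deriv_eq_cong)

lemma sheet_partials:
  shows "AE x in MS l. partial l 1 (sheet A B C) x = comb (\<lambda>_. 1) H1 x - B"
    "AE x in MS l. partial l 2 (sheet A B C) x = \<epsilon> * (comb p H1 x - C)"
    "AE x in MS l. partial l 1 (partial l 1 (sheet A B C)) x = k11 x"
    "AE x in MS l. partial l 2 (partial l 1 (sheet A B C)) x = \<epsilon> * k12 x"
    "AE x in MS l. partial l 1 (partial l 2 (sheet A B C)) x = \<epsilon> * k12 x"
    "AE x in MS l. partial l 2 (partial l 2 (sheet A B C)) x = \<epsilon> * (\<epsilon> * k22 x)"
proof -
  note w = sheet_weak_derivs
  show 1: "AE x in MS l. partial l 1 (sheet A B C) x = comb (\<lambda>_. 1) H1 x - B" by (rule weak_deriv_AE_S[OF w(1)])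
  show 2: "AE x in MS l. partial l 2 (sheet A B C) x = \<epsilon> * (comb p H1 x - C)" by (rule weak_deriv_AE_S[OF w(2)])
  show "AE x in MS l. partial l 1 (partial l 1 (sheet A B C)) x = k11 x"
    unfolding weak_deriv_eq_S[OF 1] by (rule weak_deriv_AE_S[OF w(3)])
  show "AE x in MS l. partial l 2 (partial l 1 (sheet A B C)) x = \<epsilon> * k12 x"
    unfolding weak_deriv_eq_S[OF 1] by (rule weak_deriv_AE_S[OF w(4)])
  show "AE x in MS l. partial l 1 (partial l 2 (sheet A B C)) x = \<epsilon> * k12 x"
    unfolding weak_deriv_eq_S[OF 2] by (rule weak_deriv_AE_S[OF w(5)])
  show "AE x in MS l. partial l 2 (partial l 2 (sheet A B C)) x = \<epsilon> * (\<epsilon> * k22 x)"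
    unfolding weak_deriv_eq_S[OF 2] by (rule weak_deriv_AE_S[OF w(6)])
qed

lemma sheet_W22: "sheet A B C \<in> W22 (strip_S l)"
proof -
  have L: "f \<in> L2 (strip_S l)" if "continuous_on UNIV f" for f :: "real^2 \<Rightarrow> real"
    unfolding L2_eq_sqi by (rule sqi_continuous_MS[OF that])
  note w = sheet_weak_derivs
  have W12: "f \<in> W12 (strip_S l)"
    if "continuous_on UNIV f" "is_weak_deriv (strip_S l) (axis 1 1) f g1" "is_weak_deriv (strip_S l) (axis 2 1) f g2"
      "continuous_on UNIV g1" "continuous_on UNIV g2" for f g1 g2 :: "real^2 \<Rightarrow> real"
    unfolding W12_def using L[OF that(1)] L[OF that(4)] L[OF that(5)] that(2,3) by (auto dest!: Basis_cases)
  have c: "continuous_on UNIV (comb a k)" "continuous_on UNIV (comb a H1)" for a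
    by (intro comb_continuous k_cont H1_cont)+
  have 0: "sheet A B C \<in> W12 (strip_S l)"
    by (rule W12[OF sheet_cont w(1,2)]) (intro continuous_intros c)+
  have 1: "(\<lambda>x. comb (\<lambda>_. 1) H1 x - B) \<in> W12 (strip_S l)"
    by (rule W12[OF _ w(3,4)]) (intro continuous_intros c)+
  have 2: "(\<lambda>x. \<epsilon> * (comb p H1 x - C)) \<in> W12 (strip_S l)"
    by (rule W12[OF _ w(5,6)]) (intro continuous_intros c)+
  have ae: "f \<in> W12 (strip_S l)" if "AE x in MS l. f x = g x" "g \<in> W12 (strip_S l)" for f g :: "real^2 \<Rightarrow> real"
  proof -
    have "AE x in MS l. g x = f x" using that(1) by eventually_elim simp
    with that(2) show ?thesis unfolding strip_S_box by (rule W12_cong_AE)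
  qed
  show ?thesis unfolding W22_def
    using 0 ae[OF sheet_partials(1) 1] ae[OF sheet_partials(2) 2] by (auto dest!: Basis_cases)
qed

definition hv :: "real^2 \<Rightarrow> vec3" where "hv x = (\<Sum>j<m. k j (ruling j x) *\<^sub>R rv (p j))"

lemma hv_eq: "hv x = (k11 x, k12 x, k22 x)"
  by (simp add: hv_def prod_eq_iff fst_sum snd_sum rv_def comb_def power2_eq_square mult_ac)

lemma sheet_hessian: "AE x in MS l. scaled_hessian l \<epsilon> (sheet A B C) x = sm (hv x)"
  using sheet_partials(3-6)[where A = A and B = B and C = C]
proof eventually_elim
  case (elim x)
  then show ?case using \<epsilon> by (simp add: scaled_hessian_def hv_eq sm_def power2_eq_square)
qed

text \<open>At a point of the strip two arguments differ by at most \<epsilon> (|p_i| + |p_j|) <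
  \<delta>, closer than any two points where different profiles are nonzero.\<close>

lemma one_active:
  assumes x: "x \<in> strip_S l" and ij: "i < m" "j < m" "i \<noteq> j"
  shows "k i (ruling i x) = 0 \<or> k j (ruling j x) = 0"
proof (rule ccontr)
  assume "\<not> ?thesis"
  then have "\<delta> \<le> \<bar>ruling i x - ruling j x\<bar>" using separated[OF ij(3)] by blast
  also have "ruling i x - ruling j x = \<epsilon> * ((p i - p j) * x $ 2)" by (simp add: ruling_def algebra_simps)
  also have "\<bar>\<epsilon> * ((p i - p j) * x $ 2)\<bar> = \<epsilon> * (\<bar>p i - p j\<bar> * \<bar>x $ 2\<bar>)" using \<epsilon> by (simp add: abs_mult)
  also have "\<dots> \<le> \<epsilon> * ((\<bar>p i\<bar> + \<bar>p j\<bar>) * 1)"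
    using \<epsilon> x by (intro mult_left_mono mult_mono abs_triangle_ineq4) (auto simp: strip_S_def)
  also have "\<bar>p i\<bar> + \<bar>p j\<bar> = (\<Sum>j\<in>{i, j}. \<bar>p j\<bar>)" using ij by simp
  also have "\<dots> \<le> (\<Sum>j<m. \<bar>p j\<bar>)" using ij by (intro sum_mono2) auto
  finally show False using small \<epsilon> by (simp add: mult_left_mono)
qed

lemma hv_bilinear:
  assumes "bilinear T" "x \<in> strip_S l"
  shows "T (hv x) (hv x) = (\<Sum>j<m. (k j (ruling j x))\<^sup>2 * T (rv (p j)) (rv (p j)))"
  unfolding hv_def by (rule bilinear_pairwise_zero[OF assms(1)]) (rule one_active[OF assms(2)])

text \<open>Only diagonal terms remain, and (1, p, p^2) has determinant zero.\<close>

lemma dtb_hv: "x \<in> strip_S l \<Longrightarrow> dtb (hv x) (hv x) = 0"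
  by (simp add: hv_bilinear[OF bilinear_dtb] rv_def power2_eq_square)

lemma sheet_det: "AE x in MS l. det (scaled_hessian l \<epsilon> (sheet A B C) x) = 0"
proof -
  have "AE x in MS l. x \<in> strip_S l" by (rule AE_I2) simp
  with sheet_hessian[of A B C] show ?thesis by eventually_elim (simp add: det_sm dtb_hv)
qed

lemma sheet_energy:
  assumes "sym_form S" and Q: "\<And>u. Q (sm u) = S u u"
  shows "J_eps Q l \<epsilon> (sheet A B C) = 1 / 24 * (\<integral>x. (\<Sum>j<m. (k j (ruling j x))\<^sup>2 * S (rv (p j)) (rv (p j))) \<partial>MS l)"
proof -
  interpret sym_form S by fact
  let ?f = "\<lambda>x. \<Sum>j<m. (k j (ruling j x))\<^sup>2 * S (rv (p j)) (rv (p j))"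
  have "continuous_on UNIV ?f"
    unfolding ruling_def by (intro continuous_intros continuous_on_compose2[OF k_cont]) auto
  then have m: "?f \<in> borel_measurable (MS l)" by (rule continuous_measurable_lebesgue_on)
  have "AE x in MS l. x \<in> strip_S l" by (rule AE_I2) simp
  with sheet_hessian[of A B C] have ae: "AE x in MS l. ?f x = Q (scaled_hessian l \<epsilon> (sheet A B C) x)"
    by eventually_elim (simp add: Q hv_bilinear[OF bil])
  then have ae': "AE x in MS l. Q (scaled_hessian l \<epsilon> (sheet A B C) x) = ?f x" by eventually_elim simp
  have "(\<integral>x. Q (scaled_hessian l \<epsilon> (sheet A B C) x) \<partial>MS l) = (\<integral>x. ?f x \<partial>MS l)"
    by (rule integral_cong_AE[OF measurable_cong_AE_on[OF m strip_S_lebesgue ae] m ae'])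
  then show ?thesis by (simp add: J_eps_def)
qed

end

text \<open>Uniform continuity jointly in \<epsilon> and x on a compact set. In the application the
  arguments at \<epsilon> = 0 reduce to x_1, which connects the strip with the interval.\<close>

lemma uniformly_close_at_0:
  fixes \<Psi> :: "real \<Rightarrow> real^2 \<Rightarrow> real"
  assumes "continuous_on UNIV (\<lambda>y. \<Psi> (fst y) (snd y))" "e > 0"
  shows "\<exists>\<epsilon>0>0. \<forall>\<epsilon>. 0 < \<epsilon> \<longrightarrow> \<epsilon> < \<epsilon>0 \<longrightarrow> (\<forall>x\<in>strip_S l. \<bar>\<Psi> \<epsilon> x - \<Psi> 0 x\<bar> \<le> e)"
proof -
  let ?K = "{0..1::real} \<times> cbox (Slo l) (Shi l)"
  have "uniformly_continuous_on ?K (\<lambda>y. \<Psi> (fst y) (snd y))"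
    by (rule compact_uniformly_continuous[OF continuous_on_subset[OF assms(1)]]) (auto intro: compact_Times)
  then obtain d where d: "d > 0" "\<And>y y'. y \<in> ?K \<Longrightarrow> y' \<in> ?K \<Longrightarrow> dist y' y < d \<Longrightarrow> dist (\<Psi> (fst y') (snd y')) (\<Psi> (fst y) (snd y)) < e"
    using assms(2) unfolding uniformly_continuous_on_def by meson
  show ?thesis
  proof (intro exI[of _ "min d 1"] conjI allI impI ballI)
    show "min d 1 > 0" using d(1) by simp
    fix \<epsilon> :: real and x :: "real^2" assume e: "0 < \<epsilon>" "\<epsilon> < min d 1" and x: "x \<in> strip_S l"
    have "x \<in> cbox (Slo l) (Shi l)" using x box_subset_cbox unfolding strip_S_box by blast
    then have "dist (\<Psi> \<epsilon> x) (\<Psi> 0 x) < e"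
      using d(2)[of "(0, x)" "(\<epsilon>, x)"] e by (simp add: dist_Pair_Pair)
    then show "\<bar>\<Psi> \<epsilon> x - \<Psi> 0 x\<bar> \<le> e" by (simp add: dist_real_def)
  qed
qed

section \<open>Averages over the strip\<close>

lemma integral_MS_const: "l > 0 \<Longrightarrow> (\<integral>x. c \<partial>MS l) = c * l"
  by (rule trans[OF integral_lift[of "\<lambda>_. c"] measure_MI]) simp

definition avg :: "real \<Rightarrow> (real^2 \<Rightarrow> real) \<Rightarrow> real" where "avg l f = (\<integral>x. f x \<partial>MS l) / l"

lemma avg_close:
  assumes l: "l > 0" and i: "integrable (MS l) f" "integrable (MS l) g" and c: "AE x in MS l. \<bar>f x - g x\<bar> \<le> e"
  shows "\<bar>avg l f - avg l g\<bar> \<le> e"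
proof -
  have "\<bar>(\<integral>x. f x \<partial>MS l) - (\<integral>x. g x \<partial>MS l)\<bar> = \<bar>\<integral>x. f x - g x \<partial>MS l\<bar>" using i by simp
  also have "\<dots> \<le> (\<integral>x. \<bar>f x - g x\<bar> \<partial>MS l)" by (rule integral_abs_bound)
  also have "\<dots> \<le> (\<integral>x. e \<partial>MS l)"
    using i c by (intro integral_mono_AE integrable_abs Bochner_Integration.integrable_diff finite_measure.integrable_const[OF finite_MS])
  also have "\<dots> = e * l" by (rule integral_MS_const[OF l])
  finally show ?thesis using l by (simp add: avg_def pos_divide_le_eq flip: diff_divide_distrib)
qed

lemma avg_minus_const:
  assumes l: "l > 0" and i: "integrable (MS l) f"
  shows "(\<integral>x. f x - avg l f \<partial>MS l) = 0"
proof -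
  have "(\<integral>x. f x - avg l f \<partial>MS l) = (\<integral>x. f x \<partial>MS l) - (\<integral>x. avg l f \<partial>MS l)"
    using i by (intro Bochner_Integration.integral_diff finite_measure.integrable_const[OF finite_MS])
  then show ?thesis using l by (simp only: integral_MS_const[OF l]) (simp add: avg_def)
qed

section \<open>Recovery sequences\<close>

text \<open>Second derivatives are absent on purpose: they oscillate and are controlled only through
  the energy.\<close>

definition near :: "real \<Rightarrow> (real \<Rightarrow> real) \<Rightarrow> (real \<Rightarrow> real) \<Rightarrow> real \<Rightarrow> real \<Rightarrow> (real^2 \<Rightarrow> real) \<Rightarrow> bool" where
  "near l w \<theta> \<epsilon> \<eta> u \<longleftrightarrow> (AE x in MS l. \<bar>u x - w (x $ 1)\<bar> \<le> \<eta>) \<and>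
     (AE x in MS l. \<bar>partial l 1 u x - deriv_I l w (x $ 1)\<bar> \<le> \<eta>) \<and>
     (AE x in MS l. \<bar>1 / \<epsilon> * partial l 2 u x - \<theta> (x $ 1)\<bar> \<le> \<eta>)"

lemma near_mono: "near l w \<theta> \<epsilon> \<eta> u \<Longrightarrow> \<eta> \<le> \<eta>' \<Longrightarrow> near l w \<theta> \<epsilon> \<eta>' u"
  unfolding near_def by (intro conjI; elim conjE eventually_mono; linarith)

text \<open>The mean-zero condition on f identifies the integration constant, so averages of
  approximating primitives approach it up to sign.\<close>

lemma mean0_avg:
  assumes l: "l > 0" and f: "f \<in> borel_measurable (MI l)" and g: "sqi (MI l) g"
    and eq: "AE t in MI l. f t = g t + c" and zero: "(\<integral>t. f t \<partial>MI l) = 0"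
  shows "avg l (\<lambda>x. g (x $ 1)) = - c"
proof -
  have gm: "g \<in> borel_measurable (MI l)" by (rule sqi_measurable[OF g])
  have gi: "integrable (MI l) g" by (rule finite_measure.sqi_integrable[OF finite_MI g])
  have "0 = (\<integral>t. g t + c \<partial>MI l)"
    unfolding zero[symmetric] by (rule integral_cong_AE) (use f gm eq in auto)
  also have "\<dots> = (\<integral>t. g t \<partial>MI l) + (\<integral>t. c \<partial>MI l)"
    by (rule Bochner_Integration.integral_add[OF gi finite_measure.integrable_const[OF finite_MI]])
  also have "\<dots> = (\<integral>t. g t \<partial>MI l) + c * l" by (simp only: measure_MI[OF l])
  finally have "(\<integral>t. g t \<partial>MI l) = - c * l" by simp
  then show ?thesis using l by (simp add: avg_def integral_lift[OF gm])
qed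

text \<open>The constant found for the first derivative integrates to the linear term c1 t, which is
  subtracted before du Bois-Reymond is applied again.\<close>

lemma W22_interval_representation:
  assumes l: "l > 0" and w: "w \<in> W22 (interval_I l)"
  shows "\<exists>c1 c0. (AE t in MI l. deriv_I l w t = prim l (deriv_I l (deriv_I l w)) t + c1) \<and>
    (AE t in MI l. w t = (prim l (prim l (deriv_I l (deriv_I l w))) t + c1 * t) + c0)"
proof -
  note f = W22_I_facts[OF w]
  let ?\<kappa> = "deriv_I l (deriv_I l w)"
  obtain c1 where c1: "AE t in MI l. deriv_I l w t = prim l ?\<kappa> t + c1"
    using W12_interval_representation[OF l f(5,3)] by blast
  let ?V = "\<lambda>t. prim l (prim l ?\<kappa>) t + c1 * t"
  note p = prim_weak_deriv(1)[OF f(3) l]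
  have lin: "is_weak_deriv (interval_I l) 1 (\<lambda>t. c1 * t) (\<lambda>_. c1)"
    unfolding interval_I_box
    by (rule classical_is_weak_deriv[where F = "\<lambda>_ h. c1 * h"]) (auto intro!: derivative_eq_intros)
  have "is_weak_deriv (interval_I l) 1 ?V (\<lambda>t. prim l ?\<kappa> t + c1)"
    using prim_weak_deriv(2)[OF p l] lin unfolding interval_I_box by (rule is_weak_deriv_add)
  from is_weak_deriv_add[OF f(4)[unfolded interval_I_box] is_weak_deriv_scaleR[where c = "-1", OF this[unfolded interval_I_box]]]
  have "is_weak_deriv (interval_I l) 1 (\<lambda>t. w t + (-1) *\<^sub>R ?V t) (\<lambda>t. deriv_I l w t + (-1) *\<^sub>R (prim l ?\<kappa> t + c1))"
    unfolding interval_I_box .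
  note W = this
  have Z: "AE t in MI l. deriv_I l w t + (-1) *\<^sub>R (prim l ?\<kappa> t + c1) = 0" using c1 by eventually_elim simp
  have "is_weak_deriv (interval_I l) 1 (\<lambda>t. w t + (-1) *\<^sub>R ?V t) (\<lambda>_. 0)"
    unfolding interval_I_box
    by (rule weak_deriv_cong_AE[OF W[unfolded interval_I_box] _ Z[unfolded interval_I_box]]) simp
  from du_Bois_Reymond[OF l this] obtain c0 where "AE t in MI l. w t + (-1) *\<^sub>R ?V t = c0" by blast
  then have "AE t in MI l. w t = ?V t + c0" by eventually_elim simp
  with c1 show ?thesis by blast
qed

text \<open>The profile is fixed first, with its number of pieces and its gap \<delta>; only then is
  \<epsilon> taken small. The averages subtracted from the sheet approximate, up to sign, the
  integration constants of w, w' and \<theta>, so the corrected sheet stays near the limit.\<close>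

lemma (in sym_form) approximant:
  assumes Q: "\<And>u. Q (sm u) = S u u" and l: "l > 0"
    and w: "w \<in> W22_mean0 (interval_I l)" and \<theta>: "\<theta> \<in> W12_mean0 (interval_I l)" and \<eta>: "\<eta> > 0"
  shows "\<exists>\<epsilon>0>0. \<forall>\<epsilon>. 0 < \<epsilon> \<longrightarrow> \<epsilon> < \<epsilon>0 \<longrightarrow>
    (\<exists>u\<in>W22_det l \<epsilon>. near l w \<theta> \<epsilon> \<eta> u \<and> J_eps Q l \<epsilon> u \<le> J_lim Q l w \<theta> + \<eta>)"
proof -
  have W: "w \<in> W22 (interval_I l)" and T: "\<theta> \<in> W12 (interval_I l)"
    and w0: "(\<integral>t. w t \<partial>MI l) = 0" and w0': "(\<integral>t. deriv_I l w t \<partial>MI l) = 0" and t0: "(\<integral>t. \<theta> t \<partial>MI l) = 0"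
    using w \<theta> by (simp_all add: W22_mean0_def W12_mean0_def)
  note wf = W22_I_facts[OF W] and tf = W12_I_facts[OF T]
  define \<kappa> where "\<kappa> = deriv_I l (deriv_I l w)"
  define \<tau> where "\<tau> = deriv_I l \<theta>"
  have g: "sqi (MI l) \<kappa>" "sqi (MI l) \<tau>" using wf(3) tf(2) by (simp_all add: \<kappa>_def \<tau>_def)
  obtain c1 c0 where c1: "AE t in MI l. deriv_I l w t = prim l \<kappa> t + c1"
    and c0: "AE t in MI l. w t = (prim l (prim l \<kappa>) t + c1 * t) + c0"
    using W22_interval_representation[OF l W] unfolding \<kappa>_def by blast
  obtain c2 where c2: "AE t in MI l. \<theta> t = prim l \<tau> t + c2"
    using W12_interval_representation[OF l tf(3,2)] unfolding \<tau>_def by blast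
  define V where "V t = prim l (prim l \<kappa>) t + c1 * t" for t
  have sp: "sqi (MI l) (prim l \<kappa>)" "sqi (MI l) (prim l \<tau>)" using prim_weak_deriv(1)[OF _ l] g by blast+
  have spp: "sqi (MI l) (prim l (prim l \<kappa>))" by (rule prim_weak_deriv(1)[OF sp(1) l])
  have sV: "sqi (MI l) V" unfolding V_def[abs_def]
    by (intro sqi_add spp sqi_continuous_MI continuous_intros)
  have aP: "avg l (\<lambda>x. prim l \<kappa> (x $ 1)) = - c1" by (rule mean0_avg[OF l sqi_measurable[OF wf(2)] sp(1) c1 w0'])
  have aT: "avg l (\<lambda>x. prim l \<tau> (x $ 1)) = - c2" by (rule mean0_avg[OF l sqi_measurable[OF tf(1)] sp(2) c2 t0])
  have aV: "avg l (\<lambda>x. V (x $ 1)) = - c0" by (rule mean0_avg[OF l sqi_measurable[OF wf(1)] sV c0[folded V_def] w0])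
  have inS: "AE x in MS l. x \<in> strip_S l" by (rule AE_I2) simp
  \<comment> \<open>One unit of error: values and slopes accumulate at most 4 e + 4 e l, and the
    energy at most e l / 24, all within \<eta>.\<close>
  define e where "e = \<eta> / (8 + 8 * l)"
  have e: "e > 0" using \<eta> l by (simp add: e_def)
  have e8: "e * (8 + 8 * l) = \<eta>" using l by (simp add: e_def)
  obtain m :: nat and k p \<delta> where \<delta>: "\<delta> > 0" and kc: "\<And>j. continuous_on UNIV (k j)"
    and sep: "\<And>i j s t. i \<noteq> j \<Longrightarrow> k i s \<noteq> 0 \<Longrightarrow> k j t \<noteq> 0 \<Longrightarrow> \<delta> \<le> \<bar>s - t\<bar>"
    and P1: "\<And>t. t \<in> interval_I l \<Longrightarrow> \<bar>prim l (\<lambda>s. \<Sum>j<m. k j s) t - prim l \<kappa> t\<bar> \<le> e"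
    and P2: "\<And>t. t \<in> interval_I l \<Longrightarrow> \<bar>prim l (\<lambda>s. \<Sum>j<m. p j * k j s) t - prim l \<tau> t\<bar> \<le> e"
    and P3: "(\<integral>s. (\<Sum>j<m. (k j s)\<^sup>2 * S (rv (p j)) (rv (p j))) \<partial>MI l) \<le> (\<integral>s. qb (\<kappa> s) (\<tau> s) \<partial>MI l)"
    using profile_exists[OF g l e] by blast
  have "\<forall>j. \<exists>H. (\<forall>t. (H has_real_derivative k j t) (at t)) \<and> H (- l / 2) = 0"
    by (intro allI antiderivative_exists kc)
  then obtain H1 where H1: "\<And>j t. (H1 j has_real_derivative k j t) (at t)" "\<And>j. H1 j (- l / 2) = 0" by metis
  have H1c: "continuous_on UNIV (H1 j)" for j
    by (intro continuous_at_imp_continuous_on ballI DERIV_isCont[OF H1(1)])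
  have "\<forall>j. \<exists>H. (\<forall>t. (H has_real_derivative H1 j t) (at t)) \<and> H (- l / 2) = 0"
    by (intro allI antiderivative_exists H1c)
  then obtain H0 where H0: "\<And>j t. (H0 j has_real_derivative H1 j t) (at t)" "\<And>j. H0 j (- l / 2) = 0" by metis
  have H0c: "continuous_on UNIV (H0 j)" for j
    by (intro continuous_at_imp_continuous_on ballI DERIV_isCont[OF H0(1)])
  have prim1: "prim l (\<lambda>s. \<Sum>j<m. a j * k j s) t = (\<Sum>j<m. a j * H1 j t)" if "t \<in> interval_I l" for a t
  proof (rule prim_continuous[OF _ _ _ that])
    show "continuous_on UNIV (\<lambda>s. \<Sum>j<m. a j * k j s)" by (intro continuous_intros kc)
    show "((\<lambda>t. \<Sum>j<m. a j * H1 j t) has_real_derivative (\<Sum>j<m. a j * k j t)) (at t)" for t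
      by (intro DERIV_sum DERIV_cmult H1)
  qed (simp only: H1(2) mult_zero_right sum.neutral_const)
  have prim0: "prim l (\<lambda>s. \<Sum>j<m. H1 j s) t = (\<Sum>j<m. H0 j t)" if "t \<in> interval_I l" for t
  proof (rule prim_continuous[OF _ _ _ that])
    show "continuous_on UNIV (\<lambda>s. \<Sum>j<m. H1 j s)" by (intro continuous_intros H1c)
    show "((\<lambda>t. \<Sum>j<m. H0 j t) has_real_derivative (\<Sum>j<m. H1 j t)) (at t)" for t
      by (intro DERIV_sum H0)
  qed (simp only: H0(2) sum.neutral_const)
  have lim1: "\<bar>(\<Sum>j<m. H1 j t) - prim l \<kappa> t\<bar> \<le> e" if "t \<in> interval_I l" for t
    using P1[OF that] prim1[OF that, of "\<lambda>_. 1"] by simp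
  have lim2: "\<bar>(\<Sum>j<m. p j * H1 j t) - prim l \<tau> t\<bar> \<le> e" if "t \<in> interval_I l" for t
    using P2[OF that] prim1[OF that, of p] by simp
  \<comment> \<open>Integrating the uniform error of the first primitive once more costs a factor
    l.\<close>
  have lim0: "\<bar>(\<Sum>j<m. H0 j t) - prim l (prim l \<kappa>) t\<bar> \<le> e * l" if t: "t \<in> interval_I l" for t
  proof -
    have sH: "sqi (MI l) (\<lambda>s. \<Sum>j<m. H1 j s)" by (intro sqi_continuous_MI continuous_intros H1c)
    have d: "integrable (MI l) (\<lambda>s. (\<Sum>j<m. H1 j s) - prim l \<kappa> s)"
      by (rule finite_measure.sqi_integrable[OF finite_MI sqi_diff[OF sH sp(1)]])
    have "\<bar>prim l (\<lambda>s. \<Sum>j<m. H1 j s) t - prim l (prim l \<kappa>) t\<bar> \<le> (\<integral>s. \<bar>(\<Sum>j<m. H1 j s) - prim l \<kappa> s\<bar> \<partial>MI l)"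
      unfolding prim_diff[OF sH sp(1), symmetric] by (rule prim_abs_le[OF d])
    also have "\<dots> \<le> (\<integral>s. e \<partial>MI l)"
      by (intro Bochner_Integration.integral_mono integrable_abs d finite_measure.integrable_const[OF finite_MI])
        (use lim1 in simp)
    finally show ?thesis by (simp only: measure_MI[OF l] prim0[OF t])
  qed
  let ?arg = "\<lambda>\<epsilon> j x. x $ 1 + \<epsilon> * p j * x $ (2::2)"
  have unif: "\<exists>\<epsilon>0>0. \<forall>\<epsilon>. 0 < \<epsilon> \<longrightarrow> \<epsilon> < \<epsilon>0 \<longrightarrow> (\<forall>x\<in>strip_S l.
      \<bar>(\<Sum>j<m. a j * G j (?arg \<epsilon> j x)) - (\<Sum>j<m. a j * G j (x $ 1))\<bar> \<le> e)"
    if "\<And>j. continuous_on UNIV (G j)" for a and G :: "nat \<Rightarrow> real \<Rightarrow> real"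
  proof -
    have "continuous_on UNIV (\<lambda>y::real \<times> (real^2). \<Sum>j<m. a j * G j (?arg (fst y) j (snd y)))"
      by (intro continuous_intros continuous_on_compose2[OF that]) auto
    from uniformly_close_at_0[of "\<lambda>\<epsilon> x. \<Sum>j<m. a j * G j (?arg \<epsilon> j x)", OF this e] show ?thesis by simp
  qed
  have kc2: "continuous_on UNIV (\<lambda>s. (k j s)\<^sup>2)" for j by (intro continuous_intros kc)
  obtain e1 where e1: "e1 > 0" "\<And>\<epsilon> x. 0 < \<epsilon> \<Longrightarrow> \<epsilon> < e1 \<Longrightarrow> x \<in> strip_S l \<Longrightarrow>
      \<bar>(\<Sum>j<m. 1 * H1 j (?arg \<epsilon> j x)) - (\<Sum>j<m. 1 * H1 j (x $ 1))\<bar> \<le> e"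
    using unif[of H1 "\<lambda>_. 1", OF H1c] by blast
  obtain e2 where e2: "e2 > 0" "\<And>\<epsilon> x. 0 < \<epsilon> \<Longrightarrow> \<epsilon> < e2 \<Longrightarrow> x \<in> strip_S l \<Longrightarrow>
      \<bar>(\<Sum>j<m. p j * H1 j (?arg \<epsilon> j x)) - (\<Sum>j<m. p j * H1 j (x $ 1))\<bar> \<le> e"
    using unif[of H1 p, OF H1c] by blast
  obtain e3 where e3: "e3 > 0" "\<And>\<epsilon> x. 0 < \<epsilon> \<Longrightarrow> \<epsilon> < e3 \<Longrightarrow> x \<in> strip_S l \<Longrightarrow>
      \<bar>(\<Sum>j<m. 1 * H0 j (?arg \<epsilon> j x)) - (\<Sum>j<m. 1 * H0 j (x $ 1))\<bar> \<le> e"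
    using unif[of H0 "\<lambda>_. 1", OF H0c] by blast
  obtain e4 where e4: "e4 > 0" "\<And>\<epsilon> x. 0 < \<epsilon> \<Longrightarrow> \<epsilon> < e4 \<Longrightarrow> x \<in> strip_S l \<Longrightarrow>
      \<bar>(\<Sum>j<m. S (rv (p j)) (rv (p j)) * (k j (?arg \<epsilon> j x))\<^sup>2) - (\<Sum>j<m. S (rv (p j)) (rv (p j)) * (k j (x $ 1))\<^sup>2)\<bar> \<le> e"
    using unif[of "\<lambda>j s. (k j s)\<^sup>2" "\<lambda>j. S (rv (p j)) (rv (p j))", OF kc2] by blast
  define P where "P = (\<Sum>j<m. \<bar>p j\<bar>)"
  have P: "P \<ge> 0" by (simp add: P_def sum_nonneg)
  \<comment> \<open>A bound for |C| that is independent of \<epsilon>, as needed to choose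
    \<epsilon> before C is known.\<close>
  define R where "R = \<bar>c2\<bar> + 2 * e"
  have R: "R \<ge> 0" using e by (simp add: R_def)
  \<comment> \<open>The first four bounds give uniform closeness to \<epsilon> = 0, the fifth makes
    the rulings compatible with the gaps, and the sixth keeps \<epsilon> C x_2 within e.\<close>
  define \<epsilon>0 where "\<epsilon>0 = Min {e1, e2, e3, e4, \<delta> / (P + 1), e / (R + 1)}"
  have "\<epsilon>0 > 0" unfolding \<epsilon>0_def using e1(1) e2(1) e3(1) e4(1) \<delta> P e R by auto
  moreover have "\<exists>u\<in>W22_det l \<epsilon>. near l w \<theta> \<epsilon> \<eta> u \<and> J_eps Q l \<epsilon> u \<le> J_lim Q l w \<theta> + \<eta>"
    if \<epsilon>: "0 < \<epsilon>" "\<epsilon> < \<epsilon>0" for \<epsilon>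
  proof -
    have ee: "\<epsilon> < e1" "\<epsilon> < e2" "\<epsilon> < e3" "\<epsilon> < e4" "\<epsilon> < \<delta> / (P + 1)" "\<epsilon> < e / (R + 1)"
      using \<epsilon>(2) by (simp_all add: \<epsilon>0_def)
    have "\<epsilon> * (P + 1) < \<delta>" using ee(5) P by (simp add: pos_less_divide_eq)
    then have small: "\<epsilon> * (\<Sum>j<m. \<bar>p j\<bar>) < \<delta>" using \<epsilon>(1) by (simp add: P_def[symmetric] algebra_simps)
    have "\<epsilon> * (R + 1) < e" using ee(6) R by (simp add: pos_less_divide_eq)
    then have \<epsilon>R: "\<epsilon> * R \<le> e" using \<epsilon>(1) by (simp add: algebra_simps)
    interpret developable l \<epsilon> \<delta> m k H1 H0 p
      by unfold_locales (use l \<epsilon>(1) kc H1(1) H0(1) sep small in auto)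
    have cb: "comb a G x = (\<Sum>j<m. a j * G j (?arg \<epsilon> j x))" for a G x by (simp add: comb_def ruling_def)
    have xI: "x $ 1 \<in> interval_I l" if "x \<in> strip_S l" for x using that by (simp add: strip_S_def)
    have d1: "\<bar>comb (\<lambda>_. 1) H1 x - prim l \<kappa> (x $ 1)\<bar> \<le> 2 * e" if "x \<in> strip_S l" for x
      using e1(2)[OF \<epsilon>(1) ee(1) that] lim1[OF xI[OF that]] unfolding cb by simp
    have d2: "\<bar>comb p H1 x - prim l \<tau> (x $ 1)\<bar> \<le> 2 * e" if "x \<in> strip_S l" for x
      using e2(2)[OF \<epsilon>(1) ee(2) that] lim2[OF xI[OF that]] unfolding cb by simp
    have d0: "\<bar>comb (\<lambda>_. 1) H0 x - prim l (prim l \<kappa>) (x $ 1)\<bar> \<le> e + e * l" if "x \<in> strip_S l" for x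
      using e3(2)[OF \<epsilon>(1) ee(3) that] lim0[OF xI[OF that]] unfolding cb by simp
    note iS = finite_measure.sqi_integrable[OF finite_MS]
    have cH: "continuous_on UNIV (comb a H1)" "continuous_on UNIV (comb a H0)" for a
      by (intro comb_continuous H1c H0c)+
    have iH: "integrable (MS l) (comb a H1)" for a by (rule iS[OF sqi_continuous_MS[OF cH(1)]])
    define B where "B = avg l (comb (\<lambda>_. 1) H1)"
    define C where "C = avg l (comb p H1)"
    \<comment> \<open>Averages of uniformly close functions are close, and the average of the limit
      is -c1.\<close>
    have B: "\<bar>B + c1\<bar> \<le> 2 * e"
    proof -
      have "\<bar>avg l (comb (\<lambda>_. 1) H1) - avg l (\<lambda>x. prim l \<kappa> (x $ 1))\<bar> \<le> 2 * e"
        by (rule avg_close[OF l iH iS[OF sqi_lift[OF sp(1)]]]) (use inS d1 in \<open>auto elim: eventually_mono\<close>)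
      then show ?thesis by (simp add: B_def aP)
    qed
    have C: "\<bar>C + c2\<bar> \<le> 2 * e"
    proof -
      have "\<bar>avg l (comb p H1) - avg l (\<lambda>x. prim l \<tau> (x $ 1))\<bar> \<le> 2 * e"
        by (rule avg_close[OF l iH iS[OF sqi_lift[OF sp(2)]]]) (use inS d2 in \<open>auto elim: eventually_mono\<close>)
      then show ?thesis by (simp add: C_def aT)
    qed
    let ?g = "\<lambda>x. comb (\<lambda>_. 1) H0 x - (B * x $ 1 + \<epsilon> * C * x $ 2)"
    have cg: "continuous_on UNIV ?g" by (intro continuous_intros cH)
    have ig: "integrable (MS l) ?g" by (rule iS[OF sqi_continuous_MS[OF cg]])
    define A where "A = avg l ?g"
    have gV: "\<bar>?g x - V (x $ 1)\<bar> \<le> 2 * e + 2 * (e * l)" if x: "x \<in> strip_S l" for x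
    proof -
      have x12: "\<bar>x $ 1\<bar> \<le> l / 2" "\<bar>x $ 2\<bar> \<le> 1" using x by (auto simp: strip_S_def interval_I_def)
      have "\<bar>(B + c1) * x $ 1\<bar> \<le> (2 * e) * (l / 2)"
        unfolding abs_mult using B x12 by (intro mult_mono) auto
      moreover have "\<bar>\<epsilon> * C * x $ 2\<bar> \<le> e"
      proof -
        have "\<bar>C\<bar> \<le> R" using C by (simp add: R_def)
        then have "\<bar>\<epsilon> * C * x $ 2\<bar> \<le> \<epsilon> * R * 1"
          unfolding abs_mult using \<epsilon>(1) x12(2) R by (intro mult_mono) auto
        then show ?thesis using \<epsilon>R by simp
      qed
      moreover have "?g x - V (x $ 1) = (comb (\<lambda>_. 1) H0 x - prim l (prim l \<kappa>) (x $ 1)) - (B + c1) * x $ 1 - \<epsilon> * C * x $ 2"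
        by (simp add: V_def algebra_simps)
      ultimately show ?thesis using d0[OF x] by linarith
    qed
    have A: "\<bar>A + c0\<bar> \<le> 2 * e + 2 * (e * l)"
    proof -
      have "\<bar>avg l ?g - avg l (\<lambda>x. V (x $ 1))\<bar> \<le> 2 * e + 2 * (e * l)"
        by (rule avg_close[OF l ig iS[OF sqi_lift[OF sV]]]) (use inS gV in \<open>auto elim: eventually_mono\<close>)
      then show ?thesis by (simp only: A_def aV)
    qed
    let ?u = "sheet A B C"
    have ueq: "?u = (\<lambda>x. ?g x - avg l ?g)" unfolding A_def[symmetric] by (simp add: sheet_def fun_eq_iff)
    note sq = W22_S_sqi[OF sheet_W22[of A B C]]
    note pa = sheet_partials[where A = A and B = B and C = C]
    have m1: "(\<integral>x. partial l 1 ?u x \<partial>MS l) = 0"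
    proof -
      have "(\<integral>x. partial l 1 ?u x \<partial>MS l) = (\<integral>x. comb (\<lambda>_. 1) H1 x - B \<partial>MS l)"
        by (rule integral_cong_AE[OF sqi_measurable[OF sq(2)] _ pa(1)])
          (intro continuous_measurable_lebesgue_on continuous_intros cH)
      also have "\<dots> = 0" unfolding B_def by (rule avg_minus_const[OF l iH])
      finally show ?thesis .
    qed
    have m2: "(\<integral>x. partial l 2 ?u x \<partial>MS l) = 0"
    proof -
      have "(\<integral>x. partial l 2 ?u x \<partial>MS l) = (\<integral>x. \<epsilon> * (comb p H1 x - C) \<partial>MS l)"
        by (rule integral_cong_AE[OF sqi_measurable[OF sq(2)] _ pa(2)])
          (intro continuous_measurable_lebesgue_on continuous_intros cH)
      also have "\<dots> = \<epsilon> * (\<integral>x. comb p H1 x - C \<partial>MS l)" by (rule integral_mult_right_zero)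
      also have "(\<integral>x. comb p H1 x - C \<partial>MS l) = 0" unfolding C_def by (rule avg_minus_const[OF l iH])
      finally show ?thesis by simp
    qed
    have "(\<integral>x. ?u x \<partial>MS l) = 0" unfolding ueq by (rule avg_minus_const[OF l ig])
    then have "?u \<in> W22_mean0 (strip_S l)"
      using m1 m2 sheet_W22[of A B C] by (auto simp: W22_mean0_def dest!: Basis_cases)
    then have U: "?u \<in> W22_det l \<epsilon>" by (simp add: W22_det_def sheet_det)
    have b: "4 * e \<le> \<eta>" "4 * e + 4 * (e * l) \<le> \<eta>" "e * l \<le> 24 * \<eta>"
    proof -
      have "0 \<le> e * l" using e l by simp
      then show "4 * e \<le> \<eta>" "4 * e + 4 * (e * l) \<le> \<eta>" "e * l \<le> 24 * \<eta>"
        using e8 e \<eta> by (simp_all add: algebra_simps)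
    qed
    have N: "near l w \<theta> \<epsilon> \<eta> ?u"
      unfolding near_def
    proof (intro conjI)
      show "AE x in MS l. \<bar>?u x - w (x $ 1)\<bar> \<le> \<eta>"
        using AE_lift[OF c0[folded V_def]] inS
      proof eventually_elim
        case (elim x)
        have "?u x = ?g x - A" by (simp add: sheet_def)
        then show ?case using gV[OF elim(2)] A b elim(1) by linarith
      qed
      show "AE x in MS l. \<bar>partial l 1 ?u x - deriv_I l w (x $ 1)\<bar> \<le> \<eta>"
        using AE_lift[OF c1] pa(1) inS
      proof eventually_elim
        case (elim x)
        then show ?case using d1[OF elim(3)] B b by linarith
      qed
      show "AE x in MS l. \<bar>1 / \<epsilon> * partial l 2 ?u x - \<theta> (x $ 1)\<bar> \<le> \<eta>"
        using AE_lift[OF c2] pa(2) inS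
      proof eventually_elim
        case (elim x)
        have "1 / \<epsilon> * partial l 2 ?u x = comb p H1 x - C" using elim(2) \<epsilon>(1) by simp
        then show ?case using d2[OF elim(3)] C b elim(1) by linarith
      qed
    qed
    have "J_eps Q l \<epsilon> ?u \<le> J_lim Q l w \<theta> + \<eta>"
    proof -
      let ?q = "\<lambda>j. S (rv (p j)) (rv (p j))"
      have qm: "(\<lambda>s. \<Sum>j<m. (k j s)\<^sup>2 * ?q j) \<in> borel_measurable (MI l)"
        by (intro continuous_measurable_lebesgue_on continuous_intros kc)
      have c1: "continuous_on UNIV (\<lambda>x::real^2. \<Sum>j<m. (k j (ruling j x))\<^sup>2 * ?q j)"
        unfolding ruling_def by (intro continuous_intros continuous_on_compose2[OF kc]) auto
      have c2: "continuous_on UNIV (\<lambda>x::real^2. \<Sum>j<m. (k j (x $ 1))\<^sup>2 * ?q j)"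
        by (intro continuous_intros continuous_on_compose2[OF kc]) auto
      have "(\<integral>x. (\<Sum>j<m. (k j (ruling j x))\<^sup>2 * ?q j) \<partial>MS l) \<le> (\<integral>x. (\<Sum>j<m. (k j (x $ 1))\<^sup>2 * ?q j) + e \<partial>MS l)"
      proof (rule integral_mono_AE)
        show "integrable (MS l) (\<lambda>x. \<Sum>j<m. (k j (ruling j x))\<^sup>2 * ?q j)" by (rule iS[OF sqi_continuous_MS[OF c1]])
        show "integrable (MS l) (\<lambda>x. (\<Sum>j<m. (k j (x $ 1))\<^sup>2 * ?q j) + e)"
          by (intro iS sqi_continuous_MS continuous_on_add c2 continuous_on_const)
        show "AE x in MS l. (\<Sum>j<m. (k j (ruling j x))\<^sup>2 * ?q j) \<le> (\<Sum>j<m. (k j (x $ 1))\<^sup>2 * ?q j) + e"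
          using inS
        proof eventually_elim
          case (elim x)
          have "\<bar>(\<Sum>j<m. ?q j * (k j (ruling j x))\<^sup>2) - (\<Sum>j<m. ?q j * (k j (x $ 1))\<^sup>2)\<bar> \<le> e"
            using e4(2)[OF \<epsilon>(1) ee(4) elim] by (simp only: ruling_def)
          then show ?case unfolding mult.commute[of "?q _"] by linarith
        qed
      qed
      also have "\<dots> = (\<integral>x. (\<Sum>j<m. (k j (x $ 1))\<^sup>2 * ?q j) \<partial>MS l) + (\<integral>x. e \<partial>MS l)"
        by (rule Bochner_Integration.integral_add[OF iS[OF sqi_continuous_MS[OF c2]] finite_measure.integrable_const[OF finite_MS]])
      also have "(\<integral>x. (\<Sum>j<m. (k j (x $ 1))\<^sup>2 * ?q j) \<partial>MS l) = (\<integral>s. (\<Sum>j<m. (k j s)\<^sup>2 * ?q j) \<partial>MI l)"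
        by (rule integral_lift[OF qm])
      finally have "(\<integral>x. (\<Sum>j<m. (k j (ruling j x))\<^sup>2 * ?q j) \<partial>MS l) \<le> (\<integral>s. qb (\<kappa> s) (\<tau> s) \<partial>MI l) + e * l"
        using P3 by (simp only: integral_MS_const[OF l])
      moreover have "J_lim Q l w \<theta> = 1 / 24 * (\<integral>s. qb (\<kappa> s) (\<tau> s) \<partial>MI l)"
        by (simp add: J_lim_def Q_bar_eq[OF Q] \<kappa>_def \<tau>_def)
      moreover have "J_eps Q l \<epsilon> ?u = 1 / 24 * (\<integral>x. (\<Sum>j<m. (k j (ruling j x))\<^sup>2 * ?q j) \<partial>MS l)"
        by (rule sheet_energy[OF sym_form_axioms Q])
      ultimately show ?thesis using b(3) by linarith
    qed
    with U N show ?thesis by blast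
  qed
  ultimately show ?thesis by blast
qed

text \<open>The sheet with no pieces. It is the default for those \<epsilon> at which no approximant
  is at hand.\<close>

lemma zero_in_W22_det:
  assumes "l > 0" "\<epsilon> > 0"
  shows "(\<lambda>_. 0) \<in> W22_det l \<epsilon>"
proof -
  interpret developable l \<epsilon> 1 0 "\<lambda>_ _. 0" "\<lambda>_ _. 0" "\<lambda>_ _. 0" "\<lambda>_. 0"
    by unfold_locales (use assms in auto)
  have u: "sheet 0 0 0 = (\<lambda>_. 0)" by (simp add: sheet_def fun_eq_iff comb_def)
  note pa = sheet_partials(1,2)[where A = 0 and B = 0 and C = 0, unfolded u]
  have "(\<integral>x. weak_deriv (strip_S l) b (\<lambda>_. 0 :: real) x \<partial>MS l) = 0" if "b \<in> Basis" for b
    using Basis_cases[OF that] pa by (auto intro!: integral_eq_zero_AE simp: comb_def)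
  then show ?thesis using sheet_W22[of 0 0 0] sheet_det[of 0 0 0] by (simp add: W22_det_def W22_mean0_def u)
qed

section \<open>Weak convergence of the recovery sequence\<close>

lemma is_weak_deriv_component:
  fixes f g :: "'a::euclidean_space \<Rightarrow> real^2"
  assumes w: "is_weak_deriv (box a b) v f g"
  shows "is_weak_deriv (box a b) v (\<lambda>x. f x $ i) (\<lambda>x. g x $ i)"
proof -
  have nth: "y $ i = y \<bullet> axis i 1" for y :: "real^2" by (simp add: inner_axis)
  have L: "f \<in> L1_loc (box a b)" "g \<in> L1_loc (box a b)" using w by (auto simp: is_weak_deriv_def)
  show ?thesis
    unfolding is_weak_deriv_def nth
  proof (intro conjI ballI L1_loc_inner L)
    fix \<phi> :: "'a \<Rightarrow> real" assume \<phi>: "\<phi> \<in> test_functions (box a b)"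
    let ?M = "lebesgue_on (box a b)" and ?e = "axis i 1 :: real^2"
    have "(LINT x|?M. D v \<phi> x *\<^sub>R (f x \<bullet> ?e)) = (LINT x|?M. (D v \<phi> x *\<^sub>R f x) \<bullet> ?e)" by simp
    also have "\<dots> = (LINT x|?M. D v \<phi> x *\<^sub>R f x) \<bullet> ?e"
      by (intro integral_inner_left L1_loc_integrable_test[OF L(1) test_functions_D[OF \<phi>] box_lebesgue])
    also have "(LINT x|?M. D v \<phi> x *\<^sub>R f x) = - (LINT x|?M. \<phi> x *\<^sub>R g x)" using w \<phi> by (simp add: is_weak_deriv_def)
    also have "\<dots> \<bullet> ?e = - ((LINT x|?M. \<phi> x *\<^sub>R g x) \<bullet> ?e)" by simp
    also have "(LINT x|?M. \<phi> x *\<^sub>R g x) \<bullet> ?e = (LINT x|?M. (\<phi> x *\<^sub>R g x) \<bullet> ?e)"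
      by (intro integral_inner_left[symmetric] L1_loc_integrable_test[OF L(2) \<phi> box_lebesgue])
    also have "\<dots> = (LINT x|?M. \<phi> x *\<^sub>R (g x \<bullet> ?e))" by simp
    finally show "(LINT x|?M. D v \<phi> x *\<^sub>R (f x \<bullet> ?e)) = - (LINT x|?M. \<phi> x *\<^sub>R (g x \<bullet> ?e))" .
  qed
qed

lemma uniform_imp_L2_tendsto:
  assumes fin: "finite_measure M" and g0: "sqi M g0"
    and close: "\<And>\<eta>. \<eta> > 0 \<Longrightarrow> \<forall>\<^sub>F i in F. sqi M (g i) \<and> (AE x in M. \<bar>g i x - g0 x\<bar> \<le> \<eta>)"
  shows "((\<lambda>i. \<integral>x. (g i x - g0 x)\<^sup>2 \<partial>M) \<longlongrightarrow> 0) F"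
proof (rule tendstoI)
  fix e :: real assume e: "e > 0"
  define V where "V = measure M (space M) + 1"
  have V: "V > 0" by (simp add: V_def add_nonneg_pos)
  \<comment> \<open>Chosen so that \<eta>^2 V = e/2.\<close>
  define \<eta> where "\<eta> = sqrt (e / (2 * V))"
  have \<eta>: "\<eta> > 0" "\<eta>\<^sup>2 = e / (2 * V)" using e V by (simp_all add: \<eta>_def)
  from close[OF \<eta>(1)] show "\<forall>\<^sub>F i in F. dist (\<integral>x. (g i x - g0 x)\<^sup>2 \<partial>M) 0 < e"
  proof eventually_elim
    case (elim i)
    have gi: "sqi M (g i)" and ae: "AE x in M. \<bar>g i x - g0 x\<bar> \<le> \<eta>" using elim by auto
    have "(\<integral>x. (g i x - g0 x)\<^sup>2 \<partial>M) \<le> (\<integral>x. \<eta>\<^sup>2 \<partial>M)"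
    proof (rule integral_mono_AE[OF sqi_square[OF sqi_diff[OF gi g0]] finite_measure.integrable_const[OF fin]])
      show "AE x in M. (g i x - g0 x)\<^sup>2 \<le> \<eta>\<^sup>2"
        using ae
      proof eventually_elim
        case (elim x)
        then have "\<bar>g i x - g0 x\<bar>\<^sup>2 \<le> \<eta>\<^sup>2" by (intro power_mono) auto
        then show ?case by simp
      qed
    qed
    also have "\<dots> = measure M (space M) * \<eta>\<^sup>2" by simp
    also have "\<dots> \<le> V * \<eta>\<^sup>2" by (intro mult_right_mono) (auto simp: V_def)
    also have "\<dots> = e / 2" using V by (simp add: \<eta>(2))
    also have "\<dots> < e" using e by simp
    finally have "(\<integral>x. (g i x - g0 x)\<^sup>2 \<partial>M) < e" .
    moreover have "0 \<le> (\<integral>x. (g i x - g0 x)\<^sup>2 \<partial>M)" by simp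
    ultimately show ?case by (simp only: dist_real_def diff_0_right abs_of_nonneg)
  qed
qed

lemma L2_tendsto_bounded:
  assumes lim: "((\<lambda>i. \<integral>x. (g i x - g0 x)\<^sup>2 \<partial>M) \<longlongrightarrow> 0) F" and s: "\<forall>\<^sub>F i in F. sqi M (g i)" "sqi M g0"
  shows "\<forall>\<^sub>F i in F. (\<integral>x. (g i x)\<^sup>2 \<partial>M) \<le> 2 + 2 * (\<integral>x. (g0 x)\<^sup>2 \<partial>M)"
proof -
  have "\<forall>\<^sub>F i in F. (\<integral>x. (g i x - g0 x)\<^sup>2 \<partial>M) < 1" using order_tendstoD(2)[OF lim, of 1] by simp
  with s(1) show ?thesis
  proof eventually_elim
    case (elim i)
    have "(\<integral>x. (g i x)\<^sup>2 \<partial>M) = (\<integral>x. ((g i x - g0 x) + g0 x)\<^sup>2 \<partial>M)" by simp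
    also have "\<dots> \<le> 2 * (\<integral>x. (g i x - g0 x)\<^sup>2 \<partial>M) + 2 * (\<integral>x. (g0 x)\<^sup>2 \<partial>M)"
      by (rule integral_square_add_le[OF sqi_diff[OF elim(1) s(2)] s(2)])
    finally show ?case using elim(2) by linarith
  qed
qed

text \<open>Coercivity of \<open>S\<close> applied to the energy identity. The entries are bounded
  together with their factors 1/\<epsilon> and 1/\<epsilon>^2.\<close>

lemma (in sym_form) hessian_bound:
  assumes Q: "\<And>u. Q (sm u) = S u u" and c: "c > 0" "\<And>u. c * (norm u)\<^sup>2 \<le> S u u"
    and w: "w \<in> W22 (strip_S l)"
  shows "(\<integral>x. (partial l 1 (partial l 1 w) x)\<^sup>2 \<partial>MS l) \<le> 24 * J_eps Q l \<epsilon> w / c"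
    "(\<integral>x. (1 / \<epsilon> * partial l 1 (partial l 2 w) x)\<^sup>2 \<partial>MS l) \<le> 24 * J_eps Q l \<epsilon> w / c"
    "(\<integral>x. (1 / \<epsilon>\<^sup>2 * partial l 2 (partial l 2 w) x)\<^sup>2 \<partial>MS l) \<le> 24 * J_eps Q l \<epsilon> w / c"
proof -
  note J = J_eps_eq[where l = l and \<epsilon> = \<epsilon>, OF Q w]
  let ?k = "partial l 1 (partial l 1 w)" and ?t = "\<lambda>x. 1 / \<epsilon> * partial l 1 (partial l 2 w) x"
  let ?g = "\<lambda>x. 1 / \<epsilon>\<^sup>2 * partial l 2 (partial l 2 w) x"
  let ?u = "\<lambda>x. (?k x, ?t x, ?g x)"
  note s = W22_S_sqi(3)[OF w]
  have bound: "(\<integral>x. (h x)\<^sup>2 \<partial>MS l) \<le> 24 * J_eps Q l \<epsilon> w / c"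
    if h: "sqi (MS l) h" "\<And>x. (h x)\<^sup>2 \<le> (norm (?u x))\<^sup>2" for h
  proof -
    have "c * (\<integral>x. (h x)\<^sup>2 \<partial>MS l) = (\<integral>x. c * (h x)\<^sup>2 \<partial>MS l)" by (rule integral_mult_right_zero[symmetric])
    also have "\<dots> \<le> (\<integral>x. S (?u x) (?u x) \<partial>MS l)"
    proof (rule Bochner_Integration.integral_mono[OF _ J(2)])
      show "integrable (MS l) (\<lambda>x. c * (h x)\<^sup>2)" by (intro integrable_mult_right sqi_square h)
      show "c * (h x)\<^sup>2 \<le> S (?u x) (?u x)" for x
        by (rule order_trans[OF mult_left_mono[OF h(2)] c(2)]) (use c(1) in simp)
    qed
    also have "\<dots> = 24 * J_eps Q l \<epsilon> w" unfolding J(3) by simp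
    finally show ?thesis using c(1) by (simp add: pos_le_divide_eq mult.commute)
  qed
  show "(\<integral>x. (?k x)\<^sup>2 \<partial>MS l) \<le> 24 * J_eps Q l \<epsilon> w / c" by (rule bound[OF s]) (simp add: norm_vec3)
  show "(\<integral>x. (?t x)\<^sup>2 \<partial>MS l) \<le> 24 * J_eps Q l \<epsilon> w / c" by (rule bound[OF sqi_cmult[OF s]]) (simp add: norm_vec3)
  show "(\<integral>x. (?g x)\<^sup>2 \<partial>MS l) \<le> 24 * J_eps Q l \<epsilon> w / c" by (rule bound[OF sqi_cmult[OF s]]) (simp add: norm_vec3)
qed

text \<open>For \<epsilon> < 1 the unscaled derivatives are the scaled ones times a factor in
  [0, 1], so bounds pass from scaled to unscaled.\<close>

lemma integral_square_scale_le:
  assumes "0 \<le> c" "c \<le> 1" "AE x in M. h x = c * g x" "sqi M g" "h \<in> borel_measurable M"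
  shows "(\<integral>x. (h x)\<^sup>2 \<partial>M) \<le> (\<integral>x. (g x)\<^sup>2 \<partial>M)"
proof -
  have "(\<integral>x. (h x)\<^sup>2 \<partial>M) = (\<integral>x. c\<^sup>2 * (g x)\<^sup>2 \<partial>M)"
  proof (rule integral_cong_AE)
    show "AE x in M. (h x)\<^sup>2 = c\<^sup>2 * (g x)\<^sup>2" using assms(3) by eventually_elim (simp add: power_mult_distrib)
  qed (use assms(5) sqi_measurable[OF assms(4)] in measurable)
  also have "\<dots> = c\<^sup>2 * (\<integral>x. (g x)\<^sup>2 \<partial>M)" by (rule integral_mult_right_zero)
  also have "\<dots> \<le> 1 * (\<integral>x. (g x)\<^sup>2 \<partial>M)"
    using assms(1,2) by (intro mult_right_mono power_le_one) auto
  finally show ?thesis by simp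
qed

lemma limit_in_W22:
  assumes l: "l > 0" and w: "w \<in> W22 (interval_I l)"
  shows "(\<lambda>x. w (x $ 1)) \<in> W22 (strip_S l)"
    "AE x in MS l. partial l 1 (\<lambda>x. w (x $ 1)) x = deriv_I l w (x $ 1)"
    "AE x in MS l. partial l 2 (\<lambda>x. w (x $ 1)) x = 0"
proof -
  note f = W22_I_facts[OF w]
  note d0 = weak_deriv_lift[OF l f(4,2)] and d1 = weak_deriv_lift[OF l f(5,3)]
  show p1: "AE x in MS l. partial l 1 (\<lambda>x. w (x $ 1)) x = deriv_I l w (x $ 1)"
    using weak_deriv_AE[OF d0(1)[unfolded strip_S_box]] by (simp only: strip_S_box)
  show p2: "AE x in MS l. partial l 2 (\<lambda>x. w (x $ 1)) x = 0"
    using weak_deriv_AE[OF d0(2)[unfolded strip_S_box]] by (simp only: strip_S_box)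
  have z: "(\<lambda>x::real^2. 0 :: real) \<in> L2 (strip_S l)" by (simp add: L2_eq_sqi sqi_def)
  have L: "(\<lambda>x. h (x $ 1)) \<in> L2 (strip_S l)" if "sqi (MI l) h" for h using sqi_lift[OF that] by (simp add: L2_eq_sqi)
  have W12: "g \<in> W12 (strip_S l)"
    if "g \<in> L2 (strip_S l)" "is_weak_deriv (strip_S l) (axis 1 1) g g1" "is_weak_deriv (strip_S l) (axis 2 1) g g2"
      "g1 \<in> L2 (strip_S l)" "g2 \<in> L2 (strip_S l)" for g g1 g2 :: "real^2 \<Rightarrow> real"
    unfolding W12_def using that by (auto dest!: Basis_cases)
  have ae: "g \<in> W12 (strip_S l)" if "AE x in MS l. g x = h x" "h \<in> W12 (strip_S l)" for g h :: "real^2 \<Rightarrow> real"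
  proof -
    have "AE x in MS l. h x = g x" using that(1) by eventually_elim simp
    with that(2) show ?thesis unfolding strip_S_box by (rule W12_cong_AE)
  qed
  have zero: "is_weak_deriv (strip_S l) v (\<lambda>x. 0 :: real) (\<lambda>x. 0)" for v
    unfolding strip_S_box by (rule is_weak_deriv_const)
  have "(\<lambda>x. w (x $ 1)) \<in> W12 (strip_S l)" by (rule W12[OF L[OF f(1)] d0 L[OF f(2)] z])
  moreover have "partial l 1 (\<lambda>x. w (x $ 1)) \<in> W12 (strip_S l)"
    by (rule ae[OF p1 W12[OF L[OF f(2)] d1 L[OF f(3)] z]])
  moreover have "partial l 2 (\<lambda>x. w (x $ 1)) \<in> W12 (strip_S l)"
    by (rule ae[OF p2 W12[OF z zero zero z z]])
  ultimately show "(\<lambda>x. w (x $ 1)) \<in> W22 (strip_S l)" by (auto simp: W22_def dest!: Basis_cases)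
qed

text \<open>Function and scaled gradient converge uniformly by \<open>near\<close>, hence strongly
  in L2. Second derivatives are bounded through the energy, and \<open>weak_deriv_weak_L2\<close>
  identifies their weak limits as derivatives of the strong limits.\<close>

theorem (in sym_form) ribbon_convergesI:
  assumes Q: "\<And>u. Q (sm u) = S u u" and l: "l > 0"
    and w: "w \<in> W22 (interval_I l)" and \<theta>: "\<theta> \<in> W12 (interval_I l)"
    and u: "\<And>\<epsilon>. \<epsilon> > 0 \<Longrightarrow> u \<epsilon> \<in> W22 (strip_S l)"
    and near: "\<And>\<eta>. \<eta> > 0 \<Longrightarrow> \<forall>\<^sub>F \<epsilon> in at_right 0. near l w \<theta> \<epsilon> \<eta> (u \<epsilon>)"
    and energy: "\<forall>\<^sub>F \<epsilon> in at_right 0. J_eps Q l \<epsilon> (u \<epsilon>) \<le> E"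
  shows "ribbon_converges l u w \<theta>"
proof -
  obtain c where c: "c > 0" "\<And>u. c * (norm u)\<^sup>2 \<le> S u u" using qb_bounds by blast
  define R where "R = 24 * E / c"
  have pos: "\<forall>\<^sub>F \<epsilon> in at_right (0::real). 0 < \<epsilon> \<and> \<epsilon> < 1" by (simp add: eventually_at_right_field) (use zero_less_one in blast)
  note wf = W22_I_facts[OF w] and tf = W12_I_facts[OF \<theta>]
  note fM = finite_MS
  let ?w = "\<lambda>x::real^2. w (x $ 1)" and ?dw = "\<lambda>x::real^2. deriv_I l w (x $ 1)" and ?t = "\<lambda>x::real^2. \<theta> (x $ 1)"
  have sl: "sqi (MS l) ?w" "sqi (MS l) ?dw" "sqi (MS l) ?t" by (intro sqi_lift wf tf)+
  note lim = limit_in_W22[OF l w]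
  have us: "\<forall>\<^sub>F \<epsilon> in at_right 0. u \<epsilon> \<in> W22 (strip_S l)" using pos by eventually_elim (simp add: u)
  have s0: "\<forall>\<^sub>F \<epsilon> in at_right 0. sqi (MS l) (u \<epsilon>)" using us by eventually_elim (rule W22_S_sqi(1))
  have s1: "\<forall>\<^sub>F \<epsilon> in at_right 0. sqi (MS l) (partial l i (u \<epsilon>))" for i using us by eventually_elim (rule W22_S_sqi(2))
  have s2: "\<forall>\<^sub>F \<epsilon> in at_right 0. sqi (MS l) (\<lambda>x. 1 / \<epsilon> * partial l 2 (u \<epsilon>) x)"
    using us by eventually_elim (intro sqi_cmult W22_S_sqi(2))
  have L0: "((\<lambda>\<epsilon>. \<integral>x. (u \<epsilon> x - ?w x)\<^sup>2 \<partial>MS l) \<longlongrightarrow> 0) (at_right 0)"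
  proof (rule uniform_imp_L2_tendsto[OF fM sl(1)])
    fix \<eta> :: real assume "\<eta> > 0"
    from near[OF this] s0 show "\<forall>\<^sub>F \<epsilon> in at_right 0. sqi (MS l) (u \<epsilon>) \<and> (AE x in MS l. \<bar>u \<epsilon> x - ?w x\<bar> \<le> \<eta>)"
      by eventually_elim (simp add: near_def)
  qed
  have L1: "((\<lambda>\<epsilon>. \<integral>x. (partial l 1 (u \<epsilon>) x - ?dw x)\<^sup>2 \<partial>MS l) \<longlongrightarrow> 0) (at_right 0)"
  proof (rule uniform_imp_L2_tendsto[OF fM sl(2)])
    fix \<eta> :: real assume "\<eta> > 0"
    from near[OF this] s1[of 1] show "\<forall>\<^sub>F \<epsilon> in at_right 0. sqi (MS l) (partial l 1 (u \<epsilon>)) \<and> (AE x in MS l. \<bar>partial l 1 (u \<epsilon>) x - ?dw x\<bar> \<le> \<eta>)"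
      by eventually_elim (simp add: near_def)
  qed
  have L2: "((\<lambda>\<epsilon>. \<integral>x. (1 / \<epsilon> * partial l 2 (u \<epsilon>) x - ?t x)\<^sup>2 \<partial>MS l) \<longlongrightarrow> 0) (at_right 0)"
  proof (rule uniform_imp_L2_tendsto[OF fM sl(3)])
    fix \<eta> :: real assume "\<eta> > 0"
    from near[OF this] s2 show "\<forall>\<^sub>F \<epsilon> in at_right 0. sqi (MS l) (\<lambda>x. 1 / \<epsilon> * partial l 2 (u \<epsilon>) x) \<and>
        (AE x in MS l. \<bar>1 / \<epsilon> * partial l 2 (u \<epsilon>) x - ?t x\<bar> \<le> \<eta>)"
      by eventually_elim (simp only: near_def simp_thms)
  qed
  define T where "T = 2 + 2 * (\<integral>x. (?t x)\<^sup>2 \<partial>MS l)"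
  note b0 = L2_tendsto_bounded[OF L0 s0 sl(1)] and b1 = L2_tendsto_bounded[OF L1 s1 sl(2)]
    and b2 = L2_tendsto_bounded[OF L2 s2 sl(3), folded T_def]
  \<comment> \<open>The unscaled x_2-derivative is \<epsilon> times a bounded quantity and tends to
    0, in accordance with a limit independent of x_2.\<close>
  have q2: "\<forall>\<^sub>F \<epsilon> in at_right 0. (\<integral>x. (partial l 2 (u \<epsilon>) x)\<^sup>2 \<partial>MS l) \<le> \<epsilon>\<^sup>2 * T"
    using pos b2
  proof eventually_elim
    case (elim \<epsilon>)
    have "(\<integral>x. (partial l 2 (u \<epsilon>) x)\<^sup>2 \<partial>MS l) = (\<integral>x. \<epsilon>\<^sup>2 * (1 / \<epsilon> * partial l 2 (u \<epsilon>) x)\<^sup>2 \<partial>MS l)"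
      using elim(1) by (simp add: power_mult_distrib power_divide)
    also have "\<dots> = \<epsilon>\<^sup>2 * (\<integral>x. (1 / \<epsilon> * partial l 2 (u \<epsilon>) x)\<^sup>2 \<partial>MS l)" by (rule integral_mult_right_zero)
    finally show ?case using elim(2) by (simp only: mult_left_mono zero_le_power2)
  qed
  have L3: "((\<lambda>\<epsilon>. \<integral>x. (partial l 2 (u \<epsilon>) x - 0)\<^sup>2 \<partial>MS l) \<longlongrightarrow> 0) (at_right 0)"
  proof (rule tendsto_sandwich[OF _ _ tendsto_const])
    show "\<forall>\<^sub>F \<epsilon> in at_right 0. 0 \<le> (\<integral>x. (partial l 2 (u \<epsilon>) x - 0)\<^sup>2 \<partial>MS l)" by simp
    show "\<forall>\<^sub>F \<epsilon> in at_right 0. (\<integral>x. (partial l 2 (u \<epsilon>) x - 0)\<^sup>2 \<partial>MS l) \<le> \<epsilon>\<^sup>2 * T" using q2 by simp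
    have "((\<lambda>\<epsilon>. \<epsilon>\<^sup>2 * T) \<longlongrightarrow> 0\<^sup>2 * T) (at_right 0)" by (intro tendsto_intros)
    then show "((\<lambda>\<epsilon>. \<epsilon>\<^sup>2 * T) \<longlongrightarrow> 0) (at_right 0)" by simp
  qed
  have L2cong: "((\<lambda>\<epsilon>. \<integral>x. (g \<epsilon> x - h' x)\<^sup>2 \<partial>MS l) \<longlongrightarrow> 0) (at_right 0)"
    if "((\<lambda>\<epsilon>. \<integral>x. (g \<epsilon> x - h x)\<^sup>2 \<partial>MS l) \<longlongrightarrow> 0) (at_right 0)" "AE x in MS l. h' x = h x"
      "\<forall>\<^sub>F \<epsilon> in at_right 0. sqi (MS l) (g \<epsilon>)" "sqi (MS l) h" "sqi (MS l) h'" for g h h'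
  proof -
    have "\<forall>\<^sub>F \<epsilon> in at_right 0. (\<integral>x. (g \<epsilon> x - h x)\<^sup>2 \<partial>MS l) = (\<integral>x. (g \<epsilon> x - h' x)\<^sup>2 \<partial>MS l)"
      using that(3)
    proof eventually_elim
      case (elim \<epsilon>)
      show ?case
      proof (rule integral_cong_AE)
        show "AE x in MS l. (g \<epsilon> x - h x)\<^sup>2 = (g \<epsilon> x - h' x)\<^sup>2" using that(2) by eventually_elim simp
      qed (use sqi_measurable[OF elim] sqi_measurable[OF that(4)] sqi_measurable[OF that(5)] in measurable)
    qed
    with that(1) show ?thesis by (rule Lim_transform_eventually)
  qed
  have lp: "sqi (MS l) (partial l i ?w)" for i by (rule W22_S_sqi(2)[OF lim(1)])
  have zs: "sqi (MS l) (\<lambda>_. 0)" by (simp add: sqi_def)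
  note M1 = L2cong[OF L1 lim(2) s1 sl(2) lp] and M2 = L2cong[OF L3 lim(3) s1 zs lp]
  have hess: "\<forall>\<^sub>F \<epsilon> in at_right 0.
      (\<integral>x. (partial l 1 (partial l 1 (u \<epsilon>)) x)\<^sup>2 \<partial>MS l) \<le> R \<and>
      (\<integral>x. (1 / \<epsilon> * partial l 1 (partial l 2 (u \<epsilon>)) x)\<^sup>2 \<partial>MS l) \<le> R \<and>
      (\<integral>x. (1 / \<epsilon>\<^sup>2 * partial l 2 (partial l 2 (u \<epsilon>)) x)\<^sup>2 \<partial>MS l) \<le> R"
    using us energy
  proof eventually_elim
    case (elim \<epsilon>)
    have "24 * J_eps Q l \<epsilon> (u \<epsilon>) / c \<le> R"
      unfolding R_def using elim(2) c(1) by (intro divide_right_mono) auto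
    then show ?case
      using hessian_bound[where \<epsilon> = \<epsilon>, OF Q c elim(1)] by (intro conjI) (rule order_trans, assumption, assumption)+
  qed
  have mixed: "AE x in MS l. partial l 2 (partial l 1 v) x = partial l 1 (partial l 2 v) x" if "v \<in> W22 (strip_S l)" for v
    using W22_S_sqi(4,5)[OF that] unfolding strip_S_box by (intro weak_deriv_commute)
  \<comment> \<open>Each unscaled second derivative is 1, \<epsilon> or \<epsilon>^2 times a bounded
    scaled one, with the two mixed derivatives equal almost everywhere.\<close>
  have second: "\<forall>\<^sub>F \<epsilon> in at_right 0. (\<integral>x. (partial l i (partial l j (u \<epsilon>)) x)\<^sup>2 \<partial>MS l) \<le> R" for i j :: 2
    using us pos hess
  proof eventually_elim
    case (elim \<epsilon>)
    note s = W22_S_sqi(3)[OF elim(1)]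
    have t: "(\<integral>x. (partial l 1 (partial l 2 (u \<epsilon>)) x)\<^sup>2 \<partial>MS l) \<le> (\<integral>x. (1 / \<epsilon> * partial l 1 (partial l 2 (u \<epsilon>)) x)\<^sup>2 \<partial>MS l)"
      by (rule integral_square_scale_le[where c = \<epsilon>, OF _ _ _ sqi_cmult[OF s] sqi_measurable[OF s]]) (use elim(2) in simp_all)
    have "(\<integral>x. (partial l 2 (partial l 1 (u \<epsilon>)) x)\<^sup>2 \<partial>MS l) \<le> (\<integral>x. (partial l 1 (partial l 2 (u \<epsilon>)) x)\<^sup>2 \<partial>MS l)"
      by (rule integral_square_scale_le[where c = 1, OF _ _ _ s sqi_measurable[OF s]]) (use mixed[OF elim(1)] in simp_all)
    moreover have "(\<integral>x. (partial l 2 (partial l 2 (u \<epsilon>)) x)\<^sup>2 \<partial>MS l) \<le> (\<integral>x. (1 / \<epsilon>\<^sup>2 * partial l 2 (partial l 2 (u \<epsilon>)) x)\<^sup>2 \<partial>MS l)"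
      by (rule integral_square_scale_le[where c = "\<epsilon>\<^sup>2", OF _ _ _ sqi_cmult[OF s] sqi_measurable[OF s]])
        (use elim(2) in \<open>simp_all add: power_le_one\<close>)
    ultimately have "(\<integral>x. (partial l a (partial l b (u \<epsilon>)) x)\<^sup>2 \<partial>MS l) \<le> R" if "a = 1 \<or> a = 2" "b = 1 \<or> b = 2" for a b :: 2
      using that elim(3) t by (elim disjE) (simp_all only:, linarith+)
    then show ?case using exhaust_2 by blast
  qed
  have wk2: "((\<lambda>\<epsilon>. \<integral>x. partial l i (partial l j (u \<epsilon>)) x * \<psi> x \<partial>MS l) \<longlongrightarrow> (\<integral>x. partial l i (partial l j ?w) x * \<psi> x \<partial>MS l)) (at_right 0)"
    if "sqi (MS l) \<psi>" and m: "((\<lambda>\<epsilon>. \<integral>x. (partial l j (u \<epsilon>) x - partial l j ?w x)\<^sup>2 \<partial>MS l) \<longlongrightarrow> 0) (at_right 0)" for \<psi> i j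
  proof -
    have "\<forall>\<^sub>F \<epsilon> in at_right 0. is_weak_deriv (strip_S l) (axis i 1) (partial l j (u \<epsilon>)) (partial l i (partial l j (u \<epsilon>))) \<and>
        sqi (MS l) (partial l j (u \<epsilon>)) \<and> sqi (MS l) (partial l i (partial l j (u \<epsilon>))) \<and>
        (\<integral>x. (partial l i (partial l j (u \<epsilon>)) x)\<^sup>2 \<partial>MS l) \<le> R"
      using us second[of i j] by eventually_elim (intro conjI W22_S_sqi)
    from weak_deriv_weak_L2[where a = "Slo l" and b = "Shi l", folded strip_S_box, OF this W22_S_sqi(5,2,3)[OF lim(1)] m that(1)]
    show ?thesis .
  qed
  have W22conv: "weakly_converges (W22 (strip_S l)) (W22_norm (strip_S l)) u ?w (at_right 0)"
  proof (rule W22S.weakly_convergesI[OF lim(1) us])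
    fix j \<psi> assume j: "j < (7::nat)" and \<psi>: "sqi (MS l) \<psi>"
    note str = strong_imp_weak_L2[OF _ _ \<psi>]
    show "((\<lambda>\<epsilon>. \<integral>x. D22 l j (u \<epsilon>) x * \<psi> x \<partial>MS l) \<longlongrightarrow> (\<integral>x. D22 l j ?w x * \<psi> x \<partial>MS l)) (at_right 0)"
      using j unfolding less7
      by (elim disjE) (simp_all only: D22_simps, rule str[OF s0 sl(1) L0], rule str[OF s1 lp M1], rule str[OF s1 lp M2],
        rule wk2[OF \<psi> M1], rule wk2[OF \<psi> M1], rule wk2[OF \<psi> M2], rule wk2[OF \<psi> M2])
  next
    show "\<forall>\<^sub>F \<epsilon> in at_right 0. (\<Sum>j<7. \<integral>x. (D22 l j (u \<epsilon>) x)\<^sup>2 \<partial>MS l) \<le>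
        (2 + 2 * (\<integral>x. (?w x)\<^sup>2 \<partial>MS l)) + (2 + 2 * (\<integral>x. (?dw x)\<^sup>2 \<partial>MS l)) + \<bar>T\<bar> + 4 * R"
      using pos b0 b1 q2 second[of 1 1] second[of 2 1] second[of 1 2] second[of 2 2]
    proof eventually_elim
      case (elim \<epsilon>)
      have "\<epsilon>\<^sup>2 * T \<le> \<epsilon>\<^sup>2 * \<bar>T\<bar>" by (intro mult_left_mono) auto
      also have "\<dots> \<le> 1 * \<bar>T\<bar>" using elim(1) by (intro mult_right_mono power_le_one) auto
      finally have "(\<integral>x. (partial l 2 (u \<epsilon>) x)\<^sup>2 \<partial>MS l) \<le> \<bar>T\<bar>" using elim(4) by linarith
      moreover have "(\<Sum>j<7. \<integral>x. (D22 l j (u \<epsilon>) x)\<^sup>2 \<partial>MS l) =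
        (\<integral>x. (u \<epsilon> x)\<^sup>2 \<partial>MS l) + (\<integral>x. (partial l 1 (u \<epsilon>) x)\<^sup>2 \<partial>MS l) + (\<integral>x. (partial l 2 (u \<epsilon>) x)\<^sup>2 \<partial>MS l) +
        (\<integral>x. (partial l 1 (partial l 1 (u \<epsilon>)) x)\<^sup>2 \<partial>MS l) + (\<integral>x. (partial l 2 (partial l 1 (u \<epsilon>)) x)\<^sup>2 \<partial>MS l) +
        (\<integral>x. (partial l 1 (partial l 2 (u \<epsilon>)) x)\<^sup>2 \<partial>MS l) + (\<integral>x. (partial l 2 (partial l 2 (u \<epsilon>)) x)\<^sup>2 \<partial>MS l)"
        by (simp add: D22_def eval_nat_numeral)
      ultimately show ?case using elim(2,3,5-8) by linarith
    qed
  qed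
  let ?G = "\<lambda>\<epsilon>. scaled_grad l \<epsilon> (u \<epsilon>)" and ?L = "\<lambda>x::real^2. vector [?dw x, ?t x] :: real^2"
  note ld = limit_grad_deriv[OF l w \<theta>]
  have LW: "?L \<in> W12 (strip_S l)"
  proof -
    have "(\<lambda>x. vector [deriv_I l (deriv_I l w) (x $ 1), deriv_I l \<theta> (x $ 1)] :: real^2) \<in> L2 (strip_S l)"
      by (intro L2_vector sqi_lift wf tf)
    moreover have "(\<lambda>x::real^2. vector [0, 0] :: real^2) \<in> L2 (strip_S l)" by (intro L2_vector zs)
    moreover have "?L \<in> L2 (strip_S l)" by (intro L2_vector sl)
    ultimately show ?thesis unfolding W12_def using ld by (auto dest!: Basis_cases)
  qed
  have GW: "scaled_grad l \<epsilon> v \<in> W12 (strip_S l)" if v: "v \<in> W22 (strip_S l)" for \<epsilon> v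
  proof -
    note s = W22_S_sqi(2,3)[OF v]
    have L: "(\<lambda>x. vector [partial l i (partial l 1 v) x, 1 / \<epsilon> * partial l i (partial l 2 v) x] :: real^2) \<in> L2 (strip_S l)" for i
      by (intro L2_vector sqi_cmult s)
    moreover have "scaled_grad l \<epsilon> v \<in> L2 (strip_S l)"
      unfolding scaled_grad_def[abs_def] by (intro L2_vector sqi_cmult s)
    ultimately show ?thesis unfolding W12_def using scaled_grad_deriv(2)[OF v, where \<epsilon> = \<epsilon>] by (auto dest!: Basis_cases)
  qed
  have GWe: "\<forall>\<^sub>F \<epsilon> in at_right 0. ?G \<epsilon> \<in> W12 (strip_S l)" using us by eventually_elim (rule GW)
  let ?DG = "\<lambda>i k \<epsilon> x. weak_deriv (strip_S l) (axis i 1) (?G \<epsilon>) x $ (k::2)" and ?DL = "\<lambda>i k x. weak_deriv (strip_S l) (axis i 1) ?L x $ (k::2)"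
  have wd: "is_weak_deriv (strip_S l) (axis i 1) (\<lambda>x. f x $ k) (\<lambda>x. weak_deriv (strip_S l) (axis i 1) f x $ k)"
    "sqi (MS l) (\<lambda>x. f x $ k)" "sqi (MS l) (\<lambda>x. weak_deriv (strip_S l) (axis i 1) f x $ k)"
    if f: "f \<in> W12 (strip_S l)" for f :: "real^2 \<Rightarrow> real^2" and i k
  proof -
    note d = W12_D[OF f[unfolded strip_S_box]]
    show "is_weak_deriv (strip_S l) (axis i 1) (\<lambda>x. f x $ k) (\<lambda>x. weak_deriv (strip_S l) (axis i 1) f x $ k)"
      unfolding strip_S_box by (rule is_weak_deriv_component[OF d(2)[OF axis_Basis]])
    show "sqi (MS l) (\<lambda>x. f x $ k)" "sqi (MS l) (\<lambda>x. weak_deriv (strip_S l) (axis i 1) f x $ k)"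
      unfolding strip_S_box by (rule L2_component[OF d(1)] L2_component[OF d(3)[OF axis_Basis]])+
  qed
  have bG: "\<forall>\<^sub>F \<epsilon> in at_right 0. (\<integral>x. (?DG i k \<epsilon> x)\<^sup>2 \<partial>MS l) \<le> R" for i k :: 2
    using us pos hess
  proof eventually_elim
    case (elim \<epsilon>)
    note s = W22_S_sqi(3)[OF elim(1)]
    have ae: "AE x in MS l. ?DG i 1 \<epsilon> x = partial l i (partial l 1 (u \<epsilon>)) x"
      "AE x in MS l. ?DG i 2 \<epsilon> x = 1 / \<epsilon> * partial l i (partial l 2 (u \<epsilon>)) x" for i
      using scaled_grad_deriv(1)[OF elim(1), of i \<epsilon>] by (eventually_elim, simp)+
    note m = wd(3)[OF GW[OF elim(1)], THEN sqi_measurable]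
    have 11: "(\<integral>x. (?DG 1 1 \<epsilon> x)\<^sup>2 \<partial>MS l) \<le> (\<integral>x. (partial l 1 (partial l 1 (u \<epsilon>)) x)\<^sup>2 \<partial>MS l)"
    proof (rule integral_square_scale_le[where c = 1, OF _ _ _ s m])
      show "AE x in MS l. ?DG 1 1 \<epsilon> x = 1 * partial l 1 (partial l 1 (u \<epsilon>)) x" using ae(1)[of 1] by simp
    qed simp_all
    have 12: "(\<integral>x. (?DG 1 2 \<epsilon> x)\<^sup>2 \<partial>MS l) \<le> (\<integral>x. (1 / \<epsilon> * partial l 1 (partial l 2 (u \<epsilon>)) x)\<^sup>2 \<partial>MS l)"
    proof (rule integral_square_scale_le[where c = 1, OF _ _ _ sqi_cmult[OF s] m])
      show "AE x in MS l. ?DG 1 2 \<epsilon> x = 1 * (1 / \<epsilon> * partial l 1 (partial l 2 (u \<epsilon>)) x)" using ae(2)[of 1] by simp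
    qed simp_all
    \<comment> \<open>The x_2-derivatives of the scaled gradient carry one factor 1/\<epsilon> less
      than the corresponding entries of the scaled Hessian.\<close>
    have 21: "(\<integral>x. (?DG 2 1 \<epsilon> x)\<^sup>2 \<partial>MS l) \<le> (\<integral>x. (1 / \<epsilon> * partial l 1 (partial l 2 (u \<epsilon>)) x)\<^sup>2 \<partial>MS l)"
    proof (rule integral_square_scale_le[where c = \<epsilon>, OF _ _ _ sqi_cmult[OF s] m])
      show "AE x in MS l. ?DG 2 1 \<epsilon> x = \<epsilon> * (1 / \<epsilon> * partial l 1 (partial l 2 (u \<epsilon>)) x)"
        using ae(1)[of 2] mixed[OF elim(1)]
      proof eventually_elim
        case (elim x)
        then show ?case using \<open>0 < \<epsilon> \<and> \<epsilon> < 1\<close> by simp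
      qed
    qed (use elim(2) in simp_all)
    have 22: "(\<integral>x. (?DG 2 2 \<epsilon> x)\<^sup>2 \<partial>MS l) \<le> (\<integral>x. (1 / \<epsilon>\<^sup>2 * partial l 2 (partial l 2 (u \<epsilon>)) x)\<^sup>2 \<partial>MS l)"
    proof (rule integral_square_scale_le[where c = \<epsilon>, OF _ _ _ sqi_cmult[OF s] m])
      show "AE x in MS l. ?DG 2 2 \<epsilon> x = \<epsilon> * (1 / \<epsilon>\<^sup>2 * partial l 2 (partial l 2 (u \<epsilon>)) x)"
        using ae(2)[of 2]
      proof eventually_elim
        case (elim x)
        then show ?case using \<open>0 < \<epsilon> \<and> \<epsilon> < 1\<close> by (simp add: power2_eq_square)
      qed
    qed (use elim(2) in simp_all)
    have "(\<integral>x. (?DG a b \<epsilon> x)\<^sup>2 \<partial>MS l) \<le> R" if "a = 1 \<or> a = 2" "b = 1 \<or> b = 2" for a b :: 2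
      using that elim(3) 11 12 21 22 by (elim disjE) (simp_all only:, linarith+)
    then show ?case using exhaust_2 by blast
  qed
  have wkG: "((\<lambda>\<epsilon>. \<integral>x. ?DG i k \<epsilon> x * \<psi> x \<partial>MS l) \<longlongrightarrow> (\<integral>x. ?DL i k x * \<psi> x \<partial>MS l)) (at_right 0)"
    if \<psi>: "sqi (MS l) \<psi>" and m: "((\<lambda>\<epsilon>. \<integral>x. (?G \<epsilon> x $ k - ?L x $ k)\<^sup>2 \<partial>MS l) \<longlongrightarrow> 0) (at_right 0)" for \<psi> i k
  proof -
    have "\<forall>\<^sub>F \<epsilon> in at_right 0. is_weak_deriv (strip_S l) (axis i 1) (\<lambda>x. ?G \<epsilon> x $ k) (?DG i k \<epsilon>) \<and>
        sqi (MS l) (\<lambda>x. ?G \<epsilon> x $ k) \<and> sqi (MS l) (?DG i k \<epsilon>) \<and>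
        (\<integral>x. (?DG i k \<epsilon> x)\<^sup>2 \<partial>MS l) \<le> R"
      using GWe bG[of i k] by eventually_elim (intro conjI wd)
    from weak_deriv_weak_L2[where a = "Slo l" and b = "Shi l", folded strip_S_box, OF this wd[OF LW] m \<psi>]
    show ?thesis .
  qed
  have N1: "((\<lambda>\<epsilon>. \<integral>x. (?G \<epsilon> x $ 1 - ?L x $ 1)\<^sup>2 \<partial>MS l) \<longlongrightarrow> 0) (at_right 0)"
    using L1 by (simp add: scaled_grad_def)
  have N2: "((\<lambda>\<epsilon>. \<integral>x. (?G \<epsilon> x $ 2 - ?L x $ 2)\<^sup>2 \<partial>MS l) \<longlongrightarrow> 0) (at_right 0)"
    using L2 by (simp add: scaled_grad_def)
  have W12conv: "weakly_converges (W12 (strip_S l)) (W12_norm (strip_S l)) ?G ?L (at_right 0)"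
  proof (rule W12S.weakly_convergesI[OF LW GWe])
    fix j \<psi> assume j: "j < (6::nat)" and \<psi>: "sqi (MS l) \<psi>"
    have gs: "\<forall>\<^sub>F \<epsilon> in at_right 0. sqi (MS l) (\<lambda>x. ?G \<epsilon> x $ k)" for k using GWe by eventually_elim (rule wd(2))
    note str = strong_imp_weak_L2[OF gs wd(2)[OF LW] \<psi>]
    show "((\<lambda>\<epsilon>. \<integral>x. D12 l j (?G \<epsilon>) x * \<psi> x \<partial>MS l) \<longlongrightarrow> (\<integral>x. D12 l j ?L x * \<psi> x \<partial>MS l)) (at_right 0)"
      using j unfolding less6
      by (elim disjE) (simp_all only: D12_simps, rule str[OF N1], rule str[OF N2],
        rule wkG[OF \<psi> N1], rule wkG[OF \<psi> N2], rule wkG[OF \<psi> N1], rule wkG[OF \<psi> N2])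
  next
    show "\<forall>\<^sub>F \<epsilon> in at_right 0. (\<Sum>j<6. \<integral>x. (D12 l j (?G \<epsilon>) x)\<^sup>2 \<partial>MS l) \<le>
        (2 + 2 * (\<integral>x. (?dw x)\<^sup>2 \<partial>MS l)) + T + 4 * R"
      using b1 b2 bG[of 1 1] bG[of 1 2] bG[of 2 1] bG[of 2 2]
    proof eventually_elim
      case (elim \<epsilon>)
      have "(\<Sum>j<6. \<integral>x. (D12 l j (?G \<epsilon>) x)\<^sup>2 \<partial>MS l) =
        (\<integral>x. (?G \<epsilon> x $ 1)\<^sup>2 \<partial>MS l) + (\<integral>x. (?G \<epsilon> x $ 2)\<^sup>2 \<partial>MS l) +
        (\<integral>x. (?DG 1 1 \<epsilon> x)\<^sup>2 \<partial>MS l) + (\<integral>x. (?DG 1 2 \<epsilon> x)\<^sup>2 \<partial>MS l) +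
        (\<integral>x. (?DG 2 1 \<epsilon> x)\<^sup>2 \<partial>MS l) + (\<integral>x. (?DG 2 2 \<epsilon> x)\<^sup>2 \<partial>MS l)"
        by (simp add: D12_def eval_nat_numeral)
      moreover have "(\<integral>x. (?G \<epsilon> x $ 1)\<^sup>2 \<partial>MS l) = (\<integral>x. (partial l 1 (u \<epsilon>) x)\<^sup>2 \<partial>MS l)"
        "(\<integral>x. (?G \<epsilon> x $ 2)\<^sup>2 \<partial>MS l) = (\<integral>x. (1 / \<epsilon> * partial l 2 (u \<epsilon>) x)\<^sup>2 \<partial>MS l)"
        by (simp_all add: scaled_grad_def)
      ultimately show ?case using elim by linarith
    qed
  qed
  show ?thesis unfolding ribbon_converges_def using W22conv W12conv by blast
qed

text \<open>For each \<open>\<epsilon>\<close> an admissible function is chosen whose error is within \<open>\<epsilon>\<close> of the smallest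
  possible one; this replaces a diagonal argument.\<close>

theorem (in sym_form) recovery_sequence:
  assumes Q: "\<And>u. Q (sm u) = S u u" and l: "l > 0"
    and w: "w \<in> W22_mean0 (interval_I l)" and \<theta>: "\<theta> \<in> W12_mean0 (interval_I l)"
  shows "\<exists>w\<epsilon>. (\<forall>\<epsilon>>0. w\<epsilon> \<epsilon> \<in> W22_det l \<epsilon>) \<and> ribbon_converges l w\<epsilon> w \<theta> \<and>
    Limsup (at_right 0) (\<lambda>\<epsilon>. ereal (J_eps Q l \<epsilon> (w\<epsilon> \<epsilon>))) \<le> ereal (J_lim Q l w \<theta>)"
proof -
  define good where "good \<epsilon> \<eta> u \<longleftrightarrow> near l w \<theta> \<epsilon> \<eta> u \<and> J_eps Q l \<epsilon> u \<le> J_lim Q l w \<theta> + \<eta>" for \<epsilon> \<eta> u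
  \<comment> \<open>The errors attainable at this \<epsilon>. Every fixed \<eta> > 0 belongs to the
    set once \<epsilon> is small, so its infimum tends to 0.\<close>
  define A where "A \<epsilon> = {\<eta>. \<eta> > 0 \<and> (\<exists>u\<in>W22_det l \<epsilon>. good \<epsilon> \<eta> u)}" for \<epsilon>
  have bdd: "bdd_below (A \<epsilon>)" for \<epsilon> by (rule bdd_belowI[of _ 0]) (auto simp: A_def)
  have ev: "\<exists>\<epsilon>0>0. \<forall>\<epsilon>. 0 < \<epsilon> \<longrightarrow> \<epsilon> < \<epsilon>0 \<longrightarrow> \<eta> \<in> A \<epsilon>" if "\<eta> > 0" for \<eta>
    using approximant[OF Q l w \<theta> that] that unfolding A_def good_def by blast
  \<comment> \<open>The infimum may fail to be attained, hence the slack \<epsilon>, which tends to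
    0 as well. Where the set is empty, the zero function is taken.\<close>
  have "\<exists>u. u \<in> W22_det l \<epsilon> \<and> (A \<epsilon> \<noteq> {} \<longrightarrow> (\<exists>\<eta> < Inf (A \<epsilon>) + \<epsilon>. good \<epsilon> \<eta> u))" if \<epsilon>: "\<epsilon> > 0" for \<epsilon>
  proof (cases "A \<epsilon> = {}")
    case True
    then show ?thesis using zero_in_W22_det[OF l \<epsilon>] by blast
  next
    case False
    have "Inf (A \<epsilon>) < Inf (A \<epsilon>) + \<epsilon>" using \<epsilon> by simp
    from cInf_lessD[OF False this] obtain \<eta> where "\<eta> \<in> A \<epsilon>" "\<eta> < Inf (A \<epsilon>) + \<epsilon>" by blast
    then show ?thesis unfolding A_def by blast
  qed
  then have "\<forall>\<epsilon>. \<exists>u. \<epsilon> > 0 \<longrightarrow> u \<in> W22_det l \<epsilon> \<and> (A \<epsilon> \<noteq> {} \<longrightarrow> (\<exists>\<eta> < Inf (A \<epsilon>) + \<epsilon>. good \<epsilon> \<eta> u))" by blast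
  then obtain u where u: "\<And>\<epsilon>. \<epsilon> > 0 \<Longrightarrow> u \<epsilon> \<in> W22_det l \<epsilon>"
    "\<And>\<epsilon>. \<epsilon> > 0 \<Longrightarrow> A \<epsilon> \<noteq> {} \<Longrightarrow> \<exists>\<eta> < Inf (A \<epsilon>) + \<epsilon>. good \<epsilon> \<eta> (u \<epsilon>)" by metis
  have goodev: "\<forall>\<^sub>F \<epsilon> in at_right 0. good \<epsilon> \<eta> (u \<epsilon>)" if \<eta>: "\<eta> > 0" for \<eta>
  proof -
    have "\<eta> / 2 > 0" using \<eta> by simp
    from ev[OF this] obtain \<epsilon>0 where e0: "\<epsilon>0 > 0" "\<And>\<epsilon>. 0 < \<epsilon> \<Longrightarrow> \<epsilon> < \<epsilon>0 \<Longrightarrow> \<eta> / 2 \<in> A \<epsilon>" by blast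
    \<comment> \<open>An infimum of at most \<eta>/2 and a slack below \<eta>/2 add up to at most
      \<eta>.\<close>
    have "good \<epsilon> \<eta> (u \<epsilon>)" if \<epsilon>: "0 < \<epsilon>" "\<epsilon> < min \<epsilon>0 (\<eta> / 2)" for \<epsilon>
    proof -
      have a: "\<eta> / 2 \<in> A \<epsilon>" using e0(2) \<epsilon> by simp
      then have "A \<epsilon> \<noteq> {}" by blast
      from u(2)[OF \<epsilon>(1) this] obtain \<eta>' where h: "\<eta>' < Inf (A \<epsilon>) + \<epsilon>" "good \<epsilon> \<eta>' (u \<epsilon>)" by blast
      have "Inf (A \<epsilon>) \<le> \<eta> / 2" by (rule cInf_lower[OF a bdd])
      then have "\<eta>' \<le> \<eta>" using h(1) \<epsilon>(2) by simp
      then show ?thesis using h(2) near_mono[of l w \<theta> \<epsilon> \<eta>' "u \<epsilon>" \<eta>] by (simp add: good_def)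
    qed
    moreover have "min \<epsilon>0 (\<eta> / 2) > 0" using e0(1) \<eta> by simp
    ultimately show ?thesis unfolding eventually_at_right_field by blast
  qed
  have conv: "ribbon_converges l u w \<theta>"
  proof (rule ribbon_convergesI[OF Q l])
    show "w \<in> W22 (interval_I l)" "\<theta> \<in> W12 (interval_I l)" using w \<theta> by (simp_all add: W22_mean0_def W12_mean0_def)
    show "u \<epsilon> \<in> W22 (strip_S l)" if "\<epsilon> > 0" for \<epsilon> using u(1)[OF that] by (simp add: W22_det_def W22_mean0_def)
    show "\<forall>\<^sub>F \<epsilon> in at_right 0. near l w \<theta> \<epsilon> \<eta> (u \<epsilon>)" if "\<eta> > 0" for \<eta>
      using goodev[OF that] by eventually_elim (simp add: good_def)
    show "\<forall>\<^sub>F \<epsilon> in at_right 0. J_eps Q l \<epsilon> (u \<epsilon>) \<le> J_lim Q l w \<theta> + 1"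
      using goodev[OF zero_less_one] by eventually_elim (simp add: good_def)
  qed
  have "Limsup (at_right 0) (\<lambda>\<epsilon>. ereal (J_eps Q l \<epsilon> (u \<epsilon>))) \<le> ereal (J_lim Q l w \<theta>)"
  proof (rule ereal_le_epsilon2)
    fix \<eta> :: real assume "\<eta> > 0"
    from goodev[OF this] have "\<forall>\<^sub>F \<epsilon> in at_right 0. ereal (J_eps Q l \<epsilon> (u \<epsilon>)) \<le> ereal (J_lim Q l w \<theta> + \<eta>)"
      by eventually_elim (simp add: good_def)
    from Limsup_bounded[OF this]
    show "Limsup (at_right 0) (\<lambda>\<epsilon>. ereal (J_eps Q l \<epsilon> (u \<epsilon>))) \<le> ereal (J_lim Q l w \<theta>) + ereal \<eta>" by simp
  qed
  with u(1) conv show ?thesis by blast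
qed

theorem theorem2p4:
  fixes l :: real and Q\<^sub>2 :: "real^2^2 \<Rightarrow> real"
  assumes "l > 0"
    and "pos_def_quadratic_form Q\<^sub>2"
  shows "(\<forall>w\<epsilon> w \<theta>.
            (\<forall>\<epsilon>>0. w\<epsilon> \<epsilon> \<in> W22_det l \<epsilon>) \<and>
            w \<in> W22_mean0 (interval_I l) \<and> \<theta> \<in> W12_mean0 (interval_I l) \<and>
            ribbon_converges l w\<epsilon> w \<theta> \<longrightarrow>
            Liminf (at_right 0) (\<lambda>\<epsilon>. ereal (J_eps Q\<^sub>2 l \<epsilon> (w\<epsilon> \<epsilon>))) \<ge> ereal (J_lim Q\<^sub>2 l w \<theta>))
       \<and> (\<forall>w\<in>W22_mean0 (interval_I l). \<forall>\<theta>\<in>W12_mean0 (interval_I l). \<exists>w\<epsilon>.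
            (\<forall>\<epsilon>>0. w\<epsilon> \<epsilon> \<in> W22_det l \<epsilon>) \<and>
            ribbon_converges l w\<epsilon> w \<theta> \<and>
            Limsup (at_right 0) (\<lambda>\<epsilon>. ereal (J_eps Q\<^sub>2 l \<epsilon> (w\<epsilon> \<epsilon>))) \<le> ereal (J_lim Q\<^sub>2 l w \<theta>))"
proof -
  obtain S where S: "sym_form S" and Q: "\<And>u. Q\<^sub>2 (sm u) = S u u"
    using sym_form_exists[OF assms(2)] by blast
  interpret sym_form S by (rule S)
  show ?thesis
  proof (intro conjI allI impI ballI)
    fix w\<epsilon> w \<theta>
    assume "(\<forall>\<epsilon>>0. w\<epsilon> \<epsilon> \<in> W22_det l \<epsilon>) \<and> w \<in> W22_mean0 (interval_I l) \<and> \<theta> \<in> W12_mean0 (interval_I l) \<and>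
      ribbon_converges l w\<epsilon> w \<theta>"
    then show "Liminf (at_right 0) (\<lambda>\<epsilon>. ereal (J_eps Q\<^sub>2 l \<epsilon> (w\<epsilon> \<epsilon>))) \<ge> ereal (J_lim Q\<^sub>2 l w \<theta>)"
      by (intro liminf_inequality[OF Q assms(1)]) auto
  next
    fix w \<theta> assume "w \<in> W22_mean0 (interval_I l)" "\<theta> \<in> W12_mean0 (interval_I l)"
    then show "\<exists>w\<epsilon>. (\<forall>\<epsilon>>0. w\<epsilon> \<epsilon> \<in> W22_det l \<epsilon>) \<and> ribbon_converges l w\<epsilon> w \<theta> \<and>
            Limsup (at_right 0) (\<lambda>\<epsilon>. ereal (J_eps Q\<^sub>2 l \<epsilon> (w\<epsilon> \<epsilon>))) \<le> ereal (J_lim Q\<^sub>2 l w \<theta>)"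
      by (rule recovery_sequence[OF Q assms(1)])
  qed
qed

end
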